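(* Let $(\mathsf M,z_{\mathsf M})$ and $(\mathsf N,z_{\mathsf N})$ be affine objects in $\mathcal C$. Set $M=\mathsf M/z_{\mathsf M}\mathsf M$ and $N=\mathsf N/z_{\mathsf N}\mathsf N$. (i) Assume that $\mathrm{HOM}_{\mathcal C}(M\otimes N,M\otimes N)=\mathbf k\,\mathrm{id}_{M\otimes N}$. Then $$\mathrm{HOM}_{\mathbf k[z_{\mathsf M},z_{\mathsf N}]}(\mathsf M\otimes\mathsf N,\mathsf M\otimes\mathsf N)=\mathbf k[z_{\mathsf M},z_{\mathsf N}]\,\mathrm{id}_{\mathsf M\otimes\mathsf N}.$$ (ii) Assume that $\dim_{\mathbf k}\mathrm{HOM}_{\mathcal C}(M\otimes N,N\otimes M)=1$ and $\mathrm{HOM}_{\mathbf k[z_{\mathsf M},z_{\mathsf N}]}(\mathsf M\otimes\mathsf N,\mathsf N\otimes\mathsf M)\ne0$. Then there exists $R^{\mathrm{ren}}_{\mathsf M,\mathsf N}\in\mathrm{HOM}_{\mathbf k[z_{\mathsf M},z_{\mathsf N}]}(\mathsf M\otimes\mathsf N,\mathsf N\otimes\mathsf M)$ such that $$\mathrm{HOM}_{\mathbf k[z_{\mathsf M},z_{\mathsf N}]}(\mathsf M\otimes\mathsf N,\mathsf N\otimes\mathsf M)=\mathbf k[z_{\mathsf M},z_{\mathsf N}]\,R^{\mathrm{ren}}_{\mathsf M,\mathsf N}$$ and the induced morphism $R^{\mathrm{ren}}_{\mathsf M,\mathsf N}|_{z_{\mathsf M}=z_{\mathsf N}=0}\in\mathrm{HOM}_{\mathcal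 C}(M\otimes N,N\otimes M)$ does not vanish.
   Context: $\mathbf k$ is a field. $\mathcal C$ is an abelian $\mathbf k$-linear monoidal category with a $\mathbf k$-linear auto-equivalence $q$ (grading shift), and $\mathrm{HOM}_{\mathcal C}(X,Y)=\bigoplus_{k\in\mathbb Z}\mathrm{HOM}_{\mathcal C}(X,Y)_k$ with $\mathrm{HOM}_{\mathcal C}(X,Y)_k=\mathrm{Hom}_{\mathcal C}(q^kX,Y)$, $\mathrm{END}(X)=\mathrm{HOM}(X,X)$. Every object of $\mathcal C$ has finite length; $\mathbf k\simeq\mathrm{END}_{\mathcal C}(S)$ for simple $S$; $\otimes$ is $\mathbf k$-bilinear and bi-exact; the unit $\mathbf 1$ is simple; $q(X\otimes Y)\simeq qX\otimes Y\simeq X\otimes qY$. $\mathrm{Pro}(\mathcal C)$ is the category of pro-objects, abelian monoidal with the induced $q$ and bi-exact $\otimes$; $\mathcal C$ is a full subcategory. An *affine object* $(\mathsf M,z)$ in $\mathcal C$ consists of $\mathsf M\in\mathrm{Pro}(\mathcal C)$ and $z\in\mathrm{END}_{\mathrm{Pro}(\mathcal C)}(\mathsf M)_d$ homogeneous of some degree $d\in\mathbb Z_{>0}$ such that $\mathsf M/z\mathsf M\in\mathcal C$, $\mathsf M\simeq\varprojlim^{\mathrm{pro}}_n\mathsf M/z^n\mathsf M$ (formal projective limit in $\mathrm{Pro}(\mathcal C)$), and $z$ is a monomorphism. $\mathbf k[z_{\mathsf M},z_{\mathsf N}]$ is the graded polynomial ring with $z_{\mathsf M},z_{\mathsf N}$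 in their respective degrees; it acts on $\mathsf M\otimes\mathsf N$ and on $\mathsf N\otimes\mathsf M$ through the action of $z_{\mathsf M}$ on the factor $\mathsf M$ and $z_{\mathsf N}$ on the factor $\mathsf N$. $\mathrm{HOM}_{\mathbf k[z_{\mathsf M},z_{\mathsf N}]}$ denotes the graded module of morphisms in $\mathrm{Pro}(\mathcal C)$ (of all degrees) commuting with these actions. *)

theory Defs
  imports "HOL-Computational_Algebra.Polynomial"
begin

section \<open>Categories\<close>

record ('o, 'm) cat =
  obj :: "'o set"
  arr :: "'m set"
  src :: "'m \<Rightarrow> 'o"
  tgt :: "'m \<Rightarrow> 'o"
  idn :: "'o \<Rightarrow> 'm"
  cmp :: "'m \<Rightarrow> 'm \<Rightarrow> 'm"  (infixl "\<cdot>\<index>" 70)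

definition hom :: "('o, 'm, 'x) cat_scheme \<Rightarrow> 'o \<Rightarrow> 'o \<Rightarrow> 'm set" where
  "hom C X Y = {f \<in> arr C. src C f = X \<and> tgt C f = Y}"

locale category =
  fixes C :: "('o, 'm, 'x) cat_scheme" (structure)
  assumes src_obj: "f \<in> arr C \<Longrightarrow> src C f \<in> obj C"
    and tgt_obj: "f \<in> arr C \<Longrightarrow> tgt C f \<in> obj C"
    and idn_hom: "X \<in> obj C \<Longrightarrow> idn C X \<in> hom C X X"
    and cmp_hom: "f \<in> hom C X Y \<Longrightarrow> g \<in> hom C Y Z \<Longrightarrow> g \<cdot> f \<in> hom C X Z"
    and cmp_idn: "f \<in> hom C X Y \<Longrightarrow> f \<cdot> idn C X = f"
    and idn_cmp: "f \<in> hom C X Y \<Longrightarrow> idn C Y \<cdot> f = f"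
    and cmp_assoc: "f \<in> hom C W X \<Longrightarrow> g \<in> hom C X Y \<Longrightarrow> h \<in> hom C Y Z \<Longrightarrow>
        h \<cdot> (g \<cdot> f) = (h \<cdot> g) \<cdot> f"

definition is_functor ::
  "('o, 'm, 'x) cat_scheme \<Rightarrow> ('p, 'n, 'y) cat_scheme \<Rightarrow> ('o \<Rightarrow> 'p) \<Rightarrow> ('m \<Rightarrow> 'n) \<Rightarrow> bool" where
  "is_functor C D Fo Fa \<longleftrightarrow>
     (\<forall>X\<in>obj C. Fo X \<in> obj D \<and> Fa (idn C X) = idn D (Fo X)) \<and>
     (\<forall>X Y. \<forall>f\<in>hom C X Y. Fa f \<in> hom D (Fo X) (Fo Y)) \<and>
     (\<forall>X Y Z. \<forall>f\<in>hom C X Y. \<forall>g\<in>hom C Y Z. Fa (g \<cdot>\<^bsub>C\<^esub> f) = Fa g \<cdot>\<^bsub>D\<^esub> Fa f)"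

definition iso :: "('o, 'm, 'x) cat_scheme \<Rightarrow> 'm \<Rightarrow> bool" where
  "iso C f \<longleftrightarrow> f \<in> arr C \<and>
     (\<exists>g\<in>hom C (tgt C f) (src C f).
        g \<cdot>\<^bsub>C\<^esub> f = idn C (src C f) \<and> f \<cdot>\<^bsub>C\<^esub> g = idn C (tgt C f))"

definition nat_iso ::
  "('o, 'm, 'x) cat_scheme \<Rightarrow> ('p, 'n, 'y) cat_scheme \<Rightarrow>
   ('o \<Rightarrow> 'p) \<Rightarrow> ('m \<Rightarrow> 'n) \<Rightarrow> ('o \<Rightarrow> 'p) \<Rightarrow> ('m \<Rightarrow> 'n) \<Rightarrow> ('o \<Rightarrow> 'n) \<Rightarrow> bool" where
  "nat_iso C D Fo Fa Go Ga t \<longleftrightarrow>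
     (\<forall>X\<in>obj C. t X \<in> hom D (Fo X) (Go X) \<and> iso D (t X)) \<and>
     (\<forall>X Y. \<forall>f\<in>hom C X Y. t Y \<cdot>\<^bsub>D\<^esub> Fa f = Ga f \<cdot>\<^bsub>D\<^esub> t X)"

definition mono :: "('o, 'm, 'x) cat_scheme \<Rightarrow> 'm \<Rightarrow> bool" where
  "mono C f \<longleftrightarrow> f \<in> arr C \<and>
     (\<forall>W. \<forall>g\<in>hom C W (src C f). \<forall>h\<in>hom C W (src C f). f \<cdot>\<^bsub>C\<^esub> g = f \<cdot>\<^bsub>C\<^esub> h \<longrightarrow> g = h)"

definition epi :: "('o, 'm, 'x) cat_scheme \<Rightarrow> 'm \<Rightarrow> bool" where
  "epi C f \<longleftrightarrow> f \<in> arr C \<and>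
     (\<forall>W. \<forall>g\<in>hom C (tgt C f) W. \<forall>h\<in>hom C (tgt C f) W. g \<cdot>\<^bsub>C\<^esub> f = h \<cdot>\<^bsub>C\<^esub> f \<longrightarrow> g = h)"

definition zero_obj :: "('o, 'm, 'x) cat_scheme \<Rightarrow> 'o \<Rightarrow> bool" where
  "zero_obj C O' \<longleftrightarrow> O' \<in> obj C \<and>
     (\<forall>X\<in>obj C. (\<exists>!f. f \<in> hom C O' X) \<and> (\<exists>!f. f \<in> hom C X O'))"

definition simple :: "('o, 'm, 'x) cat_scheme \<Rightarrow> 'o \<Rightarrow> bool" where
  "simple C S \<longleftrightarrow> S \<in> obj C \<and> \<not> zero_obj C S \<and>
     (\<forall>i. mono C i \<and> tgt C i = S \<longrightarrow> zero_obj C (src C i) \<or> iso C i)"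


section \<open>Abelian linear categories\<close>

record ('o, 'm, 'k) lincat = "('o, 'm) cat" +
  zer :: "'o \<Rightarrow> 'o \<Rightarrow> 'm"
  add :: "'m \<Rightarrow> 'm \<Rightarrow> 'm"
  smul :: "'k \<Rightarrow> 'm \<Rightarrow> 'm"

locale linear_category = category C
  for C :: "('o, 'm, 'k::field, 'x) lincat_scheme" (structure) +
  assumes zer_hom: "X \<in> obj C \<Longrightarrow> Y \<in> obj C \<Longrightarrow> zer C X Y \<in> hom C X Y"
    and add_hom: "f \<in> hom C X Y \<Longrightarrow> g \<in> hom C X Y \<Longrightarrow> add C f g \<in> hom C X Y"
    and smul_hom: "f \<in> hom C X Y \<Longrightarrow> smul C a f \<in> hom C X Y"
    and add_assoc: "f \<in> hom C X Y \<Longrightarrow> g \<in> hom C X Y \<Longrightarrow> h \<in> hom C X Y \<Longrightarrow>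
        add C (add C f g) h = add C f (add C g h)"
    and add_comm: "f \<in> hom C X Y \<Longrightarrow> g \<in> hom C X Y \<Longrightarrow> add C f g = add C g f"
    and add_zer: "f \<in> hom C X Y \<Longrightarrow> add C f (zer C X Y) = f"
    and add_neg: "f \<in> hom C X Y \<Longrightarrow> add C f (smul C (- 1) f) = zer C X Y"
    and smul_add: "f \<in> hom C X Y \<Longrightarrow> g \<in> hom C X Y \<Longrightarrow>
        smul C a (add C f g) = add C (smul C a f) (smul C a g)"
    and add_smul: "f \<in> hom C X Y \<Longrightarrow> smul C (a + b) f = add C (smul C a f) (smul C b f)"
    and smul_smul: "f \<in> hom C X Y \<Longrightarrow> smul C a (smul C b f) = smul C (a * b) f"
    and smul_one: "f \<in> hom C X Y \<Longrightarrow> smul C 1 f = f"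
    and cmp_add_right: "f \<in> hom C X Y \<Longrightarrow> f' \<in> hom C X Y \<Longrightarrow> g \<in> hom C Y Z \<Longrightarrow>
        g \<cdot> add C f f' = add C (g \<cdot> f) (g \<cdot> f')"
    and cmp_add_left: "f \<in> hom C X Y \<Longrightarrow> g \<in> hom C Y Z \<Longrightarrow> g' \<in> hom C Y Z \<Longrightarrow>
        add C g g' \<cdot> f = add C (g \<cdot> f) (g' \<cdot> f)"
    and cmp_smul_right: "f \<in> hom C X Y \<Longrightarrow> g \<in> hom C Y Z \<Longrightarrow> g \<cdot> smul C a f = smul C a (g \<cdot> f)"
    and cmp_smul_left: "f \<in> hom C X Y \<Longrightarrow> g \<in> hom C Y Z \<Longrightarrow> smul C a g \<cdot> f = smul C a (g \<cdot> f)"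

definition is_kernel :: "('o, 'm, 'k, 'x) lincat_scheme \<Rightarrow> 'm \<Rightarrow> 'm \<Rightarrow> bool" where
  "is_kernel C f i \<longleftrightarrow> f \<in> arr C \<and> i \<in> arr C \<and> tgt C i = src C f \<and>
     f \<cdot>\<^bsub>C\<^esub> i = zer C (src C i) (tgt C f) \<and>
     (\<forall>W. \<forall>h\<in>hom C W (src C f). f \<cdot>\<^bsub>C\<^esub> h = zer C W (tgt C f) \<longrightarrow>
        (\<exists>!u. u \<in> hom C W (src C i) \<and> i \<cdot>\<^bsub>C\<^esub> u = h))"

definition is_cokernel :: "('o, 'm, 'k, 'x) lincat_scheme \<Rightarrow> 'm \<Rightarrow> 'm \<Rightarrow> bool" where
  "is_cokernel C f p \<longleftrightarrow> f \<in> arr C \<and> p \<in> arr C \<and> src C p = tgt C f \<and>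
     p \<cdot>\<^bsub>C\<^esub> f = zer C (src C f) (tgt C p) \<and>
     (\<forall>W. \<forall>h\<in>hom C (tgt C f) W. h \<cdot>\<^bsub>C\<^esub> f = zer C (src C f) W \<longrightarrow>
        (\<exists>!u. u \<in> hom C (tgt C p) W \<and> u \<cdot>\<^bsub>C\<^esub> p = h))"

definition short_exact :: "('o, 'm, 'k, 'x) lincat_scheme \<Rightarrow> 'm \<Rightarrow> 'm \<Rightarrow> bool" where
  "short_exact C i p \<longleftrightarrow> is_kernel C p i \<and> is_cokernel C i p"

locale abelian_category = linear_category C
  for C :: "('o, 'm, 'k::field, 'x) lincat_scheme" (structure) +
  assumes ex_zero: "\<exists>O'. zero_obj C O'"
    and ex_biproduct: "X \<in> obj C \<Longrightarrow> Y \<in> obj C \<Longrightarrow>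
        \<exists>B\<in>obj C. \<exists>i\<in>hom C X B. \<exists>j\<in>hom C Y B. \<exists>p\<in>hom C B X. \<exists>r\<in>hom C B Y.
          p \<cdot> i = idn C X \<and> r \<cdot> j = idn C Y \<and> p \<cdot> j = zer C Y X \<and> r \<cdot> i = zer C X Y \<and>
          add C (i \<cdot> p) (j \<cdot> r) = idn C B"
    and ex_kernel: "f \<in> arr C \<Longrightarrow> \<exists>i. is_kernel C f i"
    and ex_cokernel: "f \<in> arr C \<Longrightarrow> \<exists>p. is_cokernel C f p"
    and mono_is_kernel: "mono C i \<Longrightarrow> \<exists>f. is_kernel C f i"
    and epi_is_cokernel: "epi C p \<Longrightarrow> \<exists>f. is_cokernel C f p"

text \<open>\<open>finite_length C X\<close> says that \<open>X\<close> has a composition series.\<close>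

inductive finite_length :: "('o, 'm, 'k, 'x) lincat_scheme \<Rightarrow> 'o \<Rightarrow> bool" for C where
  "zero_obj C X \<Longrightarrow> finite_length C X"
| "finite_length C X' \<Longrightarrow> short_exact C i p \<Longrightarrow> i \<in> hom C X' X \<Longrightarrow> p \<in> hom C X S \<Longrightarrow>
   simple C S \<Longrightarrow> finite_length C X"

definition linear_functor ::
  "('o, 'm, 'k, 'x) lincat_scheme \<Rightarrow> ('p, 'n, 'k, 'y) lincat_scheme \<Rightarrow>
   ('o \<Rightarrow> 'p) \<Rightarrow> ('m \<Rightarrow> 'n) \<Rightarrow> bool" where
  "linear_functor C D Fo Fa \<longleftrightarrow> is_functor C D Fo Fa \<and>
     (\<forall>X Y. \<forall>f\<in>hom C X Y. \<forall>g\<in>hom C X Y. Fa (add C f g) = add D (Fa f) (Fa g)) \<and>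
     (\<forall>X Y a. \<forall>f\<in>hom C X Y. Fa (smul C a f) = smul D a (Fa f))"


section \<open>Tensor product, grading shift and graded morphism spaces\<close>

text \<open>
  \<open>shf\<close> is the grading shift \<open>q\<close>, \<open>ush\<close> a quasi-inverse of it and \<open>eta\<close> the isomorphism from
  the identity to \<open>q q\<inverse>\<close>. \<open>shl X Y\<close> and \<open>shr X Y\<close> are the isomorphisms from
  \<open>q (X \<otimes> Y)\<close> to \<open>q X \<otimes> Y\<close> and to \<open>X \<otimes> q Y\<close>.
\<close>

record ('o, 'm, 'k) tscat = "('o, 'm, 'k) lincat" +
  ten :: "'o \<Rightarrow> 'o \<Rightarrow> 'o"  (infixl "\<otimes>\<index>" 75)
  tena :: "'m \<Rightarrow> 'm \<Rightarrow> 'm"  (infixl "\<odot>\<index>" 75)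
  shf :: "'o \<Rightarrow> 'o"
  shfa :: "'m \<Rightarrow> 'm"
  ush :: "'o \<Rightarrow> 'o"
  usha :: "'m \<Rightarrow> 'm"
  eta :: "'o \<Rightarrow> 'm"
  shl :: "'o \<Rightarrow> 'o \<Rightarrow> 'm"
  shr :: "'o \<Rightarrow> 'o \<Rightarrow> 'm"

definition shpow :: "('o, 'm, 'k, 'x) tscat_scheme \<Rightarrow> int \<Rightarrow> 'o \<Rightarrow> 'o" where
  "shpow C k X = (if 0 \<le> k then (shf C ^^ nat k) X else (ush C ^^ nat (- k)) X)"

definition HOM :: "('o, 'm, 'k, 'x) tscat_scheme \<Rightarrow> int \<Rightarrow> 'o \<Rightarrow> 'o \<Rightarrow> 'm set" where
  "HOM C k X Y = hom C (shpow C k X) Y"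

text \<open>
  The isomorphism \<open>wind C m X\<close> goes from \<open>X\<close> to
  \<open>q\<^sup>m q\<^sup>-\<^sup>m X\<close>, and \<open>flat\<close> is the bijection from \<open>HOM C k X Y\<close> to
  \<open>Hom (q\<^sup>a X) (q\<^sup>b Y)\<close>, where \<open>a\<close> and \<open>b\<close> are the positive and negative parts of \<open>k\<close>. The
  composite of \<open>f\<close> of degree \<open>k\<close> with \<open>g\<close> of degree \<open>l\<close> is \<open>g \<cdot> q\<^sup>l f\<close>, up to the canonical
  identification of \<open>q\<^sup>l q\<^sup>k\<close> with \<open>q\<^sup>k\<^sup>+\<^sup>l\<close>. As \<open>q\<close> is fully faithful, it is determined after
  applying a power of \<open>q\<close> which makes all exponents nonnegative.
\<close>

primrec wind :: "('o, 'm, 'k, 'x) tscat_scheme \<Rightarrow> nat \<Rightarrow> 'o \<Rightarrow> 'm" where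
  "wind C 0 X = idn C X"
| "wind C (Suc m) X = (shfa C ^^ m) (eta C ((ush C ^^ m) X)) \<cdot>\<^bsub>C\<^esub> wind C m X"

definition flat :: "('o, 'm, 'k, 'x) tscat_scheme \<Rightarrow> int \<Rightarrow> 'o \<Rightarrow> 'm \<Rightarrow> 'm" where
  "flat C k X f =
     (if 0 \<le> k then f else (shfa C ^^ nat (- k)) f \<cdot>\<^bsub>C\<^esub> wind C (nat (- k)) X)"

definition gcomp ::
  "('o, 'm, 'k, 'x) tscat_scheme \<Rightarrow> 'o \<Rightarrow> 'o \<Rightarrow> 'o \<Rightarrow> int \<Rightarrow> 'm \<Rightarrow> int \<Rightarrow> 'm \<Rightarrow> 'm" where
  "gcomp C X Y Z l g k f =
     (THE h. h \<in> HOM C (k + l) X Z \<and>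
        (shfa C ^^ (nat k + nat l - nat (k + l))) (flat C (k + l) X h) =
        (shfa C ^^ nat (- k)) (flat C l Y g) \<cdot>\<^bsub>C\<^esub> (shfa C ^^ nat l) (flat C k X f))"

text \<open>
  An element of the direct sum of the \<open>HOM C k X Y\<close> is a family indexed by the degree \<open>k\<close>,
  with finite support.
\<close>

definition gzero :: "('o, 'm, 'k, 'x) tscat_scheme \<Rightarrow> 'o \<Rightarrow> 'o \<Rightarrow> int \<Rightarrow> 'm" where
  "gzero C X Y = (\<lambda>k. zer C (shpow C k X) Y)"

definition gHOM :: "('o, 'm, 'k, 'x) tscat_scheme \<Rightarrow> 'o \<Rightarrow> 'o \<Rightarrow> (int \<Rightarrow> 'm) set" where
  "gHOM C X Y = {f. (\<forall>k. f k \<in> HOM C k X Y) \<and> finite {k. f k \<noteq> gzero C X Y k}}"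

definition gadd :: "('o, 'm, 'k, 'x) tscat_scheme \<Rightarrow> (int \<Rightarrow> 'm) \<Rightarrow> (int \<Rightarrow> 'm) \<Rightarrow> int \<Rightarrow> 'm" where
  "gadd C f g = (\<lambda>k. add C (f k) (g k))"

definition gsmul :: "('o, 'm, 'k, 'x) tscat_scheme \<Rightarrow> 'k \<Rightarrow> (int \<Rightarrow> 'm) \<Rightarrow> int \<Rightarrow> 'm" where
  "gsmul C a f = (\<lambda>k. smul C a (f k))"

definition gid :: "('o, 'm, 'k, 'x) tscat_scheme \<Rightarrow> 'o \<Rightarrow> int \<Rightarrow> 'm" where
  "gid C X = (gzero C X X)(0 := idn C X)"

text \<open>Left multiplication by a homogeneous endomorphism \<open>z\<close> of \<open>Y\<close> of degree \<open>d\<close>.\<close>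

definition gmul ::
  "('o, 'm, 'k, 'x) tscat_scheme \<Rightarrow> 'o \<Rightarrow> 'o \<Rightarrow> int \<Rightarrow> 'm \<Rightarrow> (int \<Rightarrow> 'm) \<Rightarrow> int \<Rightarrow> 'm" where
  "gmul C X Y d z f = (\<lambda>k. gcomp C X Y Y d z (k - d) (f (k - d)))"

definition lincomb ::
  "('o, 'm, 'k, 'x) tscat_scheme \<Rightarrow> 'o \<Rightarrow> 'o \<Rightarrow> 'k list \<Rightarrow> (int \<Rightarrow> 'm) list \<Rightarrow> int \<Rightarrow> 'm" where
  "lincomb C X Y as fs = foldr (\<lambda>(a, f) h. gadd C (gsmul C a f) h) (zip as fs) (gzero C X Y)"

definition gHOM_dim :: "('o, 'm, 'k, 'x) tscat_scheme \<Rightarrow> 'o \<Rightarrow> 'o \<Rightarrow> nat \<Rightarrow> bool" where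
  "gHOM_dim C X Y n \<longleftrightarrow>
     (\<exists>fs. length fs = n \<and> set fs \<subseteq> gHOM C X Y \<and>
        bij_betw (\<lambda>as. lincomb C X Y as fs) {as. length as = n} (gHOM C X Y))"


section \<open>The base category\<close>

record ('o, 'm, 'k) moncat = "('o, 'm, 'k) tscat" +
  unt :: "'o"
  asc :: "'o \<Rightarrow> 'o \<Rightarrow> 'o \<Rightarrow> 'm"
  lun :: "'o \<Rightarrow> 'm"
  run :: "'o \<Rightarrow> 'm"

locale monoidal_category = category C
  for C :: "('o, 'm, 'k, 'x) moncat_scheme" (structure) +
  assumes ten_obj: "X \<in> obj C \<Longrightarrow> Y \<in> obj C \<Longrightarrow> X \<otimes> Y \<in> obj C"
    and tena_hom: "f \<in> hom C X X' \<Longrightarrow> g \<in> hom C Y Y' \<Longrightarrow> f \<odot> g \<in> hom C (X \<otimes> Y) (X' \<otimes> Y')"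
    and tena_idn: "X \<in> obj C \<Longrightarrow> Y \<in> obj C \<Longrightarrow> idn C X \<odot> idn C Y = idn C (X \<otimes> Y)"
    and tena_cmp: "f \<in> hom C X X' \<Longrightarrow> f' \<in> hom C X' X'' \<Longrightarrow>
        g \<in> hom C Y Y' \<Longrightarrow> g' \<in> hom C Y' Y'' \<Longrightarrow>
        (f' \<cdot> f) \<odot> (g' \<cdot> g) = (f' \<odot> g') \<cdot> (f \<odot> g)"
    and unt_obj: "unt C \<in> obj C"
    and asc_iso: "X \<in> obj C \<Longrightarrow> Y \<in> obj C \<Longrightarrow> Z \<in> obj C \<Longrightarrow>
        asc C X Y Z \<in> hom C ((X \<otimes> Y) \<otimes> Z) (X \<otimes> (Y \<otimes> Z)) \<and> iso C (asc C X Y Z)"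
    and asc_natural: "f \<in> hom C X X' \<Longrightarrow> g \<in> hom C Y Y' \<Longrightarrow> h \<in> hom C Z Z' \<Longrightarrow>
        asc C X' Y' Z' \<cdot> ((f \<odot> g) \<odot> h) = (f \<odot> (g \<odot> h)) \<cdot> asc C X Y Z"
    and lun_nat_iso: "nat_iso C C (\<lambda>X. unt C \<otimes> X) (\<lambda>f. idn C (unt C) \<odot> f) id id (lun C)"
    and run_nat_iso: "nat_iso C C (\<lambda>X. X \<otimes> unt C) (\<lambda>f. f \<odot> idn C (unt C)) id id (run C)"
    and pentagon: "W \<in> obj C \<Longrightarrow> X \<in> obj C \<Longrightarrow> Y \<in> obj C \<Longrightarrow> Z \<in> obj C \<Longrightarrow>
        (idn C W \<odot> asc C X Y Z) \<cdot> asc C W (X \<otimes> Y) Z \<cdot> (asc C W X Y \<odot> idn C Z) =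
        asc C W X (Y \<otimes> Z) \<cdot> asc C (W \<otimes> X) Y Z"
    and triangle: "X \<in> obj C \<Longrightarrow> Y \<in> obj C \<Longrightarrow>
        (idn C X \<odot> lun C Y) \<cdot> asc C X (unt C) Y = run C X \<odot> idn C Y"

text \<open>
  The last axiom, the compatibility of the two isomorphisms for the shift of a tensor product,
  is what makes endomorphisms of positive degree of the two factors of a tensor product commute.
\<close>

locale graded_monoidal_category = abelian_category C + monoidal_category C
  for C :: "('o, 'm, 'k::field, 'x) moncat_scheme" (structure) +
  assumes tena_linear_left: "X \<in> obj C \<Longrightarrow> linear_functor C C (\<lambda>Y. X \<otimes> Y) (\<lambda>g. idn C X \<odot> g)"
    and tena_linear_right: "Y \<in> obj C \<Longrightarrow> linear_functor C C (\<lambda>X. X \<otimes> Y) (\<lambda>f. f \<odot> idn C Y)"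
    and exact_left: "X \<in> obj C \<Longrightarrow> short_exact C i p \<Longrightarrow>
        short_exact C (idn C X \<odot> i) (idn C X \<odot> p)"
    and exact_right: "X \<in> obj C \<Longrightarrow> short_exact C i p \<Longrightarrow>
        short_exact C (i \<odot> idn C X) (p \<odot> idn C X)"
    and finite_len: "X \<in> obj C \<Longrightarrow> finite_length C X"
    and unt_simple: "simple C (unt C)"
    and shf_functor: "linear_functor C C (shf C) (shfa C)"
    and ush_functor: "is_functor C C (ush C) (usha C)"
    and eta_nat_iso: "nat_iso C C id id (shf C \<circ> ush C) (shfa C \<circ> usha C) (eta C)"
    and ush_shf_nat_iso: "\<exists>t. nat_iso C C id id (ush C \<circ> shf C) (usha C \<circ> shfa C) t"
    and END_simple: "simple C S \<Longrightarrow> bij_betw (\<lambda>a. gsmul C a (gid C S)) UNIV (gHOM C S S)"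
    and shl_iso: "X \<in> obj C \<Longrightarrow> Y \<in> obj C \<Longrightarrow>
        shl C X Y \<in> hom C (shf C (X \<otimes> Y)) (shf C X \<otimes> Y) \<and> iso C (shl C X Y)"
    and shl_natural: "f \<in> hom C X X' \<Longrightarrow> g \<in> hom C Y Y' \<Longrightarrow>
        shl C X' Y' \<cdot> shfa C (f \<odot> g) = (shfa C f \<odot> g) \<cdot> shl C X Y"
    and shr_iso: "X \<in> obj C \<Longrightarrow> Y \<in> obj C \<Longrightarrow>
        shr C X Y \<in> hom C (shf C (X \<otimes> Y)) (X \<otimes> shf C Y) \<and> iso C (shr C X Y)"
    and shr_natural: "f \<in> hom C X X' \<Longrightarrow> g \<in> hom C Y Y' \<Longrightarrow>
        shr C X' Y' \<cdot> shfa C (f \<odot> g) = (f \<odot> shfa C g) \<cdot> shr C X Y"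
    and shl_shr: "X \<in> obj C \<Longrightarrow> Y \<in> obj C \<Longrightarrow>
        shr C (shf C X) Y \<cdot> shfa C (shl C X Y) = shl C X (shf C Y) \<cdot> shfa C (shr C X Y)"


section \<open>Pro-objects\<close>

text \<open>
  Pro-objects are diagrams indexed by small cofiltered categories. Smallness means that the
  objects and arrows of index categories are taken from the type \<open>idx\<close>. This type contains the
  arbitrary type \<open>'a\<close>, so that it can be as large as desired; it also contains the natural numbers
  and the arrows of the base category, and it is closed under pairing.
\<close>

datatype ('a, 'm) idx =
    IxNat nat
  | IxMor 'm
  | IxBase 'a
  | IxPair (ixfst: "('a, 'm) idx") (ixsnd: "('a, 'm) idx")

type_synonym ('a, 'm) icat = "(('a, 'm) idx, ('a, 'm) idx) cat"

definition cofiltered :: "('o, 'm, 'x) cat_scheme \<Rightarrow> bool" where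
  "cofiltered I \<longleftrightarrow> obj I \<noteq> {} \<and>
     (\<forall>i\<in>obj I. \<forall>j\<in>obj I. \<exists>k\<in>obj I. hom I k i \<noteq> {} \<and> hom I k j \<noteq> {}) \<and>
     (\<forall>i j. \<forall>u\<in>hom I i j. \<forall>v\<in>hom I i j. \<exists>k. \<exists>w\<in>hom I k i. u \<cdot>\<^bsub>I\<^esub> w = v \<cdot>\<^bsub>I\<^esub> w)"

definition point_cat :: "('a, 'm) icat" where
  "point_cat = \<lparr>obj = {IxNat 0}, arr = {IxNat 0}, src = (\<lambda>_. IxNat 0), tgt = (\<lambda>_. IxNat 0),
     idn = (\<lambda>_. IxNat 0), cmp = (\<lambda>_ _. IxNat 0)\<rparr>"

text \<open>The index category of towers, with one arrow from \<open>m\<close> to \<open>n\<close> if \<open>n \<le> m\<close>.\<close>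

definition tower_cat :: "('a, 'm) icat" where
  "tower_cat = \<lparr>obj = range IxNat, arr = {IxPair (IxNat m) (IxNat n) | m n. n \<le> m},
     src = ixfst, tgt = ixsnd, idn = (\<lambda>x. IxPair x x),
     cmp = (\<lambda>v u. IxPair (ixfst u) (ixsnd v))\<rparr>"

definition prod_cat :: "('a, 'm) icat \<Rightarrow> ('a, 'm) icat \<Rightarrow> ('a, 'm) icat" where
  "prod_cat I J =
     \<lparr>obj = {IxPair i j | i j. i \<in> obj I \<and> j \<in> obj J},
      arr = {IxPair u v | u v. u \<in> arr I \<and> v \<in> arr J},
      src = (\<lambda>p. IxPair (src I (ixfst p)) (src J (ixsnd p))),
      tgt = (\<lambda>p. IxPair (tgt I (ixfst p)) (tgt J (ixsnd p))),
      idn = (\<lambda>p. IxPair (idn I (ixfst p)) (idn J (ixsnd p))),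
      cmp = (\<lambda>p r. IxPair (ixfst p \<cdot>\<^bsub>I\<^esub> ixfst r) (ixsnd p \<cdot>\<^bsub>J\<^esub> ixsnd r))\<rparr>"

record ('o, 'm, 'a) pro_ob =
  pidx :: "('a, 'm) icat"
  pob :: "('a, 'm) idx \<Rightarrow> 'o"
  par :: "('a, 'm) idx \<Rightarrow> 'm"

definition pro_objs :: "('o, 'm, 'x) cat_scheme \<Rightarrow> ('o, 'm, 'a) pro_ob set" where
  "pro_objs C = {X. category (pidx X) \<and> cofiltered (pidx X) \<and> is_functor (pidx X) C (pob X) (par X)}"

text \<open>
  A morphism from \<open>X\<close> to \<open>Y\<close> is an element of
  \<open>lim\<^sub>j colim\<^sub>i Hom (X i) (Y j)\<close>. The element of \<open>colim\<^sub>i Hom (X i) c\<close> represented by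
  \<open>f : X i \<rightarrow> c\<close> is the equivalence class \<open>germ C X c i f\<close>, a set of pairs; outside of the
  index category of \<open>Y\<close> the components are set to \<open>{}\<close>, which makes equality of morphisms the
  equality of the components that matter.
\<close>

definition germ ::
  "('o, 'm, 'x) cat_scheme \<Rightarrow> ('o, 'm, 'a) pro_ob \<Rightarrow> 'o \<Rightarrow> ('a, 'm) idx \<Rightarrow> 'm \<Rightarrow>
   (('a, 'm) idx \<times> 'm) set" where
  "germ C X c i f =
     {(i', f'). i' \<in> obj (pidx X) \<and> f' \<in> hom C (pob X i') c \<and>
        (\<exists>k. \<exists>u\<in>hom (pidx X) k i. \<exists>v\<in>hom (pidx X) k i'. f \<cdot>\<^bsub>C\<^esub> par X u = f' \<cdot>\<^bsub>C\<^esub> par X v)}"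

record ('o, 'm, 'a) pro_ar =
  psrc :: "('o, 'm, 'a) pro_ob"
  ptgt :: "('o, 'm, 'a) pro_ob"
  pgerm :: "('a, 'm) idx \<Rightarrow> (('a, 'm) idx \<times> 'm) set"

definition pro_arrs :: "('o, 'm, 'x) cat_scheme \<Rightarrow> ('o, 'm, 'a) pro_ar set" where
  "pro_arrs C =
     {F. psrc F \<in> pro_objs C \<and> ptgt F \<in> pro_objs C \<and>
        (\<forall>j\<in>obj (pidx (ptgt F)). \<exists>i\<in>obj (pidx (psrc F)).
           \<exists>f\<in>hom C (pob (psrc F) i) (pob (ptgt F) j).
             pgerm F j = germ C (psrc F) (pob (ptgt F) j) i f) \<and>
        (\<forall>j. j \<notin> obj (pidx (ptgt F)) \<longrightarrow> pgerm F j = {}) \<and>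
        (\<forall>j j'. \<forall>v\<in>hom (pidx (ptgt F)) j j'. \<forall>(i, f)\<in>pgerm F j.
           (i, par (ptgt F) v \<cdot>\<^bsub>C\<^esub> f) \<in> pgerm F j')}"

text \<open>\<open>pro_map C X Y G\<close> has as \<open>j\<close>-th component the class of any of the representatives \<open>G j\<close>.\<close>

definition pro_map ::
  "('o, 'm, 'x) cat_scheme \<Rightarrow> ('o, 'm, 'a) pro_ob \<Rightarrow> ('o, 'm, 'a) pro_ob \<Rightarrow>
   (('a, 'm) idx \<Rightarrow> (('a, 'm) idx \<times> 'm) set) \<Rightarrow> ('o, 'm, 'a) pro_ar" where
  "pro_map C X Y G =
     \<lparr>psrc = X, ptgt = Y,
      pgerm = (\<lambda>j. if j \<in> obj (pidx Y) then \<Union>(i, f)\<in>G j. germ C X (pob Y j) i f else {})\<rparr>"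

definition pro_ten ::
  "('o, 'm, 'k, 'x) tscat_scheme \<Rightarrow> ('o, 'm, 'a) pro_ob \<Rightarrow> ('o, 'm, 'a) pro_ob \<Rightarrow>
   ('o, 'm, 'a) pro_ob" where
  "pro_ten C X Y =
     \<lparr>pidx = prod_cat (pidx X) (pidx Y),
      pob = (\<lambda>p. pob X (ixfst p) \<otimes>\<^bsub>C\<^esub> pob Y (ixsnd p)),
      par = (\<lambda>p. par X (ixfst p) \<odot>\<^bsub>C\<^esub> par Y (ixsnd p))\<rparr>"

definition pro_apply :: "('o \<Rightarrow> 'o) \<Rightarrow> ('m \<Rightarrow> 'm) \<Rightarrow> ('o, 'm, 'a) pro_ob \<Rightarrow> ('o, 'm, 'a) pro_ob" where
  "pro_apply Fo Fa X = \<lparr>pidx = pidx X, pob = Fo \<circ> pob X, par = Fa \<circ> par X\<rparr>"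

definition pro_applya ::
  "('o, 'm, 'x) cat_scheme \<Rightarrow> ('o \<Rightarrow> 'o) \<Rightarrow> ('m \<Rightarrow> 'm) \<Rightarrow> ('o, 'm, 'a) pro_ar \<Rightarrow>
   ('o, 'm, 'a) pro_ar" where
  "pro_applya C Fo Fa F =
     pro_map C (pro_apply Fo Fa (psrc F)) (pro_apply Fo Fa (ptgt F))
       (\<lambda>j. {(i, Fa f) | i f. (i, f) \<in> pgerm F j})"

definition Pro ::
  "('o, 'm, 'k, 'x) tscat_scheme \<Rightarrow> (('o, 'm, 'a) pro_ob, ('o, 'm, 'a) pro_ar, 'k) tscat" where
  "Pro C =
     \<lparr>obj = pro_objs C,
      arr = pro_arrs C,
      src = psrc,
      tgt = ptgt,
      idn = (\<lambda>X. pro_map C X X (\<lambda>j. {(j, idn C (pob X j))})),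
      cmp = (\<lambda>G F. pro_map C (psrc F) (ptgt G)
        (\<lambda>l. {(i, g \<cdot>\<^bsub>C\<^esub> f) | i f j g. (j, g) \<in> pgerm G l \<and> (i, f) \<in> pgerm F j})),
      zer = (\<lambda>X Y. pro_map C X Y (\<lambda>j. {(i, zer C (pob X i) (pob Y j)) | i. i \<in> obj (pidx X)})),
      add = (\<lambda>F G. pro_map C (psrc F) (ptgt F)
        (\<lambda>j. {(i, add C f g) | i f g. (i, f) \<in> pgerm F j \<and> (i, g) \<in> pgerm G j})),
      smul = (\<lambda>a F. pro_map C (psrc F) (ptgt F) (\<lambda>j. {(i, smul C a f) | i f. (i, f) \<in> pgerm F j})),
      ten = pro_ten C,
      tena = (\<lambda>F G. pro_map C (pro_ten C (psrc F) (psrc G)) (pro_ten C (ptgt F) (ptgt G))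
        (\<lambda>p. {(IxPair i i', f \<odot>\<^bsub>C\<^esub> g) | i f i' g.
                (i, f) \<in> pgerm F (ixfst p) \<and> (i', g) \<in> pgerm G (ixsnd p)})),
      shf = pro_apply (shf C) (shfa C),
      shfa = pro_applya C (shf C) (shfa C),
      ush = pro_apply (ush C) (usha C),
      usha = pro_applya C (ush C) (usha C),
      eta = (\<lambda>X. pro_map C X (pro_apply (shf C) (shfa C) (pro_apply (ush C) (usha C) X))
        (\<lambda>j. {(j, eta C (pob X j))})),
      shl = (\<lambda>X Y. pro_map C (pro_apply (shf C) (shfa C) (pro_ten C X Y))
        (pro_ten C (pro_apply (shf C) (shfa C) X) Y)
        (\<lambda>p. {(p, shl C (pob X (ixfst p)) (pob Y (ixsnd p)))})),
      shr = (\<lambda>X Y. pro_map C (pro_apply (shf C) (shfa C) (pro_ten C X Y))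
        (pro_ten C X (pro_apply (shf C) (shfa C) Y))
        (\<lambda>p. {(p, shr C (pob X (ixfst p)) (pob Y (ixsnd p)))}))\<rparr>"

text \<open>
  The embedding of \<open>C\<close> into \<open>Pro C\<close>, and its compatibility with tensor products:
  \<open>con C M \<otimes> con C N\<close> and \<open>con C (M \<otimes> N)\<close> are indexed by different one-point categories and are
  identified by \<open>con_ten\<close>.
\<close>

definition con :: "('o, 'm, 'x) cat_scheme \<Rightarrow> 'o \<Rightarrow> ('o, 'm, 'a) pro_ob" where
  "con C c = \<lparr>pidx = point_cat, pob = (\<lambda>_. c), par = (\<lambda>_. idn C c)\<rparr>"

definition cona :: "('o, 'm, 'x) cat_scheme \<Rightarrow> 'm \<Rightarrow> ('o, 'm, 'a) pro_ar" where
  "cona C f = pro_map C (con C (src C f)) (con C (tgt C f)) (\<lambda>_. {(IxNat 0, f)})"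

definition con_ten :: "('o, 'm, 'k, 'x) tscat_scheme \<Rightarrow> 'o \<Rightarrow> 'o \<Rightarrow> ('o, 'm, 'a) pro_ar" where
  "con_ten C M N = pro_map C (pro_ten C (con C M) (con C N)) (con C (M \<otimes>\<^bsub>C\<^esub> N))
     (\<lambda>_. {(IxPair (IxNat 0) (IxNat 0), idn C (M \<otimes>\<^bsub>C\<^esub> N))})"

definition pro_proj ::
  "('o, 'm, 'x) cat_scheme \<Rightarrow> ('o, 'm, 'a) pro_ob \<Rightarrow> ('a, 'm) idx \<Rightarrow> ('o, 'm, 'a) pro_ar" where
  "pro_proj C X i = pro_map C X (con C (pob X i)) (\<lambda>_. {(i, idn C (pob X i))})"


section \<open>Affine objects\<close>

text \<open>\<open>zpow C d z X n\<close> is \<open>z\<^sup>n\<close> as a morphism from \<open>q\<^sup>n\<^sup>d X\<close> to \<open>X\<close>.\<close>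

primrec zpow :: "('o, 'm, 'k, 'x) tscat_scheme \<Rightarrow> nat \<Rightarrow> 'm \<Rightarrow> 'o \<Rightarrow> nat \<Rightarrow> 'm" where
  "zpow C d z X 0 = idn C X"
| "zpow C d z X (Suc n) = z \<cdot>\<^bsub>C\<^esub> (shfa C ^^ d) (zpow C d z X n)"

text \<open>
  \<open>is_quotient C X z M p\<close>: the object \<open>M\<close> of \<open>C\<close> is the quotient of the pro-object \<open>X\<close> by the
  image of \<open>z\<close>, with projection \<open>p\<close>.
\<close>

definition is_quotient ::
  "('o, 'm, 'k, 'x) tscat_scheme \<Rightarrow> ('o, 'm, 'a) pro_ob \<Rightarrow> ('o, 'm, 'a) pro_ar \<Rightarrow>
   'o \<Rightarrow> ('o, 'm, 'a) pro_ar \<Rightarrow> bool" where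
  "is_quotient C X z M p \<longleftrightarrow>
     M \<in> obj C \<and> p \<in> hom (Pro C) X (con C M) \<and> is_cokernel (Pro C) z p"

text \<open>
  The formal projective limit of the quotients by the powers of \<open>z\<close> is the pro-object formed by a
  tower \<open>T\<close> in \<open>C\<close> with \<open>T\<^sub>n\<close> the quotient by \<open>z\<^sup>n\<close>; the transition maps of \<open>T\<close> are the
  canonical ones because the maps from \<open>X\<close> to the \<open>T\<^sub>n\<close> are compatible with them.
\<close>

definition affine_object ::
  "('o, 'm, 'k, 'x) tscat_scheme \<Rightarrow> ('o, 'm, 'a) pro_ob \<Rightarrow> nat \<Rightarrow> ('o, 'm, 'a) pro_ar \<Rightarrow> bool" where
  "affine_object C X d z \<longleftrightarrow>
     X \<in> obj (Pro C) \<and> 0 < d \<and> z \<in> HOM (Pro C) (int d) X X \<and>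
     (\<exists>M p. is_quotient C X z M p) \<and>
     (\<exists>T\<in>obj (Pro C). \<exists>\<phi>\<in>hom (Pro C) X T. pidx T = tower_cat \<and> iso (Pro C) \<phi> \<and>
        (\<forall>n. is_quotient C X (zpow (Pro C) d z X n) (pob T (IxNat n))
               (pro_proj C T (IxNat n) \<cdot>\<^bsub>Pro C\<^esub> \<phi>))) \<and>
     mono (Pro C) z"

text \<open>The iterates of \<open>shl\<close> and \<open>shr\<close>, from \<open>q\<^sup>n (X \<otimes> Y)\<close> to \<open>q\<^sup>n X \<otimes> Y\<close> and \<open>X \<otimes> q\<^sup>n Y\<close>.\<close>

primrec shl_pow :: "('o, 'm, 'k, 'x) tscat_scheme \<Rightarrow> nat \<Rightarrow> 'o \<Rightarrow> 'o \<Rightarrow> 'm" where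
  "shl_pow C 0 X Y = idn C (X \<otimes>\<^bsub>C\<^esub> Y)"
| "shl_pow C (Suc n) X Y = shl C ((shf C ^^ n) X) Y \<cdot>\<^bsub>C\<^esub> shfa C (shl_pow C n X Y)"

primrec shr_pow :: "('o, 'm, 'k, 'x) tscat_scheme \<Rightarrow> nat \<Rightarrow> 'o \<Rightarrow> 'o \<Rightarrow> 'm" where
  "shr_pow C 0 X Y = idn C (X \<otimes>\<^bsub>C\<^esub> Y)"
| "shr_pow C (Suc n) X Y = shr C X ((shf C ^^ n) Y) \<cdot>\<^bsub>C\<^esub> shfa C (shr_pow C n X Y)"

text \<open>The endomorphisms of degree \<open>d\<close> of \<open>X \<otimes> Y\<close> given by an endomorphism \<open>z\<close> of one factor.\<close>

definition on_left :: "('o, 'm, 'k, 'x) tscat_scheme \<Rightarrow> nat \<Rightarrow> 'm \<Rightarrow> 'o \<Rightarrow> 'o \<Rightarrow> 'm" where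
  "on_left C d z X Y = (z \<odot>\<^bsub>C\<^esub> idn C Y) \<cdot>\<^bsub>C\<^esub> shl_pow C d X Y"

definition on_right :: "('o, 'm, 'k, 'x) tscat_scheme \<Rightarrow> nat \<Rightarrow> 'm \<Rightarrow> 'o \<Rightarrow> 'o \<Rightarrow> 'm" where
  "on_right C d z X Y = (idn C X \<odot>\<^bsub>C\<^esub> z) \<cdot>\<^bsub>C\<^esub> shr_pow C d X Y"

text \<open>
  In the following definitions, two variables of degrees \<open>d\<close> and \<open>e\<close> act on \<open>X\<close> through
  \<open>x\<^sub>1\<close> and \<open>x\<^sub>2\<close> and on \<open>Y\<close> through \<open>y\<^sub>1\<close> and \<open>y\<^sub>2\<close>. Polynomials in the two variables are
  elements of \<open>'k poly poly\<close>, the inner variable being the first one, and act by Horner evaluation.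
\<close>

definition polyHOM ::
  "('o, 'm, 'k, 'x) tscat_scheme \<Rightarrow> nat \<Rightarrow> nat \<Rightarrow> 'o \<Rightarrow> 'm \<Rightarrow> 'm \<Rightarrow> 'o \<Rightarrow> 'm \<Rightarrow> 'm \<Rightarrow> (int \<Rightarrow> 'm) set" where
  "polyHOM C d e X x\<^sub>1 x\<^sub>2 Y y\<^sub>1 y\<^sub>2 =
     {f \<in> gHOM C X Y. \<forall>k.
        gcomp C X Y Y (int d) y\<^sub>1 k (f k) = gcomp C X X Y k (f k) (int d) x\<^sub>1 \<and>
        gcomp C X Y Y (int e) y\<^sub>2 k (f k) = gcomp C X X Y k (f k) (int e) x\<^sub>2}"

definition poly_act1 ::
  "('o, 'm, 'k::zero, 'x) tscat_scheme \<Rightarrow> 'o \<Rightarrow> 'o \<Rightarrow> nat \<Rightarrow> 'm \<Rightarrow> 'k poly \<Rightarrow> (int \<Rightarrow> 'm) \<Rightarrow> int \<Rightarrow> 'm" where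
  "poly_act1 C X Y d y p f =
     fold_coeffs (\<lambda>a h. gadd C (gsmul C a f) (gmul C X Y (int d) y h)) p (gzero C X Y)"

definition poly_act ::
  "('o, 'm, 'k::zero, 'x) tscat_scheme \<Rightarrow> nat \<Rightarrow> nat \<Rightarrow> 'o \<Rightarrow> 'o \<Rightarrow> 'm \<Rightarrow> 'm \<Rightarrow>
   'k poly poly \<Rightarrow> (int \<Rightarrow> 'm) \<Rightarrow> int \<Rightarrow> 'm" where
  "poly_act C d e X Y y\<^sub>1 y\<^sub>2 P f =
     fold_coeffs (\<lambda>p h. gadd C (poly_act1 C X Y d y\<^sub>1 p f) (gmul C X Y (int e) y\<^sub>2 h)) P (gzero C X Y)"

text \<open>
  \<open>specializes C X Y A p B r f g\<close>: for projections \<open>p\<close> from \<open>X\<close> to \<open>A\<close> and \<open>r\<close> from \<open>Y\<close> to \<open>B\<close>,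
  with \<open>A\<close> and \<open>B\<close> in \<open>C\<close>, the graded morphism \<open>g\<close> from \<open>A\<close> to \<open>B\<close> is induced by the graded
  morphism \<open>f\<close> from \<open>X\<close> to \<open>Y\<close>, that is, \<open>g p = r f\<close>.
\<close>

definition specializes ::
  "('o, 'm, 'k, 'x) tscat_scheme \<Rightarrow> ('o, 'm, 'a) pro_ob \<Rightarrow> ('o, 'm, 'a) pro_ob \<Rightarrow>
   'o \<Rightarrow> ('o, 'm, 'a) pro_ar \<Rightarrow> 'o \<Rightarrow> ('o, 'm, 'a) pro_ar \<Rightarrow>
   (int \<Rightarrow> ('o, 'm, 'a) pro_ar) \<Rightarrow> (int \<Rightarrow> 'm) \<Rightarrow> bool" where
  "specializes C X Y A p B r f g \<longleftrightarrow>
     (\<forall>k. gcomp (Pro C) X (con C A) (con C B) k (cona C (g k)) 0 p =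
          gcomp (Pro C) X Y (con C B) 0 r k (f k))"

end

theory Submission
  imports Defs
begin

text \<open>
  Write \<open>T\<^sub>n = \<M>/z\<^sup>n\<M>\<close>. Because \<open>z\<close> is a monomorphism, multiplication by \<open>z\<close> induces
  \<open>\<zeta>\<^sub>n : q\<^sup>d T\<^sub>n \<rightarrow> T\<^sub>n\<^sub>+\<^sub>1\<close>, which is the kernel of \<open>T\<^sub>n\<^sub>+\<^sub>1 \<rightarrow> T\<^sub>1\<close>. Tensoring the towers of \<open>\<M>\<close> and
  \<open>\<N>\<close> presents \<open>Y = \<N> \<otimes> \<M>\<close> as the limit of the quotients \<open>Y\<^sub>a\<^sub>b\<close> by \<open>z\<^sub>M\<^sup>a\<close> and \<open>z\<^sub>N\<^sup>b\<close>, with an exact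
  sequence for each of the two variables. Equivariant morphisms from \<open>\<M> \<otimes> \<N>\<close> to \<open>Y\<^sub>1\<^sub>1\<close> are graded morphisms
  \<open>M \<otimes> N \<rightarrow> N \<otimes> M\<close>, hence the multiples of one \<open>R\<^sub>0\<close> of degree \<open>c\<close>. So there are none to \<open>Y\<^sub>a\<^sub>b\<close> in
  degrees below \<open>c\<close>, and those of degree \<open>c\<close> are determined by their image in \<open>Y\<^sub>1\<^sub>1\<close>, since the kernels of the
  restriction maps are shifts of smaller quotients. Dividing a nonzero equivariant morphism to \<open>Y\<close> by the
  variables as often as possible, one descends to degree \<open>c\<close>, which produces a lift \<open>R\<close> of \<open>R\<^sub>0\<close>. Subtracting
  multiples of \<open>R\<close> and dividing by a variable lowers the degree, so that \<open>R\<close> generates.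
\<close>

subsection \<open>Linear and abelian categories\<close>

text \<open>Exact sequences are taken in \<open>C\<close>, and pro-objects are reached through
  morphisms into constant ones, which are represented at a single index. The cost shows at the maps
  \<zeta>: that \<open>z\<close> is a monomorphism only says that their kernels form a zero
  pro-object, so that for every n the kernel at some higher level m restricts to zero at level n.
  Vanishing at every level takes a further chase, in which the kernel of T_m -> T_n is described as
  the image of z^n. The second obstacle is the descent to degree c. A morphism of degree other than
  c vanishes on Y_11, but divisibility by a variable requires vanishing on a whole edge Y_1b or
  Y_a1. Subtracting a multiple of one variable achieves this, provided the multiple can be extended
  from the edge Y_a1 to all of Y_an. Together with the given nonzero morphism, extension over column
  a yields a lift of R_0 over column a + 1, and that lift yields extension there; so both are proved
  in one induction, over finite levels, before any morphism to Y of degree c is known.\<close>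

locale partial_vector_space =
  fixes V :: "'v set" and pl :: "'v \<Rightarrow> 'v \<Rightarrow> 'v" and sc :: "'k::field \<Rightarrow> 'v \<Rightarrow> 'v" and o0 :: 'v
  assumes zero_in [simp]: "o0 \<in> V"
    and pl_in [simp]: "f \<in> V \<Longrightarrow> g \<in> V \<Longrightarrow> pl f g \<in> V"
    and sc_in [simp]: "f \<in> V \<Longrightarrow> sc a f \<in> V"
    and pl_assoc: "f \<in> V \<Longrightarrow> g \<in> V \<Longrightarrow> h \<in> V \<Longrightarrow> pl (pl f g) h = pl f (pl g h)"
    and pl_comm: "f \<in> V \<Longrightarrow> g \<in> V \<Longrightarrow> pl f g = pl g f"
    and pl_zero [simp]: "f \<in> V \<Longrightarrow> pl f o0 = f"
    and pl_neg [simp]: "f \<in> V \<Longrightarrow> pl f (sc (- 1) f) = o0"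
    and sc_pl: "f \<in> V \<Longrightarrow> g \<in> V \<Longrightarrow> sc a (pl f g) = pl (sc a f) (sc a g)"
    and pl_sc: "f \<in> V \<Longrightarrow> sc (a + b) f = pl (sc a f) (sc b f)"
    and sc_sc: "f \<in> V \<Longrightarrow> sc a (sc b f) = sc (a * b) f"
    and sc_one [simp]: "f \<in> V \<Longrightarrow> sc 1 f = f"
begin

lemma zero_pl [simp]: "f \<in> V \<Longrightarrow> pl o0 f = f"
  using pl_comm[of o0 f] by simp

lemma pl_neg' [simp]: "f \<in> V \<Longrightarrow> pl (sc (- 1) f) f = o0"
  using pl_comm[of "sc (-1) f" f] by simp

lemma pl_left_comm: "f \<in> V \<Longrightarrow> g \<in> V \<Longrightarrow> h \<in> V \<Longrightarrow> pl f (pl g h) = pl g (pl f h)"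
  using pl_assoc[of f g h] pl_assoc[of g f h] pl_comm[of f g] by simp

lemma pl_idem_zero: "f \<in> V \<Longrightarrow> pl f f = f \<Longrightarrow> f = o0"
  using pl_assoc[of f f "sc (-1) f"] by simp

lemma sc_0 [simp]: "f \<in> V \<Longrightarrow> sc 0 f = o0"
  by (rule pl_idem_zero) (simp_all add: pl_sc[symmetric])

lemma sc_zero [simp]: "sc a o0 = o0"
  by (rule pl_idem_zero) (simp_all add: sc_pl[symmetric])

definition "df f g = pl f (sc (- 1) g)"

lemma df_in [simp]: "f \<in> V \<Longrightarrow> g \<in> V \<Longrightarrow> df f g \<in> V"
  by (simp add: df_def)

lemma df_eq_0: "f \<in> V \<Longrightarrow> g \<in> V \<Longrightarrow> df f g = o0 \<longleftrightarrow> f = g"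
proof
  assume a: "f \<in> V" "g \<in> V" "df f g = o0"
  have "f = pl f (pl (sc (-1) g) g)" using a by simp
  also have "\<dots> = pl (df f g) g" unfolding df_def using a by (intro pl_assoc[symmetric]) simp_all
  finally show "f = g" using a by simp
qed (simp add: df_def)

lemma df_pl [simp]: "f \<in> V \<Longrightarrow> g \<in> V \<Longrightarrow> pl (df f g) g = f"
  by (simp add: df_def pl_assoc)

lemma pl_df [simp]: "f \<in> V \<Longrightarrow> g \<in> V \<Longrightarrow> pl g (df f g) = f"
  using pl_comm[of g "df f g"] by simp

lemma df_zero [simp]: "f \<in> V \<Longrightarrow> df f o0 = f"
  by (simp add: df_def)

end

lemma partial_vector_space_mono:
  assumes "partial_vector_space V pl sc o0" "W \<subseteq> V" "o0 \<in> W"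
    "\<And>f g. f \<in> W \<Longrightarrow> g \<in> W \<Longrightarrow> pl f g \<in> W" "\<And>f a. f \<in> W \<Longrightarrow> sc a f \<in> W"
  shows "partial_vector_space W pl sc o0"
proof -
  interpret partial_vector_space V pl sc o0 by fact
  note [simp] = subsetD[OF assms(2)]
  show ?thesis
    by (unfold_locales) (simp_all add: assms(3-) pl_assoc pl_sc sc_pl sc_sc, rule pl_comm, simp_all)
qed

context category
begin

lemma homD: assumes "f \<in> hom C X Y"
  shows "f \<in> arr C" "src C f = X" "tgt C f = Y" "X \<in> obj C" "Y \<in> obj C"
  using assms src_obj tgt_obj by (auto simp: hom_def)

lemma arr_hom: "f \<in> arr C \<Longrightarrow> f \<in> hom C (src C f) (tgt C f)"
  by (simp add: hom_def)

lemma arr_idn [simp]: "X \<in> obj C \<Longrightarrow> idn C X \<in> arr C" "X \<in> obj C \<Longrightarrow> src C (idn C X) = X"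
  "X \<in> obj C \<Longrightarrow> tgt C (idn C X) = X"
  using idn_hom by (auto simp: hom_def)

lemma arr_cmp [simp]:
  assumes "f \<in> arr C" "g \<in> arr C" "src C g = tgt C f"
  shows "g \<cdot> f \<in> arr C" "src C (g \<cdot> f) = src C f" "tgt C (g \<cdot> f) = tgt C g"
  using cmp_hom[of f "src C f" "tgt C f" g "tgt C g"] assms by (auto simp: hom_def)

lemma cmp_idn' [simp]: "f \<in> arr C \<Longrightarrow> X = src C f \<Longrightarrow> f \<cdot> idn C X = f"
  using cmp_idn arr_hom by blast

lemma idn_cmp' [simp]: "f \<in> arr C \<Longrightarrow> X = tgt C f \<Longrightarrow> idn C X \<cdot> f = f"
  using idn_cmp arr_hom by blast

lemma cmp_assoc' [simp]:
  "f \<in> arr C \<Longrightarrow> g \<in> arr C \<Longrightarrow> h \<in> arr C \<Longrightarrow> src C g = tgt C f \<Longrightarrow> src C h = tgt C g \<Longrightarrow>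
   (h \<cdot> g) \<cdot> f = h \<cdot> (g \<cdot> f)"
  using cmp_assoc[of f "src C f" "tgt C f" g "tgt C g" h "tgt C h"] by (simp add: hom_def)

lemma cmp_extend:
  assumes "g \<cdot> f = h" "f \<in> arr C" "g \<in> arr C" "src C g = tgt C f" "x \<in> arr C" "src C f = tgt C x"
  shows "g \<cdot> (f \<cdot> x) = h \<cdot> x"
  using cmp_assoc'[of x f g] assms by simp

lemma isoE:
  assumes "iso C f" "f \<in> hom C X Y"
  obtains g where "g \<in> hom C Y X" "g \<cdot> f = idn C X" "f \<cdot> g = idn C Y"
  using assms unfolding iso_def hom_def by auto

lemma isoI:
  "f \<in> hom C X Y \<Longrightarrow> g \<in> hom C Y X \<Longrightarrow> g \<cdot> f = idn C X \<Longrightarrow> f \<cdot> g = idn C Y \<Longrightarrow> iso C f"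
  unfolding iso_def hom_def by auto

lemma iso_idn: "X \<in> obj C \<Longrightarrow> iso C (idn C X)"
  by (rule isoI[of _ X X "idn C X"]) (auto simp: idn_hom)

lemma iso_cmp:
  assumes "f \<in> hom C X Y" "g \<in> hom C Y Z" "iso C f" "iso C g" shows "iso C (g \<cdot> f)"
proof -
  obtain f' where f': "f' \<in> hom C Y X" "f' \<cdot> f = idn C X" "f \<cdot> f' = idn C Y" using isoE assms by metis
  obtain g' where g': "g' \<in> hom C Z Y" "g' \<cdot> g = idn C Y" "g \<cdot> g' = idn C Z" using isoE assms by metis
  note d = homD[OF assms(1)] homD[OF assms(2)] homD[OF f'(1)] homD[OF g'(1)]
  have "(f' \<cdot> g') \<cdot> (g \<cdot> f) = f' \<cdot> ((g' \<cdot> g) \<cdot> f)" "(g \<cdot> f) \<cdot> (f' \<cdot> g') = g \<cdot> ((f \<cdot> f') \<cdot> g')"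
    using d by auto
  then have "(f' \<cdot> g') \<cdot> (g \<cdot> f) = idn C X" "(g \<cdot> f) \<cdot> (f' \<cdot> g') = idn C Z"
    using d f' g' by (simp_all del: cmp_assoc')
  then show ?thesis using d by (intro isoI[of _ X Z "f' \<cdot> g'"]) (auto simp: hom_def)
qed

lemma iso_cancel_right:
  assumes "iso C s" "s \<in> hom C W X" "f \<in> hom C X Y" "g \<in> hom C X Y" "f \<cdot> s = g \<cdot> s"
  shows "f = g"
proof -
  obtain s' where s': "s' \<in> hom C X W" "s' \<cdot> s = idn C W" "s \<cdot> s' = idn C X" using isoE assms by metis
  have "(f \<cdot> s) \<cdot> s' = (g \<cdot> s) \<cdot> s'" using assms by simp
  then show ?thesis
    using s' homD[OF assms(2)] homD[OF assms(3)] homD[OF assms(4)] homD[OF s'(1)] by simp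
qed

lemma iso_cancel_left:
  assumes "iso C s" "s \<in> hom C Y Z" "f \<in> hom C X Y" "g \<in> hom C X Y" "s \<cdot> f = s \<cdot> g"
  shows "f = g"
proof -
  obtain s' where s': "s' \<in> hom C Z Y" "s' \<cdot> s = idn C Y" "s \<cdot> s' = idn C Z" using isoE assms by metis
  have "(s' \<cdot> s) \<cdot> f = (s' \<cdot> s) \<cdot> g"
    using assms(5) homD[OF assms(2)] homD[OF assms(3)] homD[OF assms(4)] homD[OF s'(1)] by simp
  then show ?thesis using s' homD[OF assms(3)] homD[OF assms(4)] by simp
qed

end

lemma functor_hom: "is_functor C D Fo Fa \<Longrightarrow> f \<in> hom C X Y \<Longrightarrow> Fa f \<in> hom D (Fo X) (Fo Y)"
  and functor_obj: "is_functor C D Fo Fa \<Longrightarrow> X \<in> obj C \<Longrightarrow> Fo X \<in> obj D"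
  and functor_idn: "is_functor C D Fo Fa \<Longrightarrow> X \<in> obj C \<Longrightarrow> Fa (idn C X) = idn D (Fo X)"
  and functor_cmp: "is_functor C D Fo Fa \<Longrightarrow> f \<in> hom C X Y \<Longrightarrow> g \<in> hom C Y Z \<Longrightarrow>
     Fa (g \<cdot>\<^bsub>C\<^esub> f) = Fa g \<cdot>\<^bsub>D\<^esub> Fa f"
  unfolding is_functor_def by auto

context linear_category
begin

lemma hom_vector_space:
  assumes "X \<in> obj C" "Y \<in> obj C"
  shows "partial_vector_space (hom C X Y) (add C) (smul C) (zer C X Y)"
  by unfold_locales (auto simp: assms zer_hom add_hom smul_hom add_assoc add_zer add_neg smul_add add_smul
      smul_smul smul_one intro: add_comm)

lemma arr_zer [simp]:
  assumes "X \<in> obj C" "Y \<in> obj C"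
  shows "zer C X Y \<in> arr C" "src C (zer C X Y) = X" "tgt C (zer C X Y) = Y"
  using homD[OF zer_hom[OF assms]] by auto

lemma arr_add [simp]:
  assumes "f \<in> arr C" "g \<in> arr C" "src C f = src C g" "tgt C f = tgt C g"
  shows "add C f g \<in> arr C" "src C (add C f g) = src C g" "tgt C (add C f g) = tgt C g"
  using homD[OF add_hom[of f "src C g" "tgt C g" g]] assms by (auto simp: hom_def)

lemma arr_smul [simp]:
  assumes "f \<in> arr C"
  shows "smul C a f \<in> arr C" "src C (smul C a f) = src C f" "tgt C (smul C a f) = tgt C f"
  using homD[OF smul_hom[of f "src C f" "tgt C f" a]] assms by (auto simp: hom_def)

lemma smul_0: "f \<in> hom C X Y \<Longrightarrow> smul C 0 f = zer C X Y"
  using partial_vector_space.sc_0[OF hom_vector_space] homD(4,5) by blast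

lemma cmp_zer:
  assumes "g \<in> hom C Y Z" "X \<in> obj C" shows "g \<cdot> zer C X Y = zer C X Z"
proof -
  have z: "zer C X Y \<in> hom C X Y" using assms(2) homD(4,5)[OF assms(1)] zer_hom by auto
  have "g \<cdot> zer C X Y = g \<cdot> smul C 0 (zer C X Y)" by (simp add: smul_0[OF z])
  also have "\<dots> = smul C 0 (g \<cdot> zer C X Y)" using cmp_smul_right[OF z assms(1)] .
  also have "\<dots> = zer C X Z" using smul_0 cmp_hom z assms by blast
  finally show ?thesis .
qed

lemma zer_cmp:
  assumes "f \<in> hom C X Y" "Z \<in> obj C" shows "zer C Y Z \<cdot> f = zer C X Z"
proof -
  have z: "zer C Y Z \<in> hom C Y Z" using assms(2) homD(4,5)[OF assms(1)] zer_hom by auto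
  have "zer C Y Z \<cdot> f = smul C 0 (zer C Y Z) \<cdot> f" by (simp add: smul_0[OF z])
  also have "\<dots> = smul C 0 (zer C Y Z \<cdot> f)" using cmp_smul_left[OF assms(1) z] .
  also have "\<dots> = zer C X Z" using smul_0 cmp_hom z assms by blast
  finally show ?thesis .
qed

lemma cmp_zer' [simp]: "g \<in> arr C \<Longrightarrow> X \<in> obj C \<Longrightarrow> Y = src C g \<Longrightarrow> g \<cdot> zer C X Y = zer C X (tgt C g)"
  using cmp_zer arr_hom by blast

lemma zer_cmp' [simp]: "f \<in> arr C \<Longrightarrow> Z \<in> obj C \<Longrightarrow> Y = tgt C f \<Longrightarrow> zer C Y Z \<cdot> f = zer C (src C f) Z"
  using zer_cmp arr_hom by blast

definition dif where "dif f g = add C f (smul C (- 1) g)"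

lemma arr_dif [simp]:
  assumes "f \<in> arr C" "g \<in> arr C" "src C f = src C g" "tgt C f = tgt C g"
  shows "dif f g \<in> arr C" "src C (dif f g) = src C g" "tgt C (dif f g) = tgt C g"
  unfolding dif_def using assms by auto

lemma dif_eq_0: "f \<in> hom C X Y \<Longrightarrow> g \<in> hom C X Y \<Longrightarrow> dif f g = zer C X Y \<longleftrightarrow> f = g"
  using partial_vector_space.df_eq_0[OF hom_vector_space, of X Y f g] homD[of f X Y]
  by (simp add: dif_def partial_vector_space.df_def[OF hom_vector_space])

lemma dif_hom: "f \<in> hom C X Y \<Longrightarrow> g \<in> hom C X Y \<Longrightarrow> dif f g \<in> hom C X Y"
  by (simp add: dif_def add_hom smul_hom)

lemma cmp_dif: "f \<in> hom C X Y \<Longrightarrow> f' \<in> hom C X Y \<Longrightarrow> g \<in> hom C Y Z \<Longrightarrow> g \<cdot> dif f f' = dif (g \<cdot> f) (g \<cdot> f')"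
  by (simp add: dif_def cmp_add_right[OF _ smul_hom] cmp_smul_right)

lemma dif_cmp: "f \<in> hom C X Y \<Longrightarrow> g \<in> hom C Y Z \<Longrightarrow> g' \<in> hom C Y Z \<Longrightarrow> dif g g' \<cdot> f = dif (g \<cdot> f) (g' \<cdot> f)"
  by (simp add: dif_def cmp_add_left[OF _ _ smul_hom] cmp_smul_left)

lemma mono_zeroI:
  assumes f: "f \<in> hom C X Y"
    and z: "\<And>W g. g \<in> hom C W X \<Longrightarrow> f \<cdot> g = zer C W Y \<Longrightarrow> g = zer C W X"
  shows "mono C f"
  unfolding mono_def
proof (intro conjI allI ballI impI)
  fix W g h assume a: "g \<in> hom C W (src C f)" "h \<in> hom C W (src C f)" "f \<cdot> g = f \<cdot> h"
  note d = homD[OF f]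
  have "f \<cdot> dif g h = zer C W Y"
    using cmp_dif[OF _ _ f, of g W h] a d dif_eq_0[OF cmp_hom[OF _ f] cmp_hom[OF _ f], of g W h] by simp
  then show "g = h" using z[of "dif g h" W] dif_eq_0[of g W X h] dif_hom[of g W X h] a d by simp
qed (use homD[OF f] in auto)

lemma epi_zeroI:
  assumes f: "f \<in> hom C X Y"
    and z: "\<And>W g. g \<in> hom C Y W \<Longrightarrow> g \<cdot> f = zer C X W \<Longrightarrow> g = zer C Y W"
  shows "epi C f"
  unfolding epi_def
proof (intro conjI allI ballI impI)
  fix W g h assume a: "g \<in> hom C (tgt C f) W" "h \<in> hom C (tgt C f) W" "g \<cdot> f = h \<cdot> f"
  note d = homD[OF f]
  have "dif g h \<cdot> f = zer C X W"
    using dif_cmp[OF f, of g W h] a d dif_eq_0[OF cmp_hom[OF f] cmp_hom[OF f], of g W h] by simp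
  then show "g = h" using z[of "dif g h" W] dif_eq_0[of g Y W h] dif_hom[of g Y W h] a d by simp
qed (use homD[OF f] in auto)

lemma mono_zeroD: "mono C f \<Longrightarrow> f \<in> hom C X Y \<Longrightarrow> g \<in> hom C W X \<Longrightarrow> f \<cdot> g = zer C W Y \<Longrightarrow> g = zer C W X"
  using homD[of f X Y] homD[of g W X] zer_hom[of W X] unfolding mono_def by auto

lemma epi_zeroD: "epi C f \<Longrightarrow> f \<in> hom C X Y \<Longrightarrow> g \<in> hom C Y W \<Longrightarrow> g \<cdot> f = zer C X W \<Longrightarrow> g = zer C Y W"
  using homD[of f X Y] homD[of g Y W] zer_hom[of Y W] unfolding epi_def by auto

lemma epi_cancel: "epi C f \<Longrightarrow> f \<in> hom C X Y \<Longrightarrow> g \<in> hom C Y W \<Longrightarrow> h \<in> hom C Y W \<Longrightarrow> g \<cdot> f = h \<cdot> f \<Longrightarrow> g = h"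
  unfolding epi_def using homD(2,3) by metis

lemma mono_cancel: "mono C f \<Longrightarrow> f \<in> hom C X Y \<Longrightarrow> g \<in> hom C W X \<Longrightarrow> h \<in> hom C W X \<Longrightarrow> f \<cdot> g = f \<cdot> h \<Longrightarrow> g = h"
  unfolding mono_def using homD(2,3) by metis

text \<open>The unique factorization is split into existence and the monomorphism property, the two
  forms in which it is used.\<close>

lemma is_kernelD:
  assumes "is_kernel C f i" "f \<in> hom C X Y"
  obtains K where "i \<in> hom C K X" "f \<cdot> i = zer C K Y"
    "\<And>W h. h \<in> hom C W X \<Longrightarrow> f \<cdot> h = zer C W Y \<Longrightarrow> \<exists>u\<in>hom C W K. i \<cdot> u = h" "mono C i"
proof -
  note d = homD[OF assms(2)]
  let ?K = "src C i"
  have 1: "i \<in> hom C ?K X" "f \<cdot> i = zer C ?K Y" using assms d by (auto simp: is_kernel_def hom_def)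
  have 2: "\<exists>u\<in>hom C W ?K. i \<cdot> u = h" if "h \<in> hom C W X" "f \<cdot> h = zer C W Y" for W h
    using assms d that unfolding is_kernel_def Bex_def by simp blast
  have "mono C i" unfolding mono_def
  proof (intro conjI allI ballI impI)
    fix W g h assume a: "g \<in> hom C W (src C i)" "h \<in> hom C W (src C i)" "i \<cdot> g = i \<cdot> h"
    have "f \<cdot> (i \<cdot> g) = zer C W Y" "i \<cdot> g \<in> hom C W X"
      using a 1 homD[OF 1(1)] homD[OF a(1)] d by (auto simp: cmp_extend hom_def)
    then have "\<exists>!u. u \<in> hom C W ?K \<and> i \<cdot> u = i \<cdot> g"
      using assms(1) unfolding is_kernel_def d by blast
    then show "g = h" using a by metis
  qed (use homD[OF 1(1)] in auto)
  then show ?thesis using that 1 2 by blast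
qed

lemma is_kernelI:
  assumes "f \<in> hom C X Y" "i \<in> hom C K X" "f \<cdot> i = zer C K Y" "mono C i"
    "\<And>W h. h \<in> hom C W X \<Longrightarrow> f \<cdot> h = zer C W Y \<Longrightarrow> \<exists>u\<in>hom C W K. i \<cdot> u = h"
  shows "is_kernel C f i"
  using homD[OF assms(1)] homD[OF assms(2)] assms mono_cancel[OF assms(4,2)]
  by (auto simp: is_kernel_def)

lemma is_cokernelD:
  assumes "is_cokernel C f p" "f \<in> hom C X Y"
  obtains K where "p \<in> hom C Y K" "p \<cdot> f = zer C X K"
    "\<And>W h. h \<in> hom C Y W \<Longrightarrow> h \<cdot> f = zer C X W \<Longrightarrow> \<exists>u\<in>hom C K W. u \<cdot> p = h" "epi C p"
proof -
  note d = homD[OF assms(2)]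
  let ?K = "tgt C p"
  have 1: "p \<in> hom C Y ?K" "p \<cdot> f = zer C X ?K" using assms d by (auto simp: is_cokernel_def hom_def)
  have 2: "\<exists>u\<in>hom C ?K W. u \<cdot> p = h" if "h \<in> hom C Y W" "h \<cdot> f = zer C X W" for W h
    using assms d that unfolding is_cokernel_def Bex_def by simp blast
  have "epi C p" unfolding epi_def
  proof (intro conjI allI ballI impI)
    fix W g h assume a: "g \<in> hom C (tgt C p) W" "h \<in> hom C (tgt C p) W" "g \<cdot> p = h \<cdot> p"
    have "(g \<cdot> p) \<cdot> f = zer C X W" "g \<cdot> p \<in> hom C Y W"
      using a(1) 1 homD[OF 1(1)] homD[OF a(1)] d by (auto simp: cmp_extend hom_def)
    then have "\<exists>!u. u \<in> hom C ?K W \<and> u \<cdot> p = g \<cdot> p"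
      using assms(1) unfolding is_cokernel_def d by blast
    then show "g = h" using a by metis
  qed (use homD[OF 1(1)] in auto)
  then show ?thesis using that 1 2 by blast
qed

lemma cokernelE:
  assumes "is_cokernel C f p" "f \<in> hom C X Y"
  obtains K where "p \<in> hom C Y K" "p \<cdot> f = zer C X K" "epi C p"
  using is_cokernelD[OF assms] by metis

lemma kernelE:
  assumes "is_kernel C f i" "f \<in> hom C X Y"
  obtains K where "i \<in> hom C K X" "f \<cdot> i = zer C K Y" "mono C i"
  using is_kernelD[OF assms] by metis

lemma is_cokernelI:
  assumes "f \<in> hom C X Y" "p \<in> hom C Y K" "p \<cdot> f = zer C X K" "epi C p"
    "\<And>W h. h \<in> hom C Y W \<Longrightarrow> h \<cdot> f = zer C X W \<Longrightarrow> \<exists>u\<in>hom C K W. u \<cdot> p = h"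
  shows "is_cokernel C f p"
  using homD[OF assms(1)] homD[OF assms(2)] assms epi_cancel[OF assms(4,2)]
  by (auto simp: is_cokernel_def)

lemma cokernel_factor:
  assumes "is_cokernel C f p" "p \<in> hom C Y K" "h \<in> hom C Y W" "f \<in> hom C X Y" "h \<cdot> f = zer C X W"
  shows "\<exists>u\<in>hom C K W. u \<cdot> p = h"
proof -
  obtain K' where K': "p \<in> hom C Y K'"
    "\<And>W h. h \<in> hom C Y W \<Longrightarrow> h \<cdot> f = zer C X W \<Longrightarrow> \<exists>u\<in>hom C K' W. u \<cdot> p = h"
    using is_cokernelD[OF assms(1,4)] by blast
  then have "K' = K" using assms(2) by (simp add: hom_def)
  then show ?thesis using K'(2)[OF assms(3,5)] by simp
qed

lemma kernel_factor:
  assumes "is_kernel C f i" "i \<in> hom C K X" "h \<in> hom C W X" "f \<in> hom C X Y" "f \<cdot> h = zer C W Y"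
  shows "\<exists>u\<in>hom C W K. i \<cdot> u = h"
proof -
  obtain K' where K': "i \<in> hom C K' X"
    "\<And>W h. h \<in> hom C W X \<Longrightarrow> f \<cdot> h = zer C W Y \<Longrightarrow> \<exists>u\<in>hom C W K'. i \<cdot> u = h"
    using is_kernelD[OF assms(1,4)] by blast
  then have "K' = K" using assms(2) by (simp add: hom_def)
  then show ?thesis using K'(2)[OF assms(3,5)] by simp
qed

lemma cokernel_epi: "is_cokernel C f p \<Longrightarrow> epi C p"
  using is_cokernelD[of f p "src C f" "tgt C f"] by (auto simp: is_cokernel_def hom_def)

lemma kernel_mono: "is_kernel C f p \<Longrightarrow> mono C p"
  using is_kernelD[of f p "src C f" "tgt C f"] by (auto simp: is_kernel_def hom_def)

lemma epi_factor: 
  assumes "epi C (g \<cdot> f)" "f \<in> hom C X Y" "g \<in> hom C Y Z" shows "epi C g"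
proof (rule epi_zeroI[OF assms(3)])
  fix W h assume a: "h \<in> hom C Z W" "h \<cdot> g = zer C Y W"
  note d = homD[OF assms(2)] homD[OF assms(3)] homD[OF a(1)]
  have "h \<cdot> (g \<cdot> f) = zer C X W" using d a by (simp add: cmp_extend)
  then show "h = zer C Z W" using epi_zeroD[OF assms(1) cmp_hom[OF assms(2,3)] a(1)] by simp
qed

lemma epi_cmp:
  assumes "epi C f" "epi C g" "f \<in> hom C X Y" "g \<in> hom C Y Z" shows "epi C (g \<cdot> f)"
proof (rule epi_zeroI[OF cmp_hom[OF assms(3,4)]])
  fix W h assume a: "h \<in> hom C Z W" "h \<cdot> (g \<cdot> f) = zer C X W"
  note d = homD[OF assms(3)] homD[OF assms(4)] homD[OF a(1)]
  have "(h \<cdot> g) \<cdot> f = zer C X W" using d a by simp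
  then have "h \<cdot> g = zer C Y W" using epi_zeroD[OF assms(1,3)] cmp_hom assms a by blast
  then show "h = zer C Z W" using epi_zeroD[OF assms(2,4)] a by blast
qed

lemma iso_epi:
  assumes "iso C f" "f \<in> hom C X Y" shows "epi C f"
proof (rule epi_zeroI[OF assms(2)])
  fix W g assume a: "g \<in> hom C Y W" "g \<cdot> f = zer C X W"
  then show "g = zer C Y W"
    using iso_cancel_right[OF assms a(1), of "zer C Y W"] homD[OF assms(2)] homD[OF a(1)] zer_hom
    by auto
qed

lemma iso_mono:
  assumes "iso C f" "f \<in> hom C X Y" shows "mono C f"
proof (rule mono_zeroI[OF assms(2)])
  fix W g assume a: "g \<in> hom C W X" "f \<cdot> g = zer C W Y"
  then show "g = zer C W X"
    using iso_cancel_left[OF assms a(1), of "zer C W X"] homD[OF assms(2)] homD[OF a(1)] zer_hom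
    by auto
qed

text \<open>A morphism kills \<open>f \<cdot> s\<close> exactly when it kills \<open>f\<close>, so
  both have the same cokernels.\<close>

lemma cokernel_cmp_epi:
  assumes "is_cokernel C f p" "epi C s" "s \<in> hom C W X" "f \<in> hom C X Y"
  shows "is_cokernel C (f \<cdot> s) p"
proof -
  obtain K where K: "p \<in> hom C Y K" "p \<cdot> f = zer C X K"
    "\<And>W h. h \<in> hom C Y W \<Longrightarrow> h \<cdot> f = zer C X W \<Longrightarrow> \<exists>u\<in>hom C K W. u \<cdot> p = h" "epi C p"
    using is_cokernelD[OF assms(1,4)] by blast
  note d = homD[OF assms(3)] homD[OF assms(4)] homD[OF K(1)]
  show ?thesis
  proof (rule is_cokernelI[OF cmp_hom[OF assms(3,4)] K(1) _ K(4)])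
    show "p \<cdot> (f \<cdot> s) = zer C W K" using d K by (simp add: cmp_extend)
    fix V h assume a: "h \<in> hom C Y V" "h \<cdot> (f \<cdot> s) = zer C W V"
    have "(h \<cdot> f) \<cdot> s = zer C W V" using d a homD[OF a(1)] by simp
    then have "h \<cdot> f = zer C X V" using epi_zeroD[OF assms(2,3)] cmp_hom assms a by blast
    then show "\<exists>u\<in>hom C K V. u \<cdot> p = h" using K a by blast
  qed
qed

text \<open>The same observation read backwards. It removes the epimorphism
  \<open>q^d \<psi>_n\<close> once \<open>\<psi> (Suc n) \<cdot> z\<close> has been written as
  \<zeta> after it.\<close>

lemma cokernel_cmp_epiD:
  assumes "is_cokernel C (f \<cdot> s) p" "epi C s" "s \<in> hom C W X" "f \<in> hom C X Y"
  shows "is_cokernel C f p"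
proof -
  note fs = cmp_hom[OF assms(3,4)]
  obtain K where K: "p \<in> hom C Y K" "p \<cdot> (f \<cdot> s) = zer C W K"
    "\<And>V h. h \<in> hom C Y V \<Longrightarrow> h \<cdot> (f \<cdot> s) = zer C W V \<Longrightarrow> \<exists>u\<in>hom C K V. u \<cdot> p = h" "epi C p"
    using is_cokernelD[OF assms(1) fs] by blast
  note d = homD[OF assms(3)] homD[OF assms(4)] homD[OF K(1)]
  show ?thesis
  proof (rule is_cokernelI[OF assms(4) K(1) _ K(4)])
    have "(p \<cdot> f) \<cdot> s = zer C W K" using d K by simp
    then show "p \<cdot> f = zer C X K" using epi_zeroD[OF assms(2,3)] cmp_hom assms K by blast
    fix V h assume a: "h \<in> hom C Y V" "h \<cdot> f = zer C X V"
    have "h \<cdot> (f \<cdot> s) = zer C W V" using d a homD[OF a(1)] by (simp add: cmp_extend)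
    then show "\<exists>u\<in>hom C K V. u \<cdot> p = h" using K a by blast
  qed
qed

lemma kernel_cmp_iso:
  assumes "is_kernel C f i" "iso C s" "s \<in> hom C L K" "i \<in> hom C K X" "f \<in> hom C X Y"
  shows "is_kernel C f (i \<cdot> s)"
proof -
  obtain K' where K: "i \<in> hom C K' X" "f \<cdot> i = zer C K' Y"
    "\<And>W h. h \<in> hom C W X \<Longrightarrow> f \<cdot> h = zer C W Y \<Longrightarrow> \<exists>u\<in>hom C W K'. i \<cdot> u = h" "mono C i"
    using is_kernelD[OF assms(1,5)] by blast
  have KK: "K' = K" using K(1) assms(4) by (auto simp: hom_def)
  obtain s' where s': "s' \<in> hom C K L" "s' \<cdot> s = idn C L" "s \<cdot> s' = idn C K" using isoE assms by metis
  note d = homD[OF assms(3)] homD[OF assms(4)] homD[OF assms(5)] homD[OF s'(1)]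
  show ?thesis
  proof (rule is_kernelI[OF assms(5) cmp_hom[OF assms(3,4)]])
    show "f \<cdot> (i \<cdot> s) = zer C L Y" using d K KK by (simp add: cmp_extend)
    show "mono C (i \<cdot> s)"
    proof (rule mono_zeroI[OF cmp_hom[OF assms(3,4)]])
      fix W g assume g: "g \<in> hom C W L" "i \<cdot> s \<cdot> g = zer C W X"
      have "i \<cdot> (s \<cdot> g) = zer C W X" using g d homD[OF g(1)] by simp
      then have "s \<cdot> g = zer C W K" using mono_zeroD[OF K(4) assms(4)] cmp_hom g assms by blast
      then show "g = zer C W L" using mono_zeroD[OF iso_mono] assms(2,3) g by blast
    qed
    fix W h assume a: "h \<in> hom C W X" "f \<cdot> h = zer C W Y"
    then obtain u where u: "u \<in> hom C W K" "i \<cdot> u = h" using K KK by blast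
    have "(i \<cdot> s) \<cdot> (s' \<cdot> u) = i \<cdot> ((s \<cdot> s') \<cdot> u)" using d homD[OF u(1)] by simp
    also have "\<dots> = h" using d homD[OF u(1)] u s' by simp
    finally show "\<exists>v\<in>hom C W L. (i \<cdot> s) \<cdot> v = h" using cmp_hom[OF u(1) s'(1)] by blast
  qed
qed

text \<open>A morphism on \<open>Y\<close> killing \<open>s \<cdot> w\<close> pulls back along
  \<open>s\<close> to one killing \<open>w\<close>, hence factors through \<open>p\<close>, and
  \<open>s\<close> can be cancelled. With \<open>w\<close> a power z^n and \<open>s\<close> the
  projection to T_m, this exhibits T_m -> T_n as the cokernel of z^n followed by the
  projection.\<close>

lemma cokernel_through_epi:
  assumes "is_cokernel C w p" "w \<in> hom C W X" "epi C s" "s \<in> hom C X Y" "t \<in> hom C Y Z" "t \<cdot> s = p"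
  shows "is_cokernel C (s \<cdot> w) t"
proof -
  obtain K where K: "p \<in> hom C X K" "p \<cdot> w = zer C W K"
    "\<And>V h. h \<in> hom C X V \<Longrightarrow> h \<cdot> w = zer C W V \<Longrightarrow> \<exists>u\<in>hom C K V. u \<cdot> p = h" "epi C p"
    using is_cokernelD[OF assms(1,2)] by blast
  note d = homD[OF assms(2)] homD[OF assms(4)] homD[OF assms(5)]
  have KZ: "K = Z" using K(1) d assms(6) by (auto simp: hom_def)
  show ?thesis
  proof (rule is_cokernelI[OF cmp_hom[OF assms(2,4)] assms(5)])
    show "t \<cdot> (s \<cdot> w) = zer C W Z" using d K KZ assms(6) cmp_assoc'[of w s t] by simp
    show "epi C t" using epi_factor[of t s] assms K by simp
    fix V h assume h: "h \<in> hom C Y V" "h \<cdot> (s \<cdot> w) = zer C W V"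
    have "(h \<cdot> s) \<cdot> w = zer C W V" using h d homD[OF h(1)] by simp
    then obtain u where u: "u \<in> hom C Z V" "u \<cdot> p = h \<cdot> s" using K KZ cmp_hom assms(4) h(1) by metis
    have "(u \<cdot> t) \<cdot> s = h \<cdot> s" using d homD[OF u(1)] u assms(6) by simp
    then have "u \<cdot> t = h" using epi_cancel[OF assms(3,4)] cmp_hom[OF assms(5) u(1)] h(1) by blast
    then show "\<exists>u\<in>hom C Z V. u \<cdot> t = h" using u by blast
  qed
qed

end

section \<open>Diagram chasing with covers in an abelian category\<close>

context abelian_category
begin

text \<open>\<open>i\<close> is the kernel of some \<open>f\<close>, and \<open>f\<close> factors
  through the cokernel \<open>p\<close>; so whatever \<open>p\<close> kills is killed by
  \<open>f\<close> and factors through \<open>i\<close>.\<close>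

lemma mono_kernel_of_cokernel:
  assumes "mono C i" "is_cokernel C i p" shows "is_kernel C p i"
proof -
  have i: "i \<in> hom C (src C i) (tgt C i)" using assms by (auto simp: mono_def hom_def)
  obtain f where f: "is_kernel C f i" using mono_is_kernel assms by blast
  have fh: "f \<in> hom C (tgt C i) (tgt C f)" using f by (auto simp: is_kernel_def hom_def)
  have fi: "f \<cdot> i = zer C (src C i) (tgt C f)" using f by (auto simp: is_kernel_def)
  obtain K where p: "p \<in> hom C (tgt C i) K" "p \<cdot> i = zer C (src C i) K" using cokernelE[OF assms(2) i] by blast
  obtain f' where f': "f' \<in> hom C K (tgt C f)" "f' \<cdot> p = f"
    using cokernel_factor[OF assms(2) p(1) fh i fi] by blast
  show ?thesis
  proof (rule is_kernelI[OF p(1) i p(2) assms(1)])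
    fix W h assume a: "h \<in> hom C W (tgt C i)" "p \<cdot> h = zer C W K"
    have "f \<cdot> h = f' \<cdot> (p \<cdot> h)" using f' homD[OF a(1)] homD[OF p(1)] homD[OF f'(1)] by (metis cmp_assoc')
    also have "\<dots> = zer C W (tgt C f)" using a homD[OF f'(1)] homD[OF a(1)] by simp
    finally show "\<exists>u\<in>hom C W (src C i). i \<cdot> u = h" using kernel_factor[OF f i a(1) fh] by blast
  qed
qed

lemma epi_cokernel_of_kernel:
  assumes "epi C p" "is_kernel C p i" shows "is_cokernel C i p"
proof -
  have p: "p \<in> hom C (src C p) (tgt C p)" using assms by (auto simp: epi_def hom_def)
  obtain f where f: "is_cokernel C f p" using epi_is_cokernel assms by blast
  have fh: "f \<in> hom C (src C f) (src C p)" using f by (auto simp: is_cokernel_def hom_def)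
  have pf: "p \<cdot> f = zer C (src C f) (tgt C p)" using f by (auto simp: is_cokernel_def)
  obtain K where i: "i \<in> hom C K (src C p)" "p \<cdot> i = zer C K (tgt C p)" using kernelE[OF assms(2) p] by blast
  obtain f' where f': "f' \<in> hom C (src C f) K" "i \<cdot> f' = f"
    using kernel_factor[OF assms(2) i(1) fh p pf] by blast
  show ?thesis
  proof (rule is_cokernelI[OF i(1) p i(2) assms(1)])
    fix W h assume a: "h \<in> hom C (src C p) W" "h \<cdot> i = zer C K W"
    have "h \<cdot> f = (h \<cdot> i) \<cdot> f'" using f' homD[OF a(1)] homD[OF i(1)] homD[OF f'(1)] by (metis cmp_assoc')
    also have "\<dots> = zer C (src C f) W" using a homD[OF f'(1)] homD[OF a(1)] by simp
    finally show "\<exists>u\<in>hom C (tgt C p) W. u \<cdot> p = h" using cokernel_factor[OF f p a(1) fh] by blast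
  qed
qed

text \<open>This replaces choosing a preimage of an element: the preimage exists on a cover
  \<open>w\<close> of the source. The cover is the pullback of \<open>p\<close> along
  \<open>x\<close>, built as the kernel of the difference of \<open>p\<close> and \<open>x\<close>
  on the biproduct.\<close>

lemma epi_lift:
  assumes p: "epi C p" "p \<in> hom C B D" and x: "x \<in> hom C W D"
  obtains W' w y where "epi C w" "w \<in> hom C W' W" "y \<in> hom C W' B" "p \<cdot> y = x \<cdot> w"
proof -
  note d = homD[OF p(2)] homD[OF x]
  obtain S i j pB pW where S: "S \<in> obj C" "i \<in> hom C B S" "j \<in> hom C W S" "pB \<in> hom C S B" "pW \<in> hom C S W"
    "pB \<cdot> i = idn C B" "pW \<cdot> j = idn C W" "pB \<cdot> j = zer C W B" "pW \<cdot> i = zer C B W"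
    using ex_biproduct[of B W] d by blast
  note dS = homD[OF S(2)] homD[OF S(3)] homD[OF S(4)] homD[OF S(5)]
  define \<phi> where "\<phi> = dif (p \<cdot> pB) (x \<cdot> pW)"
  have ppB: "p \<cdot> pB \<in> hom C S D" and xpW: "x \<cdot> pW \<in> hom C S D" using d dS by (auto simp: hom_def)
  have \<phi>: "\<phi> \<in> hom C S D" unfolding \<phi>_def using dif_hom ppB xpW by blast
  have "\<phi> \<cdot> i = dif (p \<cdot> pB \<cdot> i) (x \<cdot> pW \<cdot> i)" unfolding \<phi>_def by (rule dif_cmp[OF S(2) ppB xpW])
  also have "\<dots> = dif p (zer C B D)" using d dS S by simp
  also have "\<dots> = p" unfolding dif_def
    using partial_vector_space.sc_zero[OF hom_vector_space] d p(2) by (metis add_zer)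
  finally have \<phi>i: "\<phi> \<cdot> i = p" .
  have "epi C \<phi>" using epi_factor[of \<phi> i] \<phi>i p S \<phi> by metis
  obtain \<kappa> where \<kappa>: "is_kernel C \<phi> \<kappa>" using ex_kernel homD[OF \<phi>] by blast
  obtain K where K: "\<kappa> \<in> hom C K S" "\<phi> \<cdot> \<kappa> = zer C K D" using kernelE[OF \<kappa> \<phi>] by blast
  have cok: "is_cokernel C \<kappa> \<phi>" using epi_cokernel_of_kernel \<kappa> \<open>epi C \<phi>\<close> by blast
  note dK = homD[OF K(1)] homD[OF \<phi>]
  have "dif ((p \<cdot> pB) \<cdot> \<kappa>) ((x \<cdot> pW) \<cdot> \<kappa>) = zer C K D" using K dif_cmp[OF K(1) ppB xpW] \<phi>_def by simp
  then have eq: "(p \<cdot> pB) \<cdot> \<kappa> = (x \<cdot> pW) \<cdot> \<kappa>" using dif_eq_0[OF cmp_hom[OF K(1) ppB] cmp_hom[OF K(1) xpW]] by simp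
  have w: "pW \<cdot> \<kappa> \<in> hom C K W" using K S cmp_hom by blast
  \<comment> \<open>A morphism \<open>h\<close> killing this projection makes
    \<open>h \<cdot> pW\<close> factor through \<open>\<phi>\<close>, the cokernel of
    \<open>\<kappa>\<close>. On \<open>B\<close>, where \<open>pW\<close> vanishes, the factor kills
    the epimorphism \<open>p\<close>, so it is zero.\<close>
  have "epi C (pW \<cdot> \<kappa>)"
  proof (rule epi_zeroI[OF w])
    fix Z h assume h: "h \<in> hom C W Z" "h \<cdot> (pW \<cdot> \<kappa>) = zer C K Z"
    note dh = homD[OF h(1)]
    have "(h \<cdot> pW) \<cdot> \<kappa> = zer C K Z" using h dS dK dh by simp
    then obtain u where u: "u \<in> hom C D Z" "u \<cdot> \<phi> = h \<cdot> pW"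
      using cokernel_factor[OF cok \<phi> _ K(1)] cmp_hom[OF S(5) h(1)] by blast
    have "u \<cdot> p = (u \<cdot> \<phi>) \<cdot> i" using \<phi>i dS dK homD[OF u(1)] by simp
    also have "\<dots> = zer C B Z" using u dS dh S by simp
    finally have "u = zer C D Z" using epi_zeroD[OF p u(1)] by simp
    then have "h \<cdot> pW = zer C S Z" using u dK dh by simp
    then have "(h \<cdot> pW) \<cdot> j = zer C W Z" using dS dh by simp
    then show "h = zer C W Z" using dS dh S by simp
  qed
  moreover have "p \<cdot> (pB \<cdot> \<kappa>) = x \<cdot> (pW \<cdot> \<kappa>)" using eq d dS dK by simp
  ultimately show ?thesis using that w cmp_hom[OF K(1) S(4)] by blast
qed

text \<open>Exactness at \<open>B\<close> in terms of covers: an element killed by \<open>p\<close>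
  comes from \<open>A\<close>. The point is that \<open>f\<close> maps onto the kernel of
  \<open>p\<close>.\<close>

lemma cokernel_lift:
  assumes p: "is_cokernel C f p" "f \<in> hom C A B" "p \<in> hom C B D" and y: "y \<in> hom C W B" "p \<cdot> y = zer C W D"
  obtains W' w u where "epi C w" "w \<in> hom C W' W" "u \<in> hom C W' A" "f \<cdot> u = y \<cdot> w"
proof -
  obtain i where i: "is_kernel C p i" using ex_kernel homD[OF p(3)] by blast
  obtain I where I: "i \<in> hom C I B" "p \<cdot> i = zer C I D" "mono C i" using kernelE[OF i p(3)] by blast
  have pf: "p \<cdot> f = zer C A D" using p(1) homD[OF p(2)] homD[OF p(3)] by (simp add: is_cokernel_def)
  obtain e where e: "e \<in> hom C A I" "i \<cdot> e = f" using kernel_factor[OF i I(1) p(2,3) pf] by blast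
  note d = homD[OF p(2)] homD[OF p(3)] homD[OF I(1)] homD[OF e(1)]
  \<comment> \<open>If \<open>h\<close> kills \<open>e\<close>, then \<open>f\<close> factors
    through the subobject \<open>i \<cdot> k\<close>, where \<open>k\<close> is the kernel of
    \<open>h\<close>. This subobject is the kernel of some \<open>g\<close>; since \<open>g\<close>
    kills \<open>f\<close>, it factors through \<open>p\<close> and kills \<open>i\<close>. So
    \<open>i\<close> factors back through \<open>i \<cdot> k\<close>, \<open>k\<close> is split epi
    and \<open>h\<close> vanishes.\<close>
  have "epi C e"
  proof (rule epi_zeroI[OF e(1)])
    fix Z h assume h: "h \<in> hom C I Z" "h \<cdot> e = zer C A Z"
    obtain k where k: "is_kernel C h k" using ex_kernel homD[OF h(1)] by blast
    obtain L where L: "k \<in> hom C L I" "h \<cdot> k = zer C L Z" "mono C k" using kernelE[OF k h(1)] by blast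
    obtain e' where e': "e' \<in> hom C A L" "k \<cdot> e' = e" using kernel_factor[OF k L(1) e(1) h(1) h(2)] by blast
    note d2 = homD[OF L(1)] homD[OF e'(1)] homD[OF h(1)]
    have ik: "i \<cdot> k \<in> hom C L B" using L I cmp_hom by blast
    have "mono C (i \<cdot> k)"
    proof (rule mono_zeroI[OF ik])
      fix V g assume g: "g \<in> hom C V L" "i \<cdot> k \<cdot> g = zer C V B"
      have "i \<cdot> (k \<cdot> g) = zer C V B" using g d d2 homD[OF g(1)] by simp
      then have "k \<cdot> g = zer C V I" using mono_zeroD[OF I(3,1)] cmp_hom g L by blast
      then show "g = zer C V L" using mono_zeroD[OF L(3,1)] g by blast
    qed
    then obtain g where g: "is_kernel C g (i \<cdot> k)" using mono_is_kernel by blast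
    have gh: "g \<in> hom C B (tgt C g)" using g d d2 by (auto simp: is_kernel_def hom_def)
    have gik: "g \<cdot> (i \<cdot> k) = zer C L (tgt C g)" using g d d2 by (auto simp: is_kernel_def hom_def)
    note dg = homD[OF gh]
    have "g \<cdot> f = (g \<cdot> (i \<cdot> k)) \<cdot> e'" using e e' d d2 dg by simp
    also have "\<dots> = zer C A (tgt C g)" using gik d2 dg by simp
    finally obtain g' where g': "g' \<in> hom C D (tgt C g)" "g' \<cdot> p = g"
      using cokernel_factor[OF p(1,3) gh p(2)] by blast
    have "g \<cdot> i = g' \<cdot> (p \<cdot> i)" using g'(2) homD[OF g'(1)] d cmp_assoc'[of i p g'] by simp
    also have "\<dots> = zer C I (tgt C g)" using I homD[OF g'(1)] d by simp
    finally obtain s where s: "s \<in> hom C I L" "(i \<cdot> k) \<cdot> s = i"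
      using kernel_factor[OF g ik I(1) gh] by blast
    have "i \<cdot> (k \<cdot> s) = i \<cdot> idn C I" using s d d2 homD[OF s(1)] by simp
    then have ks: "k \<cdot> s = idn C I" using mono_cancel[OF I(3,1)] cmp_hom[OF s(1) L(1)] idn_hom d by blast
    have "h = (h \<cdot> k) \<cdot> s" using ks d2 homD[OF s(1)] by simp
    also have "\<dots> = zer C I Z" using L d2 homD[OF s(1)] by simp
    finally show "h = zer C I Z" .
  qed
  obtain y' where y': "y' \<in> hom C W I" "i \<cdot> y' = y" using kernel_factor[OF i I(1) y(1) p(3) y(2)] by blast
  obtain W' w u where w: "epi C w" "w \<in> hom C W' W" "u \<in> hom C W' A" "e \<cdot> u = y' \<cdot> w"
    using epi_lift[OF \<open>epi C e\<close> e(1) y'(1)] by blast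
  have "f \<cdot> u = i \<cdot> (e \<cdot> u)" using e(2) d homD[OF w(3)] cmp_assoc'[of u e i] by simp
  also have "\<dots> = y \<cdot> w" using w y'(2) d homD[OF w(2)] homD[OF y'(1)] cmp_assoc'[of w y' i] by simp
  finally show ?thesis using that w by blast
qed

end

subsection \<open>Pro-objects\<close>

lemma cofiltered_square:
  assumes "category I" "cofiltered I" "v \<in> hom I k i" "w \<in> hom I l i"
  obtains m a b where "a \<in> hom I m k" "b \<in> hom I m l" "v \<cdot>\<^bsub>I\<^esub> a = w \<cdot>\<^bsub>I\<^esub> b"
proof -
  interpret category I by fact
  have "k \<in> obj I" "l \<in> obj I" using homD[OF assms(3)] homD[OF assms(4)] by auto
  then obtain m0 a0 b0 where 0: "a0 \<in> hom I m0 k" "b0 \<in> hom I m0 l" using assms(2) unfolding cofiltered_def by fast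
  have "v \<cdot>\<^bsub>I\<^esub> a0 \<in> hom I m0 i" "w \<cdot>\<^bsub>I\<^esub> b0 \<in> hom I m0 i" using 0 assms cmp_hom by auto
  then obtain m e where e: "e \<in> hom I m m0" "(v \<cdot>\<^bsub>I\<^esub> a0) \<cdot>\<^bsub>I\<^esub> e = (w \<cdot>\<^bsub>I\<^esub> b0) \<cdot>\<^bsub>I\<^esub> e"
    using assms(2) unfolding cofiltered_def by meson
  show ?thesis
    using that[of "a0 \<cdot>\<^bsub>I\<^esub> e" m "b0 \<cdot>\<^bsub>I\<^esub> e"] e cmp_hom[OF e(1)] 0
      homD[OF assms(3)] homD[OF assms(4)] homD[OF 0(1)] homD[OF 0(2)] homD[OF e(1)] by auto
qed

text \<open>Needed when sums of germs are compared: one equation comes from a square, the other by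
  equalizing afterwards, and the first survives.\<close>

lemma cofiltered_two_squares:
  assumes "category I" "cofiltered I" "v \<in> hom I k i" "w \<in> hom I l i" "v' \<in> hom I k j" "w' \<in> hom I l j"
  obtains m a b where "a \<in> hom I m k" "b \<in> hom I m l" "v \<cdot>\<^bsub>I\<^esub> a = w \<cdot>\<^bsub>I\<^esub> b" "v' \<cdot>\<^bsub>I\<^esub> a = w' \<cdot>\<^bsub>I\<^esub> b"
proof -
  interpret category I by fact
  obtain m a b where m: "a \<in> hom I m k" "b \<in> hom I m l" "v \<cdot>\<^bsub>I\<^esub> a = w \<cdot>\<^bsub>I\<^esub> b"
    using cofiltered_square assms by metis
  have "v' \<cdot>\<^bsub>I\<^esub> a \<in> hom I m j" "w' \<cdot>\<^bsub>I\<^esub> b \<in> hom I m j" using m assms cmp_hom by auto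
  then obtain n e where e: "e \<in> hom I n m" "(v' \<cdot>\<^bsub>I\<^esub> a) \<cdot>\<^bsub>I\<^esub> e = (w' \<cdot>\<^bsub>I\<^esub> b) \<cdot>\<^bsub>I\<^esub> e"
    using assms(2) unfolding cofiltered_def by meson
  note d = homD[OF assms(3)] homD[OF assms(4)] homD[OF assms(5)] homD[OF assms(6)]
    homD[OF m(1)] homD[OF m(2)] homD[OF e(1)]
  have "v \<cdot>\<^bsub>I\<^esub> (a \<cdot>\<^bsub>I\<^esub> e) = (w \<cdot>\<^bsub>I\<^esub> b) \<cdot>\<^bsub>I\<^esub> e" using cmp_extend[OF m(3)] d by simp
  then show ?thesis
    using that[of "a \<cdot>\<^bsub>I\<^esub> e" n "b \<cdot>\<^bsub>I\<^esub> e"] e cmp_hom[OF e(1)] m d by auto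
qed

section \<open>The index categories: point, tower and product\<close>

lemma point_cat_simps [simp]: "obj point_cat = {IxNat 0}" "arr point_cat = {IxNat 0}"
  "src point_cat x = IxNat 0" "tgt point_cat x = IxNat 0" "idn point_cat x = IxNat 0"
  "cmp point_cat x y = IxNat 0"
  by (simp_all add: point_cat_def)

lemma hom_point_cat [simp]: "hom point_cat i j = (if i = IxNat 0 \<and> j = IxNat 0 then {IxNat 0} else {})"
  by (auto simp: hom_def)

lemma category_point: "category point_cat" and cofiltered_point: "cofiltered point_cat"
  by (unfold_locales; auto split: if_splits) (auto simp: cofiltered_def split: if_splits)

lemma tower_cat_simps [simp]: "obj tower_cat = range IxNat"
  "arr tower_cat = {IxPair (IxNat m) (IxNat n) | m n. n \<le> m}"
  "src tower_cat = ixfst" "tgt tower_cat = ixsnd" "idn tower_cat = (\<lambda>x. IxPair x x)"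
  "cmp tower_cat = (\<lambda>v u. IxPair (ixfst u) (ixsnd v))"
  by (simp_all add: tower_cat_def)

lemma hom_tower_cat: "u \<in> hom tower_cat i j \<longleftrightarrow> (\<exists>m n. n \<le> m \<and> i = IxNat m \<and> j = IxNat n \<and> u = IxPair i j)"
  by (auto simp: hom_def)

lemma category_tower: "category tower_cat"
  by unfold_locales (auto simp: hom_tower_cat)

lemma cofiltered_tower: "cofiltered tower_cat"
  unfolding cofiltered_def
proof (intro conjI ballI allI)
  fix i j :: "('a, 'b) idx" assume "i \<in> obj tower_cat" "j \<in> obj tower_cat"
  then obtain m n where "i = IxNat m" "j = IxNat n" by auto
  then show "\<exists>k\<in>obj tower_cat. hom tower_cat k i \<noteq> {} \<and> hom tower_cat k j \<noteq> {}"
    by (intro bexI[of _ "IxNat (max m n)"]) (auto simp: hom_tower_cat ex_in_conv[symmetric])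
next
  fix i j u v :: "('a, 'b) idx" assume "u \<in> hom tower_cat i j" "v \<in> hom tower_cat i j"
  then show "\<exists>k. \<exists>w\<in>hom tower_cat k i. u \<cdot>\<^bsub>tower_cat\<^esub> w = v \<cdot>\<^bsub>tower_cat\<^esub> w"
    by (intro exI[of _ i] bexI[of _ "IxPair i i"]) (auto simp: hom_tower_cat)
qed auto

lemma prod_cat_simps [simp]:
  "obj (prod_cat I J) = {IxPair i j | i j. i \<in> obj I \<and> j \<in> obj J}"
  "arr (prod_cat I J) = {IxPair u v | u v. u \<in> arr I \<and> v \<in> arr J}"
  "src (prod_cat I J) p = IxPair (src I (ixfst p)) (src J (ixsnd p))"
  "tgt (prod_cat I J) p = IxPair (tgt I (ixfst p)) (tgt J (ixsnd p))"
  "idn (prod_cat I J) p = IxPair (idn I (ixfst p)) (idn J (ixsnd p))"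
  "cmp (prod_cat I J) p r = IxPair (ixfst p \<cdot>\<^bsub>I\<^esub> ixfst r) (ixsnd p \<cdot>\<^bsub>J\<^esub> ixsnd r)"
  by (simp_all add: prod_cat_def)

lemma hom_prod_cat:
  "w \<in> hom (prod_cat I J) p p' \<longleftrightarrow>
    (\<exists>u v i j i' j'. w = IxPair u v \<and> p = IxPair i j \<and> p' = IxPair i' j' \<and> u \<in> hom I i i' \<and> v \<in> hom J j j')"
  by (auto simp: hom_def)

lemma category_prod:
  assumes "category I" "category J" shows "category (prod_cat I J)"
proof -
  interpret I: category I by fact
  interpret J: category J by fact
  show ?thesis
    by unfold_locales
      (auto simp: hom_prod_cat I.idn_hom J.idn_hom I.src_obj J.src_obj I.tgt_obj J.tgt_obj
        intro: I.cmp_hom J.cmp_hom I.cmp_idn I.idn_cmp J.cmp_idn J.idn_cmp I.cmp_assoc J.cmp_assoc)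
qed

lemma cofiltered_prod:
  assumes "cofiltered I" "cofiltered J" shows "cofiltered (prod_cat I J)"
  unfolding cofiltered_def
proof (intro conjI ballI allI)
  show "obj (prod_cat I J) \<noteq> {}" using assms by (auto simp: cofiltered_def)
next
  fix p q assume "p \<in> obj (prod_cat I J)" "q \<in> obj (prod_cat I J)"
  then obtain i j i' j' where pq: "p = IxPair i j" "q = IxPair i' j'" "i \<in> obj I" "j \<in> obj J" "i' \<in> obj I" "j' \<in> obj J"
    by auto
  obtain k u u' where 1: "k \<in> obj I" "u \<in> hom I k i" "u' \<in> hom I k i'" using assms(1) pq unfolding cofiltered_def by fast
  obtain l v v' where 2: "l \<in> obj J" "v \<in> hom J l j" "v' \<in> hom J l j'" using assms(2) pq unfolding cofiltered_def by fast
  have "IxPair u v \<in> hom (prod_cat I J) (IxPair k l) p" "IxPair u' v' \<in> hom (prod_cat I J) (IxPair k l) q"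
    using 1 2 pq by (auto simp: hom_prod_cat)
  moreover have "IxPair k l \<in> obj (prod_cat I J)" using 1 2 by simp
  ultimately show "\<exists>r\<in>obj (prod_cat I J). hom (prod_cat I J) r p \<noteq> {} \<and> hom (prod_cat I J) r q \<noteq> {}"
    by blast
next
  fix p q w w' assume "w \<in> hom (prod_cat I J) p q" "w' \<in> hom (prod_cat I J) p q"
  then obtain u v u' v' i j i' j' where a: "p = IxPair i j" "w = IxPair u v" "w' = IxPair u' v'"
    "u \<in> hom I i i'" "u' \<in> hom I i i'" "v \<in> hom J j j'" "v' \<in> hom J j j'"
    unfolding hom_prod_cat by auto
  obtain k x where 1: "x \<in> hom I k i" "u \<cdot>\<^bsub>I\<^esub> x = u' \<cdot>\<^bsub>I\<^esub> x" using assms(1) a unfolding cofiltered_def by meson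
  obtain l y where 2: "y \<in> hom J l j" "v \<cdot>\<^bsub>J\<^esub> y = v' \<cdot>\<^bsub>J\<^esub> y" using assms(2) a unfolding cofiltered_def by meson
  have "IxPair x y \<in> hom (prod_cat I J) (IxPair k l) p" using 1 2 a by (auto simp: hom_prod_cat)
  then show "\<exists>k. \<exists>z\<in>hom (prod_cat I J) k p. w \<cdot>\<^bsub>prod_cat I J\<^esub> z = w' \<cdot>\<^bsub>prod_cat I J\<^esub> z"
    using 1 2 a by (intro exI[of _ "IxPair k l"] bexI[of _ "IxPair x y"]) auto
qed

lemma pro_objD:
  assumes "X \<in> pro_objs C"
  shows "category (pidx X)" "cofiltered (pidx X)" "is_functor (pidx X) C (pob X) (par X)"
  using assms by (auto simp: pro_objs_def)

section \<open>Germs, the elements of the filtered colimits of Hom sets\<close>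

context category
begin

lemma pob_obj [simp]: "X \<in> pro_objs C \<Longrightarrow> i \<in> obj (pidx X) \<Longrightarrow> pob X i \<in> obj C"
  using functor_obj pro_objD by metis

lemma par_hom: "X \<in> pro_objs C \<Longrightarrow> u \<in> hom (pidx X) i j \<Longrightarrow> par X u \<in> hom C (pob X i) (pob X j)"
  using functor_hom pro_objD by metis

lemma par_idn: "X \<in> pro_objs C \<Longrightarrow> i \<in> obj (pidx X) \<Longrightarrow> par X (idn (pidx X) i) = idn C (pob X i)"
  using functor_idn pro_objD by metis

lemma par_cmp: "X \<in> pro_objs C \<Longrightarrow> u \<in> hom (pidx X) i j \<Longrightarrow> v \<in> hom (pidx X) j k \<Longrightarrow>
    par X (v \<cdot>\<^bsub>pidx X\<^esub> u) = par X v \<cdot> par X u"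
  using functor_cmp pro_objD by metis

lemma cmp_par_par:
  assumes "X \<in> pro_objs C" "u \<in> hom (pidx X) i j" "v \<in> hom (pidx X) j k" "f \<in> hom C (pob X k) c"
  shows "(f \<cdot> par X v) \<cdot> par X u = f \<cdot> par X (v \<cdot>\<^bsub>pidx X\<^esub> u)"
  using par_cmp[OF assms(1-3)] cmp_assoc[OF par_hom par_hom assms(4)] assms by metis

lemma germ_iff: "(i', f') \<in> germ C X c i f \<longleftrightarrow> i' \<in> obj (pidx X) \<and> f' \<in> hom C (pob X i') c \<and>
   (\<exists>k. \<exists>u\<in>hom (pidx X) k i. \<exists>v\<in>hom (pidx X) k i'. f \<cdot> par X u = f' \<cdot> par X v)"
  by (simp add: germ_def)

lemma germ_par:
  assumes "X \<in> pro_objs C" "u \<in> hom (pidx X) i' i" "f \<in> hom C (pob X i) c"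
  shows "(i', f \<cdot> par X u) \<in> germ C X c i f"
proof -
  interpret I: category "pidx X" using pro_objD assms by blast
  have "i' \<in> obj (pidx X)" using I.homD assms by blast
  moreover have h: "f \<cdot> par X u \<in> hom C (pob X i') c" using cmp_hom[OF par_hom] assms by blast
  ultimately show ?thesis unfolding germ_iff
    using assms(2) I.idn_hom par_idn[OF assms(1)] cmp_idn[OF h] by metis
qed

lemma germ_refl:
  assumes "X \<in> pro_objs C" "i \<in> obj (pidx X)" "f \<in> hom C (pob X i) c"
  shows "(i, f) \<in> germ C X c i f"
  using germ_par[OF assms(1) category.idn_hom[OF pro_objD(1)[OF assms(1)] assms(2)] assms(3)]
    par_idn[OF assms(1,2)] cmp_idn[OF assms(3)] by simp

lemma germ_sym:
  assumes "i \<in> obj (pidx X)" "f \<in> hom C (pob X i) c" "(i', f') \<in> germ C X c i f"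
  shows "(i, f) \<in> germ C X c i' f'"
  using assms unfolding germ_iff by metis

text \<open>The two agreements hold over different indices \<open>k\<close> and \<open>l\<close>; a
  square over \<open>i'\<close> makes them meet.\<close>

lemma germ_trans:
  assumes X: "X \<in> pro_objs C" and f: "f \<in> hom C (pob X i) c"
    and 1: "(i', f') \<in> germ C X c i f" and 2: "(i'', f'') \<in> germ C X c i' f'"
  shows "(i'', f'') \<in> germ C X c i f"
proof -
  interpret I: category "pidx X" using pro_objD X by blast
  obtain k u v where k: "u \<in> hom (pidx X) k i" "v \<in> hom (pidx X) k i'" "f \<cdot> par X u = f' \<cdot> par X v"
    using 1 unfolding germ_iff by blast
  obtain l w x where l: "w \<in> hom (pidx X) l i'" "x \<in> hom (pidx X) l i''" "f' \<cdot> par X w = f'' \<cdot> par X x"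
    using 2 unfolding germ_iff by blast
  have f': "f' \<in> hom C (pob X i') c" and f'': "i'' \<in> obj (pidx X)" "f'' \<in> hom C (pob X i'') c"
    using 1 2 unfolding germ_iff by auto
  obtain m a b where m: "a \<in> hom (pidx X) m k" "b \<in> hom (pidx X) m l" "v \<cdot>\<^bsub>pidx X\<^esub> a = w \<cdot>\<^bsub>pidx X\<^esub> b"
    using cofiltered_square[OF pro_objD(1,2)[OF X] k(2) l(1)] by blast
  have "f \<cdot> par X (u \<cdot>\<^bsub>pidx X\<^esub> a) = f'' \<cdot> par X (x \<cdot>\<^bsub>pidx X\<^esub> b)"
    using cmp_par_par[OF X m(1) k(1) f] cmp_par_par[OF X m(1) k(2) f'] cmp_par_par[OF X m(2) l(1) f']
      cmp_par_par[OF X m(2) l(2) f''(2)] k(3) l(3) m(3) by simp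
  then show ?thesis unfolding germ_iff using f'' I.cmp_hom[OF m(1) k(1)] I.cmp_hom[OF m(2) l(2)] by blast
qed

lemma germ_eq:
  assumes "X \<in> pro_objs C" "i \<in> obj (pidx X)" "f \<in> hom C (pob X i) c" "(i', f') \<in> germ C X c i f"
  shows "germ C X c i' f' = germ C X c i f"
proof -
  have 1: "i' \<in> obj (pidx X)" "f' \<in> hom C (pob X i') c" using assms(4) unfolding germ_iff by auto
  have 2: "(i, f) \<in> germ C X c i' f'" using germ_sym assms by blast
  show ?thesis using germ_trans[OF assms(1) 1(2) 2] germ_trans[OF assms(1,3,4)] by auto
qed

lemma germ_postcmp:
  assumes X: "X \<in> pro_objs C" and "(i', f') \<in> germ C X c i f" "f \<in> hom C (pob X i) c" "g \<in> hom C c d"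
  shows "(i', g \<cdot> f') \<in> germ C X d i (g \<cdot> f)"
proof -
  obtain k u v where k: "u \<in> hom (pidx X) k i" "v \<in> hom (pidx X) k i'" "f \<cdot> par X u = f' \<cdot> par X v"
    and f': "i' \<in> obj (pidx X)" "f' \<in> hom C (pob X i') c"
    using assms(2) unfolding germ_iff by blast
  have "(g \<cdot> f) \<cdot> par X u = (g \<cdot> f') \<cdot> par X v"
    using cmp_assoc[OF par_hom[OF X k(1)] assms(3,4)] cmp_assoc[OF par_hom[OF X k(2)] f'(2) assms(4)] k(3) by simp
  then show ?thesis unfolding germ_iff using k f' cmp_hom assms(4) by blast
qed

end

section \<open>Pro-objects form a linear category\<close>

locale pro_linear = linear_category C
  for C :: "('o, 'm, 'k::field, 'x) tscat_scheme" (structure) +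
  fixes P :: "(('o, 'm, 'a) pro_ob, ('o, 'm, 'a) pro_ar, 'k) tscat"
  assumes P: "P = Pro C"
begin

lemma P_simps [simp]: "obj P = pro_objs C" "arr P = pro_arrs C" "src P = psrc" "tgt P = ptgt"
  "ten P = pro_ten C" "shf P = pro_apply (shf C) (shfa C)" "shfa P = pro_applya C (shf C) (shfa C)"
  "ush P = pro_apply (ush C) (usha C)"
  by (simp_all add: P Pro_def)

lemma homP_iff: "F \<in> hom P X Y \<longleftrightarrow> F \<in> pro_arrs C \<and> psrc F = X \<and> ptgt F = Y"
  by (simp add: hom_def)

lemma homP_obj: "F \<in> hom P X Y \<Longrightarrow> X \<in> pro_objs C \<and> Y \<in> pro_objs C"
  by (auto simp: homP_iff pro_arrs_def)

lemma rep_ex: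
  assumes "F \<in> hom P X Y" "j \<in> obj (pidx Y)" shows "\<exists>i f. (i, f) \<in> pgerm F j"
proof -
  obtain i f where "i \<in> obj (pidx X)" "f \<in> hom C (pob X i) (pob Y j)" "pgerm F j = germ C X (pob Y j) i f"
    using assms unfolding homP_iff pro_arrs_def by blast
  then show ?thesis using germ_refl[of X i f] homP_obj[OF assms(1)] by auto
qed

lemma rep_hom:
  assumes "F \<in> hom P X Y" "(i, f) \<in> pgerm F j"
  shows "j \<in> obj (pidx Y)" "i \<in> obj (pidx X)" "f \<in> hom C (pob X i) (pob Y j)"
proof -
  show j: "j \<in> obj (pidx Y)" using assms unfolding homP_iff pro_arrs_def by blast
  then obtain i' f' where "pgerm F j = germ C X (pob Y j) i' f'"
    using assms unfolding homP_iff pro_arrs_def by blast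
  then show "i \<in> obj (pidx X)" "f \<in> hom C (pob X i) (pob Y j)" using assms(2) by (auto simp: germ_iff)
qed

lemma rep_germ:
  assumes "F \<in> hom P X Y" "(i, f) \<in> pgerm F j"
  shows "pgerm F j = germ C X (pob Y j) i f"
proof -
  have X: "X \<in> pro_objs C" using homP_obj assms by blast
  obtain i' f' where 1: "i' \<in> obj (pidx X)" "f' \<in> hom C (pob X i') (pob Y j)" "pgerm F j = germ C X (pob Y j) i' f'"
    using assms(1) rep_hom[OF assms] unfolding homP_iff pro_arrs_def by blast
  then show ?thesis using germ_eq[OF X 1(1,2)] assms(2) by simp
qed

lemma rep_src:
  assumes "F \<in> hom P X Y" "(i, f) \<in> pgerm F j" "u \<in> hom (pidx X) i' i"
  shows "(i', f \<cdot> par X u) \<in> pgerm F j"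
  unfolding rep_germ[OF assms(1,2)] using germ_par rep_hom[OF assms(1,2)] homP_obj[OF assms(1)] assms by blast

lemma rep_tgt:
  assumes "F \<in> hom P X Y" "(i, f) \<in> pgerm F j" "v \<in> hom (pidx Y) j j'"
  shows "(i, par Y v \<cdot> f) \<in> pgerm F j'"
  using assms unfolding homP_iff pro_arrs_def by blast

lemma rep_unique:
  assumes "F \<in> hom P X Y" "(i, f) \<in> pgerm F j" "(i', f') \<in> pgerm F j"
  obtains k u v where "u \<in> hom (pidx X) k i" "v \<in> hom (pidx X) k i'" "f \<cdot> par X u = f' \<cdot> par X v"
proof -
  have "(i', f') \<in> germ C X (pob Y j) i f" using rep_germ[OF assms(1,2)] assms(3) by simp
  then show ?thesis using that unfolding germ_iff by blast
qed

text \<open>Germs are equivalence classes, so one common representative at each index of the target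
  decides equality.\<close>

lemma pro_eqI:
  assumes "F \<in> hom P X Y" "G \<in> hom P X Y"
    "\<And>j. j \<in> obj (pidx Y) \<Longrightarrow> \<exists>i f. (i, f) \<in> pgerm F j \<and> (i, f) \<in> pgerm G j"
  shows "F = G"
proof -
  have "pgerm F j = pgerm G j" for j
  proof (cases "j \<in> obj (pidx Y)")
    case True
    then obtain i f where "(i, f) \<in> pgerm F j" "(i, f) \<in> pgerm G j" using assms(3) by blast
    then show ?thesis using rep_germ[OF assms(1)] rep_germ[OF assms(2)] by metis
  next
    case False then show ?thesis using assms unfolding homP_iff pro_arrs_def by auto
  qed
  then show ?thesis using assms(1,2) by (intro pro_ar.equality) (auto simp: homP_iff)
qed

text \<open>Equality of germs gives two arrows into \<open>i\<close>; cofiltering equalizes them, so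
  that both representatives are restricted along the same \<open>u\<close>.\<close>

lemma pro_eqD:
  assumes "F \<in> hom P X Y" "(i, f) \<in> pgerm F j" "(i', f') \<in> pgerm F j"
    and "i' = i"
  obtains k u where "u \<in> hom (pidx X) k i" "f \<cdot> par X u = f' \<cdot> par X u"
proof -
  interpret I: category "pidx X" using pro_objD homP_obj assms by blast
  have X: "X \<in> pro_objs C" using homP_obj assms by blast
  obtain k u v where k: "u \<in> hom (pidx X) k i" "v \<in> hom (pidx X) k i" "f \<cdot> par X u = f' \<cdot> par X v"
    using rep_unique[OF assms(1-3)] assms(4) by blast
  obtain l w where w: "w \<in> hom (pidx X) l k" "u \<cdot>\<^bsub>pidx X\<^esub> w = v \<cdot>\<^bsub>pidx X\<^esub> w"
    using pro_objD(2)[OF X] k unfolding cofiltered_def by meson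
  have h: "f \<in> hom C (pob X i) (pob Y j)" "f' \<in> hom C (pob X i) (pob Y j)"
    using rep_hom[OF assms(1,2)] rep_hom[OF assms(1,3)] assms(4) by auto
  have "f \<cdot> par X (u \<cdot>\<^bsub>pidx X\<^esub> w) = f' \<cdot> par X (u \<cdot>\<^bsub>pidx X\<^esub> w)"
    using cmp_par_par[OF X w(1) k(1) h(1)] cmp_par_par[OF X w(1) k(2) h(2)] k(3) w(2) by simp
  then show ?thesis using that I.cmp_hom[OF w(1) k(1)] by blast
qed

text \<open>Every operation of \<open>Pro\<close> is a \<open>pro_map\<close>, so this criterion
  supplies both its typing and its representatives. Compatibility with a transition map is asked of
  a single pair of representatives, since \<open>eq\<close> carries it over to the whole
  germ.\<close>

lemma pro_map_hom:
  assumes X: "X \<in> pro_objs C" and Y: "Y \<in> pro_objs C"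
    and ne: "\<And>j. j \<in> obj (pidx Y) \<Longrightarrow> G j \<noteq> {}"
    and h: "\<And>j i f. j \<in> obj (pidx Y) \<Longrightarrow> (i, f) \<in> G j \<Longrightarrow> i \<in> obj (pidx X) \<and> f \<in> hom C (pob X i) (pob Y j)"
    and eq: "\<And>j i f i' f'. j \<in> obj (pidx Y) \<Longrightarrow> (i, f) \<in> G j \<Longrightarrow> (i', f') \<in> G j \<Longrightarrow>
       (i', f') \<in> germ C X (pob Y j) i f"
    and tg: "\<And>j j' v. v \<in> hom (pidx Y) j j' \<Longrightarrow>
       \<exists>i f i' f'. (i, f) \<in> G j \<and> (i', f') \<in> G j' \<and> (i, par Y v \<cdot> f) \<in> germ C X (pob Y j') i' f'"
  shows "pro_map C X Y G \<in> hom P X Y"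
    and "\<And>j i f. j \<in> obj (pidx Y) \<Longrightarrow> (i, f) \<in> G j \<Longrightarrow> (i, f) \<in> pgerm (pro_map C X Y G) j"
proof -
  let ?F = "pro_map C X Y G"
  interpret J: category "pidx Y" using pro_objD Y by blast
  have pg: "pgerm ?F j = germ C X (pob Y j) i f" if j: "j \<in> obj (pidx Y)" and a: "(i, f) \<in> G j" for i f j
  proof -
    have *: "germ C X (pob Y j) i' f' = germ C X (pob Y j) i f" if "(i', f') \<in> G j" for i' f'
      using germ_eq[OF X, of i f "pob Y j" i' f'] h[OF j a] eq[OF j a that] by simp
    have "(\<Union>(i, f)\<in>G j. germ C X (pob Y j) i f) = germ C X (pob Y j) i f"
    proof (rule SUP_eq_const)
      show "G j \<noteq> {}" using a by blast
      fix p assume "p \<in> G j"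
      then show "(case p of (i, f) \<Rightarrow> germ C X (pob Y j) i f) = germ C X (pob Y j) i f"
        using *[of "fst p" "snd p"] by (simp add: case_prod_beta)
    qed
    then show ?thesis using j by (simp add: pro_map_def)
  qed
  show 2: "(i, f) \<in> pgerm ?F j" if "j \<in> obj (pidx Y)" "(i, f) \<in> G j" for i f j
    using pg[OF that] germ_refl[OF X] h[OF that] by blast
  have "?F \<in> pro_arrs C"
    unfolding pro_arrs_def mem_Collect_eq
  proof (intro conjI ballI allI impI)
    show "psrc ?F \<in> pro_objs C" "ptgt ?F \<in> pro_objs C" using X Y by (auto simp: pro_map_def)
    fix j assume "j \<in> obj (pidx (ptgt ?F))"
    then have j: "j \<in> obj (pidx Y)" by (simp add: pro_map_def)
    then obtain i f where "(i, f) \<in> G j" using ne by fastforce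
    then show "\<exists>i\<in>obj (pidx (psrc ?F)). \<exists>f\<in>hom C (pob (psrc ?F) i) (pob (ptgt ?F) j).
             pgerm ?F j = germ C (psrc ?F) (pob (ptgt ?F) j) i f"
      using pg[OF j] h[OF j] by (auto simp: pro_map_def) blast
  next
    fix j assume "j \<notin> obj (pidx (ptgt ?F))"
    then show "pgerm ?F j = {}" by (simp add: pro_map_def)
  next
    fix j j' v p assume v: "v \<in> hom (pidx (ptgt ?F)) j j'" and p: "p \<in> pgerm ?F j"
    obtain i f where p2: "p = (i, f)" by fastforce
    have v: "v \<in> hom (pidx Y) j j'" using v by (simp add: pro_map_def)
    have j: "j \<in> obj (pidx Y)" "j' \<in> obj (pidx Y)" using J.homD[OF v] by auto
    obtain i0 f0 i' f' where t: "(i0, f0) \<in> G j" "(i', f') \<in> G j'" "(i0, par Y v \<cdot> f0) \<in> germ C X (pob Y j') i' f'"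
      using tg[OF v] by blast
    have "(i, f) \<in> germ C X (pob Y j) i0 f0" using pg[OF j(1) t(1)] p p2 by simp
    then have "(i, par Y v \<cdot> f) \<in> germ C X (pob Y j') i0 (par Y v \<cdot> f0)"
      using germ_postcmp[OF X] h[OF j(1) t(1)] par_hom[OF Y v] by blast
    then have "(i, par Y v \<cdot> f) \<in> germ C X (pob Y j') i' f'"
      using germ_trans[OF X _ t(3)] h[OF j(2) t(2)] by blast
    then show "case p of (i, f) \<Rightarrow> (i, par (ptgt ?F) v \<cdot> f) \<in> pgerm ?F j'"
      using pg[OF j(2) t(2)] p2 by (simp add: pro_map_def)
  qed
  then show "?F \<in> hom P X Y" by (simp add: homP_iff pro_map_def)
qed

lemma pro_map_single:
  assumes X: "X \<in> pro_objs C" and Y: "Y \<in> pro_objs C"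
    and h: "\<And>j. j \<in> obj (pidx Y) \<Longrightarrow> i j \<in> obj (pidx X) \<and> f j \<in> hom C (pob X (i j)) (pob Y j)"
    and tg: "\<And>j j' v. v \<in> hom (pidx Y) j j' \<Longrightarrow> (i j, par Y v \<cdot> f j) \<in> germ C X (pob Y j') (i j') (f j')"
  shows "pro_map C X Y (\<lambda>j. {(i j, f j)}) \<in> hom P X Y"
    and "\<And>j. j \<in> obj (pidx Y) \<Longrightarrow> (i j, f j) \<in> pgerm (pro_map C X Y (\<lambda>j. {(i j, f j)})) j"
  using pro_map_hom[of X Y "\<lambda>j. {(i j, f j)}"] assms germ_refl[OF X] by auto

lemma idnP: 
  assumes X: "X \<in> pro_objs C"
  shows "idn P X \<in> hom P X X" "j \<in> obj (pidx X) \<Longrightarrow> (j, idn C (pob X j)) \<in> pgerm (idn P X) j"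
proof -
  have "(j, par X v \<cdot> idn C (pob X j)) \<in> germ C X (pob X j') j' (idn C (pob X j'))"
    if v: "v \<in> hom (pidx X) j j'" for j j' v
    using germ_par[OF X v idn_hom] par_hom[OF X v] homD[OF par_hom[OF X v]] by simp
  note * = pro_map_single[OF X X, of "\<lambda>j. j" "\<lambda>j. idn C (pob X j)", OF _ this]
  show "idn P X \<in> hom P X X" "j \<in> obj (pidx X) \<Longrightarrow> (j, idn C (pob X j)) \<in> pgerm (idn P X) j"
    using * X idn_hom by (auto simp: P Pro_def)
qed

lemma cmpP:
  assumes F: "F \<in> hom P X Y" and G: "G \<in> hom P Y Z"
  shows "G \<cdot>\<^bsub>P\<^esub> F \<in> hom P X Z"
    "\<And>i f j g l. (j, g) \<in> pgerm G l \<Longrightarrow> (i, f) \<in> pgerm F j \<Longrightarrow> (i, g \<cdot> f) \<in> pgerm (G \<cdot>\<^bsub>P\<^esub> F) l"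
proof -
  let ?S = "\<lambda>l. {(i, g \<cdot> f) | i f j g. (j, g) \<in> pgerm G l \<and> (i, f) \<in> pgerm F j}"
  have X: "X \<in> pro_objs C" and Y: "Y \<in> pro_objs C" and Z: "Z \<in> pro_objs C" using homP_obj F G by auto
  have eq: "G \<cdot>\<^bsub>P\<^esub> F = pro_map C X Z ?S" using F G by (simp add: P Pro_def homP_iff hom_def)
  have 1: "?S l \<noteq> {}" if l: "l \<in> obj (pidx Z)" for l
  proof -
    obtain j g where g: "(j, g) \<in> pgerm G l" using rep_ex[OF G l] by blast
    obtain i f where "(i, f) \<in> pgerm F j" using rep_ex[OF F rep_hom(2)[OF G g]] by blast
    then show ?thesis using g by blast
  qed
  have 2: "i \<in> obj (pidx X) \<and> f \<in> hom C (pob X i) (pob Z l)" if a: "(i, f) \<in> ?S l" for i f l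
  proof -
    obtain j g f0 where a: "f = g \<cdot> f0" "(j, g) \<in> pgerm G l" "(i, f0) \<in> pgerm F j" using a by blast
    show ?thesis using rep_hom[OF F a(3)] rep_hom[OF G a(2)] a(1) cmp_hom by blast
  qed
  have 3: "(i', f') \<in> germ C X (pob Z l) i f" if a: "(i, f) \<in> ?S l" and b: "(i', f') \<in> ?S l" for i f l i' f'
  proof -
    obtain j g f0 where a: "f = g \<cdot> f0" "(j, g) \<in> pgerm G l" "(i, f0) \<in> pgerm F j" using a by blast
    obtain j' g' f0' where b: "f' = g' \<cdot> f0'" "(j', g') \<in> pgerm G l" "(i', f0') \<in> pgerm F j'" using b by blast
    \<comment> \<open>The two representatives of \<open>G\<close> agree over an index
      \<open>k\<close> mapping to \<open>j\<close> and \<open>j'\<close>; a representative of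
      \<open>F\<close> at \<open>k\<close> then computes \<open>F\<close> at both \<open>j\<close>
      and \<open>j'\<close>.\<close>
    obtain k u v where k: "u \<in> hom (pidx Y) k j" "v \<in> hom (pidx Y) k j'" "g \<cdot> par Y u = g' \<cdot> par Y v"
      using rep_unique[OF G a(2) b(2)] by blast
    interpret J: category "pidx Y" using pro_objD Y by blast
    obtain m h where m: "(m, h) \<in> pgerm F k" using rep_ex[OF F, of k] J.homD[OF k(1)] by blast
    note ga = rep_hom[OF G a(2)] and gb = rep_hom[OF G b(2)] and fa = rep_hom[OF F a(3)] and fb = rep_hom[OF F b(3)]
      and hh = rep_hom[OF F m]
    have "(i, f0) \<in> germ C X (pob Y j) m (par Y u \<cdot> h)" "(i', f0') \<in> germ C X (pob Y j') m (par Y v \<cdot> h)"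
      using rep_germ[OF F rep_tgt[OF F m k(1)]] rep_germ[OF F rep_tgt[OF F m k(2)]] a b by auto
    then have "(i, g \<cdot> f0) \<in> germ C X (pob Z l) m (g \<cdot> (par Y u \<cdot> h))"
      "(i', g' \<cdot> f0') \<in> germ C X (pob Z l) m (g' \<cdot> (par Y v \<cdot> h))"
      using germ_postcmp[OF X] ga gb cmp_hom[OF hh(3) par_hom[OF Y k(1)]] cmp_hom[OF hh(3) par_hom[OF Y k(2)]] by blast+
    moreover have "g \<cdot> (par Y u \<cdot> h) = g' \<cdot> (par Y v \<cdot> h)"
      using k(3) cmp_assoc[OF hh(3) par_hom[OF Y k(1)] ga(3)] cmp_assoc[OF hh(3) par_hom[OF Y k(2)] gb(3)] by simp
    moreover have "g \<cdot> (par Y u \<cdot> h) \<in> hom C (pob X m) (pob Z l)"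
      using ga(3) hh(3) par_hom[OF Y k(1)] cmp_hom by blast
    ultimately show ?thesis using a(1) b(1) germ_trans[OF X] germ_sym[OF hh(2)] cmp_hom[OF fa(3) ga(3)] by metis
  qed
  have 4: "\<exists>i f i' f'. (i, f) \<in> ?S l \<and> (i', f') \<in> ?S l' \<and> (i, par Z v \<cdot> f) \<in> germ C X (pob Z l') i' f'"
    if v: "v \<in> hom (pidx Z) l l'" for l l' v
  proof -
    interpret J: category "pidx Z" using pro_objD Z by blast
    obtain j g where g: "(j, g) \<in> pgerm G l" using rep_ex[OF G, of l] J.homD[OF v] by blast
    then obtain i f where f: "(i, f) \<in> pgerm F j" using rep_ex[OF F] rep_hom[OF G] by blast
    note gg = rep_hom[OF G g] and ff = rep_hom[OF F f]
    have e: "par Z v \<cdot> (g \<cdot> f) = (par Z v \<cdot> g) \<cdot> f" using cmp_assoc[OF ff(3) gg(3) par_hom[OF Z v]] .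
    have r: "(i, g \<cdot> f) \<in> ?S l" "(i, (par Z v \<cdot> g) \<cdot> f) \<in> ?S l'" using g f rep_tgt[OF G g v] by blast+
    have "(i, par Z v \<cdot> (g \<cdot> f)) \<in> germ C X (pob Z l') i ((par Z v \<cdot> g) \<cdot> f)"
      unfolding e using germ_refl[OF X ff(2) cmp_hom[OF ff(3) cmp_hom[OF gg(3) par_hom[OF Z v]]]] .
    then show ?thesis using r by (intro exI conjI)
  qed
  note * = pro_map_hom[OF X Z, of ?S, OF 1 2 3 4]
  show "G \<cdot>\<^bsub>P\<^esub> F \<in> hom P X Z" unfolding eq using * by blast
  fix i f j g l assume a: "(j, g) \<in> pgerm G l" "(i, f) \<in> pgerm F j"
  then have "l \<in> obj (pidx Z)" using rep_hom[OF G] by blast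
  then show "(i, g \<cdot> f) \<in> pgerm (G \<cdot>\<^bsub>P\<^esub> F) l" unfolding eq using * a by blast
qed

lemma categoryP: "category P"
proof unfold_locales
  fix f assume "f \<in> arr P" then show "src P f \<in> obj P" "tgt P f \<in> obj P" by (auto simp: pro_arrs_def)
next
  fix X assume "X \<in> obj P" then show "idn P X \<in> hom P X X" using idnP by simp
next
  fix f X Y g Z assume "f \<in> hom P X Y" "g \<in> hom P Y Z" then show "g \<cdot>\<^bsub>P\<^esub> f \<in> hom P X Z" using cmpP by blast
next
  fix F X Y assume F: "F \<in> hom P X Y"
  have X: "X \<in> pro_objs C" and Y: "Y \<in> pro_objs C" using homP_obj F by auto
  show "F \<cdot>\<^bsub>P\<^esub> idn P X = F"
  proof (rule pro_eqI[OF cmpP(1)[OF idnP(1)[OF X] F] F])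
    fix j assume "j \<in> obj (pidx Y)"
    then obtain i f where f: "(i, f) \<in> pgerm F j" using rep_ex F by blast
    note h = rep_hom[OF F f]
    show "\<exists>i f. (i, f) \<in> pgerm (F \<cdot>\<^bsub>P\<^esub> idn P X) j \<and> (i, f) \<in> pgerm F j"
      using cmpP(2)[OF idnP(1)[OF X] F f idnP(2)[OF X h(2)]] f cmp_idn[OF h(3)] by auto
  qed
  show "idn P Y \<cdot>\<^bsub>P\<^esub> F = F"
  proof (rule pro_eqI[OF cmpP(1)[OF F idnP(1)[OF Y]] F])
    fix j assume j: "j \<in> obj (pidx Y)"
    then obtain i f where f: "(i, f) \<in> pgerm F j" using rep_ex F by blast
    note h = rep_hom[OF F f]
    show "\<exists>i f. (i, f) \<in> pgerm (idn P Y \<cdot>\<^bsub>P\<^esub> F) j \<and> (i, f) \<in> pgerm F j"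
      using cmpP(2)[OF F idnP(1)[OF Y] idnP(2)[OF Y j] f] f idn_cmp[OF h(3)] by auto
  qed
next
  fix F G H W X Y Z assume F: "F \<in> hom P W X" and G: "G \<in> hom P X Y" and H: "H \<in> hom P Y Z"
  note GF = cmpP[OF F G] and HG = cmpP[OF G H]
  show "H \<cdot>\<^bsub>P\<^esub> (G \<cdot>\<^bsub>P\<^esub> F) = H \<cdot>\<^bsub>P\<^esub> G \<cdot>\<^bsub>P\<^esub> F"
  proof (rule pro_eqI[OF cmpP(1)[OF GF(1) H] cmpP(1)[OF F HG(1)]])
    fix j assume j: "j \<in> obj (pidx Z)"
    obtain k h where h: "(k, h) \<in> pgerm H j" using rep_ex H j by blast
    obtain l g where g: "(l, g) \<in> pgerm G k" using rep_ex G rep_hom[OF H h] by blast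
    obtain i f where f: "(i, f) \<in> pgerm F l" using rep_ex F rep_hom[OF G g] by blast
    have "(i, h \<cdot> (g \<cdot> f)) \<in> pgerm (H \<cdot>\<^bsub>P\<^esub> (G \<cdot>\<^bsub>P\<^esub> F)) j" using cmpP(2)[OF GF(1) H h GF(2)[OF g f]] .
    moreover have "(i, h \<cdot> g \<cdot> f) \<in> pgerm (H \<cdot>\<^bsub>P\<^esub> G \<cdot>\<^bsub>P\<^esub> F) j" using cmpP(2)[OF F HG(1) HG(2)[OF h g] f] .
    ultimately show "\<exists>i f. (i, f) \<in> pgerm (H \<cdot>\<^bsub>P\<^esub> (G \<cdot>\<^bsub>P\<^esub> F)) j \<and> (i, f) \<in> pgerm (H \<cdot>\<^bsub>P\<^esub> G \<cdot>\<^bsub>P\<^esub> F) j"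
      using cmp_assoc[OF rep_hom(3)[OF F f] rep_hom(3)[OF G g] rep_hom(3)[OF H h]] by auto
  qed
qed

lemma zerP:
  assumes X: "X \<in> pro_objs C" and Y: "Y \<in> pro_objs C"
  shows "zer P X Y \<in> hom P X Y"
    "i \<in> obj (pidx X) \<Longrightarrow> j \<in> obj (pidx Y) \<Longrightarrow> (i, zer C (pob X i) (pob Y j)) \<in> pgerm (zer P X Y) j"
proof -
  interpret I: category "pidx X" using pro_objD X by blast
  interpret J: category "pidx Y" using pro_objD Y by blast
  let ?S = "\<lambda>j. {(i, zer C (pob X i) (pob Y j)) | i. i \<in> obj (pidx X)}"
  have eq: "zer P X Y = pro_map C X Y ?S" by (simp add: P Pro_def)
  have ne: "obj (pidx X) \<noteq> {}" using pro_objD(2)[OF X] by (auto simp: cofiltered_def)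
  have 2: "i \<in> obj (pidx X) \<and> f \<in> hom C (pob X i) (pob Y l)" if "l \<in> obj (pidx Y)" "(i, f) \<in> ?S l" for i f l
    using that zer_hom X Y by auto
  have 3: "(i', f') \<in> germ C X (pob Y l) i f" if l: "l \<in> obj (pidx Y)" and a: "(i, f) \<in> ?S l" "(i', f') \<in> ?S l" for i f l i' f'
  proof -
    obtain k u v where k: "u \<in> hom (pidx X) k i" "v \<in> hom (pidx X) k i'"
      using a pro_objD(2)[OF X] unfolding cofiltered_def by blast
    have "f \<cdot> par X u = f' \<cdot> par X v" using a l zer_cmp[OF par_hom[OF X k(1)]] zer_cmp[OF par_hom[OF X k(2)]] Y by auto
    then show ?thesis unfolding germ_iff using a 2 l k by blast
  qed
  have 4: "\<exists>i f i' f'. (i, f) \<in> ?S l \<and> (i', f') \<in> ?S l' \<and> (i, par Y v \<cdot> f) \<in> germ C X (pob Y l') i' f'"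
    if v: "v \<in> hom (pidx Y) l l'" for l l' v
  proof -
    note l = J.homD(4,5)[OF v]
    obtain i where i: "i \<in> obj (pidx X)" using ne by blast
    have "par Y v \<cdot> zer C (pob X i) (pob Y l) = zer C (pob X i) (pob Y l')" using cmp_zer[OF par_hom[OF Y v]] X i by simp
    then have "(i, par Y v \<cdot> zer C (pob X i) (pob Y l)) \<in> germ C X (pob Y l') i (zer C (pob X i) (pob Y l'))"
      using germ_refl[OF X i zer_hom, of "pob Y l'"] X Y i l by simp
    moreover have "(i, zer C (pob X i) (pob Y l)) \<in> ?S l" "(i, zer C (pob X i) (pob Y l')) \<in> ?S l'" using i by auto
    ultimately show ?thesis by (intro exI conjI)
  qed
  note * = pro_map_hom[OF X Y, of ?S, OF _ 2 3 4]
  show "zer P X Y \<in> hom P X Y" unfolding eq using * ne by blast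
  show "i \<in> obj (pidx X) \<Longrightarrow> j \<in> obj (pidx Y) \<Longrightarrow> (i, zer C (pob X i) (pob Y j)) \<in> pgerm (zer P X Y) j"
    unfolding eq using * ne by blast
qed

lemma rep_common:
  assumes F: "F \<in> hom P X Y" and G: "G \<in> hom P X Y'" and "j \<in> obj (pidx Y)" "j' \<in> obj (pidx Y')"
  obtains i f g where "(i, f) \<in> pgerm F j" "(i, g) \<in> pgerm G j'"
proof -
  obtain i f i' g where r: "(i, f) \<in> pgerm F j" "(i', g) \<in> pgerm G j'"
    using rep_ex[OF F] rep_ex[OF G] assms(3,4) by blast
  obtain k u v where "u \<in> hom (pidx X) k i" "v \<in> hom (pidx X) k i'"
    using pro_objD(2)[of X] homP_obj[OF F] rep_hom(2)[OF F r(1)] rep_hom(2)[OF G r(2)] unfolding cofiltered_def by blast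
  then show ?thesis using that rep_src[OF F r(1)] rep_src[OF G r(2)] by blast
qed

lemma add_par:
  assumes X: "X \<in> pro_objs C" and u: "u \<in> hom (pidx X) k i" "f \<in> hom C (pob X i) c" "g \<in> hom C (pob X i) c"
  shows "add C f g \<cdot> par X u = add C (f \<cdot> par X u) (g \<cdot> par X u)"
  using cmp_add_left[OF par_hom[OF X u(1)] u(2,3)] .

lemma addP:
  assumes F: "F \<in> hom P X Y" and G: "G \<in> hom P X Y"
  shows "add P F G \<in> hom P X Y"
    "(i, f) \<in> pgerm F j \<Longrightarrow> (i, g) \<in> pgerm G j \<Longrightarrow> (i, add C f g) \<in> pgerm (add P F G) j"
proof -
  have X: "X \<in> pro_objs C" and Y: "Y \<in> pro_objs C" using homP_obj F by auto
  interpret I: category "pidx X" using pro_objD X by blast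
  interpret J: category "pidx Y" using pro_objD Y by blast
  let ?S = "\<lambda>j. {(i, add C f g) | i f g. (i, f) \<in> pgerm F j \<and> (i, g) \<in> pgerm G j}"
  have eq: "add P F G = pro_map C X Y ?S" using F by (simp add: P Pro_def homP_iff hom_def)
  have 1: "?S l \<noteq> {}" if l: "l \<in> obj (pidx Y)" for l
  proof -
    obtain i f g where "(i, f) \<in> pgerm F l" "(i, g) \<in> pgerm G l" using rep_common[OF F G l l] .
    then have "(i, add C f g) \<in> ?S l" by blast
    then show ?thesis by auto
  qed
  have 2: "i \<in> obj (pidx X) \<and> f \<in> hom C (pob X i) (pob Y l)" if a: "(i, f) \<in> ?S l" for i f l
  proof -
    obtain f1 g1 where a: "f = add C f1 g1" "(i, f1) \<in> pgerm F l" "(i, g1) \<in> pgerm G l" using a by blast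
    show ?thesis using rep_hom[OF F a(2)] rep_hom[OF G a(3)] a(1) add_hom by blast
  qed
  have 3: "(i', f') \<in> germ C X (pob Y l) i f" if a: "(i, f) \<in> ?S l" and b: "(i', f') \<in> ?S l" for i f l i' f'
  proof -
    obtain f1 g1 where a: "f = add C f1 g1" "(i, f1) \<in> pgerm F l" "(i, g1) \<in> pgerm G l" using a by blast
    obtain f2 g2 where b: "f' = add C f2 g2" "(i', f2) \<in> pgerm F l" "(i', g2) \<in> pgerm G l" using b by blast
    obtain k u v where k: "u \<in> hom (pidx X) k i" "v \<in> hom (pidx X) k i'" "f1 \<cdot> par X u = f2 \<cdot> par X v"
      using rep_unique[OF F a(2) b(2)] by blast
    obtain k' u' v' where k': "u' \<in> hom (pidx X) k' i" "v' \<in> hom (pidx X) k' i'" "g1 \<cdot> par X u' = g2 \<cdot> par X v'"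
      using rep_unique[OF G a(3) b(3)] by blast
    \<comment> \<open>The representatives of \<open>F\<close> agree over \<open>k\<close> and those
      of \<open>G\<close> over \<open>k'\<close>; the sums need one index where both agreements
      hold.\<close>
    obtain m w w' where m: "w \<in> hom (pidx X) m k" "w' \<in> hom (pidx X) m k'"
      "u \<cdot>\<^bsub>pidx X\<^esub> w = u' \<cdot>\<^bsub>pidx X\<^esub> w'" "v \<cdot>\<^bsub>pidx X\<^esub> w = v' \<cdot>\<^bsub>pidx X\<^esub> w'"
      using cofiltered_two_squares[OF pro_objD(1,2)[OF X] k(1) k'(1) k(2) k'(2)] by blast
    note ha = rep_hom[OF F a(2)] rep_hom[OF G a(3)] and hb = rep_hom[OF F b(2)] rep_hom[OF G b(3)]
    note uw = I.cmp_hom[OF m(1) k(1)] and vw = I.cmp_hom[OF m(1) k(2)]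
    have e1: "f1 \<cdot> par X (u \<cdot>\<^bsub>pidx X\<^esub> w) = f2 \<cdot> par X (v \<cdot>\<^bsub>pidx X\<^esub> w)"
      using cmp_par_par[OF X m(1) k(1) ha(3)] cmp_par_par[OF X m(1) k(2) hb(3)] k(3) by simp
    have e2: "g1 \<cdot> par X (u \<cdot>\<^bsub>pidx X\<^esub> w) = g2 \<cdot> par X (v \<cdot>\<^bsub>pidx X\<^esub> w)"
      unfolding m(3,4) using cmp_par_par[OF X m(2) k'(1) ha(6)] cmp_par_par[OF X m(2) k'(2) hb(6)] k'(3) by simp
    have "f \<cdot> par X (u \<cdot>\<^bsub>pidx X\<^esub> w) = f' \<cdot> par X (v \<cdot>\<^bsub>pidx X\<^esub> w)"
      unfolding a(1) b(1) using add_par[OF X uw ha(3,6)] add_par[OF X vw hb(3,6)] e1 e2 by simp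
    then show ?thesis unfolding germ_iff using uw vw hb add_hom b(1) by blast
  qed
  have 4: "\<exists>i f i' f'. (i, f) \<in> ?S l \<and> (i', f') \<in> ?S l' \<and> (i, par Y v \<cdot> f) \<in> germ C X (pob Y l') i' f'"
    if v: "v \<in> hom (pidx Y) l l'" for l l' v
  proof -
    note l = J.homD(4,5)[OF v]
    obtain i f g where a: "(i, f) \<in> pgerm F l" "(i, g) \<in> pgerm G l" using rep_common[OF F G l(1) l(1)] by blast
    note ff = rep_hom[OF F a(1)] and gg = rep_hom[OF G a(2)]
    have e: "par Y v \<cdot> add C f g = add C (par Y v \<cdot> f) (par Y v \<cdot> g)" using cmp_add_right[OF ff(3) gg(3) par_hom[OF Y v]] .
    have b: "(i, add C (par Y v \<cdot> f) (par Y v \<cdot> g)) \<in> ?S l'" using rep_tgt[OF F a(1) v] rep_tgt[OF G a(2) v] by blast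
    have "(i, par Y v \<cdot> add C f g) \<in> germ C X (pob Y l') i (add C (par Y v \<cdot> f) (par Y v \<cdot> g))"
      unfolding e using germ_refl[OF X] 2[OF b] by blast
    moreover have "(i, add C f g) \<in> ?S l" using a by blast
    ultimately show ?thesis using b by (intro exI conjI)
  qed
  note * = pro_map_hom[OF X Y, of ?S, OF 1 2 3 4]
  show "add P F G \<in> hom P X Y" unfolding eq using * by blast
  show "(i, f) \<in> pgerm F j \<Longrightarrow> (i, g) \<in> pgerm G j \<Longrightarrow> (i, add C f g) \<in> pgerm (add P F G) j"
    unfolding eq using *(2) rep_hom(1)[OF F] by blast
qed

lemma smulP:
  assumes F: "F \<in> hom P X Y"
  shows "smul P a F \<in> hom P X Y"
    "(i, f) \<in> pgerm F j \<Longrightarrow> (i, smul C a f) \<in> pgerm (smul P a F) j"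
proof -
  have X: "X \<in> pro_objs C" and Y: "Y \<in> pro_objs C" using homP_obj F by auto
  interpret J: category "pidx Y" using pro_objD Y by blast
  let ?S = "\<lambda>j. {(i, smul C a f) | i f. (i, f) \<in> pgerm F j}"
  have eq: "smul P a F = pro_map C X Y ?S" using F by (simp add: P Pro_def homP_iff hom_def)
  have 1: "?S l \<noteq> {}" if "l \<in> obj (pidx Y)" for l using rep_ex[OF F that] by blast
  have 2: "i \<in> obj (pidx X) \<and> f \<in> hom C (pob X i) (pob Y l)" if p: "(i, f) \<in> ?S l" for i f l
  proof -
    obtain f1 where p: "f = smul C a f1" "(i, f1) \<in> pgerm F l" using p by blast
    show ?thesis using rep_hom[OF F p(2)] p(1) smul_hom by blast
  qed
  have 3: "(i', f') \<in> germ C X (pob Y l) i f" if p: "(i, f) \<in> ?S l" and b: "(i', f') \<in> ?S l" for i f l i' f'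
  proof -
    obtain f1 where p: "f = smul C a f1" "(i, f1) \<in> pgerm F l" using p by blast
    obtain f2 where b: "f' = smul C a f2" "(i', f2) \<in> pgerm F l" using b by blast
    obtain k u v where k: "u \<in> hom (pidx X) k i" "v \<in> hom (pidx X) k i'" "f1 \<cdot> par X u = f2 \<cdot> par X v"
      using rep_unique[OF F p(2) b(2)] by blast
    have "f \<cdot> par X u = f' \<cdot> par X v"
      using cmp_smul_left[OF par_hom[OF X k(1)] rep_hom(3)[OF F p(2)]]
         cmp_smul_left[OF par_hom[OF X k(2)] rep_hom(3)[OF F b(2)]] k(3) p b by simp
    then show ?thesis unfolding germ_iff using k rep_hom[OF F b(2)] smul_hom b(1) by blast
  qed
  have 4: "\<exists>i f i' f'. (i, f) \<in> ?S l \<and> (i', f') \<in> ?S l' \<and> (i, par Y v \<cdot> f) \<in> germ C X (pob Y l') i' f'"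
    if v: "v \<in> hom (pidx Y) l l'" for l l' v
  proof -
    note l = J.homD(4,5)[OF v]
    obtain i f where f: "(i, f) \<in> pgerm F l" using rep_ex[OF F l(1)] by blast
    note ff = rep_hom[OF F f]
    have e: "par Y v \<cdot> smul C a f = smul C a (par Y v \<cdot> f)" using cmp_smul_right[OF ff(3) par_hom[OF Y v]] .
    have b: "(i, smul C a (par Y v \<cdot> f)) \<in> ?S l'" using rep_tgt[OF F f v] by blast
    have "(i, par Y v \<cdot> smul C a f) \<in> germ C X (pob Y l') i (smul C a (par Y v \<cdot> f))"
      unfolding e using germ_refl[OF X] 2[OF b] by blast
    moreover have "(i, smul C a f) \<in> ?S l" using f by blast
    ultimately show ?thesis using b by (intro exI conjI)
  qed
  note * = pro_map_hom[OF X Y, of ?S, OF 1 2 3 4]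
  show "smul P a F \<in> hom P X Y" unfolding eq using * by blast
  show "(i, f) \<in> pgerm F j \<Longrightarrow> (i, smul C a f) \<in> pgerm (smul P a F) j"
    unfolding eq using *(2) rep_hom(1)[OF F] by blast
qed

lemma rep_common3:
  assumes F: "F \<in> hom P X Y" and G: "G \<in> hom P X Y" and H: "H \<in> hom P X Y" and j: "j \<in> obj (pidx Y)"
  obtains i f g h where "(i, f) \<in> pgerm F j" "(i, g) \<in> pgerm G j" "(i, h) \<in> pgerm H j"
proof -
  obtain i f g where 1: "(i, f) \<in> pgerm F j" "(i, g) \<in> pgerm G j" using rep_common[OF F G j j] by blast
  obtain i' h where 2: "(i', h) \<in> pgerm H j" using rep_ex[OF H j] by blast
  obtain k u v where "u \<in> hom (pidx X) k i" "v \<in> hom (pidx X) k i'"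
    using pro_objD(2)[of X] homP_obj[OF F] rep_hom(2)[OF F 1(1)] rep_hom(2)[OF H 2] unfolding cofiltered_def by blast
  then show ?thesis using that rep_src[OF F 1(1)] rep_src[OF G 1(2)] rep_src[OF H 2] by blast
qed

text \<open>Each law holds for representatives chosen at a common index, and \<open>pro_eqI\<close>
  lifts it to germs.\<close>

sublocale P: linear_category P
proof (intro linear_category.intro linear_category_axioms.intro)
  show "category P" by (rule categoryP)
next
  fix X Y assume "X \<in> obj P" "Y \<in> obj P" then show "zer P X Y \<in> hom P X Y" using zerP by simp
next
  fix f g X Y assume "f \<in> hom P X Y" "g \<in> hom P X Y" then show "add P f g \<in> hom P X Y" using addP by blast
next
  fix f X Y a assume "f \<in> hom P X Y" then show "smul P a f \<in> hom P X Y" using smulP by blast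
next
  fix F G H X Y assume F: "F \<in> hom P X Y" and G: "G \<in> hom P X Y" and H: "H \<in> hom P X Y"
  note FG = addP[OF F G] and GH = addP[OF G H]
  show "add P (add P F G) H = add P F (add P G H)"
  proof (rule pro_eqI[OF addP(1)[OF FG(1) H] addP(1)[OF F GH(1)]])
    fix j assume "j \<in> obj (pidx Y)"
    then obtain i f g h where r: "(i, f) \<in> pgerm F j" "(i, g) \<in> pgerm G j" "(i, h) \<in> pgerm H j"
      using rep_common3[OF F G H] by blast
    show "\<exists>i f. (i, f) \<in> pgerm (add P (add P F G) H) j \<and> (i, f) \<in> pgerm (add P F (add P G H)) j"
      using addP(2)[OF FG(1) H FG(2)[OF r(1,2)] r(3)] addP(2)[OF F GH(1) r(1) GH(2)[OF r(2,3)]]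
        add_assoc[OF rep_hom(3)[OF F r(1)] rep_hom(3)[OF G r(2)] rep_hom(3)[OF H r(3)]] by auto
  qed
next
  fix F G X Y assume F: "F \<in> hom P X Y" and G: "G \<in> hom P X Y"
  show "add P F G = add P G F"
  proof (rule pro_eqI[OF addP(1)[OF F G] addP(1)[OF G F]])
    fix j assume "j \<in> obj (pidx Y)"
    then obtain i f g where r: "(i, f) \<in> pgerm F j" "(i, g) \<in> pgerm G j" using rep_common[OF F G] by blast
    show "\<exists>i f. (i, f) \<in> pgerm (add P F G) j \<and> (i, f) \<in> pgerm (add P G F) j"
      using addP(2)[OF F G r] addP(2)[OF G F r(2,1)] add_comm[OF rep_hom(3)[OF F r(1)] rep_hom(3)[OF G r(2)]] by auto
  qed
next
  fix F X Y assume F: "F \<in> hom P X Y"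
  have X: "X \<in> pro_objs C" and Y: "Y \<in> pro_objs C" using homP_obj F by auto
  note z = zerP[OF X Y]
  show "add P F (zer P X Y) = F"
  proof (rule pro_eqI[OF addP(1)[OF F z(1)] F])
    fix j assume j: "j \<in> obj (pidx Y)"
    then obtain i f where f: "(i, f) \<in> pgerm F j" using rep_ex[OF F] by blast
    show "\<exists>i f. (i, f) \<in> pgerm (add P F (zer P X Y)) j \<and> (i, f) \<in> pgerm F j"
      using addP(2)[OF F z(1) f z(2)[OF rep_hom(2)[OF F f] j]] f add_zer[OF rep_hom(3)[OF F f]] by auto
  qed
  note s = smulP[OF F, where a = "- 1"]
  show "add P F (smul P (- 1) F) = zer P X Y"
  proof (rule pro_eqI[OF addP(1)[OF F s(1)] z(1)])
    fix j assume j: "j \<in> obj (pidx Y)"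
    then obtain i f where f: "(i, f) \<in> pgerm F j" using rep_ex[OF F] by blast
    show "\<exists>i f. (i, f) \<in> pgerm (add P F (smul P (- 1) F)) j \<and> (i, f) \<in> pgerm (zer P X Y) j"
      using addP(2)[OF F s(1) f s(2)[OF f]] z(2)[OF rep_hom(2)[OF F f] j] add_neg[OF rep_hom(3)[OF F f]] by auto
  qed
next
  fix F G X Y a assume F: "F \<in> hom P X Y" and G: "G \<in> hom P X Y"
  note FG = addP[OF F G] and s = smulP[OF F, where a = a] and t = smulP[OF G, where a = a]
  show "smul P a (add P F G) = add P (smul P a F) (smul P a G)"
  proof (rule pro_eqI[OF smulP(1)[OF FG(1)] addP(1)[OF s(1) t(1)]])
    fix j assume j: "j \<in> obj (pidx Y)"
    then obtain i f g where r: "(i, f) \<in> pgerm F j" "(i, g) \<in> pgerm G j" using rep_common[OF F G] by blast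
    show "\<exists>i f. (i, f) \<in> pgerm (smul P a (add P F G)) j \<and> (i, f) \<in> pgerm (add P (smul P a F) (smul P a G)) j"
      using smulP(2)[OF FG(1) FG(2)[OF r], where a = a] addP(2)[OF s(1) t(1) s(2)[OF r(1)] t(2)[OF r(2)]]
        smul_add[OF rep_hom(3)[OF F r(1)] rep_hom(3)[OF G r(2)]] by auto
  qed
next
  fix F X Y and a b :: 'k assume F: "F \<in> hom P X Y"
  note s = smulP[OF F]
  show "smul P (a + b) F = add P (smul P a F) (smul P b F)"
  proof (rule pro_eqI[OF s(1) addP(1)[OF s(1) s(1)]])
    fix j assume j: "j \<in> obj (pidx Y)"
    then obtain i f where f: "(i, f) \<in> pgerm F j" using rep_ex[OF F] by blast
    show "\<exists>i f. (i, f) \<in> pgerm (smul P (a + b) F) j \<and> (i, f) \<in> pgerm (add P (smul P a F) (smul P b F)) j"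
      using s(2)[OF f, where a = "a + b"] addP(2)[OF s(1) s(1) s(2)[OF f, where a = a] s(2)[OF f, where a = b]]
        add_smul[OF rep_hom(3)[OF F f]] by auto
  qed
  show "smul P a (smul P b F) = smul P (a * b) F"
  proof (rule pro_eqI[OF smulP(1)[OF s(1)] s(1)])
    fix j assume j: "j \<in> obj (pidx Y)"
    then obtain i f where f: "(i, f) \<in> pgerm F j" using rep_ex[OF F] by blast
    show "\<exists>i f. (i, f) \<in> pgerm (smul P a (smul P b F)) j \<and> (i, f) \<in> pgerm (smul P (a * b) F) j"
      using s(2)[OF f, where a = "a * b"] smulP(2)[OF s(1) s(2)[OF f, where a = b], where a = a] smul_smul[OF rep_hom(3)[OF F f]] by auto
  qed
  show "smul P 1 F = F"
  proof (rule pro_eqI[OF s(1) F])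
    fix j assume j: "j \<in> obj (pidx Y)"
    then obtain i f where f: "(i, f) \<in> pgerm F j" using rep_ex[OF F] by blast
    show "\<exists>i f. (i, f) \<in> pgerm (smul P 1 F) j \<and> (i, f) \<in> pgerm F j"
      using s(2)[OF f, where a = 1] f smul_one[OF rep_hom(3)[OF F f]] by auto
  qed
next
  fix F F' G X Y Z assume F: "F \<in> hom P X Y" and F': "F' \<in> hom P X Y" and G: "G \<in> hom P Y Z"
  note FF = addP[OF F F'] and GF = cmpP[OF F G] and GF' = cmpP[OF F' G]
  show "G \<cdot>\<^bsub>P\<^esub> add P F F' = add P (G \<cdot>\<^bsub>P\<^esub> F) (G \<cdot>\<^bsub>P\<^esub> F')"
  proof (rule pro_eqI[OF cmpP(1)[OF FF(1) G] addP(1)[OF GF(1) GF'(1)]])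
    fix l assume "l \<in> obj (pidx Z)"
    then obtain j g where g: "(j, g) \<in> pgerm G l" using rep_ex[OF G] by blast
    obtain i f f' where r: "(i, f) \<in> pgerm F j" "(i, f') \<in> pgerm F' j"
      using rep_common[OF F F' rep_hom(2)[OF G g] rep_hom(2)[OF G g]] by blast
    show "\<exists>i f. (i, f) \<in> pgerm (G \<cdot>\<^bsub>P\<^esub> add P F F') l \<and> (i, f) \<in> pgerm (add P (G \<cdot>\<^bsub>P\<^esub> F) (G \<cdot>\<^bsub>P\<^esub> F')) l"
      using cmpP(2)[OF FF(1) G g FF(2)[OF r]] addP(2)[OF GF(1) GF'(1) GF(2)[OF g r(1)] GF'(2)[OF g r(2)]]
        cmp_add_right[OF rep_hom(3)[OF F r(1)] rep_hom(3)[OF F' r(2)] rep_hom(3)[OF G g]] by auto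
  qed
next
  fix F G G' X Y Z assume F: "F \<in> hom P X Y" and G: "G \<in> hom P Y Z" and G': "G' \<in> hom P Y Z"
  note GG = addP[OF G G'] and GF = cmpP[OF F G] and GF' = cmpP[OF F G']
  show "add P G G' \<cdot>\<^bsub>P\<^esub> F = add P (G \<cdot>\<^bsub>P\<^esub> F) (G' \<cdot>\<^bsub>P\<^esub> F)"
  proof (rule pro_eqI[OF cmpP(1)[OF F GG(1)] addP(1)[OF GF(1) GF'(1)]])
    fix l assume "l \<in> obj (pidx Z)"
    then obtain j g g' where r: "(j, g) \<in> pgerm G l" "(j, g') \<in> pgerm G' l" using rep_common[OF G G'] by blast
    obtain i f where f: "(i, f) \<in> pgerm F j" using rep_ex[OF F] rep_hom(2)[OF G r(1)] by blast
    show "\<exists>i f. (i, f) \<in> pgerm (add P G G' \<cdot>\<^bsub>P\<^esub> F) l \<and> (i, f) \<in> pgerm (add P (G \<cdot>\<^bsub>P\<^esub> F) (G' \<cdot>\<^bsub>P\<^esub> F)) l"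
      using cmpP(2)[OF F GG(1) GG(2)[OF r] f] addP(2)[OF GF(1) GF'(1) GF(2)[OF r(1) f] GF'(2)[OF r(2) f]]
        cmp_add_left[OF rep_hom(3)[OF F f] rep_hom(3)[OF G r(1)] rep_hom(3)[OF G' r(2)]] by auto
  qed
next
  fix F G X Y Z and a :: 'k assume F: "F \<in> hom P X Y" and G: "G \<in> hom P Y Z"
  note s = smulP[OF F, where a = a] and t = smulP[OF G, where a = a] and GF = cmpP[OF F G]
  show "G \<cdot>\<^bsub>P\<^esub> smul P a F = smul P a (G \<cdot>\<^bsub>P\<^esub> F)"
  proof (rule pro_eqI[OF cmpP(1)[OF s(1) G] smulP(1)[OF GF(1)]])
    fix l assume "l \<in> obj (pidx Z)"
    then obtain j g where g: "(j, g) \<in> pgerm G l" using rep_ex[OF G] by blast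
    obtain i f where f: "(i, f) \<in> pgerm F j" using rep_ex[OF F] rep_hom(2)[OF G g] by blast
    show "\<exists>i f. (i, f) \<in> pgerm (G \<cdot>\<^bsub>P\<^esub> smul P a F) l \<and> (i, f) \<in> pgerm (smul P a (G \<cdot>\<^bsub>P\<^esub> F)) l"
      using cmpP(2)[OF s(1) G g s(2)[OF f]] smulP(2)[OF GF(1) GF(2)[OF g f], where a = a]
        cmp_smul_right[OF rep_hom(3)[OF F f] rep_hom(3)[OF G g]] by auto
  qed
  show "smul P a G \<cdot>\<^bsub>P\<^esub> F = smul P a (G \<cdot>\<^bsub>P\<^esub> F)"
  proof (rule pro_eqI[OF cmpP(1)[OF F t(1)] smulP(1)[OF GF(1)]])
    fix l assume "l \<in> obj (pidx Z)"
    then obtain j g where g: "(j, g) \<in> pgerm G l" using rep_ex[OF G] by blast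
    obtain i f where f: "(i, f) \<in> pgerm F j" using rep_ex[OF F] rep_hom(2)[OF G g] by blast
    show "\<exists>i f. (i, f) \<in> pgerm (smul P a G \<cdot>\<^bsub>P\<^esub> F) l \<and> (i, f) \<in> pgerm (smul P a (G \<cdot>\<^bsub>P\<^esub> F)) l"
      using cmpP(2)[OF F t(1) t(2)[OF g] f] smulP(2)[OF GF(1) GF(2)[OF g f], where a = a]
        cmp_smul_left[OF rep_hom(3)[OF F f] rep_hom(3)[OF G g]] by auto
  qed
qed

end

subsection \<open>Graded morphisms in a category with a shift\<close>

text \<open>The divisibility argument needs only morphisms whose degrees add under composition.
  Stating it for an abstract composition \<open>gc\<close> keeps shifts and negative degrees out of
  it.\<close>

locale graded_linear =
  fixes Ob :: "'o set" and GH :: "int \<Rightarrow> 'o \<Rightarrow> 'o \<Rightarrow> 'g set" and gc :: "'g \<Rightarrow> 'g \<Rightarrow> 'g" and gi :: "'o \<Rightarrow> 'g"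
    and ga :: "'g \<Rightarrow> 'g \<Rightarrow> 'g" and gs :: "'k::field \<Rightarrow> 'g \<Rightarrow> 'g" and gz :: "int \<Rightarrow> 'o \<Rightarrow> 'o \<Rightarrow> 'g"
  assumes vector_space: "X \<in> Ob \<Longrightarrow> Y \<in> Ob \<Longrightarrow> partial_vector_space (GH k X Y) ga gs (gz k X Y)"
    and GH_Ob: "F \<in> GH k X Y \<Longrightarrow> X \<in> Ob \<and> Y \<in> Ob"
    and gc_in: "F \<in> GH k X Y \<Longrightarrow> G \<in> GH l Y Z \<Longrightarrow> gc G F \<in> GH (k + l) X Z"
    and gi_in: "X \<in> Ob \<Longrightarrow> gi X \<in> GH 0 X X"
    and gc_gi: "F \<in> GH k X Y \<Longrightarrow> gc F (gi X) = F"
    and gi_gc: "F \<in> GH k X Y \<Longrightarrow> gc (gi Y) F = F"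
    and gc_assoc: "F \<in> GH k W X \<Longrightarrow> G \<in> GH l X Y \<Longrightarrow> H \<in> GH m Y Z \<Longrightarrow> gc H (gc G F) = gc (gc H G) F"
    and gc_ga: "F \<in> GH k X Y \<Longrightarrow> F' \<in> GH k X Y \<Longrightarrow> G \<in> GH l Y Z \<Longrightarrow> gc G (ga F F') = ga (gc G F) (gc G F')"
    and ga_gc: "F \<in> GH k X Y \<Longrightarrow> G \<in> GH l Y Z \<Longrightarrow> G' \<in> GH l Y Z \<Longrightarrow> gc (ga G G') F = ga (gc G F) (gc G' F)"
    and gc_gs: "F \<in> GH k X Y \<Longrightarrow> G \<in> GH l Y Z \<Longrightarrow> gc G (gs a F) = gs a (gc G F)"
    and gs_gc: "F \<in> GH k X Y \<Longrightarrow> G \<in> GH l Y Z \<Longrightarrow> gc (gs a G) F = gs a (gc G F)"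

text \<open>The shift as a fully faithful functor such that every object is isomorphic to a shifted
  one. In this form it is inherited by \<open>Pro C\<close>, and graded composition is developed
  once for both categories.\<close>

locale shift_category = linear_category C
  for C :: "('o, 'm, 'k::field, 'x) tscat_scheme" (structure) +
  assumes shf_linear: "linear_functor C C (shf C) (shfa C)"
    and shf_full: "X \<in> obj C \<Longrightarrow> Y \<in> obj C \<Longrightarrow> g \<in> hom C (shf C X) (shf C Y) \<Longrightarrow> \<exists>f\<in>hom C X Y. shfa C f = g"
    and shf_faithful: "f \<in> hom C X Y \<Longrightarrow> g \<in> hom C X Y \<Longrightarrow> shfa C f = shfa C g \<Longrightarrow> f = g"
    and ush_obj: "X \<in> obj C \<Longrightarrow> ush C X \<in> obj C"
    and eta_iso: "X \<in> obj C \<Longrightarrow> eta C X \<in> hom C X (shf C (ush C X)) \<and> iso C (eta C X)"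
begin

lemma shf_is_functor: "is_functor C C (shf C) (shfa C)"
  using shf_linear by (simp add: linear_functor_def)

lemmas shf_hom = functor_hom[OF shf_is_functor] and shf_obj = functor_obj[OF shf_is_functor]
  and shf_idn = functor_idn[OF shf_is_functor] and shf_cmp = functor_cmp[OF shf_is_functor]

lemma shf_add: "f \<in> hom C X Y \<Longrightarrow> g \<in> hom C X Y \<Longrightarrow> shfa C (add C f g) = add C (shfa C f) (shfa C g)"
  and shf_smul: "f \<in> hom C X Y \<Longrightarrow> shfa C (smul C a f) = smul C a (shfa C f)"
  using shf_linear by (auto simp: linear_functor_def)

lemma shf_zer: 
  assumes "X \<in> obj C" "Y \<in> obj C" shows "shfa C (zer C X Y) = zer C (shf C X) (shf C Y)"
proof -
  have z: "zer C X Y \<in> hom C X Y" using zer_hom assms by blast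
  have "shfa C (zer C X Y) = shfa C (smul C 0 (zer C X Y))" using smul_0[OF z] by simp
  also have "\<dots> = zer C (shf C X) (shf C Y)" using shf_smul[OF z] smul_0[OF shf_hom[OF z]] by simp
  finally show ?thesis .
qed

lemma shf_iso:
  assumes "iso C f" "f \<in> hom C X Y" shows "iso C (shfa C f)"
proof -
  obtain g where g: "g \<in> hom C Y X" "g \<cdot> f = idn C X" "f \<cdot> g = idn C Y" using isoE assms by metis
  show ?thesis
    using isoI[OF shf_hom[OF assms(2)] shf_hom[OF g(1)]] shf_cmp[OF assms(2) g(1)] shf_cmp[OF g(1) assms(2)]
      g(2,3) shf_idn homD(4,5)[OF assms(2)] by simp
qed

lemma shf_eq_zero:
  assumes "f \<in> hom C X Y" "shfa C f = zer C (shf C X) (shf C Y)" shows "f = zer C X Y"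
  using shf_faithful[OF assms(1) zer_hom] shf_zer homD(4,5)[OF assms(1)] assms(2) by simp

text \<open>Through \<open>eta\<close> the target \<open>W\<close> is a shift up to isomorphism, so
  any morphism out of \<open>shf C X\<close> is, up to that isomorphism, the shift of a morphism.
  This is what lets universal properties be tested after shifting.\<close>

lemma shf_full_right:
  assumes "X \<in> obj C" "h \<in> hom C (shf C X) W"
  obtains V e e' h' where "h' \<in> hom C X V" "e \<in> hom C W (shf C V)" "e' \<in> hom C (shf C V) W"
    "e' \<cdot> e = idn C W" "e \<cdot> h = shfa C h'" "h = e' \<cdot> shfa C h'"
proof -
  let ?V = "ush C W"
  note d = homD[OF assms(2)]
  obtain e where e: "e \<in> hom C W (shf C ?V)" "iso C e" using eta_iso[of W] d by blast
  obtain e' where e': "e' \<in> hom C (shf C ?V) W" "e' \<cdot> e = idn C W" using isoE[OF e(2,1)] by metis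
  obtain h' where h': "h' \<in> hom C X ?V" "shfa C h' = e \<cdot> h"
    using shf_full[OF assms(1), of ?V "e \<cdot> h"] ush_obj d cmp_hom[OF assms(2) e(1)] by blast
  have "h = (e' \<cdot> e) \<cdot> h" using e' d by simp
  also have "\<dots> = e' \<cdot> shfa C h'" using h' cmp_assoc[OF assms(2) e(1) e'(1)] by simp
  finally show ?thesis by (rule that[OF h'(1) e(1) e'(1) e'(2) h'(2)[symmetric]])
qed

lemma shf_full_left:
  assumes "X \<in> obj C" "h \<in> hom C W (shf C X)"
  obtains V e e' h' where "h' \<in> hom C V X" "e \<in> hom C W (shf C V)" "e' \<in> hom C (shf C V) W"
    "e \<cdot> e' = idn C (shf C V)" "h \<cdot> e' = shfa C h'" "h = shfa C h' \<cdot> e" "iso C e"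
proof -
  let ?V = "ush C W"
  note d = homD[OF assms(2)]
  obtain e where e: "e \<in> hom C W (shf C ?V)" "iso C e" using eta_iso[of W] d by blast
  obtain e' where e': "e' \<in> hom C (shf C ?V) W" "e' \<cdot> e = idn C W" "e \<cdot> e' = idn C (shf C ?V)" 
    using isoE[OF e(2,1)] by metis
  obtain h' where h': "h' \<in> hom C ?V X" "shfa C h' = h \<cdot> e'"
    using shf_full[OF _ assms(1), of ?V "h \<cdot> e'"] ush_obj d cmp_hom[OF e'(1) assms(2)] by blast
  have "h = h \<cdot> (e' \<cdot> e)" using e' d by simp
  also have "\<dots> = shfa C h' \<cdot> e" using h' cmp_assoc[OF e(1) e'(1) assms(2)] by simp
  finally show ?thesis by (rule that[OF h'(1) e(1) e'(1) e'(3) h'(2)[symmetric] _ e(2)])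
qed

lemma shf_epi:
  assumes "epi C p" "p \<in> hom C X Y" shows "epi C (shfa C p)"
proof (rule epi_zeroI[OF shf_hom[OF assms(2)]])
  fix W h assume h: "h \<in> hom C (shf C Y) W" "h \<cdot> shfa C p = zer C (shf C X) W"
  note d = homD[OF assms(2)] homD[OF h(1)]
  obtain V e e' h' where v: "h' \<in> hom C Y V" "e \<in> hom C W (shf C V)" "e' \<in> hom C (shf C V) W"
    "e' \<cdot> e = idn C W" "e \<cdot> h = shfa C h'" "h = e' \<cdot> shfa C h'" by (rule shf_full_right[OF d(5) h(1)])
  note hp = cmp_hom[OF assms(2) v(1)]
  have "shfa C (h' \<cdot> p) = (e \<cdot> h) \<cdot> shfa C p" using shf_cmp[OF assms(2) v(1)] v(5) by simp
  also have "\<dots> = e \<cdot> (h \<cdot> shfa C p)" using cmp_assoc[OF shf_hom[OF assms(2)] h(1) v(2)] by simp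
  also have "\<dots> = zer C (shf C X) (shf C V)" using h(2) cmp_zer[OF v(2)] shf_obj d by simp
  finally have "h' = zer C Y V" using epi_zeroD[OF assms v(1)] shf_eq_zero[OF hp] by simp
  then show "h = zer C (shf C Y) W" using v(6) shf_zer homD(4,5)[OF v(1)] cmp_zer[OF v(3)] shf_obj by simp
qed

lemma shf_mono:
  assumes "mono C p" "p \<in> hom C X Y" shows "mono C (shfa C p)"
proof (rule mono_zeroI[OF shf_hom[OF assms(2)]])
  fix W h assume h: "h \<in> hom C W (shf C X)" "shfa C p \<cdot> h = zer C W (shf C Y)"
  note d = homD[OF assms(2)] homD[OF h(1)]
  obtain V e e' h' where v: "h' \<in> hom C V X" "e \<in> hom C W (shf C V)" "e' \<in> hom C (shf C V) W"
    "e \<cdot> e' = idn C (shf C V)" "h \<cdot> e' = shfa C h'" "h = shfa C h' \<cdot> e" "iso C e" by (rule shf_full_left[OF d(4) h(1)])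
  note hp = cmp_hom[OF v(1) assms(2)]
  have "shfa C (p \<cdot> h') = shfa C p \<cdot> (h \<cdot> e')" using shf_cmp[OF v(1) assms(2)] v(5) by simp
  also have "\<dots> = (shfa C p \<cdot> h) \<cdot> e'" using cmp_assoc[OF v(3) h(1) shf_hom[OF assms(2)]] by simp
  also have "\<dots> = zer C (shf C V) (shf C Y)" using h(2) zer_cmp[OF v(3)] shf_obj d by simp
  finally have "h' = zer C V X" using mono_zeroD[OF assms v(1)] shf_eq_zero[OF hp] by simp
  then show "h = zer C W (shf C X)" using v(6) shf_zer homD(4,5)[OF v(1)] zer_cmp[OF v(2)] shf_obj by simp
qed

lemma shf_cokernel:
  assumes "is_cokernel C f p" "f \<in> hom C X Y" shows "is_cokernel C (shfa C f) (shfa C p)"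
proof -
  obtain K where K: "p \<in> hom C Y K" "p \<cdot> f = zer C X K" "epi C p" using cokernelE[OF assms] .
  note d = homD[OF assms(2)] homD[OF K(1)]
  show ?thesis
  proof (rule is_cokernelI[OF shf_hom[OF assms(2)] shf_hom[OF K(1)] _ shf_epi[OF K(3,1)]])
    show "shfa C p \<cdot> shfa C f = zer C (shf C X) (shf C K)"
      using shf_cmp[OF assms(2) K(1)] K(2) shf_zer d by simp
    fix W h assume h: "h \<in> hom C (shf C Y) W" "h \<cdot> shfa C f = zer C (shf C X) W"
    obtain V e e' h' where v: "h' \<in> hom C Y V" "e \<in> hom C W (shf C V)" "e' \<in> hom C (shf C V) W"
      "e' \<cdot> e = idn C W" "e \<cdot> h = shfa C h'" "h = e' \<cdot> shfa C h'" by (rule shf_full_right[OF d(5) h(1)])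
    have "shfa C (h' \<cdot> f) = (e \<cdot> h) \<cdot> shfa C f" using shf_cmp[OF assms(2) v(1)] v(5) by simp
    also have "\<dots> = e \<cdot> (h \<cdot> shfa C f)" using cmp_assoc[OF shf_hom[OF assms(2)] h(1) v(2)] by simp
    also have "\<dots> = zer C (shf C X) (shf C V)" using h(2) cmp_zer[OF v(2)] shf_obj d by simp
    finally have "h' \<cdot> f = zer C X V" using shf_eq_zero[OF cmp_hom[OF assms(2) v(1)]] by simp
    then obtain u where u: "u \<in> hom C K V" "u \<cdot> p = h'" using cokernel_factor[OF assms(1) K(1) v(1) assms(2)] by blast
    have "(e' \<cdot> shfa C u) \<cdot> shfa C p = h"
      using u(2) v(6) shf_cmp[OF K(1) u(1)] cmp_assoc[OF shf_hom[OF K(1)] shf_hom[OF u(1)] v(3)] by simp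
    then show "\<exists>u\<in>hom C (shf C K) W. u \<cdot> shfa C p = h" using cmp_hom[OF shf_hom[OF u(1)] v(3)] by blast
  qed
qed

lemma shf_kernel:
  assumes "is_kernel C f i" "f \<in> hom C X Y" shows "is_kernel C (shfa C f) (shfa C i)"
proof -
  obtain K where K: "i \<in> hom C K X" "f \<cdot> i = zer C K Y" "mono C i" using kernelE[OF assms] .
  note d = homD[OF assms(2)] homD[OF K(1)]
  show ?thesis
  proof (rule is_kernelI[OF shf_hom[OF assms(2)] shf_hom[OF K(1)] _ shf_mono[OF K(3,1)]])
    show "shfa C f \<cdot> shfa C i = zer C (shf C K) (shf C Y)"
      using shf_cmp[OF K(1) assms(2)] K(2) shf_zer d by simp
    fix W h assume h: "h \<in> hom C W (shf C X)" "shfa C f \<cdot> h = zer C W (shf C Y)"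
    obtain V e e' h' where v: "h' \<in> hom C V X" "e \<in> hom C W (shf C V)" "e' \<in> hom C (shf C V) W"
      "e \<cdot> e' = idn C (shf C V)" "h \<cdot> e' = shfa C h'" "h = shfa C h' \<cdot> e" "iso C e" by (rule shf_full_left[OF d(4) h(1)])
    have "shfa C (f \<cdot> h') = shfa C f \<cdot> (h \<cdot> e')" using shf_cmp[OF v(1) assms(2)] v(5) by simp
    also have "\<dots> = (shfa C f \<cdot> h) \<cdot> e'" using cmp_assoc[OF v(3) h(1) shf_hom[OF assms(2)]] by simp
    also have "\<dots> = zer C (shf C V) (shf C Y)" using h(2) zer_cmp[OF v(3)] shf_obj d by simp
    finally have "f \<cdot> h' = zer C V Y" using shf_eq_zero[OF cmp_hom[OF v(1) assms(2)]] by simp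
    then obtain u where u: "u \<in> hom C V K" "i \<cdot> u = h'" using kernel_factor[OF assms(1) K(1) v(1) assms(2)] by blast
    have "shfa C i \<cdot> (shfa C u \<cdot> e) = h"
      using u(2) v(6) shf_cmp[OF u(1) K(1)] cmp_assoc[OF v(2) shf_hom[OF u(1)] shf_hom[OF K(1)]] by simp
    then show "\<exists>u\<in>hom C W (shf C K). shfa C i \<cdot> u = h" using cmp_hom[OF v(2) shf_hom[OF u(1)]] by blast
  qed
qed

section \<open>Iterated shifts and stabilized graded morphisms\<close>

abbreviation Qo ("\<Q>o") where "\<Q>o n \<equiv> shf C ^^ n"
abbreviation Qa ("\<Q>a") where "\<Q>a n \<equiv> shfa C ^^ n"

lemma Q_obj: "X \<in> obj C \<Longrightarrow> \<Q>o n X \<in> obj C"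
  by (induction n) (auto simp: shf_obj)

lemma Q_hom: "f \<in> hom C X Y \<Longrightarrow> \<Q>a n f \<in> hom C (\<Q>o n X) (\<Q>o n Y)"
  by (induction n) (auto simp: shf_hom)

lemma Q_idn: "X \<in> obj C \<Longrightarrow> \<Q>a n (idn C X) = idn C (\<Q>o n X)"
  by (induction n) (auto simp: shf_idn Q_obj)

lemma Q_cmp: "f \<in> hom C X Y \<Longrightarrow> g \<in> hom C Y Z \<Longrightarrow> \<Q>a n (g \<cdot> f) = \<Q>a n g \<cdot> \<Q>a n f"
  by (induction n) (auto simp: shf_cmp[OF Q_hom Q_hom])

lemma Q_add: "f \<in> hom C X Y \<Longrightarrow> g \<in> hom C X Y \<Longrightarrow> \<Q>a n (add C f g) = add C (\<Q>a n f) (\<Q>a n g)"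
  by (induction n) (auto simp: shf_add[OF Q_hom Q_hom])

lemma Q_smul: "f \<in> hom C X Y \<Longrightarrow> \<Q>a n (smul C a f) = smul C a (\<Q>a n f)"
  by (induction n) (auto simp: shf_smul[OF Q_hom])

lemma Q_zer: "X \<in> obj C \<Longrightarrow> Y \<in> obj C \<Longrightarrow> \<Q>a n (zer C X Y) = zer C (\<Q>o n X) (\<Q>o n Y)"
  by (induction n) (auto simp: shf_zer Q_obj)

lemma Q_faithful: "f \<in> hom C X Y \<Longrightarrow> g \<in> hom C X Y \<Longrightarrow> \<Q>a n f = \<Q>a n g \<Longrightarrow> f = g"
  by (induction n) (auto dest: shf_faithful[OF Q_hom Q_hom])

lemma Q_full: "X \<in> obj C \<Longrightarrow> Y \<in> obj C \<Longrightarrow> g \<in> hom C (\<Q>o n X) (\<Q>o n Y) \<Longrightarrow> \<exists>f\<in>hom C X Y. \<Q>a n f = g"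
proof (induction n arbitrary: g)
  case (Suc n)
  have "g \<in> hom C (shf C (\<Q>o n X)) (shf C (\<Q>o n Y))" using Suc.prems by simp
  then obtain g' where g': "g' \<in> hom C (\<Q>o n X) (\<Q>o n Y)" "shfa C g' = g"
    using shf_full[OF Q_obj[OF Suc.prems(1)] Q_obj[OF Suc.prems(2)]] by blast
  then obtain f where "f \<in> hom C X Y" "\<Q>a n f = g'" using Suc.IH[OF Suc.prems(1,2) g'(1)] by blast
  then show ?case using g' by auto
qed auto

lemma Q_iso: "iso C f \<Longrightarrow> f \<in> hom C X Y \<Longrightarrow> iso C (\<Q>a n f)"
  by (induction n) (auto intro: shf_iso Q_hom)

lemma Q_epi: "epi C f \<Longrightarrow> f \<in> hom C X Y \<Longrightarrow> epi C (\<Q>a n f)"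
  by (induction n) (auto intro: shf_epi Q_hom)

lemma Q_kernel: "is_kernel C f i \<Longrightarrow> f \<in> hom C X Y \<Longrightarrow> is_kernel C (\<Q>a n f) (\<Q>a n i)"
  by (induction n) (auto intro: shf_kernel Q_hom)

lemma Q_cokernel: "is_cokernel C f p \<Longrightarrow> f \<in> hom C X Y \<Longrightarrow> is_cokernel C (\<Q>a n f) (\<Q>a n p)"
  by (induction n) (auto intro: shf_cokernel Q_hom)

lemma Qa_add: "\<Q>a (m + n) f = \<Q>a m (\<Q>a n f)" and Qo_add: "\<Q>o (m + n) X = \<Q>o m (\<Q>o n X)"
  by (simp_all add: funpow_add)

lemma ush_pow_obj: "X \<in> obj C \<Longrightarrow> (ush C ^^ n) X \<in> obj C"
  by (induction n) (auto simp: ush_obj)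

lemma shpow_obj: "X \<in> obj C \<Longrightarrow> shpow C k X \<in> obj C"
  by (simp add: shpow_def Q_obj ush_pow_obj)

lemma wind_iso: "X \<in> obj C \<Longrightarrow> wind C m X \<in> hom C X (\<Q>o m ((ush C ^^ m) X)) \<and> iso C (wind C m X)"
proof (induction m)
  case (Suc m)
  let ?U = "(ush C ^^ m) X"
  have U: "?U \<in> obj C" using ush_pow_obj Suc by blast
  have e: "\<Q>a m (eta C ?U) \<in> hom C (\<Q>o m ?U) (\<Q>o m (shf C (ush C ?U)))" "iso C (\<Q>a m (eta C ?U))"
    using eta_iso[OF U] Q_hom Q_iso by blast+
  have w: "wind C m X \<in> hom C X (\<Q>o m ?U)" "iso C (wind C m X)" using Suc by auto
  have "\<Q>o m (shf C (ush C ?U)) = \<Q>o (Suc m) ((ush C ^^ Suc m) X)" by (simp add: funpow_swap1)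
  then show ?case using cmp_hom[OF w(1) e(1)] iso_cmp[OF w(1) e(1) w(2) e(2)] by simp
qed (auto simp: idn_hom iso_idn)

lemma flat_hom:
  assumes "X \<in> obj C" "f \<in> HOM C k X Y"
  shows "flat C k X f \<in> hom C (\<Q>o (nat k) X) (\<Q>o (nat (- k)) Y)"
proof (cases "0 \<le> k")
  case False
  then have "f \<in> hom C ((ush C ^^ nat (- k)) X) Y" using assms by (simp add: HOM_def shpow_def)
  then show ?thesis using cmp_hom[OF conjunct1[OF wind_iso[OF assms(1)]] Q_hom] False by (simp add: flat_def)
qed (use assms in \<open>simp add: flat_def HOM_def shpow_def\<close>)

lemma flat_inj:
  assumes "X \<in> obj C" "f \<in> HOM C k X Y" "g \<in> HOM C k X Y" "flat C k X f = flat C k X g"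
  shows "f = g"
proof (cases "0 \<le> k")
  case False
  let ?n = "nat (- k)"
  have h: "f \<in> hom C ((ush C ^^ ?n) X) Y" "g \<in> hom C ((ush C ^^ ?n) X) Y"
    using assms False by (auto simp: HOM_def shpow_def)
  have "\<Q>a ?n f \<cdot> wind C ?n X = \<Q>a ?n g \<cdot> wind C ?n X" using assms(4) False by (simp add: flat_def)
  then have "\<Q>a ?n f = \<Q>a ?n g"
    using iso_cancel_right[OF _ _ Q_hom[OF h(1)] Q_hom[OF h(2)]] wind_iso[OF assms(1)] by blast
  then show ?thesis using Q_faithful h by blast
qed (use assms in \<open>simp add: flat_def\<close>)

lemma flat_surj:
  assumes "X \<in> obj C" "Y \<in> obj C" "g \<in> hom C (\<Q>o (nat k) X) (\<Q>o (nat (- k)) Y)"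
  shows "\<exists>f\<in>HOM C k X Y. flat C k X f = g"
proof (cases "0 \<le> k")
  case True then show ?thesis using assms by (auto simp: HOM_def shpow_def flat_def)
next
  case False
  let ?n = "nat (- k)" and ?U = "(ush C ^^ nat (- k)) X"
  have w: "wind C ?n X \<in> hom C X (\<Q>o ?n ?U)" "iso C (wind C ?n X)" using wind_iso[OF assms(1)] by auto
  obtain w' where w': "w' \<in> hom C (\<Q>o ?n ?U) X" "w' \<cdot> wind C ?n X = idn C X" using isoE[OF w(2,1)] by metis
  have g: "g \<in> hom C X (\<Q>o ?n Y)" using assms(3) False by simp
  obtain f where f: "f \<in> hom C ?U Y" "\<Q>a ?n f = g \<cdot> w'"
    using Q_full[OF ush_pow_obj[OF assms(1)] assms(2) cmp_hom[OF w'(1) g]] by blast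
  have "(g \<cdot> w') \<cdot> wind C ?n X = g" using cmp_assoc[OF w(1) w'(1) g] w'(2) cmp_idn[OF g] by simp
  then have "flat C k X f = g" using f(2) False by (simp add: flat_def del: cmp_assoc')
  moreover have "f \<in> HOM C k X Y" using f(1) False by (simp add: HOM_def shpow_def)
  ultimately show ?thesis by blast
qed

text \<open>A morphism of degree \<open>k\<close> is represented, after enough shifts, by an
  ordinary morphism from \<open>q^(n+k) X\<close> to \<open>q^n Y\<close>. Truncated subtraction has
  this meaning only for \<open>0 \<le> int n + k\<close>; hence that side condition in
  \<open>stab_hom\<close> and its consequences.\<close>

definition stab :: "nat \<Rightarrow> int \<Rightarrow> 'o \<Rightarrow> 'm \<Rightarrow> 'm" where
  "stab n k X f = \<Q>a (n - nat (- k)) (flat C k X f)"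

lemma stab_hom:
  assumes "X \<in> obj C" "f \<in> HOM C k X Y" "0 \<le> int n + k"
  shows "stab n k X f \<in> hom C (\<Q>o (nat (int n + k)) X) (\<Q>o n Y)"
proof -
  let ?m = "n - nat (- k)"
  have "?m + nat k = nat (int n + k)" "?m + nat (- k) = n" using assms(3) by auto
  then show ?thesis using Q_hom[OF flat_hom[OF assms(1,2)], of ?m] unfolding stab_def Qo_add[symmetric] by simp
qed

lemma stab_add:
  assumes "0 \<le> int n + k" shows "stab (m + n) k X f = \<Q>a m (stab n k X f)"
proof -
  have "m + n - nat (- k) = m + (n - nat (- k))" using assms by auto
  then show ?thesis by (simp add: stab_def Qa_add)
qed

lemma stab_inj:
  assumes "X \<in> obj C" "f \<in> HOM C k X Y" "g \<in> HOM C k X Y" "stab n k X f = stab n k X g"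
  shows "f = g"
  using assms Q_faithful[OF flat_hom flat_hom] flat_inj unfolding stab_def by blast

lemma stab_surj:
  assumes "X \<in> obj C" "Y \<in> obj C" "0 \<le> int n + k" "g \<in> hom C (\<Q>o (nat (int n + k)) X) (\<Q>o n Y)"
  shows "\<exists>f\<in>HOM C k X Y. stab n k X f = g"
proof -
  let ?m = "n - nat (- k)"
  have "?m + nat k = nat (int n + k)" "?m + nat (- k) = n" using assms(3) by auto
  then have "g \<in> hom C (\<Q>o ?m (\<Q>o (nat k) X)) (\<Q>o ?m (\<Q>o (nat (- k)) Y))"
    using assms(4) unfolding Qo_add[symmetric] by simp
  then obtain h where h: "h \<in> hom C (\<Q>o (nat k) X) (\<Q>o (nat (- k)) Y)" "\<Q>a ?m h = g"
    using Q_full[OF Q_obj[OF assms(1)] Q_obj[OF assms(2)]] by blast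
  then show ?thesis using flat_surj[OF assms(1,2) h(1)] unfolding stab_def by metis
qed

lemma stab_nonneg: "0 \<le> k \<Longrightarrow> stab n k X f = \<Q>a n f"
  by (simp add: stab_def flat_def)

lemma HOM_vector_space: "X \<in> obj C \<Longrightarrow> Y \<in> obj C \<Longrightarrow>
    partial_vector_space (HOM C k X Y) (add C) (smul C) (zer C (shpow C k X) Y)"
  unfolding HOM_def using hom_vector_space shpow_obj by blast

lemma stab_addition:
  assumes "X \<in> obj C" "f \<in> HOM C k X Y" "g \<in> HOM C k X Y"
  shows "stab n k X (add C f g) = add C (stab n k X f) (stab n k X g)"
proof -
  have h: "f \<in> hom C (shpow C k X) Y" "g \<in> hom C (shpow C k X) Y" using assms by (auto simp: HOM_def)
  have "flat C k X (add C f g) = add C (flat C k X f) (flat C k X g)"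
  proof (cases "0 \<le> k")
    case False
    then have "shpow C k X = (ush C ^^ nat (- k)) X" by (simp add: shpow_def)
    then show ?thesis
      using False Q_add[OF h, of "nat (- k)"] wind_iso[OF assms(1), of "nat (- k)"]
        cmp_add_left[OF _ Q_hom[OF h(1), of "nat (- k)"] Q_hom[OF h(2), of "nat (- k)"], of "wind C (nat (- k)) X" X]
      by (simp add: flat_def)
  qed (simp add: flat_def)
  then show ?thesis unfolding stab_def using Q_add[OF flat_hom flat_hom] assms by simp
qed

lemma stab_smul:
  assumes "X \<in> obj C" "f \<in> HOM C k X Y"
  shows "stab n k X (smul C a f) = smul C a (stab n k X f)"
proof -
  have h: "f \<in> hom C (shpow C k X) Y" using assms by (auto simp: HOM_def)
  have "flat C k X (smul C a f) = smul C a (flat C k X f)"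
  proof (cases "0 \<le> k")
    case False
    then have "shpow C k X = (ush C ^^ nat (- k)) X" by (simp add: shpow_def)
    then show ?thesis
      using False Q_smul[OF h, of "nat (- k)"] wind_iso[OF assms(1), of "nat (- k)"]
        cmp_smul_left[OF _ Q_hom[OF h, of "nat (- k)"], of "wind C (nat (- k)) X" X]
      by (simp add: flat_def)
  qed (simp add: flat_def)
  then show ?thesis unfolding stab_def using Q_smul[OF flat_hom] assms by simp
qed

text \<open>The definition of \<open>gcomp\<close> fixes the composite at the shift
  \<open>?N\<close>, the sum of the negative parts of the two degrees. Composition at any other
  admissible shift \<open>n\<close> is compared with it at the shift \<open>?N + n\<close>, and
  \<open>q\<close> is faithful.\<close>

lemma gcomp_stab:
  assumes X: "X \<in> obj C" and Y: "Y \<in> obj C" and Z: "Z \<in> obj C"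
    and f: "f \<in> HOM C k X Y" and g: "g \<in> HOM C l Y Z"
  shows "gcomp C X Y Z l g k f \<in> HOM C (k + l) X Z"
    and "0 \<le> int n + l \<Longrightarrow> 0 \<le> int n + l + k \<Longrightarrow>
      stab n (k + l) X (gcomp C X Y Z l g k f) = stab n l Y g \<cdot> stab (nat (int n + l)) k X f"
proof -
  let ?N = "nat (- k) + nat (- l)" and ?h = "gcomp C X Y Z l g k f"
  \<comment> \<open>These identities turn the exponents of \<open>gcomp_def\<close> into those of
    \<open>stab\<close> at the shift \<open>?N\<close>.\<close>
  have N: "nat k + nat l - nat (k + l) = ?N - nat (- (k + l))" "nat (- k) = ?N - nat (- l)"
    "nat l = nat (int ?N + l) - nat (- k)" by auto
  have Ng: "0 \<le> int ?N + l" "0 \<le> int (nat (int ?N + l)) + k" "0 \<le> int ?N + (k + l)" by auto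
  have eq: "int (nat (int ?N + l)) + k = int ?N + (k + l)" by simp
  have h: "stab ?N l Y g \<cdot> stab (nat (int ?N + l)) k X f \<in> hom C (\<Q>o (nat (int ?N + (k + l))) X) (\<Q>o ?N Z)"
    using cmp_hom[OF stab_hom[OF X f Ng(2)] stab_hom[OF Y g Ng(1)]] unfolding eq .
  have gd: "?h = (THE h. h \<in> HOM C (k + l) X Z \<and> stab ?N (k + l) X h = stab ?N l Y g \<cdot> stab (nat (int ?N + l)) k X f)"
    unfolding gcomp_def stab_def N(1) N(2)[symmetric] N(3)[symmetric] ..
  have "\<exists>!h. h \<in> HOM C (k + l) X Z \<and> stab ?N (k + l) X h = stab ?N l Y g \<cdot> stab (nat (int ?N + l)) k X f"
    using stab_surj[OF X Z Ng(3) h] stab_inj[OF X] by (intro ex_ex1I) (blast, metis)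
  then have "?h \<in> HOM C (k + l) X Z \<and> stab ?N (k + l) X ?h = stab ?N l Y g \<cdot> stab (nat (int ?N + l)) k X f"
    unfolding gd by (rule theI')
  then have 1: "?h \<in> HOM C (k + l) X Z" and 2: "stab ?N (k + l) X ?h = stab ?N l Y g \<cdot> stab (nat (int ?N + l)) k X f"
    by auto
  show "?h \<in> HOM C (k + l) X Z" by (rule 1)
  assume n: "0 \<le> int n + l" "0 \<le> int n + l + k"
  have n': "0 \<le> int (nat (int n + l)) + k" "0 \<le> int n + (k + l)" using n by auto
  have e2: "int (nat (int n + l)) + k = int n + (k + l)" using n by simp
  have s: "nat (int (n + ?N) + l) = n + nat (int ?N + l)" "nat (int (?N + n) + l) = ?N + nat (int n + l)"
    using n by auto
  have c1: "stab (nat (int n + l)) k X f \<in> hom C (\<Q>o (nat (int n + (k + l))) X) (\<Q>o (nat (int n + l)) Y)"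
    using stab_hom[OF X f n'(1)] unfolding e2 .
  have c2: "stab (nat (int ?N + l)) k X f \<in> hom C (\<Q>o (nat (int ?N + (k + l))) X) (\<Q>o (nat (int ?N + l)) Y)"
    using stab_hom[OF X f Ng(2)] unfolding eq .
  have "\<Q>a ?N (stab n (k + l) X ?h) = \<Q>a n (stab ?N (k + l) X ?h)"
    using stab_add[OF n'(2), of ?N] stab_add[OF Ng(3), of n] by (metis add.commute)
  also have "\<dots> = \<Q>a n (stab ?N l Y g) \<cdot> \<Q>a n (stab (nat (int ?N + l)) k X f)"
    unfolding 2 by (rule Q_cmp[OF c2 stab_hom[OF Y g Ng(1)]])
  also have "\<dots> = stab (n + ?N) l Y g \<cdot> stab (n + nat (int ?N + l)) k X f"
    using stab_add[OF Ng(1)] stab_add[OF Ng(2)] by simp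
  also have "n + nat (int ?N + l) = ?N + nat (int n + l)" using s by (metis add.commute)
  also have "stab (n + ?N) l Y g \<cdot> stab (?N + nat (int n + l)) k X f = \<Q>a ?N (stab n l Y g) \<cdot> \<Q>a ?N (stab (nat (int n + l)) k X f)"
    using stab_add[OF n(1), of ?N] stab_add[OF n'(1), of ?N] by (simp add: add.commute)
  also have "\<dots> = \<Q>a ?N (stab n l Y g \<cdot> stab (nat (int n + l)) k X f)"
    using Q_cmp[OF c1 stab_hom[OF Y g n(1)]] by simp
  finally show "stab n (k + l) X ?h = stab n l Y g \<cdot> stab (nat (int n + l)) k X f"
    using Q_faithful[OF stab_hom[OF X 1 n'(2)] cmp_hom[OF c1 stab_hom[OF Y g n(1)]]] by blast
qed

text \<open>An arrow does not determine its degree, nor the object of which its source is a shift.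
  Tagging it with source, target and degree makes composition a binary operation, as
  \<open>graded_linear\<close> requires.\<close>

definition GH :: "int \<Rightarrow> 'o \<Rightarrow> 'o \<Rightarrow> ('o \<times> 'o \<times> int \<times> 'm) set" where
  "GH k X Y = {(X, Y, k, f) | f. X \<in> obj C \<and> Y \<in> obj C \<and> f \<in> HOM C k X Y}"

definition gc :: "'o \<times> 'o \<times> int \<times> 'm \<Rightarrow> 'o \<times> 'o \<times> int \<times> 'm \<Rightarrow> 'o \<times> 'o \<times> int \<times> 'm" where
  "gc G F = (case G of (Y, Z, l, g) \<Rightarrow> case F of (X, _, k, f) \<Rightarrow> (X, Z, k + l, gcomp C X Y Z l g k f))"

definition gi :: "'o \<Rightarrow> 'o \<times> 'o \<times> int \<times> 'm" where "gi X = (X, X, 0, idn C X)"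

definition ga :: "'o \<times> 'o \<times> int \<times> 'm \<Rightarrow> 'o \<times> 'o \<times> int \<times> 'm \<Rightarrow> 'o \<times> 'o \<times> int \<times> 'm" where
  "ga F G = (case F of (X, Y, k, f) \<Rightarrow> (X, Y, k, add C f (snd (snd (snd G)))))"

definition gs :: "'k \<Rightarrow> 'o \<times> 'o \<times> int \<times> 'm \<Rightarrow> 'o \<times> 'o \<times> int \<times> 'm" where
  "gs a F = (case F of (X, Y, k, f) \<Rightarrow> (X, Y, k, smul C a f))"

definition gz :: "int \<Rightarrow> 'o \<Rightarrow> 'o \<Rightarrow> 'o \<times> 'o \<times> int \<times> 'm" where
  "gz k X Y = (X, Y, k, zer C (shpow C k X) Y)"

definition ST :: "nat \<Rightarrow> 'o \<times> 'o \<times> int \<times> 'm \<Rightarrow> 'm" where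
  "ST n F = (case F of (X, _, k, f) \<Rightarrow> stab n k X f)"

lemma GH_iff: "(X', Y', k', f) \<in> GH k X Y \<longleftrightarrow> X' = X \<and> Y' = Y \<and> k' = k \<and> X \<in> obj C \<and> Y \<in> obj C \<and> f \<in> HOM C k X Y"
  by (auto simp: GH_def)

lemma ST_hom: "F \<in> GH k X Y \<Longrightarrow> 0 \<le> int n + k \<Longrightarrow> ST n F \<in> hom C (\<Q>o (nat (int n + k)) X) (\<Q>o n Y)"
  by (auto simp: GH_def ST_def intro: stab_hom)

lemma ST_inj: "F \<in> GH k X Y \<Longrightarrow> G \<in> GH k X Y \<Longrightarrow> ST n F = ST n G \<Longrightarrow> F = G"
  by (auto simp: GH_def ST_def dest: stab_inj)

lemma ST_surj:
  assumes "X \<in> obj C" "Y \<in> obj C" "0 \<le> int n + k" "g \<in> hom C (\<Q>o (nat (int n + k)) X) (\<Q>o n Y)"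
  obtains F where "F \<in> GH k X Y" "ST n F = g"
proof -
  obtain f where "f \<in> HOM C k X Y" "stab n k X f = g" using stab_surj[OF assms] by blast
  then show ?thesis using that[of "(X, Y, k, f)"] assms by (simp add: GH_def ST_def)
qed

lemma ST_nonneg: "0 \<le> k \<Longrightarrow> ST n (X, Y, k, f) = \<Q>a n f"
  by (simp add: ST_def stab_nonneg)

lemma gc_GH: "F \<in> GH k X Y \<Longrightarrow> G \<in> GH l Y Z \<Longrightarrow> gc G F \<in> GH (k + l) X Z"
  by (auto simp: GH_def gc_def intro: gcomp_stab)

lemma ST_gc:
  assumes "F \<in> GH k X Y" "G \<in> GH l Y Z" "0 \<le> int n + l" "0 \<le> int n + l + k"
  shows "ST n (gc G F) = ST n G \<cdot> ST (nat (int n + l)) F"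
  using assms gcomp_stab(2) by (auto simp: GH_def ST_def gc_def)

lemma ST_ga: "F \<in> GH k X Y \<Longrightarrow> G \<in> GH k X Y \<Longrightarrow> ST n (ga F G) = add C (ST n F) (ST n G)"
  by (auto simp: GH_def ST_def ga_def stab_addition)

lemma ST_gs: "F \<in> GH k X Y \<Longrightarrow> ST n (gs a F) = smul C a (ST n F)"
  by (auto simp: GH_def ST_def gs_def stab_smul)

lemma ga_GH: "F \<in> GH k X Y \<Longrightarrow> G \<in> GH k X Y \<Longrightarrow> ga F G \<in> GH k X Y"
  using add_hom by (auto simp: GH_def ga_def HOM_def)

lemma gs_GH: "F \<in> GH k X Y \<Longrightarrow> gs a F \<in> GH k X Y"
  using smul_hom by (auto simp: GH_def gs_def HOM_def)

lemma gi_GH: "X \<in> obj C \<Longrightarrow> gi X \<in> GH 0 X X"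
  by (simp add: GH_def gi_def HOM_def shpow_def idn_hom)

lemma gz_GH: "X \<in> obj C \<Longrightarrow> Y \<in> obj C \<Longrightarrow> gz k X Y \<in> GH k X Y"
  by (simp add: GH_def gz_def HOM_def zer_hom shpow_obj)

lemma ST_gi: "X \<in> obj C \<Longrightarrow> ST n (gi X) = idn C (\<Q>o n X)"
  by (simp add: gi_def ST_nonneg Q_idn)

lemma GH_vector_space:
  assumes "X \<in> obj C" "Y \<in> obj C" shows "partial_vector_space (GH k X Y) ga gs (gz k X Y)"
proof -
  interpret partial_vector_space "HOM C k X Y" "add C" "smul C" "zer C (shpow C k X) Y"
    by (rule HOM_vector_space[OF assms])
  show ?thesis
    by unfold_locales (auto simp: GH_def ga_def gs_def gz_def assms pl_assoc sc_pl pl_sc sc_sc intro: pl_comm)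
qed

lemma ST_gz: 
  assumes "X \<in> obj C" "Y \<in> obj C" "0 \<le> int n + k" 
  shows "ST n (gz k X Y) = zer C (\<Q>o (nat (int n + k)) X) (\<Q>o n Y)"
proof -
  interpret partial_vector_space "GH k X Y" ga gs "gz k X Y" by (rule GH_vector_space[OF assms(1,2)])
  have "ST n (gz k X Y) = ST n (gs 0 (gz k X Y))" by simp
  also have "\<dots> = smul C 0 (ST n (gz k X Y))" by (rule ST_gs[OF zero_in])
  also have "\<dots> = zer C (\<Q>o (nat (int n + k)) X) (\<Q>o n Y)" by (rule smul_0[OF ST_hom[OF zero_in assms(3)]])
  finally show ?thesis .
qed

text \<open>Each law is checked on \<open>ST n\<close>, with \<open>n\<close> the sum of the
  negative parts of the degrees involved, so that every intermediate exponent is nonnegative. There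
  it is a law of ordinary composition, and \<open>ST_inj\<close> brings it back.\<close>

sublocale graded_linear "obj C" GH gc gi ga gs gz
proof (rule graded_linear.intro)
  fix X Y k assume "X \<in> obj C" "Y \<in> obj C" then show "partial_vector_space (GH k X Y) ga gs (gz k X Y)"
    by (rule GH_vector_space)
next
  fix F k X Y assume F: "F \<in> GH k X Y"
  then show XY: "X \<in> obj C \<and> Y \<in> obj C" by (auto simp: GH_def)
  define n where "n = nat (- k)"
  have n: "0 \<le> int n + k" "0 \<le> int n + k + 0" "0 \<le> int n + 0" "0 \<le> int n + 0 + k"
    "nat (int n + 0) = n" by (auto simp: n_def)
  have n2: "0 \<le> int (nat (int n + k)) + 0" by simp
  note i = gi_GH[of X] gi_GH[of Y]
  have "gc F (gi X) \<in> GH k X Y" using gc_GH[OF gi_GH F] XY by simp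
  moreover have "ST n (gc F (gi X)) = ST n F"
    using ST_gc[OF gi_GH F n(1,2)] XY ST_gi cmp_idn[OF ST_hom[OF F n(1)]] by simp
  ultimately show "gc F (gi X) = F" using ST_inj F by blast
  have "gc (gi Y) F \<in> GH k X Y" using gc_GH[OF F gi_GH] XY by simp
  moreover have "ST n (gc (gi Y) F) = ST n F"
    using ST_gc[OF F gi_GH n(3,4)] XY ST_gi idn_cmp[OF ST_hom[OF F n(1)]] by simp
  ultimately show "gc (gi Y) F = F" using ST_inj F by blast
next
  fix F k W X G l Y H m Z assume F: "F \<in> GH k W X" and G: "G \<in> GH l X Y" and H: "H \<in> GH m Y Z"
  define n where "n = nat (- k) + nat (- l) + nat (- m)"
  have n: "0 \<le> int n + m" "0 \<le> int n + m + (k + l)" "0 \<le> int (nat (int n + m)) + l" "0 \<le> int (nat (int n + m)) + l + k"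
     "0 \<le> int n + (l + m)" "0 \<le> int n + (l + m) + k" "0 \<le> int n + m + l" by (auto simp: n_def)
  have e: "nat (int (nat (int n + m)) + l) = nat (int n + (l + m))" using n by simp
  have n3: "0 \<le> int (nat (int n + (l + m))) + k" using n by simp
  have "gc H (gc G F) \<in> GH (k + l + m) W Z" "gc (gc H G) F \<in> GH (k + l + m) W Z"
    using gc_GH[OF gc_GH[OF F G] H] gc_GH[OF F gc_GH[OF G H]] by (simp_all add: add.assoc)
  moreover have "ST n (gc H (gc G F)) = ST n (gc (gc H G) F)"
    using ST_gc[OF gc_GH[OF F G] H n(1,2)] ST_gc[OF F G n(3,4)] ST_gc[OF F gc_GH[OF G H] n(5,6)] ST_gc[OF G H n(1,7)]
      cmp_assoc[OF ST_hom[OF F n3] ST_hom[OF G n(3), unfolded e] ST_hom[OF H n(1)]] e by simp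
  ultimately show "gc H (gc G F) = gc (gc H G) F" using ST_inj by blast
next
  fix F F' G k X Y l Z assume F: "F \<in> GH k X Y" and F': "F' \<in> GH k X Y" and G: "G \<in> GH l Y Z"
  define n where "n = nat (- k) + nat (- l)"
  have n: "0 \<le> int n + l" "0 \<le> int n + l + k" "0 \<le> int (nat (int n + l)) + k" by (auto simp: n_def)
  have "ST n (gc G (ga F F')) = ST n (ga (gc G F) (gc G F'))"
    using ST_gc[OF ga_GH[OF F F'] G n(1,2)] ST_ga[OF F F'] ST_ga[OF gc_GH[OF F G] gc_GH[OF F' G]]
      ST_gc[OF F G n(1,2)] ST_gc[OF F' G n(1,2)] cmp_add_right[OF ST_hom[OF F n(3)] ST_hom[OF F' n(3)] ST_hom[OF G n(1)]]
    by simp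
  then show "gc G (ga F F') = ga (gc G F) (gc G F')"
    using ST_inj gc_GH[OF ga_GH[OF F F'] G] ga_GH[OF gc_GH[OF F G] gc_GH[OF F' G]] by blast
next
  fix F G G' k X Y l Z assume F: "F \<in> GH k X Y" and G: "G \<in> GH l Y Z" and G': "G' \<in> GH l Y Z"
  define n where "n = nat (- k) + nat (- l)"
  have n: "0 \<le> int n + l" "0 \<le> int n + l + k" "0 \<le> int (nat (int n + l)) + k" by (auto simp: n_def)
  have "ST n (gc (ga G G') F) = ST n (ga (gc G F) (gc G' F))"
    using ST_gc[OF F ga_GH[OF G G'] n(1,2)] ST_ga[OF G G'] ST_ga[OF gc_GH[OF F G] gc_GH[OF F G']]
      ST_gc[OF F G n(1,2)] ST_gc[OF F G' n(1,2)] cmp_add_left[OF ST_hom[OF F n(3)] ST_hom[OF G n(1)] ST_hom[OF G' n(1)]]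
    by simp
  then show "gc (ga G G') F = ga (gc G F) (gc G' F)"
    using ST_inj gc_GH[OF F ga_GH[OF G G']] ga_GH[OF gc_GH[OF F G] gc_GH[OF F G']] by blast
next
  fix F G k X Y l Z a assume F: "F \<in> GH k X Y" and G: "G \<in> GH l Y Z"
  define n where "n = nat (- k) + nat (- l)"
  have n: "0 \<le> int n + l" "0 \<le> int n + l + k" "0 \<le> int (nat (int n + l)) + k" by (auto simp: n_def)
  have "ST n (gc G (gs a F)) = ST n (gs a (gc G F))" "ST n (gc (gs a G) F) = ST n (gs a (gc G F))"
    using ST_gc[OF gs_GH[OF F] G n(1,2)] ST_gs[OF F] ST_gs[OF gc_GH[OF F G]] ST_gs[OF G] ST_gc[OF F G n(1,2)]
      ST_gc[OF F gs_GH[OF G] n(1,2)] cmp_smul_right[OF ST_hom[OF F n(3)] ST_hom[OF G n(1)]]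
      cmp_smul_left[OF ST_hom[OF F n(3)] ST_hom[OF G n(1)]]
    by simp_all
  then show "gc G (gs a F) = gs a (gc G F)" "gc (gs a G) F = gs a (gc G F)"
    using ST_inj[OF gc_GH[OF gs_GH[OF F] G] gs_GH[OF gc_GH[OF F G]]]
      ST_inj[OF gc_GH[OF F gs_GH[OF G]] gs_GH[OF gc_GH[OF F G]]] by blast+
qed (auto intro: gc_GH gi_GH)

end

subsection \<open>Levelwise functors and constant pro-objects\<close>

lemma pidx_pro_apply [simp]: "pidx (pro_apply Fo Fa X) = pidx X" "pob (pro_apply Fo Fa X) i = Fo (pob X i)"
  "par (pro_apply Fo Fa X) u = Fa (par X u)"
  by (simp_all add: pro_apply_def)

lemma con_simps [simp]: "pidx (con C c) = point_cat" "pob (con C c) i = c" "par (con C c) u = idn C c"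
  by (simp_all add: con_def)

context pro_linear
begin

lemma pro_apply_obj:
  assumes "is_functor C C Fo Fa" "X \<in> pro_objs C" shows "pro_apply Fo Fa X \<in> pro_objs C"
proof -
  interpret I: category "pidx X" using pro_objD assms by blast
  have "is_functor (pidx X) C (pob (pro_apply Fo Fa X)) (par (pro_apply Fo Fa X))"
    unfolding is_functor_def
  proof (intro conjI ballI allI)
    fix i assume i: "i \<in> obj (pidx X)"
    show "pob (pro_apply Fo Fa X) i \<in> obj C" using functor_obj[OF assms(1)] assms(2) i by simp
    show "par (pro_apply Fo Fa X) (idn (pidx X) i) = idn C (pob (pro_apply Fo Fa X) i)"
      using functor_idn[OF assms(1)] par_idn[OF assms(2) i] assms(2) i by simp
  next
    fix i j u assume "u \<in> hom (pidx X) i j"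
    then show "par (pro_apply Fo Fa X) u \<in> hom C (pob (pro_apply Fo Fa X) i) (pob (pro_apply Fo Fa X) j)"
      using functor_hom[OF assms(1)] par_hom[OF assms(2)] by simp
  next
    fix i j k u v assume u: "u \<in> hom (pidx X) i j" and v: "v \<in> hom (pidx X) j k"
    show "par (pro_apply Fo Fa X) (v \<cdot>\<^bsub>pidx X\<^esub> u) = par (pro_apply Fo Fa X) v \<cdot> par (pro_apply Fo Fa X) u"
      using functor_cmp[OF assms(1) par_hom[OF assms(2) u] par_hom[OF assms(2) v]] par_cmp[OF assms(2) u v] by simp
  qed
  then show ?thesis using pro_objD[OF assms(2)] by (simp add: pro_objs_def)
qed

lemma germ_functor:
  assumes "is_functor C C Fo Fa" "X \<in> pro_objs C" "(i', f') \<in> germ C X c i f" "f \<in> hom C (pob X i) c"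
  shows "(i', Fa f') \<in> germ C (pro_apply Fo Fa X) (Fo c) i (Fa f)"
proof -
  obtain k u v where k: "u \<in> hom (pidx X) k i" "v \<in> hom (pidx X) k i'" "f \<cdot> par X u = f' \<cdot> par X v"
    "i' \<in> obj (pidx X)" "f' \<in> hom C (pob X i') c" using assms(3) unfolding germ_iff by blast
  have "Fa f \<cdot> Fa (par X u) = Fa f' \<cdot> Fa (par X v)"
    using functor_cmp[OF assms(1) par_hom[OF assms(2) k(1)] assms(4)]
      functor_cmp[OF assms(1) par_hom[OF assms(2) k(2)] k(5)] k(3) by simp
  then show ?thesis unfolding germ_iff using k functor_hom[OF assms(1) k(5)] by auto
qed

lemma pro_applya_hom:
  assumes Fun: "is_functor C C Fo Fa" and F: "F \<in> hom P X Y"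
  shows "pro_applya C Fo Fa F \<in> hom P (pro_apply Fo Fa X) (pro_apply Fo Fa Y)"
    "(i, f) \<in> pgerm F j \<Longrightarrow> (i, Fa f) \<in> pgerm (pro_applya C Fo Fa F) j"
proof -
  have X: "X \<in> pro_objs C" and Y: "Y \<in> pro_objs C" using homP_obj F by auto
  note X' = pro_apply_obj[OF Fun X] and Y' = pro_apply_obj[OF Fun Y]
  interpret J: category "pidx Y" using pro_objD Y by blast
  let ?S = "\<lambda>j. {(i, Fa f) | i f. (i, f) \<in> pgerm F j}"
  let ?X = "pro_apply Fo Fa X" and ?Y = "pro_apply Fo Fa Y"
  have eq: "pro_applya C Fo Fa F = pro_map C ?X ?Y ?S" using F by (simp add: pro_applya_def homP_iff hom_def)
  have 1: "?S l \<noteq> {}" if "l \<in> obj (pidx ?Y)" for l using rep_ex[OF F, of l] that by auto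
  have 2: "i \<in> obj (pidx ?X) \<and> f \<in> hom C (pob ?X i) (pob ?Y l)" if p: "(i, f) \<in> ?S l" for i f l
  proof -
    obtain f1 where p: "f = Fa f1" "(i, f1) \<in> pgerm F l" using p by blast
    show ?thesis using rep_hom[OF F p(2)] p(1) functor_hom[OF Fun] by simp
  qed
  have 3: "(i', f') \<in> germ C ?X (pob ?Y l) i f" if p: "(i, f) \<in> ?S l" and b: "(i', f') \<in> ?S l" for i f l i' f'
  proof -
    obtain f1 where p: "f = Fa f1" "(i, f1) \<in> pgerm F l" using p by blast
    obtain f2 where b: "f' = Fa f2" "(i', f2) \<in> pgerm F l" using b by blast
    show ?thesis using germ_functor[OF Fun X _ rep_hom(3)[OF F p(2)]] b p rep_germ[OF F p(2)] by simp
  qed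
  have 4: "\<exists>i f i' f'. (i, f) \<in> ?S l \<and> (i', f') \<in> ?S l' \<and> (i, par ?Y v \<cdot> f) \<in> germ C ?X (pob ?Y l') i' f'"
    if v: "v \<in> hom (pidx ?Y) l l'" for l l' v
  proof -
    have v: "v \<in> hom (pidx Y) l l'" using v by simp
    note l = J.homD(4,5)[OF v]
    obtain i f where f: "(i, f) \<in> pgerm F l" using rep_ex[OF F l(1)] by blast
    note ff = rep_hom[OF F f]
    have e: "par ?Y v \<cdot> Fa f = Fa (par Y v \<cdot> f)" using functor_cmp[OF Fun ff(3) par_hom[OF Y v]] by simp
    have b: "(i, Fa (par Y v \<cdot> f)) \<in> ?S l'" using rep_tgt[OF F f v] by blast
    have "(i, par ?Y v \<cdot> Fa f) \<in> germ C ?X (pob ?Y l') i (Fa (par Y v \<cdot> f))"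
      unfolding e using germ_refl[OF X'] 2[OF b] by blast
    moreover have "(i, Fa f) \<in> ?S l" using f by blast
    ultimately show ?thesis using b by (intro exI conjI)
  qed
  note * = pro_map_hom[OF X' Y', of ?S, OF 1 2 3 4]
  show "pro_applya C Fo Fa F \<in> hom P ?X ?Y" unfolding eq using * by blast
  show "(i, f) \<in> pgerm F j \<Longrightarrow> (i, Fa f) \<in> pgerm (pro_applya C Fo Fa F) j"
    unfolding eq using *(2)[of j i "Fa f"] rep_hom(1)[OF F] by auto
qed

section \<open>Morphisms to and between constant pro-objects\<close>

lemma con_obj [simp]:
  assumes "c \<in> obj C" shows "con C c \<in> pro_objs C"
proof -
  have "is_functor point_cat C (\<lambda>_. c) (\<lambda>_. idn C c)"
    unfolding is_functor_def
    by (intro conjI ballI allI) (simp_all add: assms idn_hom split: if_splits)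
  then show ?thesis by (simp add: pro_objs_def category_point cofiltered_point con_def)
qed

lemma pro_apply_con:
  assumes "is_functor C C Fo Fa" "c \<in> obj C" shows "pro_apply Fo Fa (con C c) = con C (Fo c)"
  using functor_idn[OF assms] by (simp add: pro_apply_def con_def comp_def)

lemma germ_con:
  assumes "c \<in> obj C" "f \<in> hom C c d" 
  shows "germ C (con C c) d (IxNat 0) f = {(IxNat 0, f)}"
  using assms cmp_idn by (auto simp: germ_iff split: if_splits)

lemma conaP:
  assumes "f \<in> hom C A B"
  shows "cona C f \<in> hom P (con C A) (con C B)"
    "(IxNat 0, f) \<in> pgerm (cona C f :: ('o, 'm, 'a) pro_ar) (IxNat 0)"
proof -
  note d = homD[OF assms]
  have e: "(cona C f :: ('o, 'm, 'a) pro_ar) = pro_map C (con C A) (con C B) (\<lambda>_. {(IxNat 0, f)})" using d by (simp add: cona_def)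
  have *: "(IxNat 0, par (con C B) v \<cdot> f) \<in> germ C (con C A :: ('o, 'm, 'a) pro_ob) (pob (con C B) j') (IxNat 0) f" for v j'
    by (simp add: germ_con[OF d(4) assms] idn_cmp[OF assms])
  show "cona C f \<in> hom P (con C A) (con C B)"
    "(IxNat 0, f) \<in> pgerm (cona C f :: ('o, 'm, 'a) pro_ar) (IxNat 0)"
    using pro_map_single[OF con_obj[OF d(4)] con_obj[OF d(5)], of "\<lambda>_. IxNat 0" "\<lambda>_. f", OF _ *] assms
    unfolding e by auto
qed

lemma con_eqI:
  assumes "F \<in> hom P X (con C B)" "G \<in> hom P X (con C B)" "(i, f) \<in> pgerm F (IxNat 0)" "(i, f) \<in> pgerm G (IxNat 0)"
  shows "F = G"
  using assms by (intro pro_eqI[OF assms(1,2)]) auto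

lemma cona_idn: "c \<in> obj C \<Longrightarrow> cona C (idn C c) = idn P (con C c)"
  using con_eqI[OF conaP(1)[OF idn_hom] idnP(1) conaP(2)[OF idn_hom]] idnP(2)[of "con C c" "IxNat 0"] by simp

lemma cona_cmp:
  assumes "f \<in> hom C X Y" "g \<in> hom C Y Z" shows "cona C (g \<cdot> f) = cona C g \<cdot>\<^bsub>P\<^esub> cona C f"
  using con_eqI[OF conaP(1)[OF cmp_hom[OF assms]] cmpP(1)[OF conaP(1)[OF assms(1)] conaP(1)[OF assms(2)]]
    conaP(2)[OF cmp_hom[OF assms]] cmpP(2)[OF conaP(1)[OF assms(1)] conaP(1)[OF assms(2)] conaP(2)[OF assms(2)] conaP(2)[OF assms(1)]]] .

lemma cona_zer: "X \<in> obj C \<Longrightarrow> Y \<in> obj C \<Longrightarrow> cona C (zer C X Y) = zer P (con C X) (con C Y)"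
  using con_eqI[OF conaP(1)[OF zer_hom] zerP(1) conaP(2)[OF zer_hom]] zerP(2)[of "con C X" "con C Y" "IxNat 0" "IxNat 0"] by simp

lemma cona_smul: "f \<in> hom C X Y \<Longrightarrow> cona C (smul C a f) = smul P a (cona C f)"
  using con_eqI[OF conaP(1)[OF smul_hom] smulP(1)[OF conaP(1)] conaP(2)[OF smul_hom] smulP(2)[OF conaP(1) conaP(2)]] by blast

lemma cona_full:
  assumes "c \<in> obj C" "F \<in> hom P (con C c) (con C d)"
  obtains f where "f \<in> hom C c d" "F = cona C f"
proof -
  obtain i f where f: "(i, f) \<in> pgerm F (IxNat 0)" using rep_ex[OF assms(2), of "IxNat 0"] by auto
  note h = rep_hom[OF assms(2) f]
  have i: "i = IxNat 0" and ff: "f \<in> hom C c d" using h by auto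
  have "F = cona C f" using con_eqI[OF assms(2) conaP(1)[OF ff] f[unfolded i] conaP(2)[OF ff]] .
  then show ?thesis using that ff by blast
qed

lemma cona_faithful:
  assumes "f \<in> hom C c d" "g \<in> hom C c d" "(cona C f :: ('o, 'm, 'a) pro_ar) = cona C g" shows "f = g"
proof -
  have "(IxNat 0, g) \<in> pgerm (cona C f :: ('o, 'm, 'a) pro_ar) (IxNat 0)" using conaP(2)[OF assms(2)] assms(3) by simp
  then have "(IxNat 0, g) \<in> germ C (con C c :: ('o, 'm, 'a) pro_ob) d (IxNat 0) f"
    using rep_germ[OF conaP(1)[OF assms(1)] conaP(2)[OF assms(1)]] by simp
  then show ?thesis by (simp add: germ_con[OF homD(4)[OF assms(1)] assms(1)])
qed

lemma cona_eq_zero: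
  assumes "f \<in> hom C X Y" "cona C f = zer P (con C X) (con C Y)" shows "f = zer C X Y"
  using cona_faithful[OF assms(1) zer_hom] cona_zer homD(4,5)[OF assms(1)] assms(2) by metis

lemma projP:
  assumes "X \<in> pro_objs C" "i \<in> obj (pidx X)"
  shows "pro_proj C X i \<in> hom P X (con C (pob X i))" "(i, idn C (pob X i)) \<in> pgerm (pro_proj C X i) (IxNat 0)"
proof -
  have o: "pob X i \<in> obj C" using assms by simp
  have "(i, idn C (pob X i) \<cdot> idn C (pob X i)) \<in> germ C X (pob X i) i (idn C (pob X i))"
    using germ_refl[OF assms idn_hom[OF o]] o by simp
  then show "pro_proj C X i \<in> hom P X (con C (pob X i))" "(i, idn C (pob X i)) \<in> pgerm (pro_proj C X i) (IxNat 0)"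
    using pro_map_single[OF assms(1) con_obj[OF o], of "\<lambda>_. i" "\<lambda>_. idn C (pob X i)"] assms(2) o idn_hom[OF o]
    unfolding pro_proj_def by (auto split: if_splits)
qed

text \<open>A morphism into a constant pro-object is an element of the filtered colimit of the
  \<open>Hom (X i) c\<close>; a representative at \<open>i\<close> amounts to a factorization
  through the projection to \<open>X i\<close>.\<close>

lemma rep_factor:
  assumes "F \<in> hom P X (con C c)" "(i, f) \<in> pgerm F (IxNat 0)"
  shows "F = cona C f \<cdot>\<^bsub>P\<^esub> pro_proj C X i"
proof -
  have X: "X \<in> pro_objs C" using homP_obj assms by blast
  have i: "i \<in> obj (pidx X)" and f: "f \<in> hom C (pob X i) c" using rep_hom[OF assms] by auto
  note pr = projP[OF X i]
  have "(i, f) \<in> pgerm (cona C f \<cdot>\<^bsub>P\<^esub> pro_proj C X i) (IxNat 0)"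
    using cmpP(2)[OF pr(1) conaP[OF f] pr(2)] cmp_idn[OF f] by simp
  then show ?thesis using con_eqI[OF assms(1) cmpP(1)[OF pr(1) conaP(1)[OF f]] assms(2)] by simp
qed

lemma con_factor:
  assumes "F \<in> hom P X (con C c)"
  obtains i f where "i \<in> obj (pidx X)" "f \<in> hom C (pob X i) c" "F = cona C f \<cdot>\<^bsub>P\<^esub> pro_proj C X i"
    "(i, f) \<in> pgerm F (IxNat 0)"
proof -
  obtain i f where f: "(i, f) \<in> pgerm F (IxNat 0)" using rep_ex[OF assms, of "IxNat 0"] by auto
  then show ?thesis using that rep_hom[OF assms f] rep_factor[OF assms f] by simp
qed

lemma rep_con_cmp:
  assumes "F \<in> hom P X (con C c)" "(i, f) \<in> pgerm F (IxNat 0)" "g \<in> hom C c d"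
  shows "(i, g \<cdot> f) \<in> pgerm (cona C g \<cdot>\<^bsub>P\<^esub> F) (IxNat 0)"
  using cmpP(2)[OF assms(1) conaP[OF assms(3)] assms(2)] .

text \<open>Vanishing in a filtered colimit is reached at some index \<open>k\<close> over
  \<open>i\<close>. This converts equations in \<open>Pro C\<close> into equations in
  \<open>C\<close>.\<close>

lemma rep_zero:
  assumes "F \<in> hom P X (con C c)" "(i, f) \<in> pgerm F (IxNat 0)" "F = zer P X (con C c)"
  obtains k u where "u \<in> hom (pidx X) k i" "f \<cdot> par X u = zer C (pob X k) c"
proof -
  have X: "X \<in> pro_objs C" and c: "(con C c :: ('o, 'm, 'a) pro_ob) \<in> pro_objs C" using homP_obj[OF assms(1)] by auto
  note h = rep_hom[OF assms(1,2)]
  have "(i, zer C (pob X i) c) \<in> pgerm F (IxNat 0)" using zerP(2)[OF X c h(2), of "IxNat 0"] assms(3) by simp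
  then obtain k u where k: "u \<in> hom (pidx X) k i" "f \<cdot> par X u = zer C (pob X i) c \<cdot> par X u"
    using pro_eqD[OF assms(1,2)] by blast
  moreover have "c \<in> obj C" using homD(5)[OF h(3)] by simp
  ultimately show ?thesis using that[OF k(1)] zer_cmp[OF par_hom[OF X k(1)], of c] by simp
qed

lemma rep_zeroI:
  assumes "F \<in> hom P X (con C c)" "(i, zer C (pob X i) c) \<in> pgerm F (IxNat 0)"
  shows "F = zer P X (con C c)"
proof -
  have X: "X \<in> pro_objs C" and c: "(con C c :: ('o, 'm, 'a) pro_ob) \<in> pro_objs C" using homP_obj[OF assms(1)] by auto
  show ?thesis
    using con_eqI[OF assms(1) zerP(1)[OF X c] assms(2)] zerP(2)[OF X c rep_hom(2)[OF assms], of "IxNat 0"] by simp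
qed

lemma proj_natural:
  assumes "X \<in> pro_objs C" "u \<in> hom (pidx X) i j"
  shows "cona C (par X u) \<cdot>\<^bsub>P\<^esub> pro_proj C X i = pro_proj C X j"
proof -
  interpret I: category "pidx X" using pro_objD assms by blast
  note ij = I.homD(4,5)[OF assms(2)]
  note pu = par_hom[OF assms]
  have "(i, idn C (pob X j) \<cdot> par X u) \<in> pgerm (pro_proj C X j) (IxNat 0)"
    using rep_src[OF projP[OF assms(1) ij(2)] assms(2)] .
  then show ?thesis
    using rep_factor[OF projP(1)[OF assms(1) ij(2)]] idn_cmp[OF pu] by simp
qed

lemma rep_proj:
  assumes "F \<in> hom P X Y" "(i, f) \<in> pgerm F j"
  shows "(i, f) \<in> pgerm (pro_proj C Y j \<cdot>\<^bsub>P\<^esub> F) (IxNat 0)"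
proof -
  have Y: "Y \<in> pro_objs C" using homP_obj assms by auto
  note h = rep_hom[OF assms]
  show ?thesis using cmpP(2)[OF assms(1) projP[OF Y h(1)] assms(2)] idn_cmp[OF h(3)] by simp
qed

lemma proj_eqI:
  assumes "F \<in> hom P X Y" "G \<in> hom P X Y"
    "\<And>j. j \<in> obj (pidx Y) \<Longrightarrow> pro_proj C Y j \<cdot>\<^bsub>P\<^esub> F = pro_proj C Y j \<cdot>\<^bsub>P\<^esub> G"
  shows "F = G"
proof (rule pro_eqI[OF assms(1,2)])
  fix j assume j: "j \<in> obj (pidx Y)"
  have Y: "Y \<in> pro_objs C" using homP_obj assms by auto
  obtain i f g where r: "(i, f) \<in> pgerm F j" "(i, g) \<in> pgerm G j" using rep_common[OF assms(1,2) j j] .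
  note pF = cmpP(1)[OF assms(1) projP(1)[OF Y j]]
  have g: "(i, g) \<in> pgerm (pro_proj C Y j \<cdot>\<^bsub>P\<^esub> F) (IxNat 0)"
    using rep_proj[OF assms(2) r(2)] assms(3)[OF j] by simp
  obtain k u where k: "u \<in> hom (pidx X) k i" "f \<cdot> par X u = g \<cdot> par X u"
    by (rule pro_eqD[OF pF rep_proj[OF assms(1) r(1)] g refl])
  have "(k, f \<cdot> par X u) \<in> pgerm F j" "(k, f \<cdot> par X u) \<in> pgerm G j"
    using rep_src[OF assms(1) r(1) k(1)] rep_src[OF assms(2) r(2) k(1)] k(2) by auto
  then show "\<exists>i f. (i, f) \<in> pgerm F j \<and> (i, f) \<in> pgerm G j" by blast
qed

text \<open>A pro-object is the limit of its constant terms: the germs of a cone are the germs of a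
  morphism. Uniqueness is \<open>proj_eqI\<close>.\<close>

lemma pro_lift:
  assumes X: "X \<in> pro_objs C" and Y: "Y \<in> pro_objs C"
    and \<phi>: "\<And>j. j \<in> obj (pidx Y) \<Longrightarrow> \<phi> j \<in> hom P X (con C (pob Y j))"
    and nat: "\<And>j j' v. v \<in> hom (pidx Y) j j' \<Longrightarrow> cona C (par Y v) \<cdot>\<^bsub>P\<^esub> \<phi> j = \<phi> j'"
  obtains F where "F \<in> hom P X Y" "\<And>j. j \<in> obj (pidx Y) \<Longrightarrow> pro_proj C Y j \<cdot>\<^bsub>P\<^esub> F = \<phi> j"
proof -
  interpret J: category "pidx Y" using pro_objD Y by blast
  let ?S = "\<lambda>j. pgerm (\<phi> j) (IxNat 0)"
  have 1: "?S j \<noteq> {}" if "j \<in> obj (pidx Y)" for j using rep_ex[OF \<phi>[OF that], of "IxNat 0"] by auto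
  have 2: "i \<in> obj (pidx X) \<and> f \<in> hom C (pob X i) (pob Y j)" if "j \<in> obj (pidx Y)" "(i, f) \<in> ?S j" for i f j
    using rep_hom[OF \<phi>[OF that(1)] that(2)] by simp
  have 3: "(i', f') \<in> germ C X (pob Y j) i f" if "j \<in> obj (pidx Y)" "(i, f) \<in> ?S j" "(i', f') \<in> ?S j" for i f j i' f'
    using rep_germ[OF \<phi>[OF that(1)] that(2)] that(3) by simp
  have 4: "\<exists>i f i' f'. (i, f) \<in> ?S l \<and> (i', f') \<in> ?S l' \<and> (i, par Y v \<cdot> f) \<in> germ C X (pob Y l') i' f'"
    if v: "v \<in> hom (pidx Y) l l'" for l l' v
  proof -
    note l = J.homD(4,5)[OF v]
    obtain i f where f: "(i, f) \<in> ?S l" using rep_ex[OF \<phi>[OF l(1)], of "IxNat 0"] by auto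
    have g: "(i, par Y v \<cdot> f) \<in> ?S l'" using rep_con_cmp[OF \<phi>[OF l(1)] f par_hom[OF Y v]] nat[OF v] by simp
    have "(i, par Y v \<cdot> f) \<in> germ C X (pob Y l') i (par Y v \<cdot> f)" using germ_refl[OF X] 2[OF l(2) g] by blast
    then show ?thesis using f g by (intro exI conjI)
  qed
  note * = pro_map_hom[OF X Y, of ?S, OF 1 2 3 4]
  have F: "pro_map C X Y ?S \<in> hom P X Y" using * by blast
  have "pro_proj C Y j \<cdot>\<^bsub>P\<^esub> pro_map C X Y ?S = \<phi> j" if j: "j \<in> obj (pidx Y)" for j
  proof -
    obtain i f where f: "(i, f) \<in> ?S j" using rep_ex[OF \<phi>[OF j], of "IxNat 0"] by auto
    then have "(i, f) \<in> pgerm (pro_map C X Y ?S) j" using * j by blast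
    then show ?thesis
      using con_eqI[OF cmpP(1)[OF F projP(1)[OF Y j]] \<phi>[OF j] rep_proj[OF F] f] by blast
  qed
  then show ?thesis using that F by blast
qed

text \<open>Filtered colimits preserve kernels: a representative killed by \<open>p\<close> in the
  colimit is killed after restriction to some index, and there it factors through \<open>i\<close>.
  The test object \<open>W\<close> is an arbitrary pro-object.\<close>

lemma con_kernel:
  assumes "is_kernel C p i" "p \<in> hom C B D" "i \<in> hom C A B" "F \<in> hom P W (con C B)"
    "cona C p \<cdot>\<^bsub>P\<^esub> F = zer P W (con C D)"
  shows "\<exists>G\<in>hom P W (con C A). cona C i \<cdot>\<^bsub>P\<^esub> G = F"
proof -
  have W: "W \<in> pro_objs C" using homP_obj assms(4) by auto
  obtain j f where f: "j \<in> obj (pidx W)" "f \<in> hom C (pob W j) B" "(j, f) \<in> pgerm F (IxNat 0)"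
    using con_factor[OF assms(4)] by metis
  obtain k u where k: "u \<in> hom (pidx W) k j" "(p \<cdot> f) \<cdot> par W u = zer C (pob W k) D"
    using rep_zero[OF cmpP(1)[OF assms(4) conaP(1)[OF assms(2)]] rep_con_cmp[OF assms(4) f(3) assms(2)] assms(5)] .
  note fu = cmp_hom[OF par_hom[OF W k(1)] f(2)]
  have "p \<cdot> (f \<cdot> par W u) = zer C (pob W k) D" using k(2) cmp_assoc[OF par_hom[OF W k(1)] f(2) assms(2)] by simp
  then obtain g where g: "g \<in> hom C (pob W k) A" "i \<cdot> g = f \<cdot> par W u"
    using kernel_factor[OF assms(1,3) fu assms(2)] by blast
  have ku: "(k, f \<cdot> par W u) \<in> pgerm F (IxNat 0)" using rep_src[OF assms(4) f(3) k(1)] .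
  have kk: "k \<in> obj (pidx W)" using rep_hom[OF assms(4) ku] by blast
  have "F = cona C (i \<cdot> g) \<cdot>\<^bsub>P\<^esub> pro_proj C W k" using rep_factor[OF assms(4) ku] g by simp
  also have "\<dots> = cona C i \<cdot>\<^bsub>P\<^esub> (cona C g \<cdot>\<^bsub>P\<^esub> pro_proj C W k)"
    using cona_cmp[OF g(1) assms(3)] P.cmp_assoc[OF projP(1)[OF W kk] conaP(1)[OF g(1)] conaP(1)[OF assms(3)]] by simp
  finally show ?thesis using cmpP(1)[OF projP(1)[OF W kk] conaP(1)[OF g(1)]] by metis
qed

lemma con_mono:
  assumes "mono C i" "i \<in> hom C A B" "F \<in> hom P W (con C A)" "cona C i \<cdot>\<^bsub>P\<^esub> F = zer P W (con C B)"
  shows "F = zer P W (con C A)"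
proof -
  have W: "W \<in> pro_objs C" using homP_obj assms(3) by auto
  obtain j f where f: "j \<in> obj (pidx W)" "f \<in> hom C (pob W j) A" "(j, f) \<in> pgerm F (IxNat 0)"
    using con_factor[OF assms(3)] by metis
  obtain k u where k: "u \<in> hom (pidx W) k j" "(i \<cdot> f) \<cdot> par W u = zer C (pob W k) B"
    using rep_zero[OF cmpP(1)[OF assms(3) conaP(1)[OF assms(2)]] rep_con_cmp[OF assms(3) f(3) assms(2)] assms(4)] .
  have "i \<cdot> (f \<cdot> par W u) = zer C (pob W k) B" using k(2) cmp_assoc[OF par_hom[OF W k(1)] f(2) assms(2)] by simp
  then have "f \<cdot> par W u = zer C (pob W k) A" using mono_zeroD[OF assms(1,2)] cmp_hom[OF par_hom[OF W k(1)] f(2)] by blast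
  then show ?thesis using rep_zeroI[OF assms(3)] rep_src[OF assms(3) f(3) k(1)] by metis
qed

lemma con_epi:
  assumes "epi P (cona C p)" "p \<in> hom C B D" shows "epi C p"
proof (rule epi_zeroI[OF assms(2)])
  fix W h assume h: "h \<in> hom C D W" "h \<cdot> p = zer C B W"
  note d = homD[OF assms(2)] homD[OF h(1)]
  have "cona C h \<cdot>\<^bsub>P\<^esub> cona C p = zer P (con C B) (con C W)"
    using cona_cmp[OF assms(2) h(1)] h(2) cona_zer d by metis
  then have "cona C h = zer P (con C D) (con C W)"
    using P.epi_zeroD[OF assms(1) conaP(1)[OF assms(2)] conaP(1)[OF h(1)]] by blast
  then show "h = zer C D W" using cona_eq_zero h by blast
qed

text \<open>A morphism \<open>h\<close> of \<open>C\<close> killing the representative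
  \<open>b\<close> kills \<open>\<beta>\<close> itself, so it factors through \<open>p\<close> in
  \<open>Pro C\<close>; fullness and faithfulness on constant objects bring the factorization back
  to \<open>C\<close>.\<close>

lemma con_cokernel_rep:
  assumes "\<beta> \<in> hom P W (con C B)" "p \<in> hom C B D" "is_cokernel P \<beta> (cona C p)"
    and r: "(k, b) \<in> pgerm \<beta> (IxNat 0)" and pb: "p \<cdot> b = zer C (pob W k) D"
  shows "is_cokernel C b p"
proof -
  have b: "b \<in> hom C (pob W k) B" using rep_hom[OF assms(1) r] by simp
  show ?thesis
  proof (rule is_cokernelI[OF b assms(2) pb])
    show "epi C p" using con_epi P.cokernel_epi assms by blast
    fix V h assume h: "h \<in> hom C B V" "h \<cdot> b = zer C (pob W k) V"
    have "cona C h \<cdot>\<^bsub>P\<^esub> \<beta> = zer P W (con C V)"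
      using rep_zeroI[OF cmpP(1)[OF assms(1) conaP(1)[OF h(1)]]] rep_con_cmp[OF assms(1) r h(1)] h(2) by metis
    then obtain U where U: "U \<in> hom P (con C D) (con C V)" "U \<cdot>\<^bsub>P\<^esub> cona C p = cona C h"
      using P.cokernel_factor[OF assms(3) conaP(1)[OF assms(2)] conaP(1)[OF h(1)] assms(1)] by blast
    obtain v where v: "v \<in> hom C D V" "U = cona C v" using cona_full[OF homD(5)[OF assms(2)] U(1)] .
    have "v \<cdot> p = h" using cona_faithful[OF cmp_hom[OF assms(2) v(1)] h(1)] cona_cmp[OF assms(2) v(1)] U(2) v(2) by simp
    then show "\<exists>u\<in>hom C D V. u \<cdot> p = h" using v by blast
  qed
qed

text \<open>\<open>p\<close> kills a given representative of \<open>\<beta>\<close> only after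
  restriction to some index, and the restricted representative is the one that works.\<close>

lemma con_cokernel:
  assumes "\<beta> \<in> hom P W (con C B)" "p \<in> hom C B D" "is_cokernel P \<beta> (cona C p)"
  obtains i b where "(i, b) \<in> pgerm \<beta> (IxNat 0)" "i \<in> obj (pidx W)" "b \<in> hom C (pob W i) B" "is_cokernel C b p"
proof -
  have W: "W \<in> pro_objs C" using homP_obj assms(1) by auto
  obtain i f where f: "i \<in> obj (pidx W)" "f \<in> hom C (pob W i) B" "(i, f) \<in> pgerm \<beta> (IxNat 0)"
    using con_factor[OF assms(1)] by metis
  have "cona C p \<cdot>\<^bsub>P\<^esub> \<beta> = zer P W (con C D)"
    using assms(3) P.homD[OF assms(1)] P.homD[OF conaP(1)[OF assms(2)]] unfolding is_cokernel_def by simp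
  then obtain k u where k: "u \<in> hom (pidx W) k i" "(p \<cdot> f) \<cdot> par W u = zer C (pob W k) D"
    using rep_zero[OF cmpP(1)[OF assms(1) conaP(1)[OF assms(2)]] rep_con_cmp[OF assms(1) f(3) assms(2)]] by blast
  let ?b = "f \<cdot> par W u"
  have r: "(k, ?b) \<in> pgerm \<beta> (IxNat 0)" using rep_src[OF assms(1) f(3) k(1)] .
  have kk: "k \<in> obj (pidx W)" and b: "?b \<in> hom C (pob W k) B" using rep_hom[OF assms(1) r] by auto
  have "p \<cdot> ?b = zer C (pob W k) D" using k(2) cmp_assoc[OF par_hom[OF W k(1)] f(2) assms(2)] by simp
  then have "is_cokernel C ?b p" by (rule con_cokernel_rep[OF assms r])
  then show ?thesis using that[OF r kk b] by blast
qed

end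

section \<open>The grading shift on pro-objects\<close>

context graded_monoidal_category
begin

lemma linear_functor_faithful:
  assumes "nat_iso C C id id (Go \<circ> Fo) (Ga \<circ> Fa) t" "f \<in> hom C X Y" "g \<in> hom C X Y" "Fa f = Fa g"
  shows "f = g"
proof -
  have n: "t Y \<cdot> f = Ga (Fa f) \<cdot> t X" "t Y \<cdot> g = Ga (Fa g) \<cdot> t X"
    using assms(1-3) unfolding nat_iso_def by auto
  have "t Y \<in> hom C Y ((Go \<circ> Fo) Y)" "iso C (t Y)"
    using assms(1) homD(5)[OF assms(2)] unfolding nat_iso_def by auto
  then show ?thesis using iso_cancel_left[OF _ _ assms(2,3)] n assms(4) by metis
qed

lemma shift_category_base: "shift_category C"
proof (intro shift_category.intro shift_category_axioms.intro)
  show "linear_category C" by unfold_locales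
  show "linear_functor C C (shf C) (shfa C)" by (rule shf_functor)
  obtain t where t: "nat_iso C C id id (ush C \<circ> shf C) (usha C \<circ> shfa C) t" using ush_shf_nat_iso by blast
  show "f = g" if "f \<in> hom C X Y" "g \<in> hom C X Y" "shfa C f = shfa C g" for f g X Y
    using linear_functor_faithful[OF t that] .
  show "ush C X \<in> obj C" if "X \<in> obj C" for X using functor_obj[OF ush_functor that] .
  show "eta C X \<in> hom C X (shf C (ush C X)) \<and> iso C (eta C X)" if "X \<in> obj C" for X
    using eta_nat_iso that unfolding nat_iso_def by simp
  have shff: "is_functor C C (shf C) (shfa C)" using shf_functor by (simp add: linear_functor_def)
  show "\<exists>f\<in>hom C X Y. shfa C f = g" if X: "X \<in> obj C" "Y \<in> obj C" and g: "g \<in> hom C (shf C X) (shf C Y)" for X Y g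
  proof -
    have tX: "t X \<in> hom C X (ush C (shf C X))" and tY: "t Y \<in> hom C Y (ush C (shf C Y))" "iso C (t Y)"
      using t X unfolding nat_iso_def by auto
    obtain s where s: "s \<in> hom C (ush C (shf C Y)) Y" "s \<cdot> t Y = idn C Y" "t Y \<cdot> s = idn C (ush C (shf C Y))"
      using isoE[OF tY(2,1)] by metis
    note Gg = functor_hom[OF ush_functor g]
    \<comment> \<open>Fullness: \<open>g\<close> is transported by the quasi-inverse and conjugated
      by the isomorphisms \<open>t\<close>. Then \<open>usha C (shfa C ?f)\<close> and
      \<open>usha C g\<close> agree, and \<open>ush\<close> is faithful because of
      \<open>eta\<close>.\<close>
    let ?f = "s \<cdot> (usha C g \<cdot> t X)"
    have f: "?f \<in> hom C X Y" using cmp_hom[OF cmp_hom[OF tX Gg] s(1)] .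
    have "usha C (shfa C ?f) \<cdot> t X = t Y \<cdot> ?f" using t f unfolding nat_iso_def by auto
    also have "\<dots> = (t Y \<cdot> s) \<cdot> (usha C g \<cdot> t X)" using cmp_assoc[OF cmp_hom[OF tX Gg] s(1) tY(1)] .
    also have "\<dots> = usha C g \<cdot> t X" using s(3) idn_cmp[OF cmp_hom[OF tX Gg]] by simp
    finally have "usha C (shfa C ?f) = usha C g"
      using iso_cancel_right[OF _ tX functor_hom[OF ush_functor functor_hom[OF shff f]] Gg] t X
      unfolding nat_iso_def by auto
    then have "shfa C ?f = g" using linear_functor_faithful[OF eta_nat_iso functor_hom[OF shff f] g] by blast
    then show ?thesis using f by blast
  qed
qed

end

locale pro_graded = graded_monoidal_category C + pro_linear C P
  for C :: "('o, 'm, 'k::field, 'x) moncat_scheme" (structure)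
    and P :: "(('o, 'm, 'a) pro_ob, ('o, 'm, 'a) pro_ar, 'k) tscat"
begin

sublocale S: shift_category C by (rule shift_category_base)

lemma etaP: 
  assumes X: "X \<in> obj P"
  shows "eta P X \<in> hom P X (shf P (ush P X)) \<and> iso P (eta P X)"
proof -
  have X: "X \<in> pro_objs C" using X by simp
  let ?Y = "pro_apply (shf C) (shfa C) (pro_apply (ush C) (usha C) X)"
  have Y: "?Y \<in> pro_objs C" using pro_apply_obj[OF S.shf_is_functor pro_apply_obj[OF ush_functor X]] .
  have e: "eta P X = pro_map C X ?Y (\<lambda>j. {(j, eta C (pob X j))})" by (simp add: P Pro_def)
  interpret I: category "pidx X" using pro_objD X by blast
  have en: "shfa C (usha C f) \<cdot> eta C A = eta C B \<cdot> f" if "f \<in> hom C A B" for f A B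
    using eta_nat_iso that unfolding nat_iso_def by auto
  have eh: "eta C (pob X j) \<in> hom C (pob X j) (pob ?Y j)" "iso C (eta C (pob X j))" if "j \<in> obj (pidx X)" for j
    using S.eta_iso X that by auto
  have 1: "(j, par ?Y v \<cdot> eta C (pob X j)) \<in> germ C X (pob ?Y j') j' (eta C (pob X j'))" if v: "v \<in> hom (pidx ?Y) j j'" for j j' v
  proof -
    have v: "v \<in> hom (pidx X) j j'" using v by simp
    show ?thesis using germ_par[OF X v eh(1)[OF I.homD(5)[OF v]]] en[OF par_hom[OF X v]] by simp
  qed
  note * = pro_map_single[OF X Y, of "\<lambda>j. j" "\<lambda>j. eta C (pob X j)", OF _ 1]
  have E: "eta P X \<in> hom P X ?Y" "\<And>j. j \<in> obj (pidx X) \<Longrightarrow> (j, eta C (pob X j)) \<in> pgerm (eta P X) j"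
    unfolding e using * eh by auto
  define i where "i j = (SOME g. g \<in> hom C (pob ?Y j) (pob X j) \<and> g \<cdot> eta C (pob X j) = idn C (pob X j) \<and> eta C (pob X j) \<cdot> g = idn C (pob ?Y j))" for j
  have i: "i j \<in> hom C (pob ?Y j) (pob X j)" "i j \<cdot> eta C (pob X j) = idn C (pob X j)" "eta C (pob X j) \<cdot> i j = idn C (pob ?Y j)"
    if "j \<in> obj (pidx X)" for j
  proof -
    have "\<exists>g. g \<in> hom C (pob ?Y j) (pob X j) \<and> g \<cdot> eta C (pob X j) = idn C (pob X j) \<and> eta C (pob X j) \<cdot> g = idn C (pob ?Y j)"
      using isoE[OF eh(2)[OF that] eh(1)[OF that]] by metis
    then have "i j \<in> hom C (pob ?Y j) (pob X j) \<and> i j \<cdot> eta C (pob X j) = idn C (pob X j) \<and> eta C (pob X j) \<cdot> i j = idn C (pob ?Y j)"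
      unfolding i_def by (rule someI_ex)
    then show "i j \<in> hom C (pob ?Y j) (pob X j)" "i j \<cdot> eta C (pob X j) = idn C (pob X j)" "eta C (pob X j) \<cdot> i j = idn C (pob ?Y j)" by auto
  qed
  \<comment> \<open>The inverses are chosen level by level; they are natural because the
    \<open>eta C (pob X j)\<close> are natural and invertible.\<close>
  have 2: "(j, par X v \<cdot> i j) \<in> germ C ?Y (pob X j') j' (i j')" if v: "v \<in> hom (pidx X) j j'" for j j' v
  proof -
    note jj = I.homD(4,5)[OF v] and pv = par_hom[OF X v] and pyv = par_hom[OF Y, of v j j'] 
    have pyv: "par ?Y v \<in> hom C (pob ?Y j) (pob ?Y j')" using par_hom[OF Y, of v j j'] v by simp
    have "i j' \<cdot> (par ?Y v \<cdot> eta C (pob X j)) = i j' \<cdot> (eta C (pob X j') \<cdot> par X v)" using en[OF pv] by simp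
    also have "\<dots> = par X v" using i[OF jj(2)] cmp_assoc[OF pv eh(1)[OF jj(2)] i(1)[OF jj(2)]] idn_cmp[OF pv] by simp
    finally have "par X v \<cdot> i j = (i j' \<cdot> (par ?Y v \<cdot> eta C (pob X j))) \<cdot> i j" by simp
    also have "\<dots> = i j' \<cdot> ((par ?Y v \<cdot> eta C (pob X j)) \<cdot> i j)"
      using cmp_assoc[OF i(1)[OF jj(1)] cmp_hom[OF eh(1)[OF jj(1)] pyv] i(1)[OF jj(2)]] by simp
    also have "\<dots> = i j' \<cdot> par ?Y v"
      using cmp_assoc[OF i(1)[OF jj(1)] eh(1)[OF jj(1)] pyv] i(3)[OF jj(1)] cmp_idn[OF pyv] by simp
    finally show ?thesis using germ_par[OF Y, of v j j' "i j'"] v i(1)[OF jj(2)] by simp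
  qed
  define G where "G = pro_map C ?Y X (\<lambda>j. {(j, i j)})"
  have G: "G \<in> hom P ?Y X" "\<And>j. j \<in> obj (pidx X) \<Longrightarrow> (j, i j) \<in> pgerm G j"
    using pro_map_single[OF Y X, of "\<lambda>j. j" i, OF _ 2] i unfolding G_def by auto
  have "G \<cdot>\<^bsub>P\<^esub> eta P X = idn P X"
  proof (rule pro_eqI[OF cmpP(1)[OF E(1) G(1)] idnP(1)[OF X]])
    fix j assume j: "j \<in> obj (pidx X)"
    then show "\<exists>i f. (i, f) \<in> pgerm (G \<cdot>\<^bsub>P\<^esub> eta P X) j \<and> (i, f) \<in> pgerm (idn P X) j"
      using cmpP(2)[OF E(1) G(1) G(2)[OF j] E(2)[OF j]] i(2)[OF j] idnP(2)[OF X j] by auto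
  qed
  moreover have "eta P X \<cdot>\<^bsub>P\<^esub> G = idn P ?Y"
  proof (rule pro_eqI[OF cmpP(1)[OF G(1) E(1)] idnP(1)[OF Y]])
    fix j assume j: "j \<in> obj (pidx ?Y)"
    then have j': "j \<in> obj (pidx X)" by simp
    show "\<exists>i f. (i, f) \<in> pgerm (eta P X \<cdot>\<^bsub>P\<^esub> G) j \<and> (i, f) \<in> pgerm (idn P ?Y) j"
      using cmpP(2)[OF G(1) E(1) E(2)[OF j'] G(2)[OF j']] i(3)[OF j'] idnP(2)[OF Y j] by auto
  qed
  ultimately have "iso P (eta P X)" by (intro P.isoI[OF E(1) G(1)])
  then show ?thesis using E(1) by simp
qed

lemma rep_shf:
  assumes "F \<in> hom P X Y"
  shows "shfa P F \<in> hom P (shf P X) (shf P Y)" "(i, f) \<in> pgerm F j \<Longrightarrow> (i, shfa C f) \<in> pgerm (shfa P F) j"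
  using pro_applya_hom[OF S.shf_is_functor assms] by simp_all

lemma shf_linearP: "linear_functor P P (shf P) (shfa P)"
  unfolding linear_functor_def is_functor_def
proof (intro conjI ballI allI)
  fix X assume X: "X \<in> obj P"
  then show s: "shf P X \<in> obj P" using pro_apply_obj[OF S.shf_is_functor] by simp
  have X: "X \<in> pro_objs C" using X by simp
  show "shfa P (idn P X) = idn P (shf P X)"
  proof (rule pro_eqI[OF rep_shf(1)[OF idnP(1)[OF X]] idnP(1)])
    show "shf P X \<in> pro_objs C" using s by simp
    fix j assume "j \<in> obj (pidx (shf P X))"
    then have j: "j \<in> obj (pidx X)" by simp
    then show "\<exists>i f. (i, f) \<in> pgerm (shfa P (idn P X)) j \<and> (i, f) \<in> pgerm (idn P (shf P X)) j"
      using rep_shf(2)[OF idnP(1)[OF X] idnP(2)[OF X j]] idnP(2)[of "shf P X" j] s S.shf_idn X by auto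
  qed
next
  fix F X Y assume F: "F \<in> hom P X Y" then show "shfa P F \<in> hom P (shf P X) (shf P Y)" by (rule rep_shf)
next
  fix F G X Y Z assume F: "F \<in> hom P X Y" and G: "G \<in> hom P Y Z"
  show "shfa P (G \<cdot>\<^bsub>P\<^esub> F) = shfa P G \<cdot>\<^bsub>P\<^esub> shfa P F"
  proof (rule pro_eqI[OF rep_shf(1)[OF cmpP(1)[OF F G]] cmpP(1)[OF rep_shf(1)[OF F] rep_shf(1)[OF G]]])
    fix l assume "l \<in> obj (pidx (shf P Z))"
    then obtain j g where g: "(j, g) \<in> pgerm G l" using rep_ex[OF G, of l] by auto
    obtain i f where f: "(i, f) \<in> pgerm F j" using rep_ex[OF F] rep_hom(2)[OF G g] by blast
    show "\<exists>i f. (i, f) \<in> pgerm (shfa P (G \<cdot>\<^bsub>P\<^esub> F)) l \<and> (i, f) \<in> pgerm (shfa P G \<cdot>\<^bsub>P\<^esub> shfa P F) l"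
      using rep_shf(2)[OF cmpP(1)[OF F G] cmpP(2)[OF F G g f]] S.shf_cmp[OF rep_hom(3)[OF F f] rep_hom(3)[OF G g]]
        cmpP(2)[OF rep_shf(1)[OF F] rep_shf(1)[OF G] rep_shf(2)[OF G g] rep_shf(2)[OF F f]] by auto
  qed
next
  fix F G X Y assume F: "F \<in> hom P X Y" and G: "G \<in> hom P X Y"
  show "shfa P (add P F G) = add P (shfa P F) (shfa P G)"
  proof (rule pro_eqI[OF rep_shf(1)[OF addP(1)[OF F G]] addP(1)[OF rep_shf(1)[OF F] rep_shf(1)[OF G]]])
    fix j assume "j \<in> obj (pidx (shf P Y))"
    then have j: "j \<in> obj (pidx Y)" by simp
    obtain i f g where r: "(i, f) \<in> pgerm F j" "(i, g) \<in> pgerm G j" using rep_common[OF F G j j] .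
    show "\<exists>i f. (i, f) \<in> pgerm (shfa P (add P F G)) j \<and> (i, f) \<in> pgerm (add P (shfa P F) (shfa P G)) j"
      using rep_shf(2)[OF addP(1)[OF F G] addP(2)[OF F G r]] S.shf_add[OF rep_hom(3)[OF F r(1)] rep_hom(3)[OF G r(2)]]
        addP(2)[OF rep_shf(1)[OF F] rep_shf(1)[OF G] rep_shf(2)[OF F r(1)] rep_shf(2)[OF G r(2)]] by auto
  qed
next
  fix F X Y and a :: 'k assume F: "F \<in> hom P X Y"
  show "shfa P (smul P a F) = smul P a (shfa P F)"
  proof (rule pro_eqI[OF rep_shf(1)[OF smulP(1)[OF F]] smulP(1)[OF rep_shf(1)[OF F]]])
    fix j assume "j \<in> obj (pidx (shf P Y))"
    then have j: "j \<in> obj (pidx Y)" by simp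
    obtain i f where r: "(i, f) \<in> pgerm F j" using rep_ex[OF F j] by blast
    show "\<exists>i f. (i, f) \<in> pgerm (shfa P (smul P a F)) j \<and> (i, f) \<in> pgerm (smul P a (shfa P F)) j"
      using rep_shf(2)[OF smulP(1)[OF F] smulP(2)[OF F r, where a = a]] S.shf_smul[OF rep_hom(3)[OF F r]]
        smulP(2)[OF rep_shf(1)[OF F] rep_shf(2)[OF F r], where a = a] by auto
  qed
qed

lemma germ_shf_iff:
  assumes "X \<in> pro_objs C" "i \<in> obj (pidx X)" "i' \<in> obj (pidx X)" "f \<in> hom C (pob X i) c" "f' \<in> hom C (pob X i') c"
    "(i', shfa C f') \<in> germ C (pro_apply (shf C) (shfa C) X) (shf C c) i (shfa C f)"
  shows "(i', f') \<in> germ C X c i f"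
proof -
  obtain k u v where k: "u \<in> hom (pidx X) k i" "v \<in> hom (pidx X) k i'"
    "shfa C f \<cdot> shfa C (par X u) = shfa C f' \<cdot> shfa C (par X v)"
    using assms(6) unfolding germ_iff by auto
  have "shfa C (f \<cdot> par X u) = shfa C (f' \<cdot> par X v)"
    using k(3) S.shf_cmp[OF par_hom[OF assms(1) k(1)] assms(4)] S.shf_cmp[OF par_hom[OF assms(1) k(2)] assms(5)] by simp
  then have "f \<cdot> par X u = f' \<cdot> par X v"
    using S.shf_faithful cmp_hom[OF par_hom[OF assms(1) k(1)] assms(4)] cmp_hom[OF par_hom[OF assms(1) k(2)] assms(5)] by blast
  then show ?thesis unfolding germ_iff using assms k by blast
qed

lemma shf_faithfulP:
  assumes F: "F \<in> hom P X Y" and G: "G \<in> hom P X Y" and e: "shfa P F = shfa P G" shows "F = G"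
proof (rule pro_eqI[OF F G])
  fix j assume j: "j \<in> obj (pidx Y)"
  have X: "X \<in> pro_objs C" using homP_obj[OF F] by blast
  obtain i f g where r: "(i, f) \<in> pgerm F j" "(i, g) \<in> pgerm G j" using rep_common[OF F G j j] .
  note hf = rep_hom[OF F r(1)] and hg = rep_hom[OF G r(2)]
  have "(i, shfa C g) \<in> pgerm (shfa P F) j" using rep_shf(2)[OF G r(2)] e by simp
  then have "(i, shfa C g) \<in> germ C (pro_apply (shf C) (shfa C) X) (shf C (pob Y j)) i (shfa C f)"
    using rep_germ[OF rep_shf(1)[OF F] rep_shf(2)[OF F r(1)]] by simp
  then have "(i, g) \<in> germ C X (pob Y j) i f" using germ_shf_iff[OF X hf(2) hf(2) hf(3) hg(3)] by blast
  then have "(i, g) \<in> pgerm F j" using rep_germ[OF F r(1)] by simp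
  then show "\<exists>i f. (i, f) \<in> pgerm F j \<and> (i, f) \<in> pgerm G j" using r(2) by blast
qed

text \<open>\<open>G\<close> lives over the same index categories as its preimage, and each of its
  representatives is the shift of a morphism of \<open>C\<close>. These morphisms represent the
  preimage; equality of their germs is read off from that of their shifts, as \<open>q\<close> is
  faithful.\<close>

lemma shf_fullP:
  assumes X: "X \<in> obj P" and Y: "Y \<in> obj P" and G: "G \<in> hom P (shf P X) (shf P Y)"
  shows "\<exists>F\<in>hom P X Y. shfa P F = G"
proof -
  have X: "X \<in> pro_objs C" and Y: "Y \<in> pro_objs C" using X Y by simp_all
  interpret J: category "pidx Y" using pro_objD Y by blast
  let ?S = "\<lambda>j. {(i, f). i \<in> obj (pidx X) \<and> f \<in> hom C (pob X i) (pob Y j) \<and> (i, shfa C f) \<in> pgerm G j}"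
  have lift: "\<exists>f. (i, f) \<in> ?S j \<and> shfa C f = g" if "(i, g) \<in> pgerm G j" for i g j
  proof -
    have h: "j \<in> obj (pidx Y)" "i \<in> obj (pidx X)" "g \<in> hom C (shf C (pob X i)) (shf C (pob Y j))"
      using rep_hom[OF G that] by auto
    then show ?thesis using S.shf_full[OF _ _ h(3)] X Y that by auto
  qed
  have ne: "?S j \<noteq> {}" if "j \<in> obj (pidx Y)" for j
    using lift rep_ex[OF G, of j] that by fastforce
  have h: "i \<in> obj (pidx X) \<and> f \<in> hom C (pob X i) (pob Y j)" if "(i, f) \<in> ?S j" for i f j using that by simp
  have eq: "(i', f') \<in> germ C X (pob Y j) i f" if a: "(i, f) \<in> ?S j" "(i', f') \<in> ?S j" for i f i' f' j
  proof -
    have "(i', shfa C f') \<in> germ C (pro_apply (shf C) (shfa C) X) (shf C (pob Y j)) i (shfa C f)"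
      using rep_germ[OF G, of i "shfa C f" j] a by simp
    then show ?thesis using germ_shf_iff[OF X] a by simp
  qed
  have tg: "\<exists>i f i' f'. (i, f) \<in> ?S j \<and> (i', f') \<in> ?S j' \<and> (i, par Y v \<cdot> f) \<in> germ C X (pob Y j') i' f'"
    if v: "v \<in> hom (pidx Y) j j'" for j j' v
  proof -
    obtain i g where "(i, g) \<in> pgerm G j" using rep_ex[OF G, of j] J.homD(4)[OF v] by auto
    then obtain f where f: "(i, f) \<in> ?S j" using lift by blast
    have ff: "i \<in> obj (pidx X)" "f \<in> hom C (pob X i) (pob Y j)" "(i, shfa C f) \<in> pgerm G j" using f by auto
    have m: "par Y v \<cdot> f \<in> hom C (pob X i) (pob Y j')" using cmp_hom[OF ff(2) par_hom[OF Y v]] .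
    have "(i, shfa C (par Y v) \<cdot> shfa C f) \<in> pgerm G j'" using rep_tgt[OF G ff(3), of v j'] v by simp
    then have "(i, par Y v \<cdot> f) \<in> ?S j'" using m ff S.shf_cmp[OF ff(2) par_hom[OF Y v]] by simp
    moreover have "(i, par Y v \<cdot> f) \<in> germ C X (pob Y j') i (par Y v \<cdot> f)" using germ_refl[OF X ff(1) m] .
    ultimately show ?thesis using f by (intro exI conjI)
  qed
  note * = pro_map_hom[OF X Y, of ?S, OF ne h eq tg]
  let ?F = "pro_map C X Y ?S"
  have F: "?F \<in> hom P X Y" using * by blast
  have "shfa P ?F = G"
  proof (rule pro_eqI[OF rep_shf(1)[OF F] G])
    fix j assume "j \<in> obj (pidx (shf P Y))"
    then have j: "j \<in> obj (pidx Y)" by simp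
    obtain i g where g: "(i, g) \<in> pgerm G j" using rep_ex[OF G, of j] j by auto
    then obtain f where f: "(i, f) \<in> ?S j" "shfa C f = g" using lift by blast
    have "(i, f) \<in> pgerm ?F j" using * j f by blast
    then show "\<exists>i f. (i, f) \<in> pgerm (shfa P ?F) j \<and> (i, f) \<in> pgerm G j" using rep_shf(2)[OF F] g f(2) by blast
  qed
  then show ?thesis using F by blast
qed

sublocale P: shift_category P
proof (intro shift_category.intro shift_category_axioms.intro)
  show "linear_category P" by unfold_locales
  show "ush P X \<in> obj P" if "X \<in> obj P" for X using pro_apply_obj[OF ush_functor] that by simp
qed (use shf_linearP shf_fullP shf_faithfulP etaP in blast)+

declare P_simps(5-8) [simp del]

lemma shf_con: "c \<in> obj C \<Longrightarrow> shf P (con C c) = con C (shf C c)"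
  and ush_con1: "c \<in> obj C \<Longrightarrow> ush P (con C c) = con C (ush C c)"
  by (simp_all add: P_simps pro_apply_con[OF S.shf_is_functor] pro_apply_con[OF ush_functor])

lemma Q_con: "c \<in> obj C \<Longrightarrow> (shf P ^^ n) (con C c) = con C ((shf C ^^ n) c)"
proof (induction n)
  case (Suc n)
  then show ?case by (simp add: shf_con S.Q_obj)
qed simp

lemma shfa_cona:
  assumes "f \<in> hom C A B" shows "shfa P (cona C f) = cona C (shfa C f)"
proof -
  note d = homD[OF assms]
  have 1: "shfa P (cona C f) \<in> hom P (con C (shf C A)) (con C (shf C B))"
    using rep_shf(1)[OF conaP(1)[OF assms]] d by (simp add: shf_con)
  show ?thesis
    using con_eqI[OF 1 conaP(1)[OF S.shf_hom[OF assms]] rep_shf(2)[OF conaP[OF assms]] conaP(2)[OF S.shf_hom[OF assms]]] .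
qed

lemma Q_cona: "f \<in> hom C A B \<Longrightarrow> (shfa P ^^ n) (cona C f) = cona C ((shfa C ^^ n) f)"
  by (induction n) (simp_all add: shfa_cona[OF S.Q_hom] del: P_simps)

lemma pidx_shf [simp]: "pidx (shf P X) = pidx X" "pob (shf P X) i = shf C (pob X i)"
  "par (shf P X) u = shfa C (par X u)"
  by (auto simp: P_simps)

lemma pidx_Q [simp]: "pidx ((shf P ^^ n) X) = pidx X" "pob ((shf P ^^ n) X) i = (shf C ^^ n) (pob X i)"
  "par ((shf P ^^ n) X) u = (shfa C ^^ n) (par X u)"
  by (induction n) auto

lemma ush_con: "c \<in> obj C \<Longrightarrow> (ush P ^^ n) (con C c) = con C ((ush C ^^ n) c)"
proof (induction n)
  case (Suc n)
  then show ?case by (simp add: ush_con1 S.ush_pow_obj)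
qed simp

lemma shpow_con: "c \<in> obj C \<Longrightarrow> shpow P k (con C c) = con C (shpow C k c)"
  by (auto simp: shpow_def Q_con ush_con)

lemma Q_proj:
  assumes "X \<in> pro_objs C" "i \<in> obj (pidx X)"
  shows "(shfa P ^^ n) (pro_proj C X i) = pro_proj C ((shf P ^^ n) X) i"
proof (induction n)
  case (Suc n)
  let ?X = "(shf P ^^ n) X"
  have X': "?X \<in> pro_objs C" "(shf P ^^ Suc n) X \<in> pro_objs C" using P.Q_obj[of X n] P.Q_obj[of X "Suc n"] assms by simp_all
  have i: "i \<in> obj (pidx ?X)" using assms by simp
  note p = projP[OF X'(1) i]
  have o: "(shf C ^^ n) (pob X i) \<in> obj C" using pob_obj[OF X'(1) i] by simp
  have 1: "shfa P (pro_proj C ?X i) \<in> hom P ((shf P ^^ Suc n) X) (con C (shf C (pob ?X i)))"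
    using rep_shf(1)[OF p(1)] by (simp add: shf_con[OF o])
  have 2: "pro_proj C ((shf P ^^ Suc n) X) i \<in> hom P ((shf P ^^ Suc n) X) (con C (shf C (pob ?X i)))"
    using projP(1)[OF X'(2), of i] assms by simp
  have 3: "(i, idn C (shf C (pob ?X i))) \<in> pgerm (shfa P (pro_proj C ?X i)) (IxNat 0)"
    using rep_shf(2)[OF p] S.shf_idn[OF o] by simp
  have 4: "(i, idn C (shf C (pob ?X i))) \<in> pgerm (pro_proj C ((shf P ^^ Suc n) X) i) (IxNat 0)"
    using projP(2)[OF X'(2), of i] assms by simp
  show ?case using con_eqI[OF 1 2 3 4] Suc by simp
qed simp

end

subsection \<open>Tensor products and shifts\<close>

text \<open>Shared by \<open>C\<close> and \<open>Pro C\<close>. The coherence between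
  \<open>shl\<close> and \<open>shr\<close> enters as an explicit premise \<open>ex\<close> and is
  supplied in \<open>C\<close>; on pro-objects the commutation of the two variables is deduced from
  the levels.\<close>

locale shift_tensor = shift_category C
  for C :: "('o, 'm, 'k::field, 'x) tscat_scheme" (structure) +
  assumes ten_ob: "X \<in> obj C \<Longrightarrow> Y \<in> obj C \<Longrightarrow> X \<otimes> Y \<in> obj C"
    and ten_hom: "f \<in> hom C X X' \<Longrightarrow> g \<in> hom C Y Y' \<Longrightarrow> f \<odot> g \<in> hom C (X \<otimes> Y) (X' \<otimes> Y')"
    and ten_idn: "X \<in> obj C \<Longrightarrow> Y \<in> obj C \<Longrightarrow> idn C X \<odot> idn C Y = idn C (X \<otimes> Y)"
    and ten_cmp: "f \<in> hom C X X' \<Longrightarrow> f' \<in> hom C X' X'' \<Longrightarrow> g \<in> hom C Y Y' \<Longrightarrow> g' \<in> hom C Y' Y'' \<Longrightarrow>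
        (f' \<cdot> f) \<odot> (g' \<cdot> g) = (f' \<odot> g') \<cdot> (f \<odot> g)"
    and shl_in: "X \<in> obj C \<Longrightarrow> Y \<in> obj C \<Longrightarrow> shl C X Y \<in> hom C (shf C (X \<otimes> Y)) (shf C X \<otimes> Y)"
    and shl_nat: "f \<in> hom C X X' \<Longrightarrow> g \<in> hom C Y Y' \<Longrightarrow>
        shl C X' Y' \<cdot> shfa C (f \<odot> g) = (shfa C f \<odot> g) \<cdot> shl C X Y"
    and shr_in: "X \<in> obj C \<Longrightarrow> Y \<in> obj C \<Longrightarrow> shr C X Y \<in> hom C (shf C (X \<otimes> Y)) (X \<otimes> shf C Y)"
    and shr_nat: "f \<in> hom C X X' \<Longrightarrow> g \<in> hom C Y Y' \<Longrightarrow>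
        shr C X' Y' \<cdot> shfa C (f \<odot> g) = (f \<odot> shfa C g) \<cdot> shr C X Y"
begin

lemma shl_pow_hom: "X \<in> obj C \<Longrightarrow> Y \<in> obj C \<Longrightarrow> shl_pow C n X Y \<in> hom C (\<Q>o n (X \<otimes> Y)) (\<Q>o n X \<otimes> Y)"
  by (induction n) (auto simp: idn_hom ten_ob intro: cmp_hom shf_hom shl_in Q_obj)

lemma shr_pow_hom: "X \<in> obj C \<Longrightarrow> Y \<in> obj C \<Longrightarrow> shr_pow C n X Y \<in> hom C (\<Q>o n (X \<otimes> Y)) (X \<otimes> \<Q>o n Y)"
  by (induction n) (auto simp: idn_hom ten_ob intro: cmp_hom shf_hom shr_in Q_obj)

lemma shl_pow_natural:
  assumes f: "f \<in> hom C X X'" and g: "g \<in> hom C Y Y'"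
  shows "shl_pow C n X' Y' \<cdot> \<Q>a n (f \<odot> g) = (\<Q>a n f \<odot> g) \<cdot> shl_pow C n X Y"
proof (induction n)
  case 0
  show ?case using cmp_idn[OF ten_hom[OF f g]] idn_cmp[OF ten_hom[OF f g]] by simp
next
  case (Suc n)
  note o = homD(4,5)[OF f] homD(4,5)[OF g]
  note a = shl_pow_hom[OF o(1,3), of n] and b = shl_pow_hom[OF o(2,4), of n]
  note c = Q_hom[OF ten_hom[OF f g], of n] and qf = Q_hom[OF f, of n]
  note s = shl_in[OF Q_obj[OF o(1)] o(3), of n] and s' = shl_in[OF Q_obj[OF o(2)] o(4), of n]
  have "shl_pow C (Suc n) X' Y' \<cdot> \<Q>a (Suc n) (f \<odot> g) = (shl C (\<Q>o n X') Y' \<cdot> shfa C (shl_pow C n X' Y')) \<cdot> shfa C (\<Q>a n (f \<odot> g))" by simp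
  also have "\<dots> = shl C (\<Q>o n X') Y' \<cdot> shfa C (shl_pow C n X' Y' \<cdot> \<Q>a n (f \<odot> g))"
    using cmp_assoc[OF shf_hom[OF c] shf_hom[OF b] s'] shf_cmp[OF c b] by simp
  also have "\<dots> = shl C (\<Q>o n X') Y' \<cdot> (shfa C (\<Q>a n f \<odot> g) \<cdot> shfa C (shl_pow C n X Y))"
    using Suc shf_cmp[OF a ten_hom[OF qf g]] by simp
  also have "\<dots> = ((shfa C (\<Q>a n f) \<odot> g) \<cdot> shl C (\<Q>o n X) Y) \<cdot> shfa C (shl_pow C n X Y)"
    using cmp_assoc[OF shf_hom[OF a] shf_hom[OF ten_hom[OF qf g]] s'] shl_nat[OF qf g] by simp
  also have "\<dots> = (\<Q>a (Suc n) f \<odot> g) \<cdot> shl_pow C (Suc n) X Y"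
    using cmp_assoc[OF shf_hom[OF a] s ten_hom[OF shf_hom[OF qf] g]] by simp
  finally show ?case .
qed

lemma shr_pow_natural:
  assumes f: "f \<in> hom C X X'" and g: "g \<in> hom C Y Y'"
  shows "shr_pow C n X' Y' \<cdot> \<Q>a n (f \<odot> g) = (f \<odot> \<Q>a n g) \<cdot> shr_pow C n X Y"
proof (induction n)
  case 0
  show ?case using cmp_idn[OF ten_hom[OF f g]] idn_cmp[OF ten_hom[OF f g]] by simp
next
  case (Suc n)
  note o = homD(4,5)[OF f] homD(4,5)[OF g]
  note a = shr_pow_hom[OF o(1,3), of n] and b = shr_pow_hom[OF o(2,4), of n]
  note c = Q_hom[OF ten_hom[OF f g], of n] and qg = Q_hom[OF g, of n]
  note s = shr_in[OF o(1) Q_obj[OF o(3)], of n] and s' = shr_in[OF o(2) Q_obj[OF o(4)], of n]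
  have "shr_pow C (Suc n) X' Y' \<cdot> \<Q>a (Suc n) (f \<odot> g) = (shr C X' (\<Q>o n Y') \<cdot> shfa C (shr_pow C n X' Y')) \<cdot> shfa C (\<Q>a n (f \<odot> g))" by simp
  also have "\<dots> = shr C X' (\<Q>o n Y') \<cdot> shfa C (shr_pow C n X' Y' \<cdot> \<Q>a n (f \<odot> g))"
    using cmp_assoc[OF shf_hom[OF c] shf_hom[OF b] s'] shf_cmp[OF c b] by simp
  also have "\<dots> = shr C X' (\<Q>o n Y') \<cdot> (shfa C (f \<odot> \<Q>a n g) \<cdot> shfa C (shr_pow C n X Y))"
    using Suc shf_cmp[OF a ten_hom[OF f qg]] by simp
  also have "\<dots> = ((f \<odot> shfa C (\<Q>a n g)) \<cdot> shr C X (\<Q>o n Y)) \<cdot> shfa C (shr_pow C n X Y)"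
    using cmp_assoc[OF shf_hom[OF a] shf_hom[OF ten_hom[OF f qg]] s'] shr_nat[OF f qg] by simp
  also have "\<dots> = (f \<odot> \<Q>a (Suc n) g) \<cdot> shr_pow C (Suc n) X Y"
    using cmp_assoc[OF shf_hom[OF a] s ten_hom[OF f shf_hom[OF qg]]] by simp
  finally show ?case .
qed

lemma on_left_hom:
  assumes "z \<in> hom C (\<Q>o d A) B" "N \<in> obj C" "A \<in> obj C" shows "on_left C d z A N \<in> hom C (\<Q>o d (A \<otimes> N)) (B \<otimes> N)"
  unfolding on_left_def using cmp_hom[OF shl_pow_hom[OF assms(3,2)] ten_hom[OF assms(1) idn_hom[OF assms(2)]]] .

lemma on_right_hom:
  assumes "z \<in> hom C (\<Q>o d A) B" "N \<in> obj C" "A \<in> obj C" shows "on_right C d z N A \<in> hom C (\<Q>o d (N \<otimes> A)) (N \<otimes> B)"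
  unfolding on_right_def using cmp_hom[OF shr_pow_hom[OF assms(2,3)] ten_hom[OF idn_hom[OF assms(2)] assms(1)]] .

lemma ten_split:
  assumes "f \<in> hom C X X'" "g \<in> hom C Y Y'"
  shows "(f \<odot> idn C Y') \<cdot> (idn C X \<odot> g) = f \<odot> g" "(idn C X' \<odot> g) \<cdot> (f \<odot> idn C Y) = f \<odot> g"
  using ten_cmp[OF idn_hom assms(1) assms(2) idn_hom] ten_cmp[OF assms(1) idn_hom idn_hom assms(2)]
    cmp_idn[OF assms(1)] idn_cmp[OF assms(1)] cmp_idn[OF assms(2)] idn_cmp[OF assms(2)]
    homD(4,5)[OF assms(1)] homD(4,5)[OF assms(2)] by simp_all

text \<open>Naturality of the iterated \<open>shl\<close> combined with the square for
  \<open>z\<close> and \<open>z'\<close>. It serves for the transition maps of a tower and for the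
  projections onto it alike.\<close>

lemma on_left_square:
  assumes z: "z \<in> hom C (\<Q>o d A) B" and z': "z' \<in> hom C (\<Q>o d A') B'" and f: "f \<in> hom C A A'" and h: "h \<in> hom C B B'"
    and g: "g \<in> hom C N N'" and e: "z' \<cdot> \<Q>a d f = h \<cdot> z"
  shows "on_left C d z' A' N' \<cdot> \<Q>a d (f \<odot> g) = (h \<odot> g) \<cdot> on_left C d z A N"
proof -
  note o = homD(4,5)[OF f] homD(4,5)[OF g]
  note a = shl_pow_hom[OF o(1,3), of d] and b = shl_pow_hom[OF o(2,4), of d] and qf = Q_hom[OF f, of d]
  have "on_left C d z' A' N' \<cdot> \<Q>a d (f \<odot> g) = (z' \<odot> idn C N') \<cdot> (shl_pow C d A' N' \<cdot> \<Q>a d (f \<odot> g))"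
    unfolding on_left_def using cmp_assoc[OF Q_hom[OF ten_hom[OF f g]] b ten_hom[OF z' idn_hom[OF o(4)]]] by simp
  also have "\<dots> = ((z' \<odot> idn C N') \<cdot> (\<Q>a d f \<odot> g)) \<cdot> shl_pow C d A N"
    unfolding shl_pow_natural[OF f g] using cmp_assoc[OF a ten_hom[OF qf g] ten_hom[OF z' idn_hom[OF o(4)]]] .
  also have "(z' \<odot> idn C N') \<cdot> (\<Q>a d f \<odot> g) = (h \<odot> g) \<cdot> (z \<odot> idn C N)"
    using ten_cmp[OF qf z' g idn_hom[OF o(4)]] ten_cmp[OF z h idn_hom[OF o(3)] g] idn_cmp[OF g] cmp_idn[OF g] e by simp
  also have "((h \<odot> g) \<cdot> (z \<odot> idn C N)) \<cdot> shl_pow C d A N = (h \<odot> g) \<cdot> on_left C d z A N"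
    unfolding on_left_def using cmp_assoc[OF a ten_hom[OF z idn_hom[OF o(3)]] ten_hom[OF h g]] by simp
  finally show ?thesis .
qed

lemma on_right_square:
  assumes z: "z \<in> hom C (\<Q>o d A) B" and z': "z' \<in> hom C (\<Q>o d A') B'" and f: "f \<in> hom C A A'" and h: "h \<in> hom C B B'"
    and g: "g \<in> hom C N N'" and e: "z' \<cdot> \<Q>a d f = h \<cdot> z"
  shows "on_right C d z' N' A' \<cdot> \<Q>a d (g \<odot> f) = (g \<odot> h) \<cdot> on_right C d z N A"
proof -
  note o = homD(4,5)[OF f] homD(4,5)[OF g]
  note a = shr_pow_hom[OF o(3,1), of d] and b = shr_pow_hom[OF o(4,2), of d] and qf = Q_hom[OF f, of d]
  have "on_right C d z' N' A' \<cdot> \<Q>a d (g \<odot> f) = (idn C N' \<odot> z') \<cdot> (shr_pow C d N' A' \<cdot> \<Q>a d (g \<odot> f))"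
    unfolding on_right_def using cmp_assoc[OF Q_hom[OF ten_hom[OF g f]] b ten_hom[OF idn_hom[OF o(4)] z']] by simp
  also have "\<dots> = ((idn C N' \<odot> z') \<cdot> (g \<odot> \<Q>a d f)) \<cdot> shr_pow C d N A"
    unfolding shr_pow_natural[OF g f] using cmp_assoc[OF a ten_hom[OF g qf] ten_hom[OF idn_hom[OF o(4)] z']] .
  also have "(idn C N' \<odot> z') \<cdot> (g \<odot> \<Q>a d f) = (g \<odot> h) \<cdot> (idn C N \<odot> z)"
    using ten_cmp[OF g idn_hom[OF o(4)] qf z'] ten_cmp[OF idn_hom[OF o(3)] g z h] idn_cmp[OF g] cmp_idn[OF g] e by simp
  also have "((g \<odot> h) \<cdot> (idn C N \<odot> z)) \<cdot> shr_pow C d N A = (g \<odot> h) \<cdot> on_right C d z N A"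
    unfolding on_right_def using cmp_assoc[OF a ten_hom[OF idn_hom[OF o(3)] z] ten_hom[OF g h]] by simp
  finally show ?thesis .
qed

text \<open>The single coherence square is iterated: over \<open>e\<close> for one left shift, then
  over \<open>d\<close>.\<close>

lemma shl_shr_exchange:
  assumes ex: "\<And>X Y. X \<in> obj C \<Longrightarrow> Y \<in> obj C \<Longrightarrow>
      shr C (shf C X) Y \<cdot> shfa C (shl C X Y) = shl C X (shf C Y) \<cdot> shfa C (shr C X Y)"
    and A: "A \<in> obj C" and N: "N \<in> obj C"
  shows "shl_pow C d A (\<Q>o e N) \<cdot> \<Q>a d (shr_pow C e A N) = shr_pow C e (\<Q>o d A) N \<cdot> \<Q>a e (shl_pow C d A N)"
proof -
  have 1: "shl C X (\<Q>o e N) \<cdot> shfa C (shr_pow C e X N) = shr_pow C e (shf C X) N \<cdot> \<Q>a e (shl C X N)"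
    if X: "X \<in> obj C" for X
  proof (induction e)
    case 0
    note s = shl_in[OF X N]
    show ?case using cmp_idn[OF s] idn_cmp[OF s] X N by (simp add: shf_idn ten_ob)
  next
    case (Suc e)
    let ?Z = "\<Q>o e N"
    have Z: "?Z \<in> obj C" using Q_obj N by blast
    note a = shr_pow_hom[OF X N, of e] and b = shr_in[OF X Z] and c = shl_in[OF X shf_obj[OF Z]] and c' = shl_in[OF X Z]
    note b' = shr_in[OF shf_obj[OF X] Z] and f = Q_hom[OF shl_in[OF X N], of e] and a' = shr_pow_hom[OF shf_obj[OF X] N, of e]
    have "shl C X (\<Q>o (Suc e) N) \<cdot> shfa C (shr_pow C (Suc e) X N)
       = (shl C X (shf C ?Z) \<cdot> shfa C (shr C X ?Z)) \<cdot> shfa C (shfa C (shr_pow C e X N))"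
      using shf_cmp[OF shf_hom[OF a] b] cmp_assoc[OF shf_hom[OF shf_hom[OF a]] shf_hom[OF b] c] by simp
    also have "\<dots> = shr C (shf C X) ?Z \<cdot> shfa C (shl C X ?Z \<cdot> shfa C (shr_pow C e X N))"
      unfolding ex[OF X Z, symmetric]
      using cmp_assoc[OF shf_hom[OF shf_hom[OF a]] shf_hom[OF c'] b'] shf_cmp[OF shf_hom[OF a] c'] by simp
    also have "\<dots> = shr C (shf C X) ?Z \<cdot> (shfa C (shr_pow C e (shf C X) N) \<cdot> shfa C (\<Q>a e (shl C X N)))"
      unfolding Suc using shf_cmp[OF f a'] by simp
    also have "\<dots> = shr_pow C (Suc e) (shf C X) N \<cdot> \<Q>a (Suc e) (shl C X N)"
      using cmp_assoc[OF shf_hom[OF f] shf_hom[OF a'] b'] by simp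
    finally show ?case .
  qed
  show ?thesis
  proof (induction d)
    case 0
    note s = shr_pow_hom[OF A N, of e]
    show ?case using cmp_idn[OF s] idn_cmp[OF s] A N by (simp add: Q_idn ten_ob Q_obj)
  next
    case (Suc d)
    let ?X = "\<Q>o d A" and ?Z = "\<Q>o e N"
    have X: "?X \<in> obj C" and Z: "?Z \<in> obj C" using Q_obj A N by auto
    note a = Q_hom[OF shr_pow_hom[OF A N, of e], of d] and b = shl_pow_hom[OF A Z, of d] and c = shl_in[OF X Z]
    note g = Q_hom[OF shl_pow_hom[OF A N, of d], of e] and h = shr_pow_hom[OF X N, of e]
    note k = shl_in[OF X N] and m = shr_pow_hom[OF shf_obj[OF X] N, of e]
    have sw: "shfa C (\<Q>a e f) = \<Q>a e (shfa C f)" for f by (simp add: funpow_swap1)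
    have so: "shf C (\<Q>o e f) = \<Q>o e (shf C f)" for f by (simp add: funpow_swap1)
    have "shl_pow C (Suc d) A ?Z \<cdot> \<Q>a (Suc d) (shr_pow C e A N)
       = shl C ?X ?Z \<cdot> shfa C (shl_pow C d A ?Z \<cdot> \<Q>a d (shr_pow C e A N))"
      using cmp_assoc[OF shf_hom[OF a] shf_hom[OF b] c] shf_cmp[OF a b] by simp
    also have "\<dots> = (shl C ?X ?Z \<cdot> shfa C (shr_pow C e ?X N)) \<cdot> shfa C (\<Q>a e (shl_pow C d A N))"
      unfolding Suc using cmp_assoc[OF shf_hom[OF g] shf_hom[OF h] c] shf_cmp[OF g h] by simp
    also have "\<dots> = (shr_pow C e (shf C ?X) N \<cdot> \<Q>a e (shl C ?X N)) \<cdot> \<Q>a e (shfa C (shl_pow C d A N))"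
      unfolding 1[OF X] sw ..
    also have "\<dots> = shr_pow C e (shf C ?X) N \<cdot> \<Q>a e (shl C ?X N \<cdot> shfa C (shl_pow C d A N))"
      using cmp_assoc[OF Q_hom[OF shf_hom[OF shl_pow_hom[OF A N, of d]], of e] Q_hom[OF k, of e] m]
        Q_cmp[OF shf_hom[OF shl_pow_hom[OF A N, of d]] k, of e] by simp
    finally show ?case by simp
  qed
qed

text \<open>Both composites are \<open>z \<odot> w\<close> after moving \<open>d\<close> shifts to
  the left factor and \<open>e\<close> shifts to the right one; by \<open>shl_shr_exchange\<close>
  the order of these moves does not matter.\<close>

lemma on_left_on_right:
  assumes ex: "\<And>X Y. X \<in> obj C \<Longrightarrow> Y \<in> obj C \<Longrightarrow>
      shr C (shf C X) Y \<cdot> shfa C (shl C X Y) = shl C X (shf C Y) \<cdot> shfa C (shr C X Y)"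
    and A: "A \<in> obj C" and N: "N \<in> obj C" and z: "z \<in> hom C (\<Q>o d A) B" and w: "w \<in> hom C (\<Q>o e N) L"
  shows "on_left C d z A L \<cdot> \<Q>a d (on_right C e w A N) = on_right C e w B N \<cdot> \<Q>a e (on_left C d z A N)"
proof -
  have o: "B \<in> obj C" "L \<in> obj C" "\<Q>o d A \<in> obj C" "\<Q>o e N \<in> obj C" using homD[OF z] homD[OF w] by auto
  note sa = shr_pow_hom[OF A N, of e] and sb = shl_pow_hom[OF A N, of d]
  note aw = ten_hom[OF idn_hom[OF A] w] and zn = ten_hom[OF z idn_hom[OF N]] and zl = ten_hom[OF z idn_hom[OF o(2)]]
  note bw = ten_hom[OF idn_hom[OF o(1)] w] and qw = ten_hom[OF idn_hom[OF o(3)] w] and ze = ten_hom[OF z idn_hom[OF o(4)]]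
  note l1 = shl_pow_hom[OF A o(2), of d] and l2 = shl_pow_hom[OF A o(4), of d]
  note r1 = shr_pow_hom[OF o(1) N, of e] and r2 = shr_pow_hom[OF o(3) N, of e]
  have "on_left C d z A L \<cdot> \<Q>a d (on_right C e w A N)
      = (z \<odot> idn C L) \<cdot> ((shl_pow C d A L \<cdot> \<Q>a d (idn C A \<odot> w)) \<cdot> \<Q>a d (shr_pow C e A N))"
    unfolding on_left_def on_right_def Q_cmp[OF sa aw]
    using cmp_assoc[OF cmp_hom[OF Q_hom[OF sa, of d] Q_hom[OF aw, of d]] l1 zl]
      cmp_assoc[OF Q_hom[OF sa, of d] Q_hom[OF aw, of d] l1] by simp
  also have "\<dots> = (z \<odot> idn C L) \<cdot> ((idn C (\<Q>o d A) \<odot> w) \<cdot> (shl_pow C d A (\<Q>o e N) \<cdot> \<Q>a d (shr_pow C e A N)))"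
    unfolding shl_pow_natural[OF idn_hom[OF A] w] Q_idn[OF A]
    using cmp_assoc[OF Q_hom[OF sa, of d] l2 qw] by simp
  also have "\<dots> = (z \<odot> w) \<cdot> (shl_pow C d A (\<Q>o e N) \<cdot> \<Q>a d (shr_pow C e A N))"
    using cmp_assoc[OF cmp_hom[OF Q_hom[OF sa, of d] l2] qw zl] ten_split(1)[OF z w] by simp
  finally have L: "on_left C d z A L \<cdot> \<Q>a d (on_right C e w A N)
     = (z \<odot> w) \<cdot> (shl_pow C d A (\<Q>o e N) \<cdot> \<Q>a d (shr_pow C e A N))" .
  have "on_right C e w B N \<cdot> \<Q>a e (on_left C d z A N)
      = (idn C B \<odot> w) \<cdot> ((shr_pow C e B N \<cdot> \<Q>a e (z \<odot> idn C N)) \<cdot> \<Q>a e (shl_pow C d A N))"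
    unfolding on_left_def on_right_def Q_cmp[OF sb zn]
    using cmp_assoc[OF cmp_hom[OF Q_hom[OF sb, of e] Q_hom[OF zn, of e]] r1 bw]
      cmp_assoc[OF Q_hom[OF sb, of e] Q_hom[OF zn, of e] r1] by simp
  also have "\<dots> = (idn C B \<odot> w) \<cdot> ((z \<odot> idn C (\<Q>o e N)) \<cdot> (shr_pow C e (\<Q>o d A) N \<cdot> \<Q>a e (shl_pow C d A N)))"
    unfolding shr_pow_natural[OF z idn_hom[OF N]] Q_idn[OF N]
    using cmp_assoc[OF Q_hom[OF sb, of e] r2 ze] by simp
  also have "\<dots> = (z \<odot> w) \<cdot> (shr_pow C e (\<Q>o d A) N \<cdot> \<Q>a e (shl_pow C d A N))"
    using cmp_assoc[OF cmp_hom[OF Q_hom[OF sb, of e] r2] ze bw] ten_split(2)[OF z w] by simp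
  finally have R: "on_right C e w B N \<cdot> \<Q>a e (on_left C d z A N)
     = (z \<odot> w) \<cdot> (shr_pow C e (\<Q>o d A) N \<cdot> \<Q>a e (shl_pow C d A N))" .
  have "shl_pow C d A (\<Q>o e N) \<cdot> \<Q>a d (shr_pow C e A N) = shr_pow C e (\<Q>o d A) N \<cdot> \<Q>a e (shl_pow C d A N)"
    by (rule shl_shr_exchange[OF _ A N]) (rule ex)
  then show ?thesis unfolding L R by simp
qed

end

lemma pro_ten_simps [simp]: "pidx (pro_ten C X Y) = prod_cat (pidx X) (pidx Y)"
  "pob (pro_ten C X Y) p = pob X (ixfst p) \<otimes>\<^bsub>C\<^esub> pob Y (ixsnd p)"
  "par (pro_ten C X Y) p = par X (ixfst p) \<odot>\<^bsub>C\<^esub> par Y (ixsnd p)"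
  by (simp_all add: pro_ten_def)

section \<open>Tensor products of pro-objects\<close>

context pro_graded
begin

sublocale S: shift_tensor C
  by (intro shift_tensor.intro shift_tensor_axioms.intro)
    (assumption | rule shift_category_base ten_obj tena_hom tena_idn tena_cmp shl_natural shr_natural
      shl_iso[THEN conjunct1] shr_iso[THEN conjunct1])+

lemma pro_ten_obj:
  assumes X: "X \<in> pro_objs C" and Y: "Y \<in> pro_objs C" shows "pro_ten C X Y \<in> pro_objs C"
proof -
  interpret I: category "pidx X" using pro_objD X by blast
  interpret J: category "pidx Y" using pro_objD Y by blast
  have "is_functor (prod_cat (pidx X) (pidx Y)) C (pob (pro_ten C X Y)) (par (pro_ten C X Y))"
    unfolding is_functor_def
  proof (intro conjI ballI allI)
    fix p assume "p \<in> obj (prod_cat (pidx X) (pidx Y))"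
    then obtain i j where p: "p = IxPair i j" "i \<in> obj (pidx X)" "j \<in> obj (pidx Y)" by auto
    show "pob (pro_ten C X Y) p \<in> obj C" using p X Y ten_obj by simp
    show "par (pro_ten C X Y) (idn (prod_cat (pidx X) (pidx Y)) p) = idn C (pob (pro_ten C X Y) p)"
      using p X Y tena_idn by (simp add: par_idn)
  next
    fix p p' w assume "w \<in> hom (prod_cat (pidx X) (pidx Y)) p p'"
    then obtain u v i j i' j' where "w = IxPair u v" "p = IxPair i j" "p' = IxPair i' j'"
      "u \<in> hom (pidx X) i i'" "v \<in> hom (pidx Y) j j'" unfolding hom_prod_cat by blast
    then show "par (pro_ten C X Y) w \<in> hom C (pob (pro_ten C X Y) p) (pob (pro_ten C X Y) p')"
      using tena_hom[OF par_hom[OF X] par_hom[OF Y]] by simp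
  next
    fix p p' p'' w w' assume "w \<in> hom (prod_cat (pidx X) (pidx Y)) p p'" "w' \<in> hom (prod_cat (pidx X) (pidx Y)) p' p''"
    then obtain u v u' v' i j i' j' i'' j'' where w: "w = IxPair u v" "w' = IxPair u' v'"
      "u \<in> hom (pidx X) i i'" "v \<in> hom (pidx Y) j j'" "u' \<in> hom (pidx X) i' i''" "v' \<in> hom (pidx Y) j' j''"
      unfolding hom_prod_cat by blast
    show "par (pro_ten C X Y) (w' \<cdot>\<^bsub>prod_cat (pidx X) (pidx Y)\<^esub> w) = par (pro_ten C X Y) w' \<cdot> par (pro_ten C X Y) w"
      using tena_cmp[OF par_hom[OF X w(3)] par_hom[OF X w(5)] par_hom[OF Y w(4)] par_hom[OF Y w(6)]]
        par_cmp[OF X w(3,5)] par_cmp[OF Y w(4,6)] w by simp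
  qed
  then show ?thesis
    using category_prod[OF pro_objD(1)[OF X] pro_objD(1)[OF Y]] cofiltered_prod[OF pro_objD(2)[OF X] pro_objD(2)[OF Y]]
    by (simp add: pro_objs_def)
qed

lemma germ_ten:
  assumes X: "X \<in> pro_objs C" and Y: "Y \<in> pro_objs C"
    and f: "(i', f') \<in> germ C X c i f" "f \<in> hom C (pob X i) c" and g: "(j', g') \<in> germ C Y d j g" "g \<in> hom C (pob Y j) d"
  shows "(IxPair i' j', f' \<odot> g') \<in> germ C (pro_ten C X Y) (c \<otimes> d) (IxPair i j) (f \<odot> g)"
proof -
  obtain k u v where k: "u \<in> hom (pidx X) k i" "v \<in> hom (pidx X) k i'" "f \<cdot> par X u = f' \<cdot> par X v"
    "i' \<in> obj (pidx X)" "f' \<in> hom C (pob X i') c" using f(1) unfolding germ_iff by blast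
  obtain l w x where l: "w \<in> hom (pidx Y) l j" "x \<in> hom (pidx Y) l j'" "g \<cdot> par Y w = g' \<cdot> par Y x"
    "j' \<in> obj (pidx Y)" "g' \<in> hom C (pob Y j') d" using g(1) unfolding germ_iff by blast
  have "IxPair u w \<in> hom (prod_cat (pidx X) (pidx Y)) (IxPair k l) (IxPair i j)"
    "IxPair v x \<in> hom (prod_cat (pidx X) (pidx Y)) (IxPair k l) (IxPair i' j')"
    using k l by (simp_all add: hom_prod_cat)
  moreover have "(f \<odot> g) \<cdot> (par X u \<odot> par Y w) = (f' \<odot> g') \<cdot> (par X v \<odot> par Y x)"
    using tena_cmp[OF par_hom[OF X k(1)] f(2) par_hom[OF Y l(1)] g(2)]
      tena_cmp[OF par_hom[OF X k(2)] k(5) par_hom[OF Y l(2)] l(5)] k(3) l(3) by simp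
  ultimately show ?thesis unfolding germ_iff
    using tena_hom[OF k(5) l(5)] k(4) l(4) by (auto intro!: exI[of _ "IxPair k l"] bexI)
qed

lemma tenaP:
  assumes F: "F \<in> hom P X X'" and G: "G \<in> hom P Y Y'"
  shows "F \<odot>\<^bsub>P\<^esub> G \<in> hom P (pro_ten C X Y) (pro_ten C X' Y')"
    "(i, f) \<in> pgerm F j \<Longrightarrow> (i', g) \<in> pgerm G j' \<Longrightarrow> (IxPair i i', f \<odot> g) \<in> pgerm (F \<odot>\<^bsub>P\<^esub> G) (IxPair j j')"
proof -
  have X: "X \<in> pro_objs C" "X' \<in> pro_objs C" and Y: "Y \<in> pro_objs C" "Y' \<in> pro_objs C" using homP_obj[OF F] homP_obj[OF G] by auto
  interpret I: category "pidx X'" using pro_objD X by blast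
  interpret J: category "pidx Y'" using pro_objD Y by blast
  let ?S = "\<lambda>p. {(IxPair i i', f \<odot> g) | i f i' g. (i, f) \<in> pgerm F (ixfst p) \<and> (i', g) \<in> pgerm G (ixsnd p)}"
  let ?A = "pro_ten C X Y" and ?B = "pro_ten C X' Y'"
  have eq: "F \<odot>\<^bsub>P\<^esub> G = pro_map C ?A ?B ?S" using F G by (simp add: P Pro_def homP_iff hom_def)
  have 1: "?S p \<noteq> {}" if p: "p \<in> obj (pidx ?B)" for p
  proof -
    obtain i f where f: "(i, f) \<in> pgerm F (ixfst p)" using rep_ex[OF F, of "ixfst p"] p by auto
    obtain j g where g: "(j, g) \<in> pgerm G (ixsnd p)" using rep_ex[OF G, of "ixsnd p"] p by auto
    show ?thesis using f g by blast
  qed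
  have 2: "p \<in> obj (pidx ?A) \<and> h \<in> hom C (pob ?A p) (pob ?B l)" if h: "(p, h) \<in> ?S l" for p h l
  proof -
    obtain i f i' g where e: "p = IxPair i i'" "h = f \<odot> g" "(i, f) \<in> pgerm F (ixfst l)" "(i', g) \<in> pgerm G (ixsnd l)"
      using h by blast
    show ?thesis using e rep_hom[OF F e(3)] rep_hom[OF G e(4)] tena_hom by simp
  qed
  have 3: "(p', h') \<in> germ C ?A (pob ?B l) p h" if h: "(p, h) \<in> ?S l" and h': "(p', h') \<in> ?S l" for p h l p' h'
  proof -
    obtain i f i' g where e: "p = IxPair i i'" "h = f \<odot> g" "(i, f) \<in> pgerm F (ixfst l)" "(i', g) \<in> pgerm G (ixsnd l)"
      using h by blast
    obtain k f1 k' g1 where e1: "p' = IxPair k k'" "h' = f1 \<odot> g1" "(k, f1) \<in> pgerm F (ixfst l)" "(k', g1) \<in> pgerm G (ixsnd l)"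
      using h' by blast
    show ?thesis
      using germ_ten[OF X(1) Y(1) _ rep_hom(3)[OF F e(3)] _ rep_hom(3)[OF G e(4)]] rep_germ[OF F e(3)] rep_germ[OF G e(4)] e1 e by simp
  qed
  have 4: "\<exists>i f i' f'. (i, f) \<in> ?S l \<and> (i', f') \<in> ?S l' \<and> (i, par ?B v \<cdot> f) \<in> germ C ?A (pob ?B l') i' f'"
    if v: "v \<in> hom (pidx ?B) l l'" for l l' v
  proof -
    obtain u w j k j' k' where v: "v = IxPair u w" "l = IxPair j k" "l' = IxPair j' k'"
      "u \<in> hom (pidx X') j j'" "w \<in> hom (pidx Y') k k'" using v by (auto simp: hom_prod_cat)
    obtain i f where f: "(i, f) \<in> pgerm F j" using rep_ex[OF F I.homD(4)[OF v(4)]] by blast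
    obtain i' g where g: "(i', g) \<in> pgerm G k" using rep_ex[OF G J.homD(4)[OF v(5)]] by blast
    have a: "(IxPair i i', f \<odot> g) \<in> ?S l" using f g v by auto
    have b: "(IxPair i i', (par X' u \<cdot> f) \<odot> (par Y' w \<cdot> g)) \<in> ?S l'"
      using rep_tgt[OF F f v(4)] rep_tgt[OF G g v(5)] v by auto
    have e: "par ?B v \<cdot> (f \<odot> g) = (par X' u \<cdot> f) \<odot> (par Y' w \<cdot> g)"
      using tena_cmp[OF rep_hom(3)[OF F f] par_hom[OF X(2) v(4)] rep_hom(3)[OF G g] par_hom[OF Y(2) v(5)]] v by simp
    have "(IxPair i i', par ?B v \<cdot> (f \<odot> g)) \<in> germ C ?A (pob ?B l') (IxPair i i') ((par X' u \<cdot> f) \<odot> (par Y' w \<cdot> g))"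
      unfolding e using germ_refl[OF pro_ten_obj[OF X(1) Y(1)]] 2[OF b] by blast
    then show ?thesis using a b by (intro exI conjI)
  qed
  note * = pro_map_hom[OF pro_ten_obj[OF X(1) Y(1)] pro_ten_obj[OF X(2) Y(2)], of ?S, OF 1 2 3 4]
  show "F \<odot>\<^bsub>P\<^esub> G \<in> hom P ?A ?B" unfolding eq using * by blast
  show "(IxPair i i', f \<odot> g) \<in> pgerm (F \<odot>\<^bsub>P\<^esub> G) (IxPair j j')" if "(i, f) \<in> pgerm F j" "(i', g) \<in> pgerm G j'"
  proof -
    have "IxPair j j' \<in> obj (pidx ?B)" using rep_hom(1)[OF F that(1)] rep_hom(1)[OF G that(2)] by simp
    moreover have "(IxPair i i', f \<odot> g) \<in> ?S (IxPair j j')" using that by auto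
    ultimately show ?thesis unfolding eq using * by blast
  qed
qed

lemma tena_idnP:
  assumes X: "X \<in> pro_objs C" and Y: "Y \<in> pro_objs C"
  shows "idn P X \<odot>\<^bsub>P\<^esub> idn P Y = idn P (pro_ten C X Y)"
proof (rule pro_eqI[OF tenaP(1)[OF idnP(1)[OF X] idnP(1)[OF Y]] idnP(1)[OF pro_ten_obj[OF X Y]]])
  fix p assume p: "p \<in> obj (pidx (pro_ten C X Y))"
  then obtain i j where e: "p = IxPair i j" "i \<in> obj (pidx X)" "j \<in> obj (pidx Y)" by auto
  show "\<exists>i f. (i, f) \<in> pgerm (idn P X \<odot>\<^bsub>P\<^esub> idn P Y) p \<and> (i, f) \<in> pgerm (idn P (pro_ten C X Y)) p"
    using tenaP(2)[OF idnP(1)[OF X] idnP(1)[OF Y] idnP(2)[OF X e(2)] idnP(2)[OF Y e(3)]] idnP(2)[OF pro_ten_obj[OF X Y] p]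
      tena_idn[of "pob X i" "pob Y j"] X Y e by auto
qed

lemma tena_cmpP:
  assumes F: "F \<in> hom P X X'" and F': "F' \<in> hom P X' X''" and G: "G \<in> hom P Y Y'" and G': "G' \<in> hom P Y' Y''"
  shows "(F' \<cdot>\<^bsub>P\<^esub> F) \<odot>\<^bsub>P\<^esub> (G' \<cdot>\<^bsub>P\<^esub> G) = (F' \<odot>\<^bsub>P\<^esub> G') \<cdot>\<^bsub>P\<^esub> (F \<odot>\<^bsub>P\<^esub> G)"
proof (rule pro_eqI[OF tenaP(1)[OF cmpP(1)[OF F F'] cmpP(1)[OF G G']] cmpP(1)[OF tenaP(1)[OF F G] tenaP(1)[OF F' G']]])
  fix p assume "p \<in> obj (pidx (pro_ten C X'' Y''))"
  then obtain j k where e: "p = IxPair j k" "j \<in> obj (pidx X'')" "k \<in> obj (pidx Y'')" by auto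
  obtain j' f' where f': "(j', f') \<in> pgerm F' j" using rep_ex[OF F' e(2)] by blast
  obtain i f where f: "(i, f) \<in> pgerm F j'" using rep_ex[OF F rep_hom(2)[OF F' f']] by blast
  obtain k' g' where g': "(k', g') \<in> pgerm G' k" using rep_ex[OF G' e(3)] by blast
  obtain l g where g: "(l, g) \<in> pgerm G k'" using rep_ex[OF G rep_hom(2)[OF G' g']] by blast
  show "\<exists>i f. (i, f) \<in> pgerm ((F' \<cdot>\<^bsub>P\<^esub> F) \<odot>\<^bsub>P\<^esub> (G' \<cdot>\<^bsub>P\<^esub> G)) p \<and> (i, f) \<in> pgerm ((F' \<odot>\<^bsub>P\<^esub> G') \<cdot>\<^bsub>P\<^esub> (F \<odot>\<^bsub>P\<^esub> G)) p"
    using tenaP(2)[OF cmpP(1)[OF F F'] cmpP(1)[OF G G'] cmpP(2)[OF F F' f' f] cmpP(2)[OF G G' g' g]]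
      cmpP(2)[OF tenaP(1)[OF F G] tenaP(1)[OF F' G'] tenaP(2)[OF F' G' f' g'] tenaP(2)[OF F G f g]]
      tena_cmp[OF rep_hom(3)[OF F f] rep_hom(3)[OF F' f'] rep_hom(3)[OF G g] rep_hom(3)[OF G' g']] e by auto
qed

lemma level_map:
  assumes X: "X \<in> pro_objs C" and Y: "Y \<in> pro_objs C" and i: "pidx X = pidx Y"
    and h: "\<And>j. j \<in> obj (pidx Y) \<Longrightarrow> f j \<in> hom C (pob X j) (pob Y j)"
    and nat: "\<And>j j' v. v \<in> hom (pidx Y) j j' \<Longrightarrow> par Y v \<cdot> f j = f j' \<cdot> par X v"
  shows "pro_map C X Y (\<lambda>j. {(j, f j)}) \<in> hom P X Y"
    and "\<And>j. j \<in> obj (pidx Y) \<Longrightarrow> (j, f j) \<in> pgerm (pro_map C X Y (\<lambda>j. {(j, f j)})) j"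
proof -
  interpret J: category "pidx Y" using pro_objD Y by blast
  have "(j, par Y v \<cdot> f j) \<in> germ C X (pob Y j') j' (f j')" if v: "v \<in> hom (pidx Y) j j'" for j j' v
    using germ_par[OF X _ h[OF J.homD(5)[OF v]], of v j] v i nat[OF v] by simp
  note * = pro_map_single[OF X Y, of "\<lambda>j. j" f, OF _ this]
  show "pro_map C X Y (\<lambda>j. {(j, f j)}) \<in> hom P X Y"
    and "\<And>j. j \<in> obj (pidx Y) \<Longrightarrow> (j, f j) \<in> pgerm (pro_map C X Y (\<lambda>j. {(j, f j)})) j"
    using * h i by auto
qed

lemma shf_objP: "X \<in> pro_objs C \<Longrightarrow> shf P X \<in> pro_objs C"
  using P.shf_obj by simp

lemma shlP:
  assumes X: "X \<in> pro_objs C" and Y: "Y \<in> pro_objs C"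
  shows "shl P X Y \<in> hom P (shf P (pro_ten C X Y)) (pro_ten C (shf P X) Y)"
    "i \<in> obj (pidx X) \<Longrightarrow> j \<in> obj (pidx Y) \<Longrightarrow> (IxPair i j, shl C (pob X i) (pob Y j)) \<in> pgerm (shl P X Y) (IxPair i j)"
proof -
  have e: "shl P X Y = pro_map C (shf P (pro_ten C X Y)) (pro_ten C (shf P X) Y)
     (\<lambda>p. {(p, shl C (pob X (ixfst p)) (pob Y (ixsnd p)))})" by (simp add: P Pro_def)
  let ?A = "shf P (pro_ten C X Y)" and ?B = "pro_ten C (shf P X) Y"
  note o = shf_objP[OF pro_ten_obj[OF X Y]] pro_ten_obj[OF shf_objP[OF X] Y]
  have h: "shl C (pob X (ixfst p)) (pob Y (ixsnd p)) \<in> hom C (pob ?A p) (pob ?B p)" if "p \<in> obj (pidx ?B)" for p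
    using that S.shl_in X Y by auto
  have n: "par ?B v \<cdot> shl C (pob X (ixfst p)) (pob Y (ixsnd p)) = shl C (pob X (ixfst p')) (pob Y (ixsnd p')) \<cdot> par ?A v"
    if "v \<in> hom (pidx ?B) p p'" for v p p'
    using that shl_natural[OF par_hom[OF X] par_hom[OF Y]] by (auto simp: hom_prod_cat)
  note * = level_map[OF o, of "\<lambda>p. shl C (pob X (ixfst p)) (pob Y (ixsnd p))", OF _ h n]
  show "shl P X Y \<in> hom P ?A ?B" unfolding e using * by simp
  show "(IxPair i j, shl C (pob X i) (pob Y j)) \<in> pgerm (shl P X Y) (IxPair i j)" if "i \<in> obj (pidx X)" "j \<in> obj (pidx Y)"
    unfolding e using *(2)[of "IxPair i j"] that by simp
qed

lemma shrP:
  assumes X: "X \<in> pro_objs C" and Y: "Y \<in> pro_objs C"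
  shows "shr P X Y \<in> hom P (shf P (pro_ten C X Y)) (pro_ten C X (shf P Y))"
    "i \<in> obj (pidx X) \<Longrightarrow> j \<in> obj (pidx Y) \<Longrightarrow> (IxPair i j, shr C (pob X i) (pob Y j)) \<in> pgerm (shr P X Y) (IxPair i j)"
proof -
  have e: "shr P X Y = pro_map C (shf P (pro_ten C X Y)) (pro_ten C X (shf P Y))
     (\<lambda>p. {(p, shr C (pob X (ixfst p)) (pob Y (ixsnd p)))})" by (simp add: P Pro_def)
  let ?A = "shf P (pro_ten C X Y)" and ?B = "pro_ten C X (shf P Y)"
  note o = shf_objP[OF pro_ten_obj[OF X Y]] pro_ten_obj[OF X shf_objP[OF Y]]
  have h: "shr C (pob X (ixfst p)) (pob Y (ixsnd p)) \<in> hom C (pob ?A p) (pob ?B p)" if "p \<in> obj (pidx ?B)" for p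
    using that S.shr_in X Y by auto
  have n: "par ?B v \<cdot> shr C (pob X (ixfst p)) (pob Y (ixsnd p)) = shr C (pob X (ixfst p')) (pob Y (ixsnd p')) \<cdot> par ?A v"
    if "v \<in> hom (pidx ?B) p p'" for v p p'
    using that shr_natural[OF par_hom[OF X] par_hom[OF Y]] by (auto simp: hom_prod_cat)
  note * = level_map[OF o, of "\<lambda>p. shr C (pob X (ixfst p)) (pob Y (ixsnd p))", OF _ h n]
  show "shr P X Y \<in> hom P ?A ?B" unfolding e using * by simp
  show "(IxPair i j, shr C (pob X i) (pob Y j)) \<in> pgerm (shr P X Y) (IxPair i j)" if "i \<in> obj (pidx X)" "j \<in> obj (pidx Y)"
    unfolding e using *(2)[of "IxPair i j"] that by simp
qed

lemma ten_P: "ten P = pro_ten C"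
  by (simp add: P_simps)

sublocale P: shift_tensor P
proof (intro shift_tensor.intro shift_tensor_axioms.intro)
  show "shift_category P" by unfold_locales
next
  fix F G X X' Y Y' assume F: "F \<in> hom P X X'" and G: "G \<in> hom P Y Y'"
  have X: "X \<in> pro_objs C" "X' \<in> pro_objs C" and Y: "Y \<in> pro_objs C" "Y' \<in> pro_objs C" using homP_obj[OF F] homP_obj[OF G] by auto
  note FG = tenaP[OF F G]
  note sF = rep_shf[OF F] and sG = rep_shf[OF G]
  show "shl P X' Y' \<cdot>\<^bsub>P\<^esub> shfa P (F \<odot>\<^bsub>P\<^esub> G) = (shfa P F \<odot>\<^bsub>P\<^esub> G) \<cdot>\<^bsub>P\<^esub> shl P X Y"
  proof (rule pro_eqI[OF cmpP(1)[OF rep_shf(1)[OF FG(1)] shlP(1)[OF X(2) Y(2)]] cmpP(1)[OF shlP(1)[OF X(1) Y(1)] tenaP(1)[OF sF(1) G]]])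
    fix p assume "p \<in> obj (pidx (pro_ten C (shf P X') Y'))"
    then obtain j k where e: "p = IxPair j k" "j \<in> obj (pidx X')" "k \<in> obj (pidx Y')" by auto
    obtain i f where f: "(i, f) \<in> pgerm F j" using rep_ex[OF F e(2)] by blast
    obtain l g where g: "(l, g) \<in> pgerm G k" using rep_ex[OF G e(3)] by blast
    show "\<exists>i f. (i, f) \<in> pgerm (shl P X' Y' \<cdot>\<^bsub>P\<^esub> shfa P (F \<odot>\<^bsub>P\<^esub> G)) p \<and> (i, f) \<in> pgerm ((shfa P F \<odot>\<^bsub>P\<^esub> G) \<cdot>\<^bsub>P\<^esub> shl P X Y) p"
      using cmpP(2)[OF rep_shf(1)[OF FG(1)] shlP(1)[OF X(2) Y(2)] shlP(2)[OF X(2) Y(2) e(2,3)] rep_shf(2)[OF FG(1) FG(2)[OF f g]]]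
        cmpP(2)[OF shlP(1)[OF X(1) Y(1)] tenaP(1)[OF sF(1) G] tenaP(2)[OF sF(1) G sF(2)[OF f] g] shlP(2)[OF X(1) Y(1) rep_hom(2)[OF F f] rep_hom(2)[OF G g]]]
        shl_natural[OF rep_hom(3)[OF F f] rep_hom(3)[OF G g]] e by auto
  qed
  show "shr P X' Y' \<cdot>\<^bsub>P\<^esub> shfa P (F \<odot>\<^bsub>P\<^esub> G) = (F \<odot>\<^bsub>P\<^esub> shfa P G) \<cdot>\<^bsub>P\<^esub> shr P X Y"
  proof (rule pro_eqI[OF cmpP(1)[OF rep_shf(1)[OF FG(1)] shrP(1)[OF X(2) Y(2)]] cmpP(1)[OF shrP(1)[OF X(1) Y(1)] tenaP(1)[OF F sG(1)]]])
    fix p assume "p \<in> obj (pidx (pro_ten C X' (shf P Y')))"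
    then obtain j k where e: "p = IxPair j k" "j \<in> obj (pidx X')" "k \<in> obj (pidx Y')" by auto
    obtain i f where f: "(i, f) \<in> pgerm F j" using rep_ex[OF F e(2)] by blast
    obtain l g where g: "(l, g) \<in> pgerm G k" using rep_ex[OF G e(3)] by blast
    show "\<exists>i f. (i, f) \<in> pgerm (shr P X' Y' \<cdot>\<^bsub>P\<^esub> shfa P (F \<odot>\<^bsub>P\<^esub> G)) p \<and> (i, f) \<in> pgerm ((F \<odot>\<^bsub>P\<^esub> shfa P G) \<cdot>\<^bsub>P\<^esub> shr P X Y) p"
      using cmpP(2)[OF rep_shf(1)[OF FG(1)] shrP(1)[OF X(2) Y(2)] shrP(2)[OF X(2) Y(2) e(2,3)] rep_shf(2)[OF FG(1) FG(2)[OF f g]]]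
        cmpP(2)[OF shrP(1)[OF X(1) Y(1)] tenaP(1)[OF F sG(1)] tenaP(2)[OF F sG(1) f sG(2)[OF g]] shrP(2)[OF X(1) Y(1) rep_hom(2)[OF F f] rep_hom(2)[OF G g]]]
        shr_natural[OF rep_hom(3)[OF F f] rep_hom(3)[OF G g]] e by auto
  qed
next
  fix F F' G G' X X' X'' Y Y' Y''
  assume "F \<in> hom P X X'" "F' \<in> hom P X' X''" "G \<in> hom P Y Y'" "G' \<in> hom P Y' Y''"
  then show "(F' \<cdot>\<^bsub>P\<^esub> F) \<odot>\<^bsub>P\<^esub> (G' \<cdot>\<^bsub>P\<^esub> G) = (F' \<odot>\<^bsub>P\<^esub> G') \<cdot>\<^bsub>P\<^esub> (F \<odot>\<^bsub>P\<^esub> G)" by (rule tena_cmpP)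
qed (simp_all add: ten_P pro_ten_obj tenaP(1) tena_idnP shlP(1) shrP(1))

lemma con_tenP:
  assumes M: "M \<in> obj C" and N: "N \<in> obj C"
  shows "con_ten C M N \<in> hom P (con C M \<otimes>\<^bsub>P\<^esub> con C N) (con C (M \<otimes> N))"
    "(IxPair (IxNat 0) (IxNat 0), idn C (M \<otimes> N)) \<in> pgerm (con_ten C M N :: ('o, 'm, 'a) pro_ar) (IxNat 0)"
proof -
  let ?A = "pro_ten C (con C M) (con C N) :: ('o, 'm, 'a) pro_ob"
  let ?Z = "IxPair (IxNat 0) (IxNat 0) :: ('a, 'm) idx"
  have A: "?A \<in> pro_objs C" using pro_ten_obj con_obj M N by blast
  have B: "(con C (M \<otimes> N) :: ('o, 'm, 'a) pro_ob) \<in> pro_objs C" using con_obj ten_obj M N by blast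
  have i: "idn C (M \<otimes> N) \<in> hom C (M \<otimes> N) (M \<otimes> N)" using idn_hom ten_obj M N by blast
  have "(?Z, idn C (M \<otimes> N)) \<in> germ C ?A (M \<otimes> N) ?Z (idn C (M \<otimes> N))"
    using germ_refl[OF A, of ?Z "idn C (M \<otimes> N)"] i by simp
  note * = pro_map_single[OF A B, of "\<lambda>_. ?Z" "\<lambda>_. idn C (M \<otimes> N)"]
  have 1: "con_ten C M N = pro_map C ?A (con C (M \<otimes> N)) (\<lambda>_. {(?Z, idn C (M \<otimes> N))})" by (simp add: con_ten_def)
  have g: "(?Z, idn C (M \<otimes> N) \<cdot> idn C (M \<otimes> N)) \<in> germ C ?A (M \<otimes> N) ?Z (idn C (M \<otimes> N))"
    using germ_refl[OF A, of ?Z "idn C (M \<otimes> N)"] i idn_cmp[OF i] by simp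
  show "con_ten C M N \<in> hom P (con C M \<otimes>\<^bsub>P\<^esub> con C N) (con C (M \<otimes> N))"
    "(?Z, idn C (M \<otimes> N)) \<in> pgerm (con_ten C M N :: ('o, 'm, 'a) pro_ar) (IxNat 0)"
    using * i g unfolding 1 ten_P by (auto split: if_splits)
qed

lemma con_ten_natural:
  assumes f: "f \<in> hom C M M'" and g: "g \<in> hom C N N'"
  shows "con_ten C M' N' \<cdot>\<^bsub>P\<^esub> (cona C f \<odot>\<^bsub>P\<^esub> cona C g) = cona C (f \<odot> g) \<cdot>\<^bsub>P\<^esub> con_ten C M N"
proof -
  note o = homD(4,5)[OF f] homD(4,5)[OF g]
  note c = con_tenP[OF o(1,3)] con_tenP[OF o(2,4)] and t = tenaP[OF conaP(1)[OF f] conaP(1)[OF g]]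
  note fg = tena_hom[OF f g]
  show ?thesis
  proof (rule con_eqI[OF cmpP(1)[OF t(1)[folded ten_P] c(3)] cmpP(1)[OF c(1) conaP(1)[OF fg]]])
    show "(IxPair (IxNat 0) (IxNat 0), f \<odot> g) \<in> pgerm (con_ten C M' N' \<cdot>\<^bsub>P\<^esub> (cona C f \<odot>\<^bsub>P\<^esub> cona C g)) (IxNat 0)"
      using cmpP(2)[OF t(1)[folded ten_P] c(3) c(4) t(2)[OF conaP(2)[OF f] conaP(2)[OF g]]] idn_cmp[OF fg] by simp
    show "(IxPair (IxNat 0) (IxNat 0), f \<odot> g) \<in> pgerm (cona C (f \<odot> g) \<cdot>\<^bsub>P\<^esub> con_ten C M N) (IxNat 0)"
      using cmpP(2)[OF c(1) conaP(1)[OF fg] conaP(2)[OF fg] c(2)] cmp_idn[OF fg] by simp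
  qed
qed

end

subsection \<open>The tower of an affine object\<close>

locale affine_tower = pro_graded C P
  for C :: "('o, 'm, 'k::field, 'x) moncat_scheme" (structure)
    and P :: "(('o, 'm, 'a) pro_ob, ('o, 'm, 'a) pro_ar, 'k) tscat" +
  fixes X :: "('o, 'm, 'a) pro_ob" and d :: nat and z :: "('o, 'm, 'a) pro_ar"
    and T :: "('o, 'm, 'a) pro_ob" and \<phi> :: "('o, 'm, 'a) pro_ar"
  assumes X: "X \<in> pro_objs C" and d: "0 < d" and z: "z \<in> hom P ((shf P ^^ d) X) X" and z_mono: "mono P z"
    and T: "T \<in> pro_objs C" and \<phi>: "\<phi> \<in> hom P X T" and T_idx: "pidx T = tower_cat" and \<phi>_iso: "iso P \<phi>"
    and quot: "\<And>n. is_quotient C X (zpow P d z X n) (pob T (IxNat n)) (pro_proj C T (IxNat n) \<cdot>\<^bsub>P\<^esub> \<phi>)"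
begin

definition Tn :: "nat \<Rightarrow> 'o" where "Tn n = pob T (IxNat n)"
definition tr :: "nat \<Rightarrow> nat \<Rightarrow> 'm" where "tr m n = par T (IxPair (IxNat m) (IxNat n))"
definition \<psi> :: "nat \<Rightarrow> ('o, 'm, 'a) pro_ar" where "\<psi> n = pro_proj C T (IxNat n) \<cdot>\<^bsub>P\<^esub> \<phi>"

lemma tower_hom: "n \<le> m \<Longrightarrow> IxPair (IxNat m) (IxNat n) \<in> hom (pidx T) (IxNat m) (IxNat n)"
  by (simp add: T_idx hom_tower_cat)

lemma Tn_obj [simp]: "Tn n \<in> obj C"
  using T by (simp add: Tn_def T_idx)

lemma tr_hom: "n \<le> m \<Longrightarrow> tr m n \<in> hom C (Tn m) (Tn n)"
  unfolding Tn_def tr_def using par_hom[OF T tower_hom] .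

lemma tr_id: "tr n n = idn C (Tn n)"
  unfolding Tn_def tr_def using par_idn[OF T, of "IxNat n"] by (simp add: T_idx)

lemma tr_cmp: "l \<le> n \<Longrightarrow> n \<le> m \<Longrightarrow> tr n l \<cdot> tr m n = tr m l"
  unfolding tr_def using par_cmp[OF T tower_hom tower_hom, of n m l] by (simp add: T_idx)

lemma \<psi>_hom: "\<psi> n \<in> hom P X (con C (Tn n))"
  unfolding \<psi>_def Tn_def using cmpP(1)[OF \<phi> projP(1)[OF T]] by (simp add: T_idx)

lemma tr_\<psi>: "n \<le> m \<Longrightarrow> cona C (tr m n) \<cdot>\<^bsub>P\<^esub> \<psi> m = \<psi> n"
proof -
  assume n: "n \<le> m"
  note p = projP(1)[OF T, of "IxNat m"]
  have p: "pro_proj C T (IxNat m) \<in> hom P T (con C (Tn m))" using projP(1)[OF T, of "IxNat m"] by (simp add: T_idx Tn_def)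
  have "cona C (tr m n) \<cdot>\<^bsub>P\<^esub> pro_proj C T (IxNat m) = pro_proj C T (IxNat n)"
    unfolding tr_def using proj_natural[OF T tower_hom[OF n]] .
  then show ?thesis unfolding \<psi>_def using P.cmp_assoc[OF \<phi> p conaP(1)[OF tr_hom[OF n]]] by simp
qed

lemma zpow_hom: "zpow P d z X n \<in> hom P ((shf P ^^ (n * d)) X) X"
proof (induction n)
  case 0 show ?case using idnP(1)[OF X] by simp
next
  case (Suc n)
  have "(shfa P ^^ d) (zpow P d z X n) \<in> hom P ((shf P ^^ (Suc n * d)) X) ((shf P ^^ d) X)"
    using P.Q_hom[OF Suc, of d] P.Qo_add[of d "n * d" X] by simp
  then show ?case using cmpP(1)[OF _ z] by simp
qed

lemma \<psi>_cokernel: "is_cokernel P (zpow P d z X n) (\<psi> n)"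
  using quot[of n] unfolding is_quotient_def \<psi>_def P[symmetric] by blast

lemma \<psi>_epi: "epi P (\<psi> n)"
  using P.cokernel_epi[OF \<psi>_cokernel] .

lemma \<psi>_zpow: "\<psi> n \<cdot>\<^bsub>P\<^esub> zpow P d z X n = zer P ((shf P ^^ (n * d)) X) (con C (Tn n))"
  using \<psi>_cokernel[of n] P.homD[OF zpow_hom[of n]] P.homD[OF \<psi>_hom[of n]] unfolding is_cokernel_def by simp

lemma tr_epi: "n \<le> m \<Longrightarrow> epi C (tr m n)"
  using con_epi[OF P.epi_factor[OF _ \<psi>_hom conaP(1)[OF tr_hom]] tr_hom] tr_\<psi> \<psi>_epi by metis

lemma Q_\<psi>: "(shfa P ^^ s) (\<psi> n) \<in> hom P ((shf P ^^ s) X) (con C ((shf C ^^ s) (Tn n)))"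
  using P.Q_hom[OF \<psi>_hom, of s n] by (simp add: Q_con)

lemma QTn_obj: "(shf C ^^ s) (Tn n) \<in> obj C"
  using S.Q_obj by simp

text \<open>\<open>\<psi> (Suc n) \<cdot> z\<close> kills \<open>q^d z^n\<close>, since
  \<open>z\<close> after \<open>q^d z^n\<close> is \<open>z^(n+1)\<close>; hence it factors through
  \<open>q^d \<psi>_n\<close>, the cokernel of \<open>q^d z^n\<close>. Both ends of the factor are
  constant, so it comes from \<open>C\<close>.\<close>

lemma zeta_ex: "\<exists>\<zeta>\<in>hom C ((shf C ^^ d) (Tn n)) (Tn (Suc n)). \<psi> (Suc n) \<cdot>\<^bsub>P\<^esub> z = cona C \<zeta> \<cdot>\<^bsub>P\<^esub> (shfa P ^^ d) (\<psi> n)"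
proof -
  note q = P.Q_hom[OF zpow_hom, of d n]
  note c = P.Q_cokernel[OF \<psi>_cokernel zpow_hom, of d n]
  have h: "\<psi> (Suc n) \<cdot>\<^bsub>P\<^esub> z \<in> hom P ((shf P ^^ d) X) (con C (Tn (Suc n)))" using cmpP(1)[OF z \<psi>_hom] .
  have "(\<psi> (Suc n) \<cdot>\<^bsub>P\<^esub> z) \<cdot>\<^bsub>P\<^esub> (shfa P ^^ d) (zpow P d z X n) = \<psi> (Suc n) \<cdot>\<^bsub>P\<^esub> zpow P d z X (Suc n)"
    using P.cmp_assoc[OF q z \<psi>_hom] by simp
  also have "\<dots> = zer P ((shf P ^^ d) ((shf P ^^ (n * d)) X)) (con C (Tn (Suc n)))"
    unfolding \<psi>_zpow using P.Qo_add[of d "n * d" X] by simp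
  finally obtain u where u: "u \<in> hom P (con C ((shf C ^^ d) (Tn n))) (con C (Tn (Suc n)))"
    "u \<cdot>\<^bsub>P\<^esub> (shfa P ^^ d) (\<psi> n) = \<psi> (Suc n) \<cdot>\<^bsub>P\<^esub> z"
    using P.cokernel_factor[OF c Q_\<psi> h q] by blast
  then show ?thesis using cona_full[OF QTn_obj u(1)] by metis
qed

definition \<zeta> :: "nat \<Rightarrow> 'm" where
  "\<zeta> n = (SOME \<zeta>. \<zeta> \<in> hom C ((shf C ^^ d) (Tn n)) (Tn (Suc n)) \<and> \<psi> (Suc n) \<cdot>\<^bsub>P\<^esub> z = cona C \<zeta> \<cdot>\<^bsub>P\<^esub> (shfa P ^^ d) (\<psi> n))"

lemma \<zeta>: "\<zeta> n \<in> hom C ((shf C ^^ d) (Tn n)) (Tn (Suc n))"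
    "\<psi> (Suc n) \<cdot>\<^bsub>P\<^esub> z = cona C (\<zeta> n) \<cdot>\<^bsub>P\<^esub> (shfa P ^^ d) (\<psi> n)"
  using someI_ex[OF zeta_ex[of n, unfolded Bex_def], folded \<zeta>_def] by auto

lemma Q_tr: "n \<le> m \<Longrightarrow> (shfa C ^^ s) (tr m n) \<in> hom C ((shf C ^^ s) (Tn m)) ((shf C ^^ s) (Tn n))"
  using S.Q_hom[OF tr_hom] .

lemma Q_\<psi>_epi: "epi P ((shfa P ^^ s) (\<psi> n))"
  using P.Q_epi[OF \<psi>_epi \<psi>_hom] .

lemma Q_tr_\<psi>: "n \<le> m \<Longrightarrow> cona C ((shfa C ^^ s) (tr m n)) \<cdot>\<^bsub>P\<^esub> (shfa P ^^ s) (\<psi> m) = (shfa P ^^ s) (\<psi> n)"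
  using P.Q_cmp[OF \<psi>_hom conaP(1)[OF tr_hom], of n m s] Q_cona[OF tr_hom, of n m s] tr_\<psi> by simp

lemma con_epi_cancel:
  assumes "epi P E" "E \<in> hom P W (con C A)" "f \<in> hom C A B" "g \<in> hom C A B" "cona C f \<cdot>\<^bsub>P\<^esub> E = cona C g \<cdot>\<^bsub>P\<^esub> E"
  shows "f = g"
  using cona_faithful[OF assms(3,4)] P.epi_cancel[OF assms(1,2) conaP(1)[OF assms(3)] conaP(1)[OF assms(4)] assms(5)] .

text \<open>It suffices to compare after the epimorphism \<open>q^d \<psi>_m\<close>, where both
  sides become \<open>\<psi> (Suc n) \<cdot> z\<close>.\<close>

lemma tr_\<zeta>:
  assumes n: "n \<le> m" shows "tr (Suc m) (Suc n) \<cdot> \<zeta> m = \<zeta> n \<cdot> (shfa C ^^ d) (tr m n)"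
proof -
  have n': "Suc n \<le> Suc m" using n by simp
  note t = tr_hom[OF n'] and qt = Q_tr[OF n, of d]
  have "cona C (tr (Suc m) (Suc n) \<cdot> \<zeta> m) \<cdot>\<^bsub>P\<^esub> (shfa P ^^ d) (\<psi> m)
      = cona C (tr (Suc m) (Suc n)) \<cdot>\<^bsub>P\<^esub> (\<psi> (Suc m) \<cdot>\<^bsub>P\<^esub> z)"
    using cona_cmp[OF \<zeta>(1) t] \<zeta>(2) P.cmp_assoc[OF Q_\<psi> conaP(1)[OF \<zeta>(1)] conaP(1)[OF t]] by simp
  also have "\<dots> = cona C (\<zeta> n) \<cdot>\<^bsub>P\<^esub> (shfa P ^^ d) (\<psi> n)"
    using P.cmp_assoc[OF z \<psi>_hom conaP(1)[OF t]] tr_\<psi>[OF n'] \<zeta>(2) by simp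
  also have "\<dots> = cona C (\<zeta> n \<cdot> (shfa C ^^ d) (tr m n)) \<cdot>\<^bsub>P\<^esub> (shfa P ^^ d) (\<psi> m)"
    using cona_cmp[OF qt \<zeta>(1)] Q_tr_\<psi>[OF n, of d] P.cmp_assoc[OF Q_\<psi> conaP(1)[OF qt] conaP(1)[OF \<zeta>(1)]] by simp
  finally show ?thesis
    using con_epi_cancel[OF Q_\<psi>_epi Q_\<psi> cmp_hom[OF \<zeta>(1) t] cmp_hom[OF qt \<zeta>(1)]] by blast
qed

text \<open>The projection \<open>\<psi> 0\<close> is epi and zero at once, being the cokernel of
  the identity \<open>z^0\<close>.\<close>

lemma T0: "idn C (Tn 0) = zer C (Tn 0) (Tn 0)"
proof -
  have "\<psi> 0 = zer P X (con C (Tn 0))" using \<psi>_zpow[of 0] P.cmp_idn[OF \<psi>_hom[of 0]] by simp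
  then have "cona C (idn C (Tn 0)) \<cdot>\<^bsub>P\<^esub> \<psi> 0 = cona C (zer C (Tn 0) (Tn 0)) \<cdot>\<^bsub>P\<^esub> \<psi> 0"
    using cona_idn[of "Tn 0"] cona_zer[of "Tn 0" "Tn 0"] P.idn_cmp[OF \<psi>_hom[of 0]] P.zer_cmp[OF \<psi>_hom[of 0], of "con C (Tn 0)"] by simp
  then show ?thesis
    using con_epi_cancel[OF \<psi>_epi \<psi>_hom idn_hom zer_hom] by simp
qed

text \<open>
  The kernels of the \<open>\<zeta> n\<close> form a pro-object, which is killed by the monomorphism \<open>z\<close>.
\<close>

lemma kernel_eventually_zero:
  assumes \<kappa>: "\<And>n. is_kernel C (\<zeta> n) (\<kappa> n)"
  obtains m where "n \<le> m" "(shfa C ^^ d) (tr m n) \<cdot> \<kappa> m = zer C (src C (\<kappa> m)) ((shf C ^^ d) (Tn n))"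
proof -
  define K where "K n = src C (\<kappa> n)" for n
  have \<kappa>h: "\<kappa> n \<in> hom C (K n) ((shf C ^^ d) (Tn n))" "\<zeta> n \<cdot> \<kappa> n = zer C (K n) (Tn (Suc n))" "mono C (\<kappa> n)" for n
  proof -
    obtain L where "\<kappa> n \<in> hom C L ((shf C ^^ d) (Tn n))" "\<zeta> n \<cdot> \<kappa> n = zer C L (Tn (Suc n))" "mono C (\<kappa> n)"
      using kernelE[OF \<kappa> \<zeta>(1)] .
    then show "\<kappa> n \<in> hom C (K n) ((shf C ^^ d) (Tn n))" "\<zeta> n \<cdot> \<kappa> n = zer C (K n) (Tn (Suc n))" "mono C (\<kappa> n)"
      unfolding K_def using homD(2)[of "\<kappa> n" L] by auto
  qed
  have Ko: "K n \<in> obj C" for n using homD(4)[OF \<kappa>h(1)] .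
  have ex: "\<exists>u\<in>hom C (K m) (K n). \<kappa> n \<cdot> u = (shfa C ^^ d) (tr m n) \<cdot> \<kappa> m" if n: "n \<le> m" for m n
  proof -
    have n': "Suc n \<le> Suc m" using n by simp
    have "\<zeta> n \<cdot> ((shfa C ^^ d) (tr m n) \<cdot> \<kappa> m) = (tr (Suc m) (Suc n) \<cdot> \<zeta> m) \<cdot> \<kappa> m"
      using cmp_assoc[OF \<kappa>h(1) Q_tr[OF n] \<zeta>(1)] tr_\<zeta>[OF n] by simp
    also have "\<dots> = zer C (K m) (Tn (Suc n))"
      using cmp_assoc[OF \<kappa>h(1) \<zeta>(1) tr_hom[OF n']] \<kappa>h(2)[of m] cmp_zer[OF tr_hom[OF n'] Ko] by simp
    finally show ?thesis using kernel_factor[OF \<kappa> \<kappa>h(1) cmp_hom[OF \<kappa>h(1) Q_tr[OF n]] \<zeta>(1)] by blast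
  qed
  \<comment> \<open>The maps induced on kernels. As the \<open>\<kappa> n\<close> are mono, these
    maps are unique and therefore functorial.\<close>
  define k where "k m n = (SOME u. u \<in> hom C (K m) (K n) \<and> \<kappa> n \<cdot> u = (shfa C ^^ d) (tr m n) \<cdot> \<kappa> m)" for m n
  have k: "k m n \<in> hom C (K m) (K n) \<and> \<kappa> n \<cdot> k m n = (shfa C ^^ d) (tr m n) \<cdot> \<kappa> m" if n: "n \<le> m" for m n
    unfolding k_def by (rule someI_ex) (use ex[OF n] in blast)
  define num where "num i = (THE n. i = IxNat n)" for i :: "('a, 'm) idx"
  have num [simp]: "num (IxNat n) = n" for n by (simp add: num_def)
  define Kp :: "('o, 'm, 'a) pro_ob" where
    "Kp = \<lparr>pidx = tower_cat, pob = (\<lambda>i. K (num i)), par = (\<lambda>w. k (num (ixfst w)) (num (ixsnd w)))\<rparr>"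
  have Kp_simps [simp]: "pidx Kp = tower_cat" "pob Kp i = K (num i)" "par Kp w = k (num (ixfst w)) (num (ixsnd w))" for i w
    by (simp_all add: Kp_def)
  have k_id: "k n n = idn C (K n)" for n
  proof -
    have "\<kappa> n \<cdot> k n n = \<kappa> n \<cdot> idn C (K n)"
      using k[of n n] tr_id[of n] S.Q_idn[of "Tn n" d] idn_cmp[OF \<kappa>h(1)] cmp_idn[OF \<kappa>h(1)] by simp
    then show ?thesis using mono_cancel[OF \<kappa>h(3,1) _ idn_hom[OF Ko]] k[of n n] by simp
  qed
  have k_cmp: "k m l = k n l \<cdot> k m n" if l: "l \<le> n" "n \<le> m" for l n m
  proof -
    have lm: "l \<le> m" using l by simp
    note kk = k[OF l(1)] k[OF l(2)] k[OF lm]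
    have "\<kappa> l \<cdot> (k n l \<cdot> k m n) = (\<kappa> l \<cdot> k n l) \<cdot> k m n"
      using cmp_assoc[OF conjunct1[OF k[OF l(2)]] conjunct1[OF k[OF l(1)]] \<kappa>h(1)] .
    also have "\<dots> = (shfa C ^^ d) (tr n l) \<cdot> (\<kappa> n \<cdot> k m n)"
      using k[OF l(1)] cmp_assoc[OF conjunct1[OF k[OF l(2)]] \<kappa>h(1) Q_tr[OF l(1)]] by simp
    also have "\<dots> = ((shfa C ^^ d) (tr n l) \<cdot> (shfa C ^^ d) (tr m n)) \<cdot> \<kappa> m"
      using kk cmp_assoc[OF \<kappa>h(1) Q_tr[OF l(2)] Q_tr[OF l(1)]] by simp
    also have "\<dots> = \<kappa> l \<cdot> k m l" using S.Q_cmp[OF tr_hom[OF l(2)] tr_hom[OF l(1)], of d] tr_cmp[OF l] kk by simp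
    finally have e: "\<kappa> l \<cdot> (k n l \<cdot> k m n) = \<kappa> l \<cdot> k m l" .
    have h: "k n l \<cdot> k m n \<in> hom C (K m) (K l)" "k m l \<in> hom C (K m) (K l)" using kk cmp_hom by blast+
    show ?thesis by (rule mono_cancel[OF \<kappa>h(3,1) h e, symmetric])
  qed
  have "is_functor tower_cat C (pob Kp) (par Kp)"
    unfolding is_functor_def
  proof (intro conjI ballI allI)
    fix i :: "('a, 'm) idx" assume "i \<in> obj tower_cat"
    then obtain n where "i = IxNat n" by auto
    then show "pob Kp i \<in> obj C" "par Kp (idn tower_cat i) = idn C (pob Kp i)" using Ko k_id by simp_all
  next
    fix i j u :: "('a, 'm) idx" assume "u \<in> hom tower_cat i j"
    then obtain m n where "n \<le> m" "i = IxNat m" "j = IxNat n" "u = IxPair i j" unfolding hom_tower_cat by blast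
    then show "par Kp u \<in> hom C (pob Kp i) (pob Kp j)" using k by simp
  next
    fix i j l u v :: "('a, 'm) idx" assume "u \<in> hom tower_cat i j" "v \<in> hom tower_cat j l"
    then obtain m n n' where "n \<le> m" "n' \<le> n" "i = IxNat m" "j = IxNat n" "u = IxPair i j" "l = IxNat n'" "v = IxPair j l"
      unfolding hom_tower_cat by auto
    then show "par Kp (v \<cdot>\<^bsub>tower_cat\<^esub> u) = par Kp v \<cdot> par Kp u" using k_cmp[of n' n m] by simp
  qed
  then have Kp: "Kp \<in> pro_objs C" by (simp add: pro_objs_def category_tower cofiltered_tower)
  let ?QT = "(shf P ^^ d) T"
  have QT: "?QT \<in> pro_objs C" and QX: "(shf P ^^ d) X \<in> pro_objs C" using P.Q_obj[of T d] P.Q_obj[of X d] T X by simp_all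
  define f where "f j = \<kappa> (num j)" for j
  have f1: "f j \<in> hom C (pob Kp j) (pob ?QT j)" if j: "j \<in> obj (pidx ?QT)" for j
  proof -
    obtain n where "j = IxNat n" using j by (auto simp: T_idx)
    then show ?thesis using \<kappa>h(1)[of n] by (simp add: f_def Tn_def)
  qed
  have f2: "par ?QT v \<cdot> f j = f j' \<cdot> par Kp v" if "v \<in> hom (pidx ?QT) j j'" for v j j'
  proof -
    have "v \<in> hom tower_cat j j'" using that by (simp add: T_idx)
    then obtain m n where "n \<le> m" "j = IxNat m" "j' = IxNat n" "v = IxPair j j'" unfolding hom_tower_cat by blast
    then show ?thesis using k[of n m] by (simp add: f_def tr_def)
  qed
  define \<kappa>p where "\<kappa>p = pro_map C Kp ?QT (\<lambda>j. {(j, f j)})"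
  have \<kappa>p: "\<kappa>p \<in> hom P Kp ?QT" "\<And>j. j \<in> obj (pidx ?QT) \<Longrightarrow> (j, f j) \<in> pgerm \<kappa>p j"
    using level_map[OF Kp QT, of f, OF _ f1 f2] unfolding \<kappa>p_def by (auto simp: T_idx)
  note q\<phi> = P.Q_hom[OF \<phi>, of d] and q\<phi>i = P.Q_iso[OF \<phi>_iso \<phi>, of d]
  obtain \<iota> where \<iota>: "\<iota> \<in> hom P ?QT ((shf P ^^ d) X)" "(shfa P ^^ d) \<phi> \<cdot>\<^bsub>P\<^esub> \<iota> = idn P ?QT"
    using P.isoE[OF q\<phi>i q\<phi>] by metis
  \<comment> \<open>\<open>\<phi>\<close> identifies \<open>X\<close> with its tower, so the
    levelwise inclusions of kernels become one morphism \<open>L\<close> into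
    \<open>q^d X\<close>.\<close>
  define L where "L = \<iota> \<cdot>\<^bsub>P\<^esub> \<kappa>p"
  have L: "L \<in> hom P Kp ((shf P ^^ d) X)" unfolding L_def using cmpP(1)[OF \<kappa>p(1) \<iota>(1)] .
  have qL: "(shfa P ^^ d) \<phi> \<cdot>\<^bsub>P\<^esub> L = \<kappa>p"
    unfolding L_def using P.cmp_assoc[OF \<kappa>p(1) \<iota>(1) q\<phi>] \<iota>(2) P.idn_cmp[OF \<kappa>p(1)] by simp
  have pm: "pro_proj C T (IxNat n) \<in> hom P T (con C (Tn n))" for n
    using projP(1)[OF T, of "IxNat n"] by (simp add: T_idx Tn_def)
  have \<kappa>n: "(IxNat n, \<kappa> n) \<in> pgerm ((shfa P ^^ d) (\<psi> n) \<cdot>\<^bsub>P\<^esub> L) (IxNat 0)" for n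
  proof -
    have i: "IxNat n \<in> obj (pidx ?QT)" by (simp add: T_idx)
    have "(shfa P ^^ d) (\<psi> n) \<cdot>\<^bsub>P\<^esub> L = ((shfa P ^^ d) (pro_proj C T (IxNat n)) \<cdot>\<^bsub>P\<^esub> (shfa P ^^ d) \<phi>) \<cdot>\<^bsub>P\<^esub> L"
      unfolding \<psi>_def using P.Q_cmp[OF \<phi> pm] by simp
    also have "\<dots> = pro_proj C ?QT (IxNat n) \<cdot>\<^bsub>P\<^esub> \<kappa>p"
      unfolding P.cmp_assoc[OF L q\<phi> P.Q_hom[OF pm], symmetric] qL using Q_proj[OF T, of "IxNat n" d] by (simp add: T_idx)
    finally show ?thesis using rep_proj[OF \<kappa>p(1) \<kappa>p(2)[OF i]] by (simp add: f_def)
  qed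
  have zL: "z \<cdot>\<^bsub>P\<^esub> L \<in> hom P Kp X" using cmpP(1)[OF L z] .
  \<comment> \<open>All projections of \<open>z \<cdot> L\<close> vanish: at level
    \<open>Suc m\<close> the projection is represented by
    \<open>\<zeta> m \<cdot> \<kappa> m\<close>, and at level 0 the target is a zero object.\<close>
  have \<psi>zL: "\<psi> n \<cdot>\<^bsub>P\<^esub> (z \<cdot>\<^bsub>P\<^esub> L) = zer P Kp (con C (Tn n))" for n
  proof (cases n)
    case 0
    have h: "\<psi> 0 \<cdot>\<^bsub>P\<^esub> (z \<cdot>\<^bsub>P\<^esub> L) \<in> hom P Kp (con C (Tn 0))" using cmpP(1)[OF zL \<psi>_hom] .
    have "\<psi> 0 \<cdot>\<^bsub>P\<^esub> (z \<cdot>\<^bsub>P\<^esub> L) = cona C (idn C (Tn 0)) \<cdot>\<^bsub>P\<^esub> (\<psi> 0 \<cdot>\<^bsub>P\<^esub> (z \<cdot>\<^bsub>P\<^esub> L))"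
      using cona_idn[of "Tn 0"] P.idn_cmp[OF h] by simp
    also have "\<dots> = zer P Kp (con C (Tn 0))"
      unfolding T0 using cona_zer[of "Tn 0" "Tn 0"] P.zer_cmp[OF h, of "con C (Tn 0)"] by simp
    finally show ?thesis using 0 by simp
  next
    case (Suc m)
    note qL = cmpP(1)[OF L Q_\<psi>[of d m]]
    have "\<psi> n \<cdot>\<^bsub>P\<^esub> (z \<cdot>\<^bsub>P\<^esub> L) = cona C (\<zeta> m) \<cdot>\<^bsub>P\<^esub> ((shfa P ^^ d) (\<psi> m) \<cdot>\<^bsub>P\<^esub> L)"
      using P.cmp_assoc[OF L z \<psi>_hom, of n] \<zeta>(2)[of m] P.cmp_assoc[OF L Q_\<psi>[of d m] conaP(1)[OF \<zeta>(1)[of m]]] Suc by simp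
    moreover have "(IxNat m, \<zeta> m \<cdot> \<kappa> m) \<in> pgerm (cona C (\<zeta> m) \<cdot>\<^bsub>P\<^esub> ((shfa P ^^ d) (\<psi> m) \<cdot>\<^bsub>P\<^esub> L)) (IxNat 0)"
      using rep_con_cmp[OF qL \<kappa>n \<zeta>(1)] .
    ultimately show ?thesis
      using rep_zeroI[OF cmpP(1)[OF qL conaP(1)[OF \<zeta>(1)[of m]]], of "IxNat m"] \<kappa>h(2)[of m] Suc by simp
  qed
  have "\<phi> \<cdot>\<^bsub>P\<^esub> (z \<cdot>\<^bsub>P\<^esub> L) = \<phi> \<cdot>\<^bsub>P\<^esub> zer P Kp X"
  proof (rule proj_eqI[OF cmpP(1)[OF zL \<phi>] cmpP(1)[OF zerP(1)[OF Kp X] \<phi>]])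
    fix j assume "j \<in> obj (pidx T)"
    then obtain n where j: "j = IxNat n" by (auto simp: T_idx)
    show "pro_proj C T j \<cdot>\<^bsub>P\<^esub> (\<phi> \<cdot>\<^bsub>P\<^esub> (z \<cdot>\<^bsub>P\<^esub> L)) = pro_proj C T j \<cdot>\<^bsub>P\<^esub> (\<phi> \<cdot>\<^bsub>P\<^esub> zer P Kp X)"
      using P.cmp_assoc[OF zL \<phi> pm[of n]] P.cmp_assoc[OF zerP(1)[OF Kp X] \<phi> pm[of n]] \<psi>zL[of n]
        P.cmp_zer[OF \<psi>_hom[of n], of Kp] Kp j unfolding \<psi>_def by simp
  qed
  then have "z \<cdot>\<^bsub>P\<^esub> L = zer P Kp X" using P.iso_cancel_left[OF \<phi>_iso \<phi> zL zerP(1)[OF Kp X]] by blast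
  then have "L = zer P Kp ((shf P ^^ d) X)" using P.mono_zeroD[OF z_mono z L] by blast
  then have "(shfa P ^^ d) (\<psi> n) \<cdot>\<^bsub>P\<^esub> L = zer P Kp (con C ((shf C ^^ d) (Tn n)))"
    using P.cmp_zer[OF Q_\<psi>[of d n], of Kp] Kp by simp
  \<comment> \<open>As \<open>L\<close> vanishes, the germ of \<open>\<kappa> n\<close> is zero, and
    a representative of zero dies at some later index of the tower, which is the required
    \<open>m\<close>.\<close>
  then obtain i u where u: "u \<in> hom (pidx Kp) i (IxNat n)" "\<kappa> n \<cdot> par Kp u = zer C (pob Kp i) ((shf C ^^ d) (Tn n))"
    by (rule rep_zero[OF cmpP(1)[OF L Q_\<psi>[of d n]] \<kappa>n[of n]])
  obtain m where m: "n \<le> m" "i = IxNat m" "u = IxPair i (IxNat n)" using u(1) unfolding Kp_simps hom_tower_cat by auto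
  have "(shfa C ^^ d) (tr m n) \<cdot> \<kappa> m = zer C (src C (\<kappa> m)) ((shf C ^^ d) (Tn n))"
    using u(2) k[OF m(1)] m(2,3) by (simp add: K_def)
  then show ?thesis by (rule that[OF m(1)])
qed

text \<open>Let \<open>x\<close> be killed by \<open>\<zeta> n\<close>, choose \<open>m\<close> such
  that the kernel of \<open>\<zeta> m\<close> restricts to zero on \<open>q^d T_n\<close>, and lift
  \<open>x\<close> to \<open>y\<close> in \<open>q^d T_m\<close>. Then
  \<open>\<zeta> m \<cdot> y\<close> restricts to zero on \<open>T_(n+1)\<close>, so it lies in the
  image of \<open>z^(n+1)\<close>, which is obtained by applying \<open>\<zeta> m\<close> to the
  shifted image of \<open>z^n\<close>. Up to the kernel of \<open>\<zeta> m\<close>, then,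
  \<open>y\<close> comes from the image of \<open>z^n\<close>. Both parts restrict to zero on
  \<open>q^d T_n\<close>, so \<open>x\<close> is zero.\<close>

lemma \<zeta>_mono: "mono C (\<zeta> n)"
proof (rule mono_zeroI[OF \<zeta>(1)])
  fix W x assume x: "x \<in> hom C W ((shf C ^^ d) (Tn n))" "\<zeta> n \<cdot> x = zer C W (Tn (Suc n))"
  have "\<exists>k. is_kernel C (\<zeta> n) k" for n using ex_kernel homD(1)[OF \<zeta>(1)] by blast
  then obtain \<kappa> where \<kappa>: "\<And>n. is_kernel C (\<zeta> n) (\<kappa> n)" by metis
  obtain m where m: "n \<le> m" and km: "(shfa C ^^ d) (tr m n) \<cdot> \<kappa> m = zer C (src C (\<kappa> m)) ((shf C ^^ d) (Tn n))"
    by (rule kernel_eventually_zero[OF \<kappa>])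
  obtain K where K: "\<kappa> m \<in> hom C K ((shf C ^^ d) (Tn m))" "\<zeta> m \<cdot> \<kappa> m = zer C K (Tn (Suc m))"
    using kernelE[OF \<kappa> \<zeta>(1)] by metis
  have Ko: "K \<in> obj C" and Ks: "src C (\<kappa> m) = K" using homD[OF K(1)] by auto
  have m': "Suc n \<le> Suc m" using m by simp
  let ?W = "(shf P ^^ (n * d)) X" and ?t = "(shfa C ^^ d) (tr m n)"
  \<comment> \<open>This stands for the image of \<open>z^n\<close> inside \<open>T_m\<close>; its
    cokernel is \<open>tr m n\<close>. A suitable representative \<open>b\<close> at a single index
    has the same cokernel in \<open>C\<close>.\<close>
  define \<beta> where "\<beta> = \<psi> m \<cdot>\<^bsub>P\<^esub> zpow P d z X n"
  have \<beta>: "\<beta> \<in> hom P ?W (con C (Tn m))" unfolding \<beta>_def using cmpP(1)[OF zpow_hom \<psi>_hom] .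
  have c\<beta>: "is_cokernel P \<beta> (cona C (tr m n))"
    unfolding \<beta>_def by (rule P.cokernel_through_epi[OF \<psi>_cokernel zpow_hom \<psi>_epi \<psi>_hom conaP(1)[OF tr_hom[OF m]] tr_\<psi>[OF m]])
  obtain i b where b: "(i, b) \<in> pgerm \<beta> (IxNat 0)" "b \<in> hom C (pob ?W i) (Tn m)" "is_cokernel C b (tr m n)"
    using con_cokernel[OF \<beta> tr_hom[OF m] c\<beta>] by metis
  have tb: "tr m n \<cdot> b = zer C (pob ?W i) (Tn n)"
    using b(3) homD[OF b(2)] homD[OF tr_hom[OF m]] unfolding is_cokernel_def by simp
  note q\<beta> = P.Q_hom[OF \<beta>, of d]
  have q\<beta>: "(shfa P ^^ d) \<beta> \<in> hom P ((shf P ^^ d) ?W) (con C ((shf C ^^ d) (Tn m)))"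
    using P.Q_hom[OF \<beta>, of d] by (simp add: Q_con)
  \<comment> \<open>The corresponding morphism for \<open>z^(n+1)\<close> into
    \<open>T_(m+1)\<close>. It is \<open>\<zeta> m\<close> after \<open>q^d \<beta>\<close>, so
    \<open>\<zeta> m\<close> after \<open>q^d b\<close> represents it.\<close>
  define \<gamma> where "\<gamma> = \<psi> (Suc m) \<cdot>\<^bsub>P\<^esub> zpow P d z X (Suc n)"
  have \<gamma>: "\<gamma> = cona C (\<zeta> m) \<cdot>\<^bsub>P\<^esub> (shfa P ^^ d) \<beta>"
  proof -
    note q = P.Q_hom[OF zpow_hom, of d n]
    have "\<gamma> = (\<psi> (Suc m) \<cdot>\<^bsub>P\<^esub> z) \<cdot>\<^bsub>P\<^esub> (shfa P ^^ d) (zpow P d z X n)"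
      unfolding \<gamma>_def using P.cmp_assoc[OF q z \<psi>_hom] by simp
    also have "\<dots> = cona C (\<zeta> m) \<cdot>\<^bsub>P\<^esub> ((shfa P ^^ d) (\<psi> m) \<cdot>\<^bsub>P\<^esub> (shfa P ^^ d) (zpow P d z X n))"
      using \<zeta>(2) P.cmp_assoc[OF q Q_\<psi> conaP(1)[OF \<zeta>(1)]] by simp
    finally show ?thesis unfolding \<beta>_def using P.Q_cmp[OF zpow_hom \<psi>_hom] by simp
  qed
  have \<gamma>h: "\<gamma> \<in> hom P ((shf P ^^ d) ?W) (con C (Tn (Suc m)))" unfolding \<gamma> using cmpP(1)[OF q\<beta> conaP(1)[OF \<zeta>(1)]] .
  have c\<gamma>: "is_cokernel P \<gamma> (cona C (tr (Suc m) (Suc n)))"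
    unfolding \<gamma>_def by (rule P.cokernel_through_epi[OF \<psi>_cokernel zpow_hom \<psi>_epi \<psi>_hom conaP(1)[OF tr_hom[OF m']] tr_\<psi>[OF m']])
  let ?b = "(shfa C ^^ d) b"
  have qb: "?b \<in> hom C ((shf C ^^ d) (pob ?W i)) ((shf C ^^ d) (Tn m))" using S.Q_hom[OF b(2)] .
  have rQ: "(i, (shfa C ^^ s) b) \<in> pgerm ((shfa P ^^ s) \<beta>) (IxNat 0)" for s
  proof (induction s)
    case (Suc s) then show ?case using rep_shf(2)[OF P.Q_hom[OF \<beta>, of s]] by simp
  qed (use b in simp)
  have r\<gamma>: "(i, \<zeta> m \<cdot> ?b) \<in> pgerm \<gamma> (IxNat 0)" unfolding \<gamma> using rep_con_cmp[OF q\<beta> rQ \<zeta>(1)] .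
  have tqb: "?t \<cdot> ?b = zer C ((shf C ^^ d) (pob ?W i)) ((shf C ^^ d) (Tn n))"
    using S.Q_cmp[OF b(2) tr_hom[OF m], of d] tb S.Q_zer[of "pob ?W i" "Tn n" d] homD(4)[OF b(2)] by simp
  have "tr (Suc m) (Suc n) \<cdot> (\<zeta> m \<cdot> ?b) = \<zeta> n \<cdot> (?t \<cdot> ?b)"
    using cmp_assoc[OF qb \<zeta>(1) tr_hom[OF m']] tr_\<zeta>[OF m] cmp_assoc[OF qb Q_tr[OF m] \<zeta>(1)] by simp
  also have "\<dots> = zer C (pob ((shf P ^^ d) ?W) i) (Tn (Suc n))" using tqb cmp_zer[OF \<zeta>(1)] homD(4)[OF qb] by simp
  finally have c: "is_cokernel C (\<zeta> m \<cdot> ?b) (tr (Suc m) (Suc n))"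
    using con_cokernel_rep[OF \<gamma>h tr_hom[OF m'] c\<gamma> r\<gamma>] by blast
  note zb = cmp_hom[OF qb \<zeta>(1)]
  \<comment> \<open>A preimage of \<open>x\<close> exists on a cover \<open>w\<close>; the
    conclusion descends because \<open>w\<close> and the later cover \<open>w'\<close> are
    epi.\<close>
  obtain W' w y where w: "epi C w" "w \<in> hom C W' W" "y \<in> hom C W' ((shf C ^^ d) (Tn m))" "?t \<cdot> y = x \<cdot> w"
    using epi_lift[OF S.Q_epi[OF tr_epi[OF m] tr_hom[OF m]] Q_tr[OF m] x(1)] .
  note zy = cmp_hom[OF w(3) \<zeta>(1)]
  have Wo: "W' \<in> obj C" "W \<in> obj C" using homD[OF w(2)] by auto
  have "tr (Suc m) (Suc n) \<cdot> (\<zeta> m \<cdot> y) = \<zeta> n \<cdot> (x \<cdot> w)"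
    using cmp_assoc[OF w(3) \<zeta>(1) tr_hom[OF m']] tr_\<zeta>[OF m] cmp_assoc[OF w(3) Q_tr[OF m] \<zeta>(1)] w(4) by simp
  also have "\<dots> = zer C W' (Tn (Suc n))" using cmp_assoc[OF w(2) x(1) \<zeta>(1)] x(2) zer_cmp[OF w(2)] by simp
  finally obtain W'' w' u where v: "epi C w'" "w' \<in> hom C W'' W'" "u \<in> hom C W'' ((shf C ^^ d) (pob ?W i))"
    "(\<zeta> m \<cdot> ?b) \<cdot> u = (\<zeta> m \<cdot> y) \<cdot> w'"
    using cokernel_lift[OF c zb tr_hom[OF m'] zy] by blast
  have Wo'': "W'' \<in> obj C" using homD[OF v(2)] by auto
  note bu = cmp_hom[OF v(3) qb] and yw = cmp_hom[OF v(2) w(3)]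
  have "\<zeta> m \<cdot> (?b \<cdot> u) = \<zeta> m \<cdot> (y \<cdot> w')"
    using v(4) cmp_assoc[OF v(3) qb \<zeta>(1)] cmp_assoc[OF v(2) w(3) \<zeta>(1)] by simp
  then have "\<zeta> m \<cdot> dif (?b \<cdot> u) (y \<cdot> w') = zer C W'' (Tn (Suc m))"
    using cmp_dif[OF bu yw \<zeta>(1)] dif_eq_0[OF cmp_hom[OF bu \<zeta>(1)] cmp_hom[OF yw \<zeta>(1)]] by simp
  \<comment> \<open>\<open>?b \<cdot> u\<close> and \<open>y \<cdot> w'\<close> differ by an element
    of the kernel of \<open>\<zeta> m\<close>, which the choice of \<open>m\<close> makes vanish
    after \<open>?t\<close>.\<close>
  then obtain v' where v': "v' \<in> hom C W'' K" "\<kappa> m \<cdot> v' = dif (?b \<cdot> u) (y \<cdot> w')"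
    using kernel_factor[OF \<kappa> K(1) dif_hom[OF bu yw] \<zeta>(1)] by blast
  have "?t \<cdot> dif (?b \<cdot> u) (y \<cdot> w') = (?t \<cdot> \<kappa> m) \<cdot> v'" using cmp_assoc[OF v'(1) K(1) Q_tr[OF m]] v'(2) by simp
  also have "\<dots> = zer C W'' ((shf C ^^ d) (Tn n))" using km zer_cmp[OF v'(1) QTn_obj] Ks by simp
  finally have "?t \<cdot> (?b \<cdot> u) = ?t \<cdot> (y \<cdot> w')"
    using cmp_dif[OF bu yw Q_tr[OF m]] dif_eq_0[OF cmp_hom[OF bu Q_tr[OF m]] cmp_hom[OF yw Q_tr[OF m]]] by simp
  moreover have "?t \<cdot> (?b \<cdot> u) = zer C W'' ((shf C ^^ d) (Tn n))"
    using cmp_assoc[OF v(3) qb Q_tr[OF m]] tqb zer_cmp[OF v(3) QTn_obj] by simp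
  ultimately have "(x \<cdot> w) \<cdot> w' = zer C W'' ((shf C ^^ d) (Tn n))"
    using cmp_assoc[OF v(2) w(3) Q_tr[OF m]] w(4) by simp
  then have "x \<cdot> w = zer C W' ((shf C ^^ d) (Tn n))"
    using epi_zeroD[OF v(1,2) cmp_hom[OF w(2) x(1)]] by blast
  then show "x = zer C W ((shf C ^^ d) (Tn n))" using epi_zeroD[OF w(1,2) x(1)] by blast
qed

text \<open>\<open>\<psi> (Suc n) \<cdot> z\<close> has the cokernel \<open>T_(n+1) -> T_1\<close>
  and equals \<open>\<zeta> n\<close> after the epimorphism \<open>q^d \<psi>_n\<close>, so this is
  the cokernel of \<open>\<zeta> n\<close> as well; being mono, \<open>\<zeta> n\<close> is the
  kernel of its cokernel.\<close>

lemma zeta_exact: "short_exact C (\<zeta> n) (tr (Suc n) (Suc 0))"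
proof -
  let ?t = "tr (Suc n) (Suc 0)"
  have t: "?t \<in> hom C (Tn (Suc n)) (Tn (Suc 0))" using tr_hom by simp
  have z1: "zpow P d z X (Suc 0) = z" using P.Q_idn[of X d] P.cmp_idn[OF z] X by simp
  have "is_cokernel P (\<psi> (Suc n) \<cdot>\<^bsub>P\<^esub> z) (cona C ?t)"
    using P.cokernel_through_epi[OF \<psi>_cokernel[of "Suc 0", unfolded z1] z \<psi>_epi \<psi>_hom conaP(1)[OF t] tr_\<psi>] by simp
  then have 1: "is_cokernel P (cona C (\<zeta> n)) (cona C ?t)"
    unfolding \<zeta>(2) using P.cokernel_cmp_epiD[OF _ Q_\<psi>_epi Q_\<psi> conaP(1)[OF \<zeta>(1)]] by blast
  have "cona C (?t \<cdot> \<zeta> n) = zer P (con C ((shf C ^^ d) (Tn n))) (con C (Tn (Suc 0)))"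
    using 1 cona_cmp[OF \<zeta>(1) t] P.homD[OF conaP(1)[OF \<zeta>(1)[of n]]] P.homD[OF conaP(1)[OF t]] unfolding is_cokernel_def by simp
  then have "?t \<cdot> \<zeta> n = zer C ((shf C ^^ d) (Tn n)) (Tn (Suc 0))"
    using cona_eq_zero[OF cmp_hom[OF \<zeta>(1) t]] by blast
  then have "is_cokernel C (\<zeta> n) ?t"
    using con_cokernel_rep[OF conaP(1)[OF \<zeta>(1)] t 1 conaP(2)[OF \<zeta>(1)]] by simp
  then show ?thesis unfolding short_exact_def using mono_kernel_of_cokernel[OF \<zeta>_mono] by blast
qed

end

subsection \<open>Doubly filtered graded objects\<close>

context graded_linear
begin

definition gd where "gd F G = ga F (gs (- 1) G)"

lemma gz_in: "X \<in> Ob \<Longrightarrow> Y \<in> Ob \<Longrightarrow> gz k X Y \<in> GH k X Y"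
  using partial_vector_space.zero_in[OF vector_space] .

lemma ga_in: "F \<in> GH k X Y \<Longrightarrow> G \<in> GH k X Y \<Longrightarrow> ga F G \<in> GH k X Y"
  using partial_vector_space.pl_in[OF vector_space] GH_Ob by metis

lemma gs_in: "F \<in> GH k X Y \<Longrightarrow> gs a F \<in> GH k X Y"
  using partial_vector_space.sc_in[OF vector_space] GH_Ob by metis

lemma gd_in: "F \<in> GH k X Y \<Longrightarrow> G \<in> GH k X Y \<Longrightarrow> gd F G \<in> GH k X Y"
  by (simp add: gd_def ga_in gs_in)

lemma gd_df: "F \<in> GH k X Y \<Longrightarrow> gd F G = partial_vector_space.df ga gs F G"
  using partial_vector_space.df_def[OF vector_space[of X Y k], of F G] GH_Ob[of F k X Y] by (simp add: gd_def)

lemma gd_eq_0: "F \<in> GH k X Y \<Longrightarrow> G \<in> GH k X Y \<Longrightarrow> gd F G = gz k X Y \<longleftrightarrow> F = G"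
  using partial_vector_space.df_eq_0[OF vector_space, of X Y F k G] GH_Ob[of F k X Y]
  by (simp add: gd_df)

lemma gd_zero: "F \<in> GH k X Y \<Longrightarrow> gd F (gz k X Y) = F"
  using partial_vector_space.df_zero[OF vector_space, of X Y F k] GH_Ob[of F k X Y]
  by (simp add: gd_df)

lemma ga_gd: "F \<in> GH k X Y \<Longrightarrow> G \<in> GH k X Y \<Longrightarrow> ga G (gd F G) = F"
  using partial_vector_space.pl_df[OF vector_space, of X Y F k G] GH_Ob[of F k X Y]
  by (simp add: gd_df)

lemma gs_0: "F \<in> GH k X Y \<Longrightarrow> gs 0 F = gz k X Y"
  using partial_vector_space.sc_0[OF vector_space] GH_Ob by metis

lemma gs_gz: "X \<in> Ob \<Longrightarrow> Y \<in> Ob \<Longrightarrow> gs a (gz k X Y) = gz k X Y"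
  using partial_vector_space.sc_zero[OF vector_space] .

lemma gs_gs: "F \<in> GH k X Y \<Longrightarrow> gs a (gs b F) = gs (a * b) F"
  using partial_vector_space.sc_sc[OF vector_space] GH_Ob by metis

lemma gs_1: "F \<in> GH k X Y \<Longrightarrow> gs 1 F = F"
  using partial_vector_space.sc_one[OF vector_space] GH_Ob by metis

lemma gc_gd: "F \<in> GH k X Y \<Longrightarrow> F' \<in> GH k X Y \<Longrightarrow> G \<in> GH l Y Z \<Longrightarrow> gc G (gd F F') = gd (gc G F) (gc G F')"
  by (simp add: gd_def gc_ga[OF _ gs_in] gc_gs)

lemma gc_gz:
  assumes "G \<in> GH l Y Z" "X \<in> Ob" shows "gc G (gz k X Y) = gz (k + l) X Z"
proof -
  have z: "gz k X Y \<in> GH k X Y" using gz_in assms GH_Ob by blast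
  have "gc G (gz k X Y) = gc G (gs 0 (gz k X Y))" using gs_0[OF z] by simp
  also have "\<dots> = gz (k + l) X Z" using gc_gs[OF z assms(1), of 0] gs_0[OF gc_in[OF z assms(1)]] by simp
  finally show ?thesis .
qed

lemma gz_gc:
  assumes "F \<in> GH k X Y" "Z \<in> Ob" shows "gc (gz l Y Z) F = gz (k + l) X Z"
proof -
  have z: "gz l Y Z \<in> GH l Y Z" using gz_in assms GH_Ob by blast
  have "gc (gz l Y Z) F = gc (gs 0 (gz l Y Z)) F" using gs_0[OF z] by simp
  also have "\<dots> = gz (k + l) X Z" using gs_gc[OF assms(1) z, of 0] gs_0[OF gc_in[OF assms(1) z]] by simp
  finally show ?thesis .
qed

lemma gc_zero_object:
  assumes "gi Y = gz 0 Y Y" "F \<in> GH k X Y" shows "F = gz k X Y"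
  using gi_gc[OF assms(2)] gz_gc[OF assms(2), of Y 0] GH_Ob[OF assms(2)] assms(1) by simp

end

text \<open>\<open>Z a b\<close> plays the quotient of \<open>Y\<close> by \<open>y1^a\<close> and
  \<open>y2^b\<close>, so that \<open>Z 0 b\<close> and \<open>Z a 0\<close> are zero, and
  \<open>s1\<close>, \<open>s2\<close> are multiplication by a variable into the next quotient.
  \<open>K\<close> collects the constant objects: morphisms out of \<open>Y\<close> and the
  \<open>Z a b\<close> are controlled when they end in \<open>K\<close> (\<open>factor\<close>,
  \<open>r_epi\<close>, \<open>cok1\<close>, \<open>cok2\<close>), while morphisms into them are
  allowed from any object. The axioms are symmetric in the two variables.\<close>

locale bitower = graded_linear Ob GH gc gi ga gs gz
  for Ob :: "'o set" and GH :: "int \<Rightarrow> 'o \<Rightarrow> 'o \<Rightarrow> 'g set" and gc :: "'g \<Rightarrow> 'g \<Rightarrow> 'g" and gi :: "'o \<Rightarrow> 'g"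
    and ga :: "'g \<Rightarrow> 'g \<Rightarrow> 'g" and gs :: "'k::field \<Rightarrow> 'g \<Rightarrow> 'g" and gz :: "int \<Rightarrow> 'o \<Rightarrow> 'o \<Rightarrow> 'g" +
  fixes K :: "'o set" and Y :: 'o and d1 d2 :: int and y1 y2 :: 'g and Z :: "nat \<Rightarrow> nat \<Rightarrow> 'o" and r :: "nat \<Rightarrow> nat \<Rightarrow> 'g"
    and t :: "nat \<Rightarrow> nat \<Rightarrow> nat \<Rightarrow> nat \<Rightarrow> 'g" and s1 s2 :: "nat \<Rightarrow> nat \<Rightarrow> 'g"
  assumes d1: "0 < d1" and d2: "0 < d2"
    and y1: "y1 \<in> GH d1 Y Y" and y2: "y2 \<in> GH d2 Y Y"
    and K: "K \<subseteq> Ob" and Z: "Z a b \<in> K"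
    and r: "r a b \<in> GH 0 Y (Z a b)"
    and t: "a' \<le> a \<Longrightarrow> b' \<le> b \<Longrightarrow> t a b a' b' \<in> GH 0 (Z a b) (Z a' b')"
    and t_id: "t a b a b = gi (Z a b)"
    and t_t: "a' \<le> a \<Longrightarrow> b' \<le> b \<Longrightarrow> a'' \<le> a' \<Longrightarrow> b'' \<le> b' \<Longrightarrow> gc (t a' b' a'' b'') (t a b a' b') = t a b a'' b''"
    and t_r: "a' \<le> a \<Longrightarrow> b' \<le> b \<Longrightarrow> gc (t a b a' b') (r a b) = r a' b'"
    and s1: "s1 a b \<in> GH d1 (Z a b) (Z (Suc a) b)" and s2: "s2 a b \<in> GH d2 (Z a b) (Z a (Suc b))"
    and r_y1: "gc (r (Suc a) b) y1 = gc (s1 a b) (r a b)" and r_y2: "gc (r a (Suc b)) y2 = gc (s2 a b) (r a b)"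
    and t_s1: "a' \<le> a \<Longrightarrow> b' \<le> b \<Longrightarrow> gc (t (Suc a) b (Suc a') b') (s1 a b) = gc (s1 a' b') (t a b a' b')"
    and t_s2: "a' \<le> a \<Longrightarrow> b' \<le> b \<Longrightarrow> gc (t a (Suc b) a' (Suc b')) (s2 a b) = gc (s2 a' b') (t a b a' b')"
    and s1_s2: "gc (s1 a (Suc b)) (s2 a b) = gc (s2 (Suc a) b) (s1 a b)"
    and zero_left: "gi (Z 0 b) = gz 0 (Z 0 b) (Z 0 b)" and zero_right: "gi (Z a 0) = gz 0 (Z a 0) (Z a 0)"
    and ker1: "F \<in> GH k W (Z (Suc a) b) \<Longrightarrow> gc (t (Suc a) b 1 b) F = gz k W (Z 1 b) \<Longrightarrow>
        \<exists>G\<in>GH (k - d1) W (Z a b). gc (s1 a b) G = F"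
    and ker2: "F \<in> GH k W (Z a (Suc b)) \<Longrightarrow> gc (t a (Suc b) a 1) F = gz k W (Z a 1) \<Longrightarrow>
        \<exists>G\<in>GH (k - d2) W (Z a b). gc (s2 a b) G = F"
    and mono1: "G \<in> GH k W (Z a b) \<Longrightarrow> gc (s1 a b) G = gz (k + d1) W (Z (Suc a) b) \<Longrightarrow> G = gz k W (Z a b)"
    and mono2: "G \<in> GH k W (Z a b) \<Longrightarrow> gc (s2 a b) G = gz (k + d2) W (Z a (Suc b)) \<Longrightarrow> G = gz k W (Z a b)"
    and limit: "W \<in> Ob \<Longrightarrow> (\<And>a b. f a b \<in> GH k W (Z a b)) \<Longrightarrow>
        (\<And>a b a' b'. a' \<le> a \<Longrightarrow> b' \<le> b \<Longrightarrow> gc (t a b a' b') (f a b) = f a' b') \<Longrightarrow>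
        \<exists>G\<in>GH k W Y. \<forall>a b. gc (r a b) G = f a b"
    and separated: "G \<in> GH k W Y \<Longrightarrow> G' \<in> GH k W Y \<Longrightarrow> (\<And>a b. gc (r a b) G = gc (r a b) G') \<Longrightarrow> G = G'"
    and factor: "c \<in> K \<Longrightarrow> F \<in> GH k Y c \<Longrightarrow> \<exists>a b. \<exists>G\<in>GH k (Z a b) c. F = gc G (r a b)"
    and r_epi: "c \<in> K \<Longrightarrow> G \<in> GH k (Z a b) c \<Longrightarrow> gc G (r a b) = gz k Y c \<Longrightarrow> G = gz k (Z a b) c"
    and cok1: "c \<in> K \<Longrightarrow> G \<in> GH k (Z (Suc a) b) c \<Longrightarrow> gc G (s1 a b) = gz (k + d1) (Z a b) c \<Longrightarrow>
        \<exists>H\<in>GH k (Z 1 b) c. gc H (t (Suc a) b 1 b) = G"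
    and cok2: "c \<in> K \<Longrightarrow> G \<in> GH k (Z a (Suc b)) c \<Longrightarrow> gc G (s2 a b) = gz (k + d2) (Z a b) c \<Longrightarrow>
        \<exists>H\<in>GH k (Z a 1) c. gc H (t a (Suc b) a 1) = G"
begin

text \<open>The symmetry serves twice: it yields the statements about the second variable, and it
  matches the variables of \<M> \<otimes> \<N> with those of \<N> \<otimes> \<M>, where they act on
  the opposite factors.\<close>

lemma swap: "bitower Ob GH gc gi ga gs gz K Y d2 d1 y2 y1 (\<lambda>a b. Z b a) (\<lambda>a b. r b a) (\<lambda>a b a' b'. t b a b' a')
   (\<lambda>a b. s2 b a) (\<lambda>a b. s1 b a)"
proof (intro bitower.intro bitower_axioms.intro)
  show "graded_linear Ob GH gc gi ga gs gz" by unfold_locales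
  show "\<exists>G\<in>GH k W Y. \<forall>a b. gc (r b a) G = F a b" if "W \<in> Ob" "\<And>a b. F a b \<in> GH k W (Z b a)"
    "\<And>a b a' b'. a' \<le> a \<Longrightarrow> b' \<le> b \<Longrightarrow> gc (t b a b' a') (F a b) = F a' b'" for F k W
    using limit[of W "\<lambda>a b. F b a" k] that by blast
  show "G = G'" if "G \<in> GH k W Y" "G' \<in> GH k W Y" "\<And>a b. gc (r b a) G = gc (r b a) G'" for G k W G'
    using separated[OF that(1,2)] that(3) by blast
  show "\<exists>a b. \<exists>G\<in>GH k (Z b a) c. F = gc G (r b a)" if "c \<in> K" "F \<in> GH k Y c" for c F k
    using factor[OF that] by blast
qed ((rule d1 d2 y1 y2 K Z r t t_id t_t t_r s1 s2 r_y1 r_y2 t_s1 t_s2 s1_s2[symmetric] zero_left zero_right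
   ker1 ker2 mono1 mono2 r_epi cok1 cok2; assumption)+)

lemma Z_Ob: "Z a b \<in> Ob"
  using K Z by blast

lemma Y_Ob: "Y \<in> Ob"
  using GH_Ob[OF y1] by blast

text \<open>Compared in every quotient: if an index is 0 the target is zero, otherwise
  \<open>r_y1\<close> and \<open>r_y2\<close> reduce the claim to \<open>s1_s2\<close>.\<close>

lemma y1_y2: "gc y1 y2 = gc y2 y1"
proof (rule separated)
  show "gc y1 y2 \<in> GH (d2 + d1) Y Y" "gc y2 y1 \<in> GH (d2 + d1) Y Y"
    using gc_in[OF y2 y1] gc_in[OF y1 y2] by (simp_all add: add.commute)
  fix a b
  consider "a = 0" | "b = 0" | a' b' where "a = Suc a'" "b = Suc b'" by (cases a; cases b) auto
  then show "gc (r a b) (gc y1 y2) = gc (r a b) (gc y2 y1)"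
  proof (cases)
    case 1
    show ?thesis
      using gc_zero_object[OF zero_left gc_in[OF gc_in[OF y2 y1] r[of 0 b]]]
        gc_zero_object[OF zero_left gc_in[OF gc_in[OF y1 y2] r[of 0 b]]] 1 by (simp add: add.commute)
  next
    case 2
    show ?thesis
      using gc_zero_object[OF zero_right gc_in[OF gc_in[OF y2 y1] r[of a 0]]]
        gc_zero_object[OF zero_right gc_in[OF gc_in[OF y1 y2] r[of a 0]]] 2 by (simp add: add.commute)
  next
    case 3
    have "gc (r a b) (gc y1 y2) = gc (gc (s1 a' b) (r a' b)) y2" using gc_assoc[OF y2 y1 r[of a b]] r_y1 3 by simp
    also have "\<dots> = gc (s1 a' b) (gc (s2 a' b') (r a' b'))" unfolding gc_assoc[OF y2 r s1, symmetric] 3 r_y2 ..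
    also have "\<dots> = gc (gc (s2 a b') (s1 a' b')) (r a' b')" unfolding 3 gc_assoc[OF r s2 s1] s1_s2 ..
    also have "\<dots> = gc (s2 a b') (gc (r a b') y1)" unfolding 3 gc_assoc[OF r s1 s2, symmetric] r_y1 ..
    also have "\<dots> = gc (r a b) (gc y2 y1)" unfolding 3 gc_assoc[OF y1 r s2] gc_assoc[OF y1 y2 r] r_y2 ..
    finally show ?thesis .
  qed
qed

text \<open>A morphism from \<open>Y\<close> to a constant object lives on some quotient.
  \<open>r_epi\<close> moves the two vanishing conditions from \<open>y1\<close>, \<open>y2\<close>
  to \<open>s1\<close>, \<open>s2\<close>, whose cokernels are the restrictions to index 1, first in
  one direction and then in the other.\<close>

lemma factor_zero:
  assumes c: "c \<in> K" and F: "F \<in> GH k Y c" and F1: "gc F y1 = gz (k + d1) Y c" and F2: "gc F y2 = gz (k + d2) Y c"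
  shows "\<exists>G\<in>GH k (Z 1 1) c. F = gc G (r 1 1)"
proof -
  have cO: "c \<in> Ob" using c K by blast
  obtain a b G0 where G0: "G0 \<in> GH k (Z a b) c" "F = gc G0 (r a b)" using factor[OF c F] by blast
  \<comment> \<open>One step higher in both directions, so that \<open>s1\<close> and
    \<open>s2\<close> end in the quotient on which the factor is defined.\<close>
  have tt: "t (Suc a) (Suc b) a b \<in> GH 0 (Z (Suc a) (Suc b)) (Z a b)" using t by simp
  define G where "G = gc G0 (t (Suc a) (Suc b) a b)"
  have G: "G \<in> GH k (Z (Suc a) (Suc b)) c" unfolding G_def using gc_in[OF tt G0(1)] by simp
  have FG: "F = gc G (r (Suc a) (Suc b))"
    unfolding G_def G0(2) using gc_assoc[OF r tt G0(1)] t_r[of a "Suc a" b "Suc b"] by simp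
  have "gc (gc G (s1 a (Suc b))) (r a (Suc b)) = gz (k + d1) Y c"
    using gc_assoc[OF r s1 G] r_y1[of a "Suc b"] gc_assoc[OF y1 r G] FG F1 by simp
  then have "gc G (s1 a (Suc b)) = gz (k + d1) (Z a (Suc b)) c"
    using r_epi[OF c, of "gc G (s1 a (Suc b))" "k + d1"] gc_in[OF s1 G] by (simp add: add.commute)
  then obtain H where H: "H \<in> GH k (Z 1 (Suc b)) c" "gc H (t (Suc a) (Suc b) 1 (Suc b)) = G"
    using cok1[OF c G] by blast
  have t1: "t (Suc a) (Suc b) 1 (Suc b) \<in> GH 0 (Z (Suc a) (Suc b)) (Z 1 (Suc b))" using t by simp
  have FH: "F = gc H (r 1 (Suc b))" using FG H gc_assoc[OF r t1 H(1)] t_r[of 1 "Suc a" "Suc b" "Suc b"] by simp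
  have "gc (gc H (s2 1 b)) (r 1 b) = gz (k + d2) Y c"
    using gc_assoc[OF r s2 H(1)] r_y2[of 1 b] gc_assoc[OF y2 r H(1)] FH F2 by simp
  then have "gc H (s2 1 b) = gz (k + d2) (Z 1 b) c"
    using r_epi[OF c, of "gc H (s2 1 b)" "k + d2"] gc_in[OF s2 H(1)] by (simp add: add.commute)
  then obtain L where L: "L \<in> GH k (Z 1 1) c" "gc L (t 1 (Suc b) 1 1) = H"
    using cok2[OF c H(1)] by blast
  have t2: "t 1 (Suc b) 1 1 \<in> GH 0 (Z 1 (Suc b)) (Z 1 1)" using t by simp
  have "F = gc L (r 1 1)" using FH L gc_assoc[OF r t2 L(1)] t_r[of 1 1 1 "Suc b"] by simp
  then show ?thesis using L by blast
qed

text \<open>The endomorphism of \<open>Z a b\<close> induced by \<open>y1\<close>, see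
  \<open>r_w1\<close>: multiply into the next quotient and restrict back.\<close>

definition w1 where "w1 a b = gc (t (Suc a) b a b) (s1 a b)"
definition w2 where "w2 a b = gc (t a (Suc b) a b) (s2 a b)"

lemma w1: "w1 a b \<in> GH d1 (Z a b) (Z a b)"
  using gc_in[OF s1 t[of a "Suc a" b b]] by (simp add: w1_def)

lemma r_w1: "gc (r a b) y1 = gc (w1 a b) (r a b)"
proof -
  have tt: "t (Suc a) b a b \<in> GH 0 (Z (Suc a) b) (Z a b)" using t by simp
  have "gc (r a b) y1 = gc (gc (t (Suc a) b a b) (r (Suc a) b)) y1" using t_r[of a "Suc a" b b] by simp
  also have "\<dots> = gc (w1 a b) (r a b)"
    unfolding w1_def using gc_assoc[OF y1 r tt] gc_assoc[OF r s1 tt] r_y1 by simp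
  finally show ?thesis .
qed

lemma t_w1:
  assumes "a' \<le> a" "b' \<le> b" shows "gc (t a b a' b') (w1 a b) = gc (w1 a' b') (t a b a' b')"
proof -
  have 1: "t (Suc a) b a b \<in> GH 0 (Z (Suc a) b) (Z a b)" and 2: "t a b a' b' \<in> GH 0 (Z a b) (Z a' b')"
    and 3: "t (Suc a') b' a' b' \<in> GH 0 (Z (Suc a') b') (Z a' b')"
    and 4: "t (Suc a) b (Suc a') b' \<in> GH 0 (Z (Suc a) b) (Z (Suc a') b')" using t assms by simp_all
  have "gc (t a b a' b') (w1 a b) = gc (t (Suc a) b a' b') (s1 a b)"
    unfolding w1_def using gc_assoc[OF s1 1 2] t_t[of a "Suc a" b b a' b'] assms by simp
  also have "\<dots> = gc (t (Suc a') b' a' b') (gc (t (Suc a) b (Suc a') b') (s1 a b))"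
    using gc_assoc[OF s1 4 3] t_t[of "Suc a'" "Suc a" b' b a' b'] assms by simp
  also have "\<dots> = gc (w1 a' b') (t a b a' b')"
    unfolding w1_def using t_s1[OF assms] gc_assoc[OF 2 s1 3] by simp
  finally show ?thesis .
qed

lemma w1_s1: "gc (w1 (Suc a) b) (s1 a b) = gc (s1 a b) (w1 a b)"
proof -
  have 1: "t (Suc a) b a b \<in> GH 0 (Z (Suc a) b) (Z a b)" using t by simp
  show ?thesis unfolding w1_def using t_s1[of a "Suc a" b b] gc_assoc[OF s1 1 s1] by simp
qed

lemma w2_s1: "gc (w2 (Suc a) b) (s1 a b) = gc (s1 a b) (w2 a b)"
proof -
  have 1: "t (Suc a) (Suc b) (Suc a) b \<in> GH 0 (Z (Suc a) (Suc b)) (Z (Suc a) b)"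
    and 2: "t a (Suc b) a b \<in> GH 0 (Z a (Suc b)) (Z a b)" using t by simp_all
  have "gc (w2 (Suc a) b) (s1 a b) = gc (t (Suc a) (Suc b) (Suc a) b) (gc (s1 a (Suc b)) (s2 a b))"
    unfolding w2_def using gc_assoc[OF s1 s2 1] s1_s2 by simp
  also have "\<dots> = gc (s1 a b) (w2 a b)"
    unfolding w2_def using gc_assoc[OF s2 s1 1] t_s1[of a a b "Suc b"] gc_assoc[OF s2 2 s1] by simp
  finally show ?thesis .
qed

text \<open>The endomorphism factors through \<open>Z 0 b\<close>, which is zero.\<close>

lemma w1_1: "w1 1 b = gz d1 (Z 1 b) (Z 1 b)"
proof -
  have 1: "t 1 b 0 b \<in> GH 0 (Z 1 b) (Z 0 b)" using t by simp
  have "w1 1 b = gc (s1 0 b) (t 1 b 0 b)" unfolding w1_def using t_s1[of 0 1 b b] by simp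
  then show ?thesis using gc_zero_object[OF zero_left 1] gc_gz[OF s1[of 0 b], of "Z 1 b" 0] Z_Ob by simp
qed

lemma s1_cancel:
  assumes "G \<in> GH k W (Z a b)" "G' \<in> GH k W (Z a b)" "gc (s1 a b) G = gc (s1 a b) G'" shows "G = G'"
proof -
  have "gc (s1 a b) (gd G G') = gz (k + d1) W (Z (Suc a) b)"
    using gc_gd[OF assms(1,2) s1] gd_eq_0[OF gc_in[OF assms(1) s1] gc_in[OF assms(2) s1]] assms(3) by simp
  then show ?thesis using mono1[OF gd_in[OF assms(1,2)]] gd_eq_0[OF assms(1,2)] by blast
qed

end

section \<open>Equivariant morphisms into \<open>Y\<close> and its quotients\<close>

locale bitower_hom = bitower +
  fixes X :: 'a and x1 x2 :: 'b
  assumes x1: "x1 \<in> GH d1 X X" and x2: "x2 \<in> GH d2 X X"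
begin

definition U where
  "U a b k = {F \<in> GH k X (Z a b). gc F x1 = gc (w1 a b) F \<and> gc F x2 = gc (w2 a b) F}"

definition H where
  "H k = {F \<in> GH k X Y. gc F x1 = gc y1 F \<and> gc F x2 = gc y2 F}"

lemma X_Ob: "X \<in> Ob"
  using GH_Ob[OF x1] by blast

lemma swap_hom: "bitower_hom Ob GH gc gi ga gs gz K Y d2 d1 y2 y1 (\<lambda>a b. Z b a) (\<lambda>a b. r b a) (\<lambda>a b a' b'. t b a b' a')
   (\<lambda>a b. s2 b a) (\<lambda>a b. s1 b a) X x2 x1"
  by (intro bitower_hom.intro bitower_hom_axioms.intro swap x1 x2)

text \<open>Facts about \<open>w2\<close> are those about \<open>w1\<close> in the swapped
  structure; the rewrite rules make the swapped constants appear under their own names.\<close>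

sublocale sw: bitower Ob GH gc gi ga gs gz K Y d2 d1 y2 y1 "\<lambda>a b. Z b a" "\<lambda>a b. r b a" "\<lambda>a b a' b'. t b a b' a'"
   "\<lambda>a b. s2 b a" "\<lambda>a b. s1 b a"
  rewrites "sw.w1 = (\<lambda>a b. w2 b a)" and "sw.w2 = (\<lambda>a b. w1 b a)"
proof -
  show "bitower Ob GH gc gi ga gs gz K Y d2 d1 y2 y1 (\<lambda>a b. Z b a) (\<lambda>a b. r b a) (\<lambda>a b a' b'. t b a b' a')
   (\<lambda>a b. s2 b a) (\<lambda>a b. s1 b a)" by (rule swap)
  then interpret S: bitower Ob GH gc gi ga gs gz K Y d2 d1 y2 y1 "\<lambda>a b. Z b a" "\<lambda>a b. r b a" "\<lambda>a b a' b'. t b a b' a'"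
   "\<lambda>a b. s2 b a" "\<lambda>a b. s1 b a" .
  show "S.w1 = (\<lambda>a b. w2 b a)" "S.w2 = (\<lambda>a b. w1 b a)" by (simp_all add: fun_eq_iff S.w1_def S.w2_def w1_def w2_def)
qed

lemma U_GH: "F \<in> U a b k \<Longrightarrow> F \<in> GH k X (Z a b)"
  by (simp add: U_def)

lemma U_vector_space: "partial_vector_space (U a b k) ga gs (gz k X (Z a b))"
proof (rule partial_vector_space_mono[OF vector_space[OF X_Ob Z_Ob]])
  show "U a b k \<subseteq> GH k X (Z a b)" by (auto simp: U_def)
  show "gz k X (Z a b) \<in> U a b k"
    unfolding U_def using gz_in[OF X_Ob Z_Ob] gz_gc[OF x1 Z_Ob] gz_gc[OF x2 Z_Ob] gc_gz[OF w1 X_Ob] gc_gz[OF sw.w1 X_Ob]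
    by (simp add: add.commute)
  show "ga F G \<in> U a b k" if "F \<in> U a b k" "G \<in> U a b k" for F G
  proof -
    have h: "F \<in> GH k X (Z a b)" "G \<in> GH k X (Z a b)" using that by (auto simp: U_def)
    show ?thesis
      using that ga_in[OF h] ga_gc[OF x1 h] ga_gc[OF x2 h] gc_ga[OF h w1] gc_ga[OF h sw.w1] by (simp add: U_def)
  qed
  show "gs c F \<in> U a b k" if "F \<in> U a b k" for F c
  proof -
    have h: "F \<in> GH k X (Z a b)" using that by (auto simp: U_def)
    show ?thesis
      using that gs_in[OF h] gs_gc[OF x1 h] gs_gc[OF x2 h] gc_gs[OF h w1] gc_gs[OF h sw.w1] by (simp add: U_def)
  qed
qed

lemma U_gz: "gz k X (Z a b) \<in> U a b k"
  using partial_vector_space.zero_in[OF U_vector_space] .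

lemma U_gs: "F \<in> U a b k \<Longrightarrow> gs c F \<in> U a b k"
  using partial_vector_space.sc_in[OF U_vector_space] .

lemma U_gd: "F \<in> U a b k \<Longrightarrow> G \<in> U a b k \<Longrightarrow> gd F G \<in> U a b k"
  using partial_vector_space.pl_in[OF U_vector_space] U_gs by (simp add: gd_def)

lemma U_t:
  assumes F: "F \<in> U a b k" and ab: "a' \<le> a" "b' \<le> b" shows "gc (t a b a' b') F \<in> U a' b' k"
proof -
  note tt = t[OF ab] and F' = U_GH[OF F]
  have "gc (gc (t a b a' b') F) x1 = gc (w1 a' b') (gc (t a b a' b') F)"
    using gc_assoc[OF x1 F' tt] gc_assoc[OF F' w1 tt] gc_assoc[OF F' tt w1] t_w1[OF ab] F by (simp add: U_def)
  moreover have "gc (gc (t a b a' b') F) x2 = gc (w2 a' b') (gc (t a b a' b') F)"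
    using gc_assoc[OF x2 F' tt] gc_assoc[OF F' sw.w1 tt] gc_assoc[OF F' tt sw.w1] sw.t_w1[OF ab(2,1)] F by (simp add: U_def)
  ultimately show ?thesis using gc_in[OF F' tt] by (simp add: U_def)
qed

lemma U_s1:
  assumes F: "F \<in> U a b k" shows "gc (s1 a b) F \<in> U (Suc a) b (k + d1)"
proof -
  note F' = U_GH[OF F]
  have "gc (gc (s1 a b) F) x1 = gc (w1 (Suc a) b) (gc (s1 a b) F)"
    using gc_assoc[OF x1 F' s1] gc_assoc[OF F' w1 s1] gc_assoc[OF F' s1 w1] w1_s1 F by (simp add: U_def)
  moreover have "gc (gc (s1 a b) F) x2 = gc (w2 (Suc a) b) (gc (s1 a b) F)"
    using gc_assoc[OF x2 F' s1] gc_assoc[OF F' sw.w1 s1] gc_assoc[OF F' s1 sw.w1] w2_s1 F by (simp add: U_def)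
  ultimately show ?thesis using gc_in[OF F' s1] by (simp add: U_def)
qed

text \<open>The kernel axiom gives a quotient \<open>G\<close> without regard to equivariance.
  \<open>G\<close> inherits equivariance because \<open>s1\<close> commutes with \<open>w1\<close>
  and \<open>w2\<close> and can be cancelled.\<close>

lemma U_div1:
  assumes F: "F \<in> U (Suc a) b k" and z: "gc (t (Suc a) b 1 b) F = gz k X (Z 1 b)"
  shows "\<exists>G\<in>U a b (k - d1). gc (s1 a b) G = F"
proof -
  obtain G where G: "G \<in> GH (k - d1) X (Z a b)" "gc (s1 a b) G = F" using ker1[OF U_GH[OF F] z] by blast
  have "gc (s1 a b) (gc G x1) = gc (s1 a b) (gc (w1 a b) G)"
    using gc_assoc[OF x1 G(1) s1] gc_assoc[OF G(1) w1 s1] gc_assoc[OF G(1) s1 w1] w1_s1 F G(2) by (simp add: U_def)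
  then have 1: "gc G x1 = gc (w1 a b) G" 
    using s1_cancel[of "gc G x1" k X a b] gc_in[OF x1 G(1)] gc_in[OF G(1) w1] by simp
  have "gc (s1 a b) (gc G x2) = gc (s1 a b) (gc (w2 a b) G)"
    using gc_assoc[OF x2 G(1) s1] gc_assoc[OF G(1) sw.w1 s1] gc_assoc[OF G(1) s1 sw.w1] w2_s1 F G(2) by (simp add: U_def)
  moreover have "d2 + (k - d1) = k - d1 + d2" by simp
  ultimately have "gc G x2 = gc (w2 a b) G"
    using s1_cancel[OF gc_in[OF x2 G(1)], of "gc (w2 a b) G"] gc_in[OF G(1) sw.w1[of a b]] by metis
  then show ?thesis using 1 G by (auto simp: U_def)
qed

lemma H_U: 
  assumes F: "F \<in> H k" shows "gc (r a b) F \<in> U a b k"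
proof -
  have F': "F \<in> GH k X Y" using F by (simp add: H_def)
  have "gc (gc (r a b) F) x1 = gc (w1 a b) (gc (r a b) F)"
    using gc_assoc[OF x1 F' r] gc_assoc[OF F' y1 r] gc_assoc[OF F' r w1] r_w1 F by (simp add: H_def)
  moreover have "gc (gc (r a b) F) x2 = gc (w2 a b) (gc (r a b) F)"
    using gc_assoc[OF x2 F' r] gc_assoc[OF F' y2 r] gc_assoc[OF F' r sw.w1] sw.r_w1 F by (simp add: H_def)
  ultimately show ?thesis using gc_in[OF F' r] by (simp add: U_def)
qed

lemma H_t: "F \<in> H k \<Longrightarrow> a' \<le> a \<Longrightarrow> b' \<le> b \<Longrightarrow> gc (t a b a' b') (gc (r a b) F) = gc (r a' b') F"
  using gc_assoc[of F k X Y "r a b" 0 "Z a b" "t a b a' b'" 0 "Z a' b'"] r t[of a' a b' b] t_r[of a' a b' b] by (simp add: H_def)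

text \<open>The limit property gives the morphism, and its equivariance may be checked in every
  quotient by \<open>separated\<close>.\<close>

lemma glue:
  assumes F: "\<And>a b. F a b \<in> U a b k" and c: "\<And>a b a' b'. a' \<le> a \<Longrightarrow> b' \<le> b \<Longrightarrow> gc (t a b a' b') (F a b) = F a' b'"
  shows "\<exists>G\<in>H k. \<forall>a b. gc (r a b) G = F a b"
proof -
  obtain G where G: "G \<in> GH k X Y" "\<And>a b. gc (r a b) G = F a b" using limit[of X F k] U_GH[OF F] c X_Ob by blast
  have "gc G x1 = gc y1 G"
  proof (rule separated)
    show "gc G x1 \<in> GH (k + d1) X Y" "gc y1 G \<in> GH (k + d1) X Y" using gc_in[OF x1 G(1)] gc_in[OF G(1) y1] by (simp_all add: add.commute)
    show "gc (r a b) (gc G x1) = gc (r a b) (gc y1 G)" for a b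
      using gc_assoc[OF x1 G(1) r] gc_assoc[OF G(1) y1 r] gc_assoc[OF G(1) r w1] r_w1 G(2) F[of a b] by (simp add: U_def)
  qed
  moreover have "gc G x2 = gc y2 G"
  proof (rule separated)
    show "gc G x2 \<in> GH (k + d2) X Y" "gc y2 G \<in> GH (k + d2) X Y" using gc_in[OF x2 G(1)] gc_in[OF G(1) y2] by (simp_all add: add.commute)
    show "gc (r a b) (gc G x2) = gc (r a b) (gc y2 G)" for a b
      using gc_assoc[OF x2 G(1) r] gc_assoc[OF G(1) y2 r] gc_assoc[OF G(1) r sw.w1] sw.r_w1 G(2) F[of a b] by (simp add: U_def)
  qed
  ultimately show ?thesis using G by (auto simp: H_def)
qed

lemma H_GH: "F \<in> H k \<Longrightarrow> F \<in> GH k X Y"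
  by (simp add: H_def)

lemma H_vector_space: "partial_vector_space (H k) ga gs (gz k X Y)"
proof (rule partial_vector_space_mono[OF vector_space[OF X_Ob Y_Ob]])
  show "H k \<subseteq> GH k X Y" by (auto simp: H_def)
  show "gz k X Y \<in> H k"
    unfolding H_def using gz_in[OF X_Ob Y_Ob] gz_gc[OF x1 Y_Ob] gz_gc[OF x2 Y_Ob] gc_gz[OF y1 X_Ob] gc_gz[OF y2 X_Ob]
    by (simp add: add.commute)
  show "ga F G \<in> H k" if "F \<in> H k" "G \<in> H k" for F G
  proof -
    have h: "F \<in> GH k X Y" "G \<in> GH k X Y" using that by (auto simp: H_def)
    show ?thesis
      using that ga_in[OF h] ga_gc[OF x1 h] ga_gc[OF x2 h] gc_ga[OF h y1] gc_ga[OF h y2] by (simp add: H_def)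
  qed
  show "gs c F \<in> H k" if "F \<in> H k" for F c
  proof -
    have h: "F \<in> GH k X Y" using that by (auto simp: H_def)
    show ?thesis
      using that gs_in[OF h] gs_gc[OF x1 h] gs_gc[OF x2 h] gc_gs[OF h y1] gc_gs[OF h y2] by (simp add: H_def)
  qed
qed

lemma H_gz: "gz k X Y \<in> H k"
  using partial_vector_space.zero_in[OF H_vector_space] .

lemma H_gs: "F \<in> H k \<Longrightarrow> gs c F \<in> H k"
  using partial_vector_space.sc_in[OF H_vector_space] .

lemma H_ga: "F \<in> H k \<Longrightarrow> G \<in> H k \<Longrightarrow> ga F G \<in> H k"
  using partial_vector_space.pl_in[OF H_vector_space] .

lemma H_gd: "F \<in> H k \<Longrightarrow> G \<in> H k \<Longrightarrow> gd F G \<in> H k"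
  using H_ga H_gs by (simp add: gd_def)

lemma H_y1:
  assumes F: "F \<in> H k" shows "gc y1 F \<in> H (k + d1)"
proof -
  note F' = H_GH[OF F]
  have "gc (gc y1 F) x1 = gc y1 (gc y1 F)" using gc_assoc[OF x1 F' y1] F by (simp add: H_def)
  moreover have "gc (gc y1 F) x2 = gc y2 (gc y1 F)"
    using gc_assoc[OF x2 F' y1] gc_assoc[OF F' y2 y1] gc_assoc[OF F' y1 y2] y1_y2 F by (simp add: H_def)
  ultimately show ?thesis using gc_in[OF F' y1] by (simp add: H_def)
qed

lemma U_zero_left: "F \<in> U 0 b k \<Longrightarrow> F = gz k X (Z 0 b)"
  using gc_zero_object[OF zero_left U_GH] .

lemma U_zero_right: "F \<in> U a 0 k \<Longrightarrow> F = gz k X (Z a 0)"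
  using gc_zero_object[OF zero_right U_GH] .

text \<open>Divisibility by \<open>y1\<close> is tested on the quotients \<open>Z 1 b\<close>. The
  quotients found level by level are compatible because \<open>s1\<close> can be cancelled, so they
  glue. Level \<open>a\<close> of the result comes from level \<open>Suc a\<close> of
  \<open>F\<close>, and level 0 is zero anyway.\<close>

lemma H_div1:
  assumes F: "F \<in> H k" and z: "\<And>b. gc (r 1 b) F = gz k X (Z 1 b)"
  shows "\<exists>G\<in>H (k - d1). gc y1 G = F"
proof -
  have "\<exists>G\<in>U a b (k - d1). gc (s1 a b) G = gc (r (Suc a) b) F" for a b
    using U_div1[OF H_U[OF F]] H_t[OF F, of 1 "Suc a" b b] z by simp
  then obtain g where g: "\<And>a b. g a b \<in> U a b (k - d1)" "\<And>a b. gc (s1 a b) (g a b) = gc (r (Suc a) b) F" by metis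
  have c: "gc (t a b a' b') (g a b) = g a' b'" if ab: "a' \<le> a" "b' \<le> b" for a b a' b'
  proof (rule s1_cancel[OF gc_in[OF U_GH[OF g(1)] t[OF ab]]])
    show "g a' b' \<in> GH (k - d1 + 0) X (Z a' b')" using U_GH[OF g(1)] by simp
    have t': "t (Suc a) b (Suc a') b' \<in> GH 0 (Z (Suc a) b) (Z (Suc a') b')" using t ab by simp
    have "gc (s1 a' b') (gc (t a b a' b') (g a b)) = gc (t (Suc a) b (Suc a') b') (gc (s1 a b) (g a b))"
      using gc_assoc[OF U_GH[OF g(1)] t[OF ab] s1] gc_assoc[OF U_GH[OF g(1)] s1 t'] t_s1[OF ab] by simp
    also have "\<dots> = gc (s1 a' b') (g a' b')" using g(2) H_t[OF F, of "Suc a'" "Suc a" b' b] ab by simp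
    finally show "gc (s1 a' b') (gc (t a b a' b') (g a b)) = gc (s1 a' b') (g a' b')" .
  qed
  obtain G where G: "G \<in> H (k - d1)" "\<And>a b. gc (r a b) G = g a b" using glue[OF g(1) c] by blast
  have "gc y1 G = F"
  proof (rule separated)
    show "gc y1 G \<in> GH k X Y" "F \<in> GH k X Y" using H_GH[OF H_y1[OF G(1)]] H_GH[OF F] by simp_all
    fix a b
    show "gc (r a b) (gc y1 G) = gc (r a b) F"
    proof (cases a)
      case 0
      then show ?thesis using U_zero_left[OF H_U[OF F]] U_zero_left[OF H_U[OF H_y1[OF G(1)]]] by simp
    next
      case (Suc a')
      then show ?thesis
        using gc_assoc[OF H_GH[OF G(1)] y1 r] r_y1 gc_assoc[OF H_GH[OF G(1)] r s1] G(2) g(2) by simp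
    qed
  qed
  then show ?thesis using G by blast
qed

lemma H_zero: "F \<in> H k \<Longrightarrow> (\<And>a b. gc (r a b) F = gz k X (Z a b)) \<Longrightarrow> F = gz k X Y"
  using separated[OF H_GH H_GH[OF H_gz]] gc_gz[OF r X_Ob] by simp

text \<open>If \<open>F\<close> vanishes on all \<open>Z 1 b\<close>, it is divisible by
  \<open>y1\<close>, and the quotient is nonzero already at a level with \<open>a\<close> one
  smaller. This cannot continue, because \<open>Z 0 b\<close> is zero.\<close>

lemma nonzero_reduce:
  assumes "F \<in> H k" "F \<noteq> gz k X Y"
  shows "\<exists>k' b. \<exists>F'\<in>H k'. gc (r 1 b) F' \<noteq> gz k' X (Z 1 b)"
proof -
  obtain a b where "gc (r a b) F \<noteq> gz k X (Z a b)" using assms H_zero by blast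
  then show ?thesis using assms(1)
  proof (induction a arbitrary: F k)
    case 0 then show ?case using U_zero_left[OF H_U] by blast
  next
    case (Suc a)
    show ?case
    proof (cases "\<forall>b. gc (r 1 b) F = gz k X (Z 1 b)")
      case True
      then obtain G where G: "G \<in> H (k - d1)" "gc y1 G = F" using H_div1[OF Suc.prems(2)] by blast
      have "gc (s1 a b) (gc (r a b) G) \<noteq> gz k X (Z (Suc a) b)"
        using Suc.prems(1) G gc_assoc[OF H_GH[OF G(1)] y1 r] r_y1 gc_assoc[OF H_GH[OF G(1)] r s1] by metis
      then have "gc (r a b) G \<noteq> gz (k - d1) X (Z a b)" using gc_gz[OF s1[of a b] X_Ob, of "k - d1"] by auto
      then show ?thesis using Suc.IH G(1) by blast
    qed (use Suc.prems in blast)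
  qed
qed

lemma
  shows U_div2: "F \<in> U a (Suc b) k \<Longrightarrow> gc (t a (Suc b) a 1) F = gz k X (Z a 1) \<Longrightarrow>
      \<exists>G\<in>U a b (k - d2). gc (s2 a b) G = F"
    and H_y2: "F \<in> H k \<Longrightarrow> gc y2 F \<in> H (k + d2)"
    and H_div2: "F \<in> H k \<Longrightarrow> (\<And>a. gc (r a 1) F = gz k X (Z a 1)) \<Longrightarrow> \<exists>G\<in>H (k - d2). gc y2 G = F"
proof -
  interpret S: bitower_hom Ob GH gc gi ga gs gz K Y d2 d1 y2 y1 "\<lambda>a b. Z b a" "\<lambda>a b. r b a" "\<lambda>a b a' b'. t b a b' a'"
   "\<lambda>a b. s2 b a" "\<lambda>a b. s1 b a" X x2 x1 by (rule swap_hom)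
  have w: "bitower.w1 gc (\<lambda>a b a' b'. t b a b' a') (\<lambda>a b. s2 b a) a b = w2 b a"
    "bitower.w2 gc (\<lambda>a b a' b'. t b a b' a') (\<lambda>a b. s1 b a) a b = w1 b a" for a b
    by (simp_all add: bitower.w1_def[OF swap] bitower.w2_def[OF swap] w1_def w2_def)
  have U: "S.U a b k = U b a k" and H: "S.H k = H k" for a b k
    by (auto simp: S.U_def U_def S.H_def H_def w)
  show "F \<in> U a (Suc b) k \<Longrightarrow> gc (t a (Suc b) a 1) F = gz k X (Z a 1) \<Longrightarrow> \<exists>G\<in>U a b (k - d2). gc (s2 a b) G = F"
    using S.U_div1[unfolded U] .
  show "F \<in> H k \<Longrightarrow> gc y2 F \<in> H (k + d2)"
    using S.H_y1[unfolded H] .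
  show "F \<in> H k \<Longrightarrow> (\<And>a. gc (r a 1) F = gz k X (Z a 1)) \<Longrightarrow> \<exists>G\<in>H (k - d2). gc y2 G = F"
    using S.H_div1[unfolded H] .
qed

lemma U_11: "F \<in> U 1 1 k \<Longrightarrow> F \<in> GH k X (Z 1 1) \<and> gc F x1 = gz (k + d1) X (Z 1 1) \<and> gc F x2 = gz (k + d2) X (Z 1 1)"
  using w1_1[of 1] sw.w1_1[of 1] gz_gc[of F k X "Z 1 1" "Z 1 1"] Z_Ob by (auto simp: U_def)

end

text \<open>The hypothesis on HOM in \<open>C\<close>, read on \<open>Z 1 1\<close>: the equivariant
  morphisms there are the multiples of \<open>R0\<close>, all of degree \<open>c\<close>. This
  degree is where every process of division stops.\<close>

locale bitower_line = bitower_hom +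
  fixes c :: int and R0 :: 'b
  assumes only_c: "F \<in> U 1 1 k \<Longrightarrow> k \<noteq> c \<Longrightarrow> F = gz k X (Z 1 1)"
    and line: "F \<in> U 1 1 c \<Longrightarrow> \<exists>a. F = gs a R0"
    and R0: "R0 \<in> U 1 1 c"
begin

lemma t_cmp_U:
  assumes "F \<in> U a b k" "a' \<le> a" "b' \<le> b" "a'' \<le> a'" "b'' \<le> b'"
  shows "gc (t a' b' a'' b'') (gc (t a b a' b') F) = gc (t a b a'' b'') F"
  using gc_assoc[OF U_GH[OF assms(1)] t[OF assms(2,3)] t[OF assms(4,5)]] t_t[OF assms(2-5)] by simp

lemma t_s1_U:
  assumes "F \<in> U a b k" "a' \<le> a" "b' \<le> b"
  shows "gc (t (Suc a) b (Suc a') b') (gc (s1 a b) F) = gc (s1 a' b') (gc (t a b a' b') F)"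
proof -
  have t': "t (Suc a) b (Suc a') b' \<in> GH 0 (Z (Suc a) b) (Z (Suc a') b')" using t assms by simp
  show ?thesis
    using gc_assoc[OF U_GH[OF assms(1)] s1 t'] gc_assoc[OF U_GH[OF assms(1)] t[OF assms(2,3)] s1] t_s1[OF assms(2,3)] by simp
qed

lemma t_s2_U:
  assumes "F \<in> U a b k" "a' \<le> a" "b' \<le> b"
  shows "gc (t a (Suc b) a' (Suc b')) (gc (s2 a b) F) = gc (s2 a' b') (gc (t a b a' b') F)"
proof -
  have t': "t a (Suc b) a' (Suc b') \<in> GH 0 (Z a (Suc b)) (Z a' (Suc b'))" using t assms by simp
  show ?thesis
    using gc_assoc[OF U_GH[OF assms(1)] s2 t'] gc_assoc[OF U_GH[OF assms(1)] t[OF assms(2,3)] s2] t_s2[OF assms(2,3)] by simp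
qed

text \<open>Induction on \<open>a + b\<close>. If \<open>F\<close> vanishes on an edge, it is
  \<open>s1 G\<close> or \<open>s2 G\<close> with \<open>G\<close> on a smaller quotient and of
  degree below \<open>c\<close>; such a \<open>G\<close> vanishes on \<open>Z 1 1\<close> by
  \<open>only_c\<close>, hence altogether. Vanishing on the edge \<open>Z 1 b\<close> is itself an
  instance of the induction hypothesis.\<close>

lemma U_low:
  assumes "F \<in> U a b k" "0 < a" "0 < b" "k \<le> c" "gc (t a b 1 1) F = gz k X (Z 1 1)"
  shows "F = gz k X (Z a b)"
  using assms
proof (induction "a + b" arbitrary: a b k F rule: less_induct)
  case less
  consider "a = 1" "b = 1" | a' where "a = Suc a'" "0 < a'" | b' where "a = 1" "b = Suc b'" "0 < b'"
    using less.prems(2,3) by (cases a; cases b) (auto simp: Suc_lessI)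
  then show ?case
  proof cases
    case 1
    then show ?thesis using less.prems(1,5) t_id gi_gc[OF U_GH[OF less.prems(1)]] by simp
  next
    case (2 a')
    have le: "1 \<le> a" "b \<le> b" "1 \<le> (1::nat)" "1 \<le> b" using 2 less.prems by simp_all
    let ?F = "gc (t a b 1 b) F"
    have "gc (t 1 b 1 1) ?F = gz k X (Z 1 1)"
      using t_cmp_U[OF less.prems(1) le(1,2,3,4)] less.prems(5) by simp
    then have "?F = gz k X (Z 1 b)"
      using less.hyps[of 1 b ?F k] U_t[OF less.prems(1) le(1,2)] less.prems(3,4) 2 by simp
    then obtain G where G: "G \<in> U a' b (k - d1)" "gc (s1 a' b) G = F"
      using U_div1[of F a' b k] less.prems(1) 2 by blast
    have le': "1 \<le> a'" "1 \<le> b" using 2 less.prems by simp_all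
    have "gc (t a' b 1 1) G = gz (k - d1) X (Z 1 1)"
      using only_c[OF U_t[OF G(1) le']] less.prems(4) d1 by simp
    then have "G = gz (k - d1) X (Z a' b)"
      using less.hyps[of a' b G "k - d1"] G(1) 2 less.prems(3,4) d1 by simp
    then show ?thesis using G(2) gc_gz[OF s1[of a' b] X_Ob, of "k - d1"] 2 by simp
  next
    case (3 b')
    obtain G where G: "G \<in> U a b' (k - d2)" "gc (s2 a b') G = F"
      using U_div2[of F a b' k] less.prems(1,5) 3 by auto
    have le': "1 \<le> a" "1 \<le> b'" using 3 less.prems by simp_all
    have "gc (t a b' 1 1) G = gz (k - d2) X (Z 1 1)"
      using only_c[OF U_t[OF G(1) le']] less.prems(4) d2 by simp
    then have "G = gz (k - d2) X (Z a b')"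
      using less.hyps[of a b' G "k - d2"] G(1) 3 less.prems(2,4) d2 by simp
    then show ?thesis using G(2) gc_gz[OF s2[of a b'] X_Ob, of "k - d2"] 3 by simp
  qed
qed

text \<open>Below degree \<open>c\<close> the condition of \<open>U_low\<close> on
  \<open>Z 1 1\<close> holds by \<open>only_c\<close>.\<close>

lemma U_below:
  assumes "F \<in> U a b k" "k < c" shows "F = gz k X (Z a b)"
proof (cases "a = 0 \<or> b = 0")
  case True then show ?thesis using assms(1) U_zero_left U_zero_right by blast
next
  case False
  then show ?thesis using U_low[OF assms(1)] only_c[OF U_t[OF assms(1), of 1 1]] assms(2) by simp
qed

lemma H_below: "F \<in> H k \<Longrightarrow> k < c \<Longrightarrow> F = gz k X Y"
  using H_zero U_below[OF H_U] by blast

definition lifts :: "nat \<Rightarrow> nat \<Rightarrow> bool" where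
  "lifts a b \<longleftrightarrow> (\<exists>R\<in>U a b c. gc (t a b 1 1) R = R0)"

text \<open>Extension along the second index, from the edge \<open>b = 1\<close>, in every degree.
  Each finite \<open>n\<close> is treated by itself, so extensions for different \<open>n\<close>
  need not be compatible.\<close>

definition extends :: "nat \<Rightarrow> bool" where
  "extends a \<longleftrightarrow> (\<forall>n k. 0 < n \<longrightarrow> (\<forall>h\<in>U a 1 k. \<exists>g\<in>U a n k. gc (t a n a 1) g = h))"

lemma extends_0: "extends 0"
  unfolding extends_def
proof (intro allI impI ballI)
  fix n k h assume "0 < (n::nat)" "h \<in> U 0 1 k"
  then have le: "0 \<le> (0::nat)" "1 \<le> n" and h: "h = gz k X (Z 0 1)" using U_zero_left by auto
  have "gc (t 0 n 0 1) (gz k X (Z 0 n)) = h" using gc_gz[OF t[OF le] X_Ob, of k] h by simp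
  then show "\<exists>g\<in>U 0 n k. gc (t 0 n 0 1) g = h" using U_gz by blast
qed

text \<open>From morphisms of degree \<open>k > c\<close> on the quotients
  \<open>Z (Suc a) n\<close>, nonzero on \<open>Z 1 b0\<close>, one obtains morphisms of degree
  \<open>k - d2\<close> that are nonzero on \<open>Z 1 (b0 - 1)\<close>. By \<open>U_below\<close> a
  nonzero morphism never has degree below \<open>c\<close>, so the descent ends exactly at
  \<open>c\<close>. The hypothesis treats each \<open>n\<close> separately because the corrections
  taken from \<open>extends\<close> are not compatible in \<open>n\<close>.\<close>

lemma lift_step:
  assumes S: "extends a" and nz: "\<And>n. b0 \<le> n \<Longrightarrow> \<exists>g\<in>U (Suc a) n k. gc (t (Suc a) n 1 b0) g \<noteq> gz k X (Z 1 b0)"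
  shows "\<exists>b0. \<forall>n\<ge>b0. \<exists>g\<in>U (Suc a) n c. gc (t (Suc a) n 1 b0) g \<noteq> gz c X (Z 1 b0)"
  using nz
proof (induction "nat (k - c + 1)" arbitrary: k b0 rule: less_induct)
  case less
  obtain g0 where g0: "g0 \<in> U (Suc a) b0 k" "gc (t (Suc a) b0 1 b0) g0 \<noteq> gz k X (Z 1 b0)" using less.prems by blast
  have le0: "1 \<le> Suc a" "b0 \<le> b0" by simp_all
  obtain b' where b': "b0 = Suc b'"
  proof (cases b0)
    case 0
    then show ?thesis using g0(2) U_zero_right[of "gc (t (Suc a) b0 1 b0) g0" 1 k] U_t[OF g0(1) le0] by simp
  qed
  have kc: "c \<le> k" using U_below[OF U_t[OF g0(1) le0]] g0(2) by force
  show ?case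
  proof (cases "k = c")
    case True then show ?thesis using less.prems by blast
  next
    case False
    have "\<exists>g\<in>U (Suc a) n (k - d2). gc (t (Suc a) n 1 b') g \<noteq> gz (k - d2) X (Z 1 b')" if n: "b' \<le> n" for n
    proof -
      have "b0 \<le> Suc n" using n b' by simp
      then obtain g where g: "g \<in> U (Suc a) (Suc n) k" "gc (t (Suc a) (Suc n) 1 (Suc b')) g \<noteq> gz k X (Z 1 (Suc b'))"
        using less.prems[of "Suc n"] b' by blast
      have le: "Suc a \<le> Suc a" "1 \<le> Suc n" "1 \<le> Suc a" "1 \<le> (1::nat)" "a \<le> a" "Suc b' \<le> Suc n" "0 \<le> a" "b' \<le> n" using n by simp_all
      let ?h = "gc (t (Suc a) (Suc n) (Suc a) 1) g"
      \<comment> \<open>Off degree \<open>c\<close> the restriction to \<open>Z 1 1\<close>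
        vanishes, so the restriction \<open>?h\<close> to the edge \<open>b = 1\<close> is divisible
        by the first variable; the quotient has first index \<open>a\<close> and can be extended
        along the second one.\<close>
      have "gc (t (Suc a) 1 1 1) ?h = gc (t (Suc a) (Suc n) 1 1) g" using t_cmp_U[OF g(1) le(1-4)] .
      also have "\<dots> = gz k X (Z 1 1)" using only_c[OF U_t[OF g(1) le(3,2)]] False by simp
      finally obtain h where h: "h \<in> U a 1 (k - d1)" "gc (s1 a 1) h = ?h"
        using U_div1[OF U_t[OF g(1) le(1,2)]] by blast
      obtain h' where h': "h' \<in> U a (Suc n) (k - d1)" "gc (t a (Suc n) a 1) h' = h"
        using S h(1) unfolding extends_def by blast
      \<comment> \<open>Subtracting this multiple of the first variable kills the edge
        \<open>b = 1\<close> and makes the difference divisible by the second variable. On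
        \<open>Z 1 (Suc b')\<close> nothing changes, because there the correction passes through
        \<open>Z 0 (Suc b')\<close>, which is zero.\<close>
      let ?g = "gd g (gc (s1 a (Suc n)) h')"
      have sh: "gc (s1 a (Suc n)) h' \<in> U (Suc a) (Suc n) k" using U_s1[OF h'(1)] by simp
      have g': "?g \<in> U (Suc a) (Suc n) k" using U_gd[OF g(1) sh] .
      have tg: "gc (t (Suc a) (Suc n) i j) ?g = gd (gc (t (Suc a) (Suc n) i j) g) (gc (t (Suc a) (Suc n) i j) (gc (s1 a (Suc n)) h'))"
        if "i \<le> Suc a" "j \<le> Suc n" for i j using gc_gd[OF U_GH[OF g(1)] U_GH[OF sh] t[OF that]] .
      have "gc (t (Suc a) (Suc n) (Suc a) 1) ?g = gd ?h ?h"
        using tg[OF le(1,2)] t_s1_U[OF h'(1) le(5,2)] h h' by simp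
      also have "\<dots> = gz k X (Z (Suc a) 1)" using gd_eq_0[OF U_GH U_GH] U_t[OF g(1) le(1,2)] by blast
      finally obtain g'' where g'': "g'' \<in> U (Suc a) n (k - d2)" "gc (s2 (Suc a) n) g'' = ?g" using U_div2[OF g'] by blast
      have "gc (t a (Suc n) 0 (Suc b')) h' = gz (k - d1) X (Z 0 (Suc b'))"
        using U_zero_left[OF U_t[OF h'(1) le(7,6)]] .
      then have "gc (t (Suc a) (Suc n) 1 (Suc b')) (gc (s1 a (Suc n)) h') = gz k X (Z 1 (Suc b'))"
        using t_s1_U[OF h'(1) le(7,6)] gc_gz[OF s1[of 0 "Suc b'"] X_Ob, of "k - d1"] by simp
      then have "gc (t (Suc a) (Suc n) 1 (Suc b')) ?g = gc (t (Suc a) (Suc n) 1 (Suc b')) g"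
        using tg[OF le(3,6)] gd_zero[OF U_GH[OF U_t[OF g(1) le(3,6)]]] by simp
      then have "gc (s2 1 b') (gc (t (Suc a) n 1 b') g'') \<noteq> gz k X (Z 1 (Suc b'))"
        using t_s2_U[OF g''(1) le(3,8)] g''(2) g(2) by simp
      then have "gc (t (Suc a) n 1 b') g'' \<noteq> gz (k - d2) X (Z 1 b')"
        using gc_gz[OF s2[of 1 b'] X_Ob, of "k - d2"] by auto
      then show ?thesis using g''(1) by blast
    qed
    then show ?thesis using less.hyps[of "k - d2" b'] kc d2 by auto
  qed
qed

text \<open>The restrictions of \<open>f\<close> feed the descent of \<open>lift_step\<close>. The
  resulting morphism of degree \<open>c\<close> is nonzero, hence nonzero on \<open>Z 1 1\<close> by
  \<open>U_low\<close>, and can be scaled so as to lift \<open>R0\<close>.\<close>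

lemma lifts_Suc:
  assumes S: "extends a" and f: "f \<in> H k" "gc (r 1 b0) f \<noteq> gz k X (Z 1 b0)" and n: "0 < n"
  shows "lifts (Suc a) n"
proof -
  have "\<exists>g\<in>U (Suc a) n k. gc (t (Suc a) n 1 b0) g \<noteq> gz k X (Z 1 b0)" if "b0 \<le> n" for n
    using H_t[OF f(1), of 1 "Suc a" b0 n] H_U[OF f(1)] f(2) that by (intro bexI[of _ "gc (r (Suc a) n) f"]) auto
  then obtain b1 where b1: "\<And>n. b1 \<le> n \<Longrightarrow> \<exists>g\<in>U (Suc a) n c. gc (t (Suc a) n 1 b1) g \<noteq> gz c X (Z 1 b1)"
    using lift_step[OF S] by blast
  \<comment> \<open>The level has to be at least \<open>b1\<close> for the descent and at least
    \<open>n\<close> for the restriction to \<open>Z (Suc a) n\<close>.\<close>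
  let ?N = "max n b1"
  obtain g where g: "g \<in> U (Suc a) ?N c" "gc (t (Suc a) ?N 1 b1) g \<noteq> gz c X (Z 1 b1)" using b1[of ?N] by auto
  have le: "1 \<le> Suc a" "1 \<le> ?N" "b1 \<le> ?N" "Suc a \<le> Suc a" "n \<le> ?N" "1 \<le> n" using n by auto
  have "g \<noteq> gz c X (Z (Suc a) ?N)" using g(2) gc_gz[OF t[OF le(1,3)] X_Ob, of c] by auto
  then have nz: "gc (t (Suc a) ?N 1 1) g \<noteq> gz c X (Z 1 1)" using U_low[OF g(1)] n less_max_iff_disj[of 0 n b1] by auto
  obtain s where s: "gc (t (Suc a) ?N 1 1) g = gs s R0" using line[OF U_t[OF g(1) le(1,2)]] by blast
  have s0: "s \<noteq> 0" using nz s gs_0[OF U_GH[OF R0]] by auto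
  let ?R = "gs (1 / s) (gc (t (Suc a) ?N (Suc a) n) g)"
  have tn: "gc (t (Suc a) ?N (Suc a) n) g \<in> U (Suc a) n c" using U_t[OF g(1) le(4,5)] .
  have "gc (t (Suc a) n 1 1) ?R = gs (1 / s) (gs s R0)"
    using gc_gs[OF U_GH[OF tn] t[OF le(1,6)]] t_cmp_U[OF g(1) le(4,5,1,6)] s by simp
  also have "\<dots> = R0" using gs_gs[OF U_GH[OF R0]] gs_1[OF U_GH[OF R0]] s0 by simp
  finally show ?thesis unfolding lifts_def using U_gs[OF tn] by blast
qed

text \<open>In degree \<open>c\<close>, \<open>U_low\<close> identifies \<open>h\<close> with the
  restriction of a multiple of a lift of \<open>R0\<close>. In any other degree \<open>h\<close> is
  divisible by the first variable, and its quotient is extended over column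
  \<open>a\<close>.\<close>

lemma extends_Suc:
  assumes S: "extends a" and L: "\<And>n. 0 < n \<Longrightarrow> lifts (Suc a) n" shows "extends (Suc a)"
  unfolding extends_def
proof (intro allI impI ballI)
  fix n k h assume n: "0 < (n::nat)" and h: "h \<in> U (Suc a) 1 k"
  have le: "1 \<le> Suc a" "1 \<le> (1::nat)" "Suc a \<le> Suc a" "1 \<le> n" "a \<le> a" using n by auto
  show "\<exists>g\<in>U (Suc a) n k. gc (t (Suc a) n (Suc a) 1) g = h"
  proof (cases "k = c")
    case True
    obtain R where R: "R \<in> U (Suc a) n c" "gc (t (Suc a) n 1 1) R = R0" using L[OF n] unfolding lifts_def by blast
    obtain s where s: "gc (t (Suc a) 1 1 1) h = gs s R0" using line U_t[OF h le(1,2)] True by blast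
    let ?g = "gs s R" and ?R = "gc (t (Suc a) n (Suc a) 1) R"
    have tR: "?R \<in> U (Suc a) 1 c" using U_t[OF R(1) le(3,4)] .
    have tg: "gc (t (Suc a) n (Suc a) 1) ?g = gs s ?R" using gc_gs[OF U_GH[OF R(1)] t[OF le(3,4)]] .
    have hc: "h \<in> U (Suc a) 1 c" using h True by simp
    have "gc (t (Suc a) 1 1 1) (gd h (gs s ?R)) = gd (gs s R0) (gs s R0)"
      using gc_gd[OF U_GH[OF hc] U_GH[OF U_gs[OF tR]] t[OF le(1,2)]] gc_gs[OF U_GH[OF tR] t[OF le(1,2)]]
        t_cmp_U[OF R(1) le(3,4,1,2)] s R(2) by simp
    also have "\<dots> = gz c X (Z 1 1)" using gd_eq_0[OF U_GH U_GH, OF U_gs[OF R0] U_gs[OF R0]] by blast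
    finally have "gd h (gs s ?R) = gz c X (Z (Suc a) 1)" using U_low[OF U_gd[OF hc U_gs[OF tR]]] by simp
    then have "h = gs s ?R" using gd_eq_0[OF U_GH[OF hc] U_GH[OF U_gs[OF tR]]] by blast
    then show ?thesis using tg U_gs[OF R(1)] True by auto
  next
    case False
    have "gc (t (Suc a) 1 1 1) h = gz k X (Z 1 1)" using only_c[OF U_t[OF h le(1,2)]] False by simp
    then obtain g where g: "g \<in> U a 1 (k - d1)" "gc (s1 a 1) g = h" using U_div1[OF h] by blast
    obtain g' where g': "g' \<in> U a n (k - d1)" "gc (t a n a 1) g' = g" using S g(1) n unfolding extends_def by blast
    have "gc (t (Suc a) n (Suc a) 1) (gc (s1 a n) g') = h" using t_s1_U[OF g'(1) le(5,4)] g g' by simp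
    then show ?thesis using U_s1[OF g'(1)] by auto
  qed
qed

text \<open>Lifts of \<open>R0\<close> in degree \<open>c\<close> are unique by
  \<open>U_low\<close>; therefore those at different levels are compatible and glue to a morphism
  into \<open>Y\<close>.\<close>

theorem ex_renormalized:
  assumes "F \<in> H k" "F \<noteq> gz k X Y"
  shows "\<exists>R\<in>H c. gc (r 1 1) R = R0"
proof -
  obtain k' b0 f where f: "f \<in> H k'" "gc (r 1 b0) f \<noteq> gz k' X (Z 1 b0)" using nonzero_reduce[OF assms] by blast
  \<comment> \<open>Induction on the column: \<open>extends a\<close> gives lifts of
    \<open>R0\<close> over column \<open>Suc a\<close> by means of \<open>f\<close>, and these give
    \<open>extends (Suc a)\<close>.\<close>
  have "extends a" for a by (induction a) (use extends_0 extends_Suc lifts_Suc[OF _ f] in blast)+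
  then have L: "lifts a b" if "0 < a" "0 < b" for a b using lifts_Suc[OF _ f that(2), of "a - 1"] that(1) by simp
  \<comment> \<open>At an index 0 there is no restriction to \<open>Z 1 1\<close>; a zero morphism
    fills these places so that \<open>glue\<close> applies to the whole family.\<close>
  have "\<exists>R\<in>U a b c. 0 < a \<longrightarrow> 0 < b \<longrightarrow> gc (t a b 1 1) R = R0" for a b
    using L[of a b] U_gz[of c a b] unfolding lifts_def by blast
  then obtain R where R: "\<And>a b. R a b \<in> U a b c" "\<And>a b. 0 < a \<Longrightarrow> 0 < b \<Longrightarrow> gc (t a b 1 1) (R a b) = R0" by metis
  have "gc (t a b a' b') (R a b) = R a' b'" if le: "a' \<le> a" "b' \<le> b" for a b a' b'
  proof -
    note tR = U_t[OF R(1)[of a b] le]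
    show ?thesis
    proof (cases "a' = 0 \<or> b' = 0")
      case True then show ?thesis using U_zero_left U_zero_right tR R(1)[of a' b'] by metis
    next
      case False
      then have le1: "1 \<le> a'" "1 \<le> b'" by auto
      have "gc (t a' b' 1 1) (gd (gc (t a b a' b') (R a b)) (R a' b')) = gd R0 R0"
        using gc_gd[OF U_GH[OF tR] U_GH[OF R(1)] t[OF le1]] t_cmp_U[OF R(1) le le1] R(2)[of a b] R(2)[of a' b'] le1 le by simp
      also have "\<dots> = gz c X (Z 1 1)" using gd_eq_0[OF U_GH[OF R0] U_GH[OF R0]] by blast
      finally have "gd (gc (t a b a' b') (R a b)) (R a' b') = gz c X (Z a' b')"
        using U_low[OF U_gd[OF tR R(1)]] le1 by simp
      then show ?thesis using gd_eq_0[OF U_GH[OF tR] U_GH[OF R(1)]] by blast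
    qed
  qed
  then obtain G where "G \<in> H c" "\<And>a b. gc (r a b) G = R a b" using glue[of R c] R(1) by blast
  moreover have "R 1 1 = R0" using R(2)[of 1 1] gi_gc[OF U_GH[OF R(1)[of 1 1]]] t_id by simp
  ultimately show ?thesis by blast
qed

text \<open>
  The sets \<open>S1\<close> and \<open>S\<close> stand for the multiples of \<open>R\<close> by polynomials in \<open>y1\<close> and in \<open>y1\<close>, \<open>y2\<close>.
\<close>

lemma generated_by:
  assumes R: "R \<in> H c" "gc (r 1 1) R = R0"
    and S1_zero: "\<And>k. gz k X Y \<in> S1 k" and S1_R: "\<And>a. gs a R \<in> S1 c" and S1_y1: "\<And>F k. F \<in> H k \<Longrightarrow> F \<in> S1 k \<Longrightarrow> gc y1 F \<in> S1 (k + d1)"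
    and S_zero: "\<And>k. gz k X Y \<in> S k"
    and S: "\<And>F G k. F \<in> H k \<Longrightarrow> F \<in> S1 k \<Longrightarrow> G \<in> H (k - d2) \<Longrightarrow> G \<in> S (k - d2) \<Longrightarrow> ga F (gc y2 G) \<in> S k"
    and F: "F \<in> H k"
  shows "F \<in> S k"
proof -
  \<comment> \<open>A compatible family on the edge \<open>b = 1\<close> stands for a morphism into
    the quotient of \<open>Y\<close> by \<open>y2\<close>; it is induced by a polynomial in
    \<open>y1\<close> times \<open>R\<close>. In degree \<open>c\<close> this is the uniqueness of
    \<open>U_low\<close>; above \<open>c\<close> the family vanishes on \<open>Z 1 1\<close> and is
    divided by \<open>y1\<close>.\<close>
  have A: "\<exists>G\<in>H k. G \<in> S1 k \<and> (\<forall>a. gc (r a 1) G = f a)"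
    if "\<And>a. f a \<in> U a 1 k" "\<And>a a'. a' \<le> a \<Longrightarrow> gc (t a 1 a' 1) (f a) = f a'" for f k
    using that
  proof (induction "nat (k - c + 1)" arbitrary: k f rule: less_induct)
    case less
    note f = less.prems
    have le: "1 \<le> Suc a" "1 \<le> (1::nat)" for a by simp_all
    consider "k < c" | "k = c" | "c < k" by linarith
    then show ?case
    proof cases
      case 1
      then have "f a = gz k X (Z a 1)" for a using U_below[OF f(1)] by blast
      then show ?thesis using H_gz[of k] S1_zero[of k] gc_gz[OF r X_Ob, of _ _ k] by (intro bexI[of _ "gz k X Y"]) auto
    next
      case 2
      then obtain s where s: "f 1 = gs s R0" using line f(1)[of 1] by blast
      have G: "gs s R \<in> H c" using H_gs R(1) by blast
      have "gc (r a 1) (gs s R) = f a" for a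
      proof (cases a)
        case 0 then show ?thesis using U_zero_left[OF H_U[OF G]] U_zero_left f(1)[of 0] 2 by simp
      next
        case (Suc a')
        have fa: "f a \<in> U a 1 c" using f(1)[of a] 2 by simp
        have le1: "1 \<le> a" using Suc by simp
        have "gc (t a 1 1 1) (gd (f a) (gc (r a 1) (gs s R))) = gd (gs s R0) (gs s R0)"
          using gc_gd[OF U_GH[OF fa] U_GH[OF H_U[OF G]] t[OF le1 le(2)]] H_t[OF G le1 le(2)] f(2)[OF le1] s
            gc_gs[OF H_GH[OF R(1)] r] R(2) by simp
        also have "\<dots> = gz c X (Z 1 1)" using gd_eq_0[OF U_GH U_GH, OF U_gs[OF R0] U_gs[OF R0]] by blast
        finally have "gd (f a) (gc (r a 1) (gs s R)) = gz c X (Z a 1)" using U_low[OF U_gd[OF fa H_U[OF G]]] le1 by simp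
        then show ?thesis using gd_eq_0[OF U_GH[OF fa] U_GH[OF H_U[OF G]]] by simp
      qed
      then show ?thesis using G S1_R 2 by blast
    next
      case 3
      have "f 1 = gz k X (Z 1 1)" using only_c[OF f(1)[of 1]] 3 by simp
      then have "\<exists>g\<in>U a 1 (k - d1). gc (s1 a 1) g = f (Suc a)" for a
        using U_div1[OF f(1)] f(2)[OF le(1)[of a]] by simp
      then obtain g where g: "\<And>a. g a \<in> U a 1 (k - d1)" "\<And>a. gc (s1 a 1) (g a) = f (Suc a)" by metis
      have gt: "gc (t a 1 a' 1) (g a) = g a'" if aa: "a' \<le> a" for a a'
      proof (rule s1_cancel[OF U_GH[OF U_t[OF g(1) aa le(2)]] U_GH[OF g(1)]])
        have aa': "Suc a' \<le> Suc a" using aa by simp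
        show "gc (s1 a' 1) (gc (t a 1 a' 1) (g a)) = gc (s1 a' 1) (g a')"
          using t_s1_U[OF g(1) aa le(2)] g(2) f(2)[OF aa'] by simp
      qed
      have "nat (k - d1 - c + 1) < nat (k - c + 1)" using 3 d1 by simp
      then obtain G where G: "G \<in> H (k - d1)" "G \<in> S1 (k - d1)" "\<And>a. gc (r a 1) G = g a"
        using less.hyps[of "k - d1" g] g(1) gt by blast
      have yG: "gc y1 G \<in> H k" "gc y1 G \<in> S1 k" using H_y1[OF G(1)] S1_y1[OF G(1,2)] by simp_all
      have "gc (r a 1) (gc y1 G) = f a" for a
      proof (cases a)
        case 0 then show ?thesis using U_zero_left[OF H_U[OF yG(1)]] U_zero_left f(1)[of 0] by simp
      next
        case (Suc a')
        have "gc (r (Suc a') 1) (gc y1 G) = gc (s1 a' 1) (gc (r a' 1) G)"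
          unfolding gc_assoc[OF H_GH[OF G(1)] y1 r] r_y1 gc_assoc[OF H_GH[OF G(1)] r s1] ..
        then show ?thesis using G(3) g(2) Suc by simp
      qed
      then show ?thesis using yG by blast
    qed
  qed
  show ?thesis using F
  proof (induction "nat (k - c + 1)" arbitrary: k F rule: less_induct)
    case less
    note F = less.prems
    show ?case
    proof (cases "k < c")
      case True then show ?thesis using H_below[OF F] S_zero by simp
    next
      case False
      \<comment> \<open>\<open>G\<close> agrees with \<open>F\<close> modulo \<open>y2\<close>, so
        the difference is divisible by \<open>y2\<close> and the quotient has degree
        \<open>k - d2\<close>; below degree \<open>c\<close> nothing is left.\<close>
      obtain G where G: "G \<in> H k" "G \<in> S1 k" "\<And>a. gc (r a 1) G = gc (r a 1) F"
        using A[of "\<lambda>a. gc (r a 1) F" k] H_U[OF F] H_t[OF F] by blast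
      have "gc (r a 1) (gd F G) = gz k X (Z a 1)" for a
        using gc_gd[OF H_GH[OF F] H_GH[OF G(1)] r] G(3) gd_eq_0[OF U_GH U_GH, OF H_U[OF F] H_U[OF F]] by simp
      then obtain L where L: "L \<in> H (k - d2)" "gc y2 L = gd F G" using H_div2[OF H_gd[OF F G(1)]] by blast
      have "nat (k - d2 - c + 1) < nat (k - c + 1)" using False d2 by simp
      then have "L \<in> S (k - d2)" using less.hyps L(1) by blast
      then have "ga G (gc y2 L) \<in> S k" using S[OF G(1,2) L(1)] by blast
      then show ?thesis using ga_gd[OF H_GH[OF F] H_GH[OF G(1)]] L(2) by simp
    qed
  qed
qed

end

subsection \<open>The double tower of a tensor product\<close>

context shift_category
begin

lemma gcomp_nonneg:
  assumes "X \<in> obj C" "Y \<in> obj C" "Z \<in> obj C" "f \<in> HOM C k X Y" "g \<in> HOM C l Y Z" "0 \<le> k" "0 \<le> l"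
  shows "gcomp C X Y Z l g k f = g \<cdot> \<Q>a (nat l) f"
proof -
  have "stab 0 (k + l) X (gcomp C X Y Z l g k f) = stab 0 l Y g \<cdot> stab (nat (int 0 + l)) k X f"
    using gcomp_stab(2)[OF assms(1-5), of 0] assms(6,7) by simp
  then show ?thesis using assms(6,7) by (simp add: stab_nonneg)
qed

lemma gc_nonneg:
  assumes "(X, Y, k, f) \<in> GH k X Y" "(Y, Z, l, g) \<in> GH l Y Z" "0 \<le> k" "0 \<le> l"
  shows "gc (Y, Z, l, g) (X, Y, k, f) = (X, Z, k + l, g \<cdot> \<Q>a (nat l) f)"
  using gcomp_nonneg[of X Y Z f k g l] assms by (simp add: gc_def GH_iff)

lemma GH_nat: "X \<in> obj C \<Longrightarrow> Y \<in> obj C \<Longrightarrow> f \<in> hom C (\<Q>o d X) Y \<Longrightarrow> (X, Y, int d, f) \<in> GH (int d) X Y"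
  by (simp add: GH_iff HOM_def shpow_def)

lemma GH_0: "f \<in> hom C X Y \<Longrightarrow> (X, Y, 0, f) \<in> GH 0 X Y"
  using homD(4,5)[of f X Y] by (simp add: GH_iff HOM_def shpow_def)

lemma ex_shift: obtains n where "0 \<le> int n + k"
  by (rule that[of "nat (- k)"]) simp

end

section \<open>Exactness for graded morphisms into constant objects\<close>

context pro_graded
begin

lemma con_objP: "c \<in> obj C \<Longrightarrow> (con C c :: ('o, 'm, 'a) pro_ob) \<in> obj P"
  by simp

lemma cona_GH0: "p \<in> hom C B D \<Longrightarrow> (con C B, con C D, 0, cona C p) \<in> P.GH 0 (con C B) (con C D)"
  using P.GH_0[OF conaP(1)] .

lemma cona_GH:
  assumes "i \<in> hom C ((shf C ^^ d) A) B" "A \<in> obj C"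
  shows "(con C A, con C B, int d, cona C i) \<in> P.GH (int d) (con C A) (con C B)"
proof (rule P.GH_nat[OF con_objP[OF assms(2)] con_objP])
  show "B \<in> obj C" using homD[OF assms(1)] by simp
  show "cona C i \<in> hom P ((shf P ^^ d) (con C A)) (con C B)" using conaP(1)[OF assms(1)] assms(2) by (simp add: Q_con)
qed

lemma ST_cona0: "p \<in> hom C B D \<Longrightarrow> P.ST n (con C B, con C D, 0, cona C p) = cona C ((shfa C ^^ n) p)"
  by (simp add: P.ST_nonneg Q_cona)

lemma ST_cona: "i \<in> hom C ((shf C ^^ d) A) B \<Longrightarrow> P.ST n (con C A, con C B, int d, cona C i) = cona C ((shfa C ^^ n) i)"
  by (simp add: P.ST_nonneg Q_cona)

lemma ST_to_con:
  assumes "F \<in> P.GH k W (con C B)" "B \<in> obj C" "0 \<le> int n + k"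
  shows "P.ST n F \<in> hom P ((shf P ^^ nat (int n + k)) W) (con C ((shf C ^^ n) B))"
  using P.ST_hom[OF assms(1,3)] assms(2) by (simp add: Q_con)

lemma ST_con_con:
  assumes "F \<in> P.GH k (con C A) (con C B)" "A \<in> obj C" "B \<in> obj C" "0 \<le> int n + k"
  obtains f where "f \<in> hom C ((shf C ^^ nat (int n + k)) A) ((shf C ^^ n) B)" "P.ST n F = cona C f"
proof -
  have "P.ST n F \<in> hom P (con C ((shf C ^^ nat (int n + k)) A)) (con C ((shf C ^^ n) B))"
    using ST_to_con[OF assms(1,3,4)] assms(2) by (simp add: Q_con)
  then show ?thesis using cona_full[OF S.Q_obj[OF assms(2)]] that by blast
qed

lemma GH_con_con:
  assumes "f \<in> hom C ((shf C ^^ nat (int n + k)) A) ((shf C ^^ n) B)" "A \<in> obj C" "B \<in> obj C" "0 \<le> int n + k"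
  obtains F where "F \<in> P.GH k (con C A) (con C B)" "P.ST n F = cona C f"
proof -
  have "cona C f \<in> hom P ((shf P ^^ nat (int n + k)) (con C A)) ((shf P ^^ n) (con C B))"
    using conaP(1)[OF assms(1)] assms by (simp add: Q_con)
  then show ?thesis using P.ST_surj[OF con_objP[OF assms(2)] con_objP[OF assms(3)] assms(4)] that by metis
qed

text \<open>At a shift \<open>n\<close> admissible for \<open>F\<close> the graded equation is one
  between morphisms into constant objects, and \<open>con_kernel\<close> applies to the shifted
  kernel. As \<open>i\<close> has degree \<open>d\<close>, the factor it yields is \<open>G\<close>
  at the shift \<open>n + d\<close>.\<close>

lemma kernel_graded:
  assumes k: "is_kernel C p i" and p: "p \<in> hom C B D" and i: "i \<in> hom C ((shf C ^^ d) A) B" and A: "A \<in> obj C"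
    and F: "F \<in> P.GH k W (con C B)" and z: "P.gc (con C B, con C D, 0, cona C p) F = P.gz k W (con C D)"
  shows "\<exists>G\<in>P.GH (k - int d) W (con C A). P.gc (con C A, con C B, int d, cona C i) G = F"
proof -
  obtain n where n: "0 \<le> int n + k" by (rule P.ex_shift)
  have o: "B \<in> obj C" "D \<in> obj C" using homD[OF p] by auto
  have W: "W \<in> obj P" using P.GH_Ob[OF F] by blast
  note fh = ST_to_con[OF F o(1) n]
  have "P.ST n (P.gc (con C B, con C D, 0, cona C p) F) = cona C ((shfa C ^^ n) p) \<cdot>\<^bsub>P\<^esub> P.ST n F"
    using P.ST_gc[OF F cona_GH0[OF p], of n] n ST_cona0[OF p, of n] by simp
  moreover have "P.ST n (P.gz k W (con C D)) = zer P ((shf P ^^ nat (int n + k)) W) (con C ((shf C ^^ n) D))"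
    using P.ST_gz[OF W con_objP[OF o(2)] n] o by (simp add: Q_con)
  ultimately have "cona C ((shfa C ^^ n) p) \<cdot>\<^bsub>P\<^esub> P.ST n F = zer P ((shf P ^^ nat (int n + k)) W) (con C ((shf C ^^ n) D))"
    using z by simp
  then obtain g where g: "g \<in> hom P ((shf P ^^ nat (int n + k)) W) (con C ((shf C ^^ n) ((shf C ^^ d) A)))"
    "cona C ((shfa C ^^ n) i) \<cdot>\<^bsub>P\<^esub> g = P.ST n F"
    using con_kernel[OF S.Q_kernel[OF k p] S.Q_hom[OF p] S.Q_hom[OF i] fh] by blast
  have n': "0 \<le> int (n + d) + (k - int d)" "nat (int (n + d) + (k - int d)) = nat (int n + k)" using n by auto
  have "g \<in> hom P ((shf P ^^ nat (int (n + d) + (k - int d))) W) ((shf P ^^ (n + d)) (con C A))"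
    unfolding n'(2) using g(1) A by (simp add: Q_con S.Qo_add)
  then obtain G where G: "G \<in> P.GH (k - int d) W (con C A)" "P.ST (n + d) G = g"
    using P.ST_surj[OF W con_objP[OF A] n'(1)] by blast
  have GF: "P.gc (con C A, con C B, int d, cona C i) G \<in> P.GH k W (con C B)" using P.gc_GH[OF G(1) cona_GH[OF i A]] by simp
  have "nat (int n + int d) = n + d" by simp
  then have "P.ST n (P.gc (con C A, con C B, int d, cona C i) G) = P.ST n F"
    using P.ST_gc[OF G(1) cona_GH[OF i A], of n] n ST_cona[OF i, of n] g(2) G(2) by simp
  then show ?thesis using P.ST_inj[OF GF F] G(1) by blast
qed

lemma mono_graded:
  assumes m: "mono C i" and i: "i \<in> hom C ((shf C ^^ d) A) B" and A: "A \<in> obj C"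
    and G: "G \<in> P.GH k W (con C A)" and z: "P.gc (con C A, con C B, int d, cona C i) G = P.gz (k + int d) W (con C B)"
  shows "G = P.gz k W (con C A)"
proof -
  obtain n where n0: "0 \<le> int n + (k + int d)" by (rule P.ex_shift)
  have n: "0 \<le> int n + int d + k" "0 \<le> int (n + d) + k" using n0 by simp_all
  have B: "B \<in> obj C" using homD[OF i] by simp
  have W: "W \<in> obj P" using P.GH_Ob[OF G] by blast
  have e: "nat (int n + int d) = n + d" "nat (int n + (k + int d)) = nat (int (n + d) + k)" by (simp_all add: algebra_simps)
  have mi: "mono C ((shfa C ^^ n) i)"
  proof (induction n)
    case (Suc n) then show ?case using S.shf_mono[OF Suc S.Q_hom[OF i]] by simp
  qed (use m in simp)
  have gh: "P.ST (n + d) G \<in> hom P ((shf P ^^ nat (int (n + d) + k)) W) (con C ((shf C ^^ n) ((shf C ^^ d) A)))"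
    using ST_to_con[OF G A n(2)] by (simp add: S.Qo_add)
  have "cona C ((shfa C ^^ n) i) \<cdot>\<^bsub>P\<^esub> P.ST (n + d) G = zer P ((shf P ^^ nat (int (n + d) + k)) W) (con C ((shf C ^^ n) B))"
    using P.ST_gc[OF G cona_GH[OF i A], of n] n ST_cona[OF i, of n] z P.ST_gz[OF W con_objP[OF B] n0] e B by (simp add: Q_con)
  then have "P.ST (n + d) G = zer P ((shf P ^^ nat (int (n + d) + k)) W) (con C ((shf C ^^ n) ((shf C ^^ d) A)))"
    using con_mono[OF mi S.Q_hom[OF i] gh] by blast
  also have "\<dots> = P.ST (n + d) (P.gz k W (con C A))" using P.ST_gz[OF W con_objP[OF A] n(2)] A by (simp add: Q_con S.Qo_add)
  finally show ?thesis using P.ST_inj[OF G P.gz_GH[OF W con_objP[OF A]]] by blast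
qed

text \<open>Both ends of \<open>G\<close> are constant, so after stabilization the equation descends
  to \<open>C\<close> by faithfulness, and the factorization found there is lifted back.\<close>

lemma cokernel_graded:
  assumes k: "is_cokernel C i p" and p: "p \<in> hom C B D" and i: "i \<in> hom C ((shf C ^^ d) A) B" and A: "A \<in> obj C"
    and c: "c \<in> obj C" and G: "G \<in> P.GH k (con C B) (con C c)"
    and z: "P.gc G (con C A, con C B, int d, cona C i) = P.gz (k + int d) (con C A) (con C c)"
  shows "\<exists>H\<in>P.GH k (con C D) (con C c). P.gc H (con C B, con C D, 0, cona C p) = G"
proof -
  obtain n where n: "0 \<le> int n + k" by (rule P.ex_shift)
  have o: "B \<in> obj C" "D \<in> obj C" using homD[OF p] by auto
  let ?N = "nat (int n + k)"
  obtain g where g: "g \<in> hom C ((shf C ^^ ?N) B) ((shf C ^^ n) c)" "P.ST n G = cona C g"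
    using ST_con_con[OF G o(1) c n] .
  note qi = S.Q_hom[OF i, of ?N] and qp = S.Q_hom[OF p, of ?N]
  have n': "0 \<le> int n + (k + int d)" "nat (int n + (k + int d)) = ?N + d" using n by auto
  have "cona C (g \<cdot> (shfa C ^^ ?N) i) = P.ST n (P.gc G (con C A, con C B, int d, cona C i))"
    using P.ST_gc[OF cona_GH[OF i A] G n] n ST_cona[OF i, of ?N] g(2) cona_cmp[OF qi g(1)] by simp
  also have "\<dots> = zer P (con C ((shf C ^^ ?N) ((shf C ^^ d) A))) (con C ((shf C ^^ n) c))"
    unfolding z using P.ST_gz[OF con_objP[OF A] con_objP[OF c] n'(1)] n'(2) A c by (simp add: Q_con S.Qo_add)
  finally have "g \<cdot> (shfa C ^^ ?N) i = zer C ((shf C ^^ ?N) ((shf C ^^ d) A)) ((shf C ^^ n) c)"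
    using cona_eq_zero[OF cmp_hom[OF qi g(1)]] by blast
  then obtain h where h: "h \<in> hom C ((shf C ^^ ?N) D) ((shf C ^^ n) c)" "h \<cdot> (shfa C ^^ ?N) p = g"
    using cokernel_factor[OF S.Q_cokernel[OF k i] qp g(1) qi] by blast
  obtain H where H: "H \<in> P.GH k (con C D) (con C c)" "P.ST n H = cona C h"
    using GH_con_con[OF h(1) o(2) c n] .
  have "P.ST n (P.gc H (con C B, con C D, 0, cona C p)) = cona C h \<cdot>\<^bsub>P\<^esub> cona C ((shfa C ^^ ?N) p)"
    using P.ST_gc[OF cona_GH0[OF p] H(1) n] n ST_cona0[OF p, of ?N] H(2) by simp
  also have "\<dots> = P.ST n G" using cona_cmp[OF qp h(1)] h(2) g(2) by simp
  finally have "P.gc H (con C B, con C D, 0, cona C p) = G"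
    using P.ST_inj[OF _ G] P.gc_GH[OF cona_GH0[OF p] H(1)] by simp
  then show ?thesis using H(1) by blast
qed

text \<open>Bi-exactness is stated for short exact sequences; an epimorphism together with its
  kernel is one.\<close>

lemma tena_epi_left:
  assumes "epi C f" "f \<in> hom C A B" "N \<in> obj C" shows "epi C (f \<odot> idn C N)"
proof -
  obtain k where "is_kernel C f k" using ex_kernel homD(1)[OF assms(2)] by blast
  then have "short_exact C k f" using epi_cokernel_of_kernel assms(1) by (simp add: short_exact_def)
  then show ?thesis using exact_right[OF assms(3)] cokernel_epi by (auto simp: short_exact_def)
qed

lemma tena_epi_right:
  assumes "epi C f" "f \<in> hom C A B" "N \<in> obj C" shows "epi C (idn C N \<odot> f)"
proof -
  obtain k where "is_kernel C f k" using ex_kernel homD(1)[OF assms(2)] by blast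
  then have "short_exact C k f" using epi_cokernel_of_kernel assms(1) by (simp add: short_exact_def)
  then show ?thesis using exact_left[OF assms(3)] cokernel_epi by (auto simp: short_exact_def)
qed

lemma tena_epi:
  assumes "epi C f" "f \<in> hom C A B" "epi C g" "g \<in> hom C N L" shows "epi C (f \<odot> g)"
proof -
  note o = homD(4,5)[OF assms(2)] homD(4,5)[OF assms(4)]
  note 1 = tena_epi_left[OF assms(1,2) o(4)] and 2 = tena_epi_right[OF assms(3,4) o(1)]
  show ?thesis
    using epi_cmp[OF 2 1 tena_hom[OF idn_hom[OF o(1)] assms(4)] tena_hom[OF assms(2) idn_hom[OF o(4)]]]
      S.ten_split(1)[OF assms(2,4)] by simp
qed

lemma shl_pow_iso:
  assumes "X \<in> obj C" "Y \<in> obj C" shows "iso C (shl_pow C n X Y)"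
proof (induction n)
  case 0 show ?case using iso_idn ten_obj assms by simp
next
  case (Suc n)
  note a = S.shl_pow_hom[OF assms, of n] and b = shl_iso[OF S.Q_obj[OF assms(1)] assms(2), of n]
  show ?case using iso_cmp[OF S.shf_hom[OF a] _ S.shf_iso[OF Suc a]] b by auto
qed

lemma shr_pow_iso:
  assumes "X \<in> obj C" "Y \<in> obj C" shows "iso C (shr_pow C n X Y)"
proof (induction n)
  case 0 show ?case using iso_idn ten_obj assms by simp
next
  case (Suc n)
  note a = S.shr_pow_hom[OF assms, of n] and b = shr_iso[OF assms(1) S.Q_obj[OF assms(2)], of n]
  show ?case using iso_cmp[OF S.shf_hom[OF a] _ S.shf_iso[OF Suc a]] b by auto
qed

text \<open>Tensoring preserves the exact sequence, and \<open>on_left\<close> differs from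
  \<open>\<zeta> \<odot> idn C N\<close> only by the isomorphism \<open>shl_pow\<close>.\<close>

lemma on_left_exact:
  assumes e: "short_exact C \<zeta> p" and \<zeta>: "\<zeta> \<in> hom C ((shf C ^^ d) A) B" and A: "A \<in> obj C" and p: "p \<in> hom C B D" and N: "N \<in> obj C"
  shows "is_kernel C (p \<odot> idn C N) (on_left C d \<zeta> A N)" "is_cokernel C (on_left C d \<zeta> A N) (p \<odot> idn C N)"
proof -
  have e': "is_kernel C (p \<odot> idn C N) (\<zeta> \<odot> idn C N)" "is_cokernel C (\<zeta> \<odot> idn C N) (p \<odot> idn C N)"
    using exact_right[OF N e] by (auto simp: short_exact_def)
  note h = S.shl_pow_hom[OF A N, of d] tena_hom[OF \<zeta> idn_hom[OF N]] tena_hom[OF p idn_hom[OF N]] and i = shl_pow_iso[OF A N, of d]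
  show "is_kernel C (p \<odot> idn C N) (on_left C d \<zeta> A N)"
    unfolding on_left_def using kernel_cmp_iso[OF e'(1) i h(1,2,3)] .
  show "is_cokernel C (on_left C d \<zeta> A N) (p \<odot> idn C N)"
    unfolding on_left_def using cokernel_cmp_epi[OF e'(2) iso_epi[OF i h(1)] h(1,2)] .
qed

lemma on_right_exact:
  assumes e: "short_exact C \<zeta> p" and \<zeta>: "\<zeta> \<in> hom C ((shf C ^^ d) A) B" and A: "A \<in> obj C" and p: "p \<in> hom C B D" and N: "N \<in> obj C"
  shows "is_kernel C (idn C N \<odot> p) (on_right C d \<zeta> N A)" "is_cokernel C (on_right C d \<zeta> N A) (idn C N \<odot> p)"
proof -
  have e': "is_kernel C (idn C N \<odot> p) (idn C N \<odot> \<zeta>)" "is_cokernel C (idn C N \<odot> \<zeta>) (idn C N \<odot> p)"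
    using exact_left[OF N e] by (auto simp: short_exact_def)
  note h = S.shr_pow_hom[OF N A, of d] tena_hom[OF idn_hom[OF N] \<zeta>] tena_hom[OF idn_hom[OF N] p] and i = shr_pow_iso[OF N A, of d]
  show "is_kernel C (idn C N \<odot> p) (on_right C d \<zeta> N A)"
    unfolding on_right_def using kernel_cmp_iso[OF e'(1) i h(1,2,3)] .
  show "is_cokernel C (on_right C d \<zeta> N A) (idn C N \<odot> p)"
    unfolding on_right_def using cokernel_cmp_epi[OF e'(2) iso_epi[OF i h(1)] h(1,2)] .
qed

lemma con_ten_shl:
  assumes M: "M \<in> obj C" and N: "N \<in> obj C"
  shows "con_ten C (shf C M) N \<cdot>\<^bsub>P\<^esub> shl P (con C M) (con C N) = cona C (shl C M N) \<cdot>\<^bsub>P\<^esub> shfa P (con_ten C M N)"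
proof -
  have o: "(con C M :: ('o, 'm, 'a) pro_ob) \<in> pro_objs C" "(con C N :: ('o, 'm, 'a) pro_ob) \<in> pro_objs C" using M N by simp_all
  have qM: "shf C M \<in> obj C" and MN: "M \<otimes> N \<in> obj C" using S.shf_obj M ten_obj N by auto
  note c = con_tenP[OF qM N] and c0 = con_tenP[OF M N] and s = S.shl_in[OF M N]
  have s1: "shl P (con C M) (con C N) \<in> hom P (shf P (con C M \<otimes>\<^bsub>P\<^esub> con C N)) (con C (shf C M) \<otimes>\<^bsub>P\<^esub> con C N)"
    using shlP(1)[OF o] by (simp add: ten_P shf_con M)
  have q0: "shfa P (con_ten C M N) \<in> hom P (shf P (con C M \<otimes>\<^bsub>P\<^esub> con C N)) (con C (shf C (M \<otimes> N)))"
    using rep_shf(1)[OF c0(1)] MN by (simp add: shf_con)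
  let ?z = "IxPair (IxNat 0) (IxNat 0) :: ('a, 'm) idx"
  have r1: "(?z, shl C M N) \<in> pgerm (shl P (con C M) (con C N) :: ('o, 'm, 'a) pro_ar) ?z" using shlP(2)[OF o, of "IxNat 0" "IxNat 0"] by simp
  show ?thesis
  proof (rule con_eqI[OF cmpP(1)[OF s1 c(1)] cmpP(1)[OF q0 conaP(1)[OF s]]])
    show "(?z, shl C M N) \<in> pgerm (con_ten C (shf C M) N \<cdot>\<^bsub>P\<^esub> shl P (con C M) (con C N)) (IxNat 0)"
      using cmpP(2)[OF s1 c(1) c(2) r1] idn_cmp[OF s] by simp
    show "(?z, shl C M N) \<in> pgerm (cona C (shl C M N) \<cdot>\<^bsub>P\<^esub> shfa P (con_ten C M N)) (IxNat 0)"
      using cmpP(2)[OF q0 conaP[OF s] rep_shf(2)[OF c0]] S.shf_idn[OF MN] cmp_idn[OF s] by simp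
  qed
qed

lemma con_ten_shr:
  assumes M: "M \<in> obj C" and N: "N \<in> obj C"
  shows "con_ten C M (shf C N) \<cdot>\<^bsub>P\<^esub> shr P (con C M) (con C N) = cona C (shr C M N) \<cdot>\<^bsub>P\<^esub> shfa P (con_ten C M N)"
proof -
  have o: "(con C M :: ('o, 'm, 'a) pro_ob) \<in> pro_objs C" "(con C N :: ('o, 'm, 'a) pro_ob) \<in> pro_objs C" using M N by simp_all
  have qN: "shf C N \<in> obj C" and MN: "M \<otimes> N \<in> obj C" using S.shf_obj M ten_obj N by auto
  note c = con_tenP[OF M qN] and c0 = con_tenP[OF M N] and s = S.shr_in[OF M N]
  have s1: "shr P (con C M) (con C N) \<in> hom P (shf P (con C M \<otimes>\<^bsub>P\<^esub> con C N)) (con C M \<otimes>\<^bsub>P\<^esub> con C (shf C N))"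
    using shrP(1)[OF o] by (simp add: ten_P shf_con N)
  have q0: "shfa P (con_ten C M N) \<in> hom P (shf P (con C M \<otimes>\<^bsub>P\<^esub> con C N)) (con C (shf C (M \<otimes> N)))"
    using rep_shf(1)[OF c0(1)] MN by (simp add: shf_con)
  let ?z = "IxPair (IxNat 0) (IxNat 0) :: ('a, 'm) idx"
  have r1: "(?z, shr C M N) \<in> pgerm (shr P (con C M) (con C N) :: ('o, 'm, 'a) pro_ar) ?z" using shrP(2)[OF o, of "IxNat 0" "IxNat 0"] by simp
  show ?thesis
  proof (rule con_eqI[OF cmpP(1)[OF s1 c(1)] cmpP(1)[OF q0 conaP(1)[OF s]]])
    show "(?z, shr C M N) \<in> pgerm (con_ten C M (shf C N) \<cdot>\<^bsub>P\<^esub> shr P (con C M) (con C N)) (IxNat 0)"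
      using cmpP(2)[OF s1 c(1) c(2) r1] idn_cmp[OF s] by simp
    show "(?z, shr C M N) \<in> pgerm (cona C (shr C M N) \<cdot>\<^bsub>P\<^esub> shfa P (con_ten C M N)) (IxNat 0)"
      using cmpP(2)[OF q0 conaP[OF s] rep_shf(2)[OF c0]] S.shf_idn[OF MN] cmp_idn[OF s] by simp
  qed
qed

lemma con_ten_shl_pow:
  assumes M: "M \<in> obj C" and N: "N \<in> obj C"
  shows "con_ten C ((shf C ^^ n) M) N \<cdot>\<^bsub>P\<^esub> shl_pow P n (con C M) (con C N)
    = cona C (shl_pow C n M N) \<cdot>\<^bsub>P\<^esub> (shfa P ^^ n) (con_ten C M N)"
proof (induction n)
  case 0
  note c = con_tenP(1)[OF M N]
  show ?case using P.cmp_idn[OF c] P.idn_cmp[OF c] cona_idn ten_obj M N by simp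
next
  case (Suc n)
  let ?M = "(shf C ^^ n) M"
  have qM: "?M \<in> obj C" "shf C ?M \<in> obj C" using S.Q_obj[OF M, of n] S.shf_obj by auto
  note a = P.shl_pow_hom[OF con_objP[OF M] con_objP[OF N], of n]
  have a: "shl_pow P n (con C M) (con C N) \<in> hom P ((shf P ^^ n) (con C M \<otimes>\<^bsub>P\<^esub> con C N)) (con C ?M \<otimes>\<^bsub>P\<^esub> con C N)"
    using P.shl_pow_hom[OF con_objP[OF M] con_objP[OF N], of n] M by (simp add: Q_con)
  have s: "shl P (con C ?M) (con C N) \<in> hom P (shf P (con C ?M \<otimes>\<^bsub>P\<^esub> con C N)) (con C (shf C ?M) \<otimes>\<^bsub>P\<^esub> con C N)"
    using P.shl_in[OF con_objP[OF qM(1)] con_objP[OF N]] qM by (simp add: shf_con)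
  note c = con_tenP(1)[OF qM(2) N] and c1 = con_tenP(1)[OF qM(1) N] and b = S.shl_in[OF qM(1) N] and b' = S.shl_pow_hom[OF M N, of n]
  have c1': "shfa P (con_ten C ?M N) \<in> hom P (shf P (con C ?M \<otimes>\<^bsub>P\<^esub> con C N)) (con C (shf C (?M \<otimes> N)))"
    using P.shf_hom[OF c1] ten_obj[OF qM(1) N] by (simp add: shf_con)
  have c0: "(shfa P ^^ n) (con_ten C M N) \<in> hom P ((shf P ^^ n) (con C M \<otimes>\<^bsub>P\<^esub> con C N)) (con C ((shf C ^^ n) (M \<otimes> N)))"
    using P.Q_hom[OF con_tenP(1)[OF M N], of n] ten_obj[OF M N] by (simp add: Q_con)
  have c0': "shfa P ((shfa P ^^ n) (con_ten C M N)) \<in> hom P (shf P ((shf P ^^ n) (con C M \<otimes>\<^bsub>P\<^esub> con C N))) (con C (shf C ((shf C ^^ n) (M \<otimes> N))))"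
    using P.shf_hom[OF c0] S.Q_obj[OF ten_obj[OF M N], of n] by (simp add: shf_con)
  have "con_ten C ((shf C ^^ Suc n) M) N \<cdot>\<^bsub>P\<^esub> shl_pow P (Suc n) (con C M) (con C N)
    = (con_ten C (shf C ?M) N \<cdot>\<^bsub>P\<^esub> shl P (con C ?M) (con C N)) \<cdot>\<^bsub>P\<^esub> shfa P (shl_pow P n (con C M) (con C N))"
    using P.cmp_assoc[OF P.shf_hom[OF a] s c] M by (simp add: Q_con)
  also have "\<dots> = cona C (shl C ?M N) \<cdot>\<^bsub>P\<^esub> shfa P (con_ten C ?M N \<cdot>\<^bsub>P\<^esub> shl_pow P n (con C M) (con C N))"
    unfolding con_ten_shl[OF qM(1) N] using P.cmp_assoc[OF P.shf_hom[OF a] c1' conaP(1)[OF b]] P.shf_cmp[OF a c1] by simp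
  also have "\<dots> = cona C (shl C ?M N) \<cdot>\<^bsub>P\<^esub> (cona C (shfa C (shl_pow C n M N)) \<cdot>\<^bsub>P\<^esub> shfa P ((shfa P ^^ n) (con_ten C M N)))"
    unfolding Suc using P.shf_cmp[OF c0 conaP(1)[OF b']] shfa_cona[OF b'] by simp
  also have "\<dots> = cona C (shl_pow C (Suc n) M N) \<cdot>\<^bsub>P\<^esub> (shfa P ^^ Suc n) (con_ten C M N)"
    using P.cmp_assoc[OF c0' conaP(1)[OF S.shf_hom[OF b']] conaP(1)[OF b]] cona_cmp[OF S.shf_hom[OF b'] b] by simp
  finally show ?case .
qed

lemma con_ten_shr_pow:
  assumes M: "M \<in> obj C" and N: "N \<in> obj C"
  shows "con_ten C M ((shf C ^^ n) N) \<cdot>\<^bsub>P\<^esub> shr_pow P n (con C M) (con C N)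
    = cona C (shr_pow C n M N) \<cdot>\<^bsub>P\<^esub> (shfa P ^^ n) (con_ten C M N)"
proof (induction n)
  case 0
  note c = con_tenP(1)[OF M N]
  show ?case using P.cmp_idn[OF c] P.idn_cmp[OF c] cona_idn ten_obj M N by simp
next
  case (Suc n)
  let ?N = "(shf C ^^ n) N"
  have qN: "?N \<in> obj C" "shf C ?N \<in> obj C" using S.Q_obj[OF N, of n] S.shf_obj by auto
  have a: "shr_pow P n (con C M) (con C N) \<in> hom P ((shf P ^^ n) (con C M \<otimes>\<^bsub>P\<^esub> con C N)) (con C M \<otimes>\<^bsub>P\<^esub> con C ?N)"
    using P.shr_pow_hom[OF con_objP[OF M] con_objP[OF N], of n] N by (simp add: Q_con)
  have s: "shr P (con C M) (con C ?N) \<in> hom P (shf P (con C M \<otimes>\<^bsub>P\<^esub> con C ?N)) (con C M \<otimes>\<^bsub>P\<^esub> con C (shf C ?N))"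
    using P.shr_in[OF con_objP[OF M] con_objP[OF qN(1)]] qN by (simp add: shf_con)
  note c = con_tenP(1)[OF M qN(2)] and c1 = con_tenP(1)[OF M qN(1)] and b = S.shr_in[OF M qN(1)] and b' = S.shr_pow_hom[OF M N, of n]
  have c1': "shfa P (con_ten C M ?N) \<in> hom P (shf P (con C M \<otimes>\<^bsub>P\<^esub> con C ?N)) (con C (shf C (M \<otimes> ?N)))"
    using P.shf_hom[OF c1] ten_obj[OF M qN(1)] by (simp add: shf_con)
  have c0: "(shfa P ^^ n) (con_ten C M N) \<in> hom P ((shf P ^^ n) (con C M \<otimes>\<^bsub>P\<^esub> con C N)) (con C ((shf C ^^ n) (M \<otimes> N)))"
    using P.Q_hom[OF con_tenP(1)[OF M N], of n] ten_obj[OF M N] by (simp add: Q_con)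
  have c0': "shfa P ((shfa P ^^ n) (con_ten C M N)) \<in> hom P (shf P ((shf P ^^ n) (con C M \<otimes>\<^bsub>P\<^esub> con C N))) (con C (shf C ((shf C ^^ n) (M \<otimes> N))))"
    using P.shf_hom[OF c0] S.Q_obj[OF ten_obj[OF M N], of n] by (simp add: shf_con)
  have "con_ten C M ((shf C ^^ Suc n) N) \<cdot>\<^bsub>P\<^esub> shr_pow P (Suc n) (con C M) (con C N)
    = (con_ten C M (shf C ?N) \<cdot>\<^bsub>P\<^esub> shr P (con C M) (con C ?N)) \<cdot>\<^bsub>P\<^esub> shfa P (shr_pow P n (con C M) (con C N))"
    using P.cmp_assoc[OF P.shf_hom[OF a] s c] N by (simp add: Q_con)
  also have "\<dots> = cona C (shr C M ?N) \<cdot>\<^bsub>P\<^esub> shfa P (con_ten C M ?N \<cdot>\<^bsub>P\<^esub> shr_pow P n (con C M) (con C N))"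
    unfolding con_ten_shr[OF M qN(1)] using P.cmp_assoc[OF P.shf_hom[OF a] c1' conaP(1)[OF b]] P.shf_cmp[OF a c1] by simp
  also have "\<dots> = cona C (shr C M ?N) \<cdot>\<^bsub>P\<^esub> (cona C (shfa C (shr_pow C n M N)) \<cdot>\<^bsub>P\<^esub> shfa P ((shfa P ^^ n) (con_ten C M N)))"
    unfolding Suc using P.shf_cmp[OF c0 conaP(1)[OF b']] shfa_cona[OF b'] by simp
  also have "\<dots> = cona C (shr_pow C (Suc n) M N) \<cdot>\<^bsub>P\<^esub> (shfa P ^^ Suc n) (con_ten C M N)"
    using P.cmp_assoc[OF c0' conaP(1)[OF S.shf_hom[OF b']] conaP(1)[OF b]] cona_cmp[OF S.shf_hom[OF b'] b] by simp
  finally show ?case .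
qed

definition cten where "cten M N F G = con_ten C M N \<cdot>\<^bsub>P\<^esub> (F \<odot>\<^bsub>P\<^esub> G)"

lemma cten_hom:
  assumes "F \<in> hom P X (con C M)" "G \<in> hom P Y (con C N)" "M \<in> obj C" "N \<in> obj C"
  shows "cten M N F G \<in> hom P (X \<otimes>\<^bsub>P\<^esub> Y) (con C (M \<otimes> N))"
  unfolding cten_def using cmpP(1)[OF P.ten_hom[OF assms(1,2)] con_tenP(1)[OF assms(3,4)]] .

lemma cona_cten:
  assumes F: "F \<in> hom P X (con C M)" and G: "G \<in> hom P Y (con C N)" and f: "f \<in> hom C M M'" and g: "g \<in> hom C N N'"
  shows "cona C (f \<odot> g) \<cdot>\<^bsub>P\<^esub> cten M N F G = cten M' N' (cona C f \<cdot>\<^bsub>P\<^esub> F) (cona C g \<cdot>\<^bsub>P\<^esub> G)"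
proof -
  note o = homD(4,5)[OF f] homD(4,5)[OF g]
  note FG = P.ten_hom[OF F G] and fg = P.ten_hom[OF conaP(1)[OF f] conaP(1)[OF g]]
  note c = con_tenP(1)[OF o(1,3)] and c' = con_tenP(1)[OF o(2,4)]
  have "cona C (f \<odot> g) \<cdot>\<^bsub>P\<^esub> cten M N F G = (cona C (f \<odot> g) \<cdot>\<^bsub>P\<^esub> con_ten C M N) \<cdot>\<^bsub>P\<^esub> (F \<odot>\<^bsub>P\<^esub> G)"
    unfolding cten_def using P.cmp_assoc[OF FG c conaP(1)[OF tena_hom[OF f g]]] .
  also have "\<dots> = con_ten C M' N' \<cdot>\<^bsub>P\<^esub> ((cona C f \<odot>\<^bsub>P\<^esub> cona C g) \<cdot>\<^bsub>P\<^esub> (F \<odot>\<^bsub>P\<^esub> G))"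
    unfolding con_ten_natural[OF f g, symmetric] using P.cmp_assoc[OF FG fg c'] by simp
  finally show ?thesis unfolding cten_def using P.ten_cmp[OF F conaP(1)[OF f] G conaP(1)[OF g]] by simp
qed

text \<open>\<open>on_left_square\<close> in \<open>Pro C\<close> replaces \<open>z\<close> by
  \<open>\<zeta>\<close> between constant pro-objects; there \<open>con_ten\<close> identifies
  \<open>on_left\<close> formed in \<open>Pro C\<close> with the one formed in
  \<open>C\<close>.\<close>

lemma cten_on_left:
  assumes z: "z \<in> hom P ((shf P ^^ d) X) X" and \<psi>: "\<psi> \<in> hom P X (con C A)" and \<psi>': "\<psi>' \<in> hom P X (con C B)"
    and \<zeta>: "\<zeta> \<in> hom C ((shf C ^^ d) A) B" and e: "\<psi>' \<cdot>\<^bsub>P\<^esub> z = cona C \<zeta> \<cdot>\<^bsub>P\<^esub> (shfa P ^^ d) \<psi>"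
    and \<chi>: "\<chi> \<in> hom P Y (con C L)" and A: "A \<in> obj C" and L: "L \<in> obj C"
  shows "cten B L \<psi>' \<chi> \<cdot>\<^bsub>P\<^esub> on_left P d z X Y = cona C (on_left C d \<zeta> A L) \<cdot>\<^bsub>P\<^esub> (shfa P ^^ d) (cten A L \<psi> \<chi>)"
proof -
  have B: "B \<in> obj C" and qA: "(shf C ^^ d) A \<in> obj C" using homD[OF \<zeta>] by auto
  have X: "X \<in> obj P" "Y \<in> obj P" using homP_obj[OF \<psi>] homP_obj[OF \<chi>] by auto
  have \<zeta>P: "cona C \<zeta> \<in> hom P ((shf P ^^ d) (con C A)) (con C B)" using conaP(1)[OF \<zeta>] A by (simp add: Q_con)
  note l = P.on_left_hom[OF z X(2,1)] and l' = P.on_left_hom[OF \<zeta>P con_objP[OF L] con_objP[OF A]]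
  note pc = P.ten_hom[OF \<psi>' \<chi>] and pc0 = P.ten_hom[OF \<psi> \<chi>] and c = con_tenP(1)[OF B L] and c0 = con_tenP(1)[OF A L]
  have sq: "on_left P d (cona C \<zeta>) (con C A) (con C L) \<cdot>\<^bsub>P\<^esub> (shfa P ^^ d) (\<psi> \<odot>\<^bsub>P\<^esub> \<chi>) = (\<psi>' \<odot>\<^bsub>P\<^esub> \<chi>) \<cdot>\<^bsub>P\<^esub> on_left P d z X Y"
    using P.on_left_square[OF z \<zeta>P \<psi> \<psi>' \<chi> e[symmetric]] .
  have s: "shl_pow P d (con C A) (con C L) \<in> hom P ((shf P ^^ d) (con C A \<otimes>\<^bsub>P\<^esub> con C L)) (con C ((shf C ^^ d) A) \<otimes>\<^bsub>P\<^esub> con C L)"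
    using P.shl_pow_hom[OF con_objP[OF A] con_objP[OF L], of d] A by (simp add: Q_con)
  have zi: "cona C \<zeta> \<odot>\<^bsub>P\<^esub> idn P (con C L) = cona C \<zeta> \<odot>\<^bsub>P\<^esub> cona C (idn C L)" using cona_idn[OF L] by simp
  note zl = P.ten_hom[OF conaP(1)[OF \<zeta>] conaP(1)[OF idn_hom[OF L]]] and zC = tena_hom[OF \<zeta> idn_hom[OF L]]
  note cq = con_tenP(1)[OF qA L] and sC = S.shl_pow_hom[OF A L, of d]
  have c0': "(shfa P ^^ d) (con_ten C A L) \<in> hom P ((shf P ^^ d) (con C A \<otimes>\<^bsub>P\<^esub> con C L)) (con C ((shf C ^^ d) (A \<otimes> L)))"
    using P.Q_hom[OF c0, of d] ten_obj[OF A L] by (simp add: Q_con)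
  have "con_ten C B L \<cdot>\<^bsub>P\<^esub> on_left P d (cona C \<zeta>) (con C A) (con C L)
     = (con_ten C B L \<cdot>\<^bsub>P\<^esub> (cona C \<zeta> \<odot>\<^bsub>P\<^esub> cona C (idn C L))) \<cdot>\<^bsub>P\<^esub> shl_pow P d (con C A) (con C L)"
    unfolding on_left_def zi using P.cmp_assoc[OF s zl c] .
  also have "\<dots> = cona C (\<zeta> \<odot> idn C L) \<cdot>\<^bsub>P\<^esub> (con_ten C ((shf C ^^ d) A) L \<cdot>\<^bsub>P\<^esub> shl_pow P d (con C A) (con C L))"
    unfolding con_ten_natural[OF \<zeta> idn_hom[OF L]] using P.cmp_assoc[OF s cq conaP(1)[OF zC]] by simp
  also have "\<dots> = cona C (on_left C d \<zeta> A L) \<cdot>\<^bsub>P\<^esub> (shfa P ^^ d) (con_ten C A L)"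
    unfolding con_ten_shl_pow[OF A L] on_left_def cona_cmp[OF sC zC]
    using P.cmp_assoc[OF c0' conaP(1)[OF sC] conaP(1)[OF zC]] .
  finally have main: "con_ten C B L \<cdot>\<^bsub>P\<^esub> on_left P d (cona C \<zeta>) (con C A) (con C L) = cona C (on_left C d \<zeta> A L) \<cdot>\<^bsub>P\<^esub> (shfa P ^^ d) (con_ten C A L)" .
  have oC: "on_left C d \<zeta> A L \<in> hom C ((shf C ^^ d) (A \<otimes> L)) (B \<otimes> L)" using S.on_left_hom[OF \<zeta> L A] .
  have "cten B L \<psi>' \<chi> \<cdot>\<^bsub>P\<^esub> on_left P d z X Y = con_ten C B L \<cdot>\<^bsub>P\<^esub> (on_left P d (cona C \<zeta>) (con C A) (con C L) \<cdot>\<^bsub>P\<^esub> (shfa P ^^ d) (\<psi> \<odot>\<^bsub>P\<^esub> \<chi>))"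
    unfolding cten_def sq using P.cmp_assoc[OF l pc c] by simp
  also have "\<dots> = (cona C (on_left C d \<zeta> A L) \<cdot>\<^bsub>P\<^esub> (shfa P ^^ d) (con_ten C A L)) \<cdot>\<^bsub>P\<^esub> (shfa P ^^ d) (\<psi> \<odot>\<^bsub>P\<^esub> \<chi>)"
    unfolding main[symmetric] using P.cmp_assoc[OF P.Q_hom[OF pc0] l' c] .
  also have "\<dots> = cona C (on_left C d \<zeta> A L) \<cdot>\<^bsub>P\<^esub> (shfa P ^^ d) (cten A L \<psi> \<chi>)"
    unfolding cten_def P.Q_cmp[OF pc0 c0] using P.cmp_assoc[OF P.Q_hom[OF pc0] c0' conaP(1)[OF oC]] by simp
  finally show ?thesis .
qed

lemma cten_on_right:
  assumes z: "z \<in> hom P ((shf P ^^ d) X) X" and \<psi>: "\<psi> \<in> hom P X (con C A)" and \<psi>': "\<psi>' \<in> hom P X (con C B)"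
    and \<zeta>: "\<zeta> \<in> hom C ((shf C ^^ d) A) B" and e: "\<psi>' \<cdot>\<^bsub>P\<^esub> z = cona C \<zeta> \<cdot>\<^bsub>P\<^esub> (shfa P ^^ d) \<psi>"
    and \<chi>: "\<chi> \<in> hom P Y (con C L)" and A: "A \<in> obj C" and L: "L \<in> obj C"
  shows "cten L B \<chi> \<psi>' \<cdot>\<^bsub>P\<^esub> on_right P d z Y X = cona C (on_right C d \<zeta> L A) \<cdot>\<^bsub>P\<^esub> (shfa P ^^ d) (cten L A \<chi> \<psi>)"
proof -
  have B: "B \<in> obj C" and qA: "(shf C ^^ d) A \<in> obj C" using homD[OF \<zeta>] by auto
  have X: "X \<in> obj P" "Y \<in> obj P" using homP_obj[OF \<psi>] homP_obj[OF \<chi>] by auto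
  have \<zeta>P: "cona C \<zeta> \<in> hom P ((shf P ^^ d) (con C A)) (con C B)" using conaP(1)[OF \<zeta>] A by (simp add: Q_con)
  note l = P.on_right_hom[OF z X(2,1)] and l' = P.on_right_hom[OF \<zeta>P con_objP[OF L] con_objP[OF A]]
  note pc = P.ten_hom[OF \<chi> \<psi>'] and pc0 = P.ten_hom[OF \<chi> \<psi>] and c = con_tenP(1)[OF L B] and c0 = con_tenP(1)[OF L A]
  have sq: "on_right P d (cona C \<zeta>) (con C L) (con C A) \<cdot>\<^bsub>P\<^esub> (shfa P ^^ d) (\<chi> \<odot>\<^bsub>P\<^esub> \<psi>) = (\<chi> \<odot>\<^bsub>P\<^esub> \<psi>') \<cdot>\<^bsub>P\<^esub> on_right P d z Y X"
    using P.on_right_square[OF z \<zeta>P \<psi> \<psi>' \<chi> e[symmetric]] .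
  have s: "shr_pow P d (con C L) (con C A) \<in> hom P ((shf P ^^ d) (con C L \<otimes>\<^bsub>P\<^esub> con C A)) (con C L \<otimes>\<^bsub>P\<^esub> con C ((shf C ^^ d) A))"
    using P.shr_pow_hom[OF con_objP[OF L] con_objP[OF A], of d] A by (simp add: Q_con)
  have zi: "idn P (con C L) \<odot>\<^bsub>P\<^esub> cona C \<zeta> = cona C (idn C L) \<odot>\<^bsub>P\<^esub> cona C \<zeta>" using cona_idn[OF L] by simp
  note zl = P.ten_hom[OF conaP(1)[OF idn_hom[OF L]] conaP(1)[OF \<zeta>]] and zC = tena_hom[OF idn_hom[OF L] \<zeta>]
  note cq = con_tenP(1)[OF L qA] and sC = S.shr_pow_hom[OF L A, of d]
  have c0': "(shfa P ^^ d) (con_ten C L A) \<in> hom P ((shf P ^^ d) (con C L \<otimes>\<^bsub>P\<^esub> con C A)) (con C ((shf C ^^ d) (L \<otimes> A)))"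
    using P.Q_hom[OF c0, of d] ten_obj[OF L A] by (simp add: Q_con)
  have "con_ten C L B \<cdot>\<^bsub>P\<^esub> on_right P d (cona C \<zeta>) (con C L) (con C A)
     = (con_ten C L B \<cdot>\<^bsub>P\<^esub> (cona C (idn C L) \<odot>\<^bsub>P\<^esub> cona C \<zeta>)) \<cdot>\<^bsub>P\<^esub> shr_pow P d (con C L) (con C A)"
    unfolding on_right_def zi using P.cmp_assoc[OF s zl c] .
  also have "\<dots> = cona C (idn C L \<odot> \<zeta>) \<cdot>\<^bsub>P\<^esub> (con_ten C L ((shf C ^^ d) A) \<cdot>\<^bsub>P\<^esub> shr_pow P d (con C L) (con C A))"
    unfolding con_ten_natural[OF idn_hom[OF L] \<zeta>] using P.cmp_assoc[OF s cq conaP(1)[OF zC]] by simp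
  also have "\<dots> = cona C (on_right C d \<zeta> L A) \<cdot>\<^bsub>P\<^esub> (shfa P ^^ d) (con_ten C L A)"
    unfolding con_ten_shr_pow[OF L A] on_right_def cona_cmp[OF sC zC]
    using P.cmp_assoc[OF c0' conaP(1)[OF sC] conaP(1)[OF zC]] .
  finally have main: "con_ten C L B \<cdot>\<^bsub>P\<^esub> on_right P d (cona C \<zeta>) (con C L) (con C A) = cona C (on_right C d \<zeta> L A) \<cdot>\<^bsub>P\<^esub> (shfa P ^^ d) (con_ten C L A)" .
  have oC: "on_right C d \<zeta> L A \<in> hom C ((shf C ^^ d) (L \<otimes> A)) (L \<otimes> B)" using S.on_right_hom[OF \<zeta> L A] .
  have "cten L B \<chi> \<psi>' \<cdot>\<^bsub>P\<^esub> on_right P d z Y X = con_ten C L B \<cdot>\<^bsub>P\<^esub> (on_right P d (cona C \<zeta>) (con C L) (con C A) \<cdot>\<^bsub>P\<^esub> (shfa P ^^ d) (\<chi> \<odot>\<^bsub>P\<^esub> \<psi>))"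
    unfolding cten_def sq using P.cmp_assoc[OF l pc c] by simp
  also have "\<dots> = (cona C (on_right C d \<zeta> L A) \<cdot>\<^bsub>P\<^esub> (shfa P ^^ d) (con_ten C L A)) \<cdot>\<^bsub>P\<^esub> (shfa P ^^ d) (\<chi> \<odot>\<^bsub>P\<^esub> \<psi>)"
    unfolding main[symmetric] using P.cmp_assoc[OF P.Q_hom[OF pc0] l' c] .
  also have "\<dots> = cona C (on_right C d \<zeta> L A) \<cdot>\<^bsub>P\<^esub> (shfa P ^^ d) (cten L A \<chi> \<psi>)"
    unfolding cten_def P.Q_cmp[OF pc0 c0] using P.cmp_assoc[OF P.Q_hom[OF pc0] c0' conaP(1)[OF oC]] by simp
  finally show ?thesis .
qed

end

section \<open>Levels, transition maps and multiplication maps of the double tower\<close>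

locale two_towers = A: affine_tower C P XA dA zA TA \<phi>A + B: affine_tower C P XB dB zB TB \<phi>B
  for C :: "('o, 'm, 'k::field, 'x) moncat_scheme" (structure)
    and P :: "(('o, 'm, 'a) pro_ob, ('o, 'm, 'a) pro_ar, 'k) tscat"
    and XA dA zA TA \<phi>A XB dB zB TB \<phi>B
begin

definition Y where "Y = XA \<otimes>\<^bsub>P\<^esub> XB"
definition D where "D = pro_ten C TA TB"
definition \<Phi> where "\<Phi> = \<phi>A \<odot>\<^bsub>P\<^esub> \<phi>B"
definition Zo where "Zo a b = A.Tn a \<otimes> B.Tn b"
definition \<rho> where "\<rho> a b = A.cten (A.Tn a) (B.Tn b) (A.\<psi> a) (B.\<psi> b)"
definition tt where "tt a b a' b' = A.tr a a' \<odot> B.tr b b'"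
definition e1 where "e1 a b = on_left C dA (A.\<zeta> a) (A.Tn a) (B.Tn b)"
definition e2 where "e2 a b = on_right C dB (B.\<zeta> b) (A.Tn a) (B.Tn b)"

lemma Zo_obj [simp]: "Zo a b \<in> obj C"
  by (simp add: Zo_def A.ten_obj)

lemma Y_obj: "Y \<in> pro_objs C"
  unfolding Y_def A.ten_P using A.pro_ten_obj[OF A.X B.X] .

lemma D_obj: "D \<in> pro_objs C"
  unfolding D_def using A.pro_ten_obj[OF A.T B.T] .

lemma D_idx: "pidx D = prod_cat tower_cat tower_cat" "pob D (IxPair (IxNat a) (IxNat b)) = Zo a b"
  by (simp_all add: D_def A.T_idx B.T_idx Zo_def A.Tn_def B.Tn_def)

lemma D_index: "IxPair (IxNat a) (IxNat b) \<in> obj (pidx D)"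
  by (simp add: D_idx)

lemma D_cases:
  assumes "p \<in> obj (pidx D)" obtains a b where "p = IxPair (IxNat a) (IxNat b)"
  using assms by (auto simp: D_idx)

lemma D_hom:
  assumes "v \<in> hom (pidx D) p p'"
  obtains a b a' b' where "p = IxPair (IxNat a) (IxNat b)" "p' = IxPair (IxNat a') (IxNat b')" "a' \<le> a" "b' \<le> b"
    "par D v = tt a b a' b'"
proof -
  have v: "v \<in> hom (prod_cat tower_cat tower_cat) p p'" using assms D_idx by simp
  then obtain u w i j i' j' where e: "v = IxPair u w" "p = IxPair i j" "p' = IxPair i' j'"
    "u \<in> hom tower_cat i i'" "w \<in> hom tower_cat j j'" unfolding hom_prod_cat by blast
  obtain a a' where a: "a' \<le> a" "i = IxNat a" "i' = IxNat a'" "u = IxPair i i'" using e(4) unfolding hom_tower_cat by blast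
  obtain b b' where b: "b' \<le> b" "j = IxNat b" "j' = IxNat b'" "w = IxPair j j'" using e(5) unfolding hom_tower_cat by blast
  show ?thesis using that[of a b a' b'] a b e by (simp add: D_def tt_def A.tr_def B.tr_def)
qed

lemma \<Phi>: "\<Phi> \<in> hom P Y D"
  unfolding \<Phi>_def Y_def D_def using A.tenaP(1)[OF A.\<phi> B.\<phi>] by (simp add: A.ten_P)

lemma \<Phi>_iso: "iso P \<Phi>"
proof -
  obtain g where g: "g \<in> hom P TA XA" "g \<cdot>\<^bsub>P\<^esub> \<phi>A = idn P XA" "\<phi>A \<cdot>\<^bsub>P\<^esub> g = idn P TA"
    using A.P.isoE[OF A.\<phi>_iso A.\<phi>] by metis
  obtain h where h: "h \<in> hom P TB XB" "h \<cdot>\<^bsub>P\<^esub> \<phi>B = idn P XB" "\<phi>B \<cdot>\<^bsub>P\<^esub> h = idn P TB"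
    using A.P.isoE[OF B.\<phi>_iso B.\<phi>] by metis
  have gh: "g \<odot>\<^bsub>P\<^esub> h \<in> hom P D Y" unfolding Y_def D_def using A.tenaP(1)[OF g(1) h(1)] by (simp add: A.ten_P)
  show ?thesis
  proof (rule A.P.isoI[OF \<Phi> gh])
    show "(g \<odot>\<^bsub>P\<^esub> h) \<cdot>\<^bsub>P\<^esub> \<Phi> = idn P Y"
      unfolding \<Phi>_def Y_def A.ten_P using A.tena_cmpP[OF A.\<phi> g(1) B.\<phi> h(1)] g h A.tena_idnP[OF A.X B.X] by simp
    show "\<Phi> \<cdot>\<^bsub>P\<^esub> (g \<odot>\<^bsub>P\<^esub> h) = idn P D"
      unfolding \<Phi>_def D_def using A.tena_cmpP[OF g(1) A.\<phi> h(1) B.\<phi>] g h A.tena_idnP[OF A.T B.T] by simp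
  qed
qed

lemma \<rho>_hom: "\<rho> a b \<in> hom P Y (con C (Zo a b))"
  unfolding \<rho>_def Y_def Zo_def using A.cten_hom[OF A.\<psi>_hom B.\<psi>_hom A.Tn_obj B.Tn_obj] .

lemma proj_D: "pro_proj C D (IxPair (IxNat a) (IxNat b)) \<in> hom P D (con C (Zo a b))"
  using A.projP(1)[OF D_obj D_index] D_idx(2) by simp

text \<open>The projections built from the two factors are the projections of the pro-object
  \<open>D\<close>, composed with the isomorphism \<open>\<Phi>\<close>. This gives access to limits
  and germs over the product index category.\<close>

lemma \<rho>_proj: "\<rho> a b = pro_proj C D (IxPair (IxNat a) (IxNat b)) \<cdot>\<^bsub>P\<^esub> \<Phi>"
proof -
  have i: "IxNat a \<in> obj (pidx TA)" "IxNat b \<in> obj (pidx TB)" by (simp_all add: A.T_idx B.T_idx)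
  have pa: "pro_proj C TA (IxNat a) \<in> hom P TA (con C (A.Tn a))" "(IxNat a, idn C (A.Tn a)) \<in> pgerm (pro_proj C TA (IxNat a)) (IxNat 0)"
    using A.projP[OF A.T i(1)] by (simp_all add: A.Tn_def)
  have pb: "pro_proj C TB (IxNat b) \<in> hom P TB (con C (B.Tn b))" "(IxNat b, idn C (B.Tn b)) \<in> pgerm (pro_proj C TB (IxNat b)) (IxNat 0)"
    using A.projP[OF B.T i(2)] by (simp_all add: B.Tn_def)
  note c = A.con_tenP[OF A.Tn_obj[of a] B.Tn_obj[of b]]
  have pp: "pro_proj C TA (IxNat a) \<odot>\<^bsub>P\<^esub> pro_proj C TB (IxNat b) \<in> hom P D (con C (A.Tn a) \<otimes>\<^bsub>P\<^esub> con C (B.Tn b))"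
    unfolding D_def using A.tenaP(1)[OF pa(1) pb(1)] by (simp add: A.ten_P)
  have ii: "idn C (A.Tn a) \<odot> idn C (B.Tn b) = idn C (Zo a b)" unfolding Zo_def using A.tena_idn by simp
  have z: "idn C (Zo a b) \<cdot> idn C (Zo a b) = idn C (Zo a b)" by simp
  have "A.cten (A.Tn a) (B.Tn b) (pro_proj C TA (IxNat a)) (pro_proj C TB (IxNat b)) = pro_proj C D (IxPair (IxNat a) (IxNat b))"
  proof (rule A.con_eqI)
    show "A.cten (A.Tn a) (B.Tn b) (pro_proj C TA (IxNat a)) (pro_proj C TB (IxNat b)) \<in> hom P D (con C (Zo a b))"
      unfolding D_def Zo_def using A.cten_hom[OF pa(1) pb(1) A.Tn_obj B.Tn_obj] by (simp add: A.ten_P)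
    show "pro_proj C D (IxPair (IxNat a) (IxNat b)) \<in> hom P D (con C (Zo a b))" by (rule proj_D)
    show "(IxPair (IxNat a) (IxNat b), idn C (Zo a b)) \<in> pgerm (pro_proj C D (IxPair (IxNat a) (IxNat b))) (IxNat 0)"
      using A.projP(2)[OF D_obj D_index] D_idx(2) by simp
    show "(IxPair (IxNat a) (IxNat b), idn C (Zo a b)) \<in> pgerm (A.cten (A.Tn a) (B.Tn b) (pro_proj C TA (IxNat a)) (pro_proj C TB (IxNat b))) (IxNat 0)"
      using A.cmpP(2)[OF pp c(1) c(2) A.tenaP(2)[OF pa(1) pb(1) pa(2) pb(2)]] ii z unfolding A.cten_def Zo_def by simp
  qed
  moreover have "A.cten (A.Tn a) (B.Tn b) (pro_proj C TA (IxNat a)) (pro_proj C TB (IxNat b)) \<cdot>\<^bsub>P\<^esub> \<Phi> = \<rho> a b"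
    unfolding A.cten_def \<rho>_def A.\<psi>_def B.\<psi>_def A.tena_cmpP[OF A.\<phi> pa(1) B.\<phi> pb(1)] \<Phi>_def[symmetric]
    using A.P.cmp_assoc[OF \<Phi> pp c(1)] by simp
  ultimately show ?thesis by simp
qed

lemma tt_hom: "a' \<le> a \<Longrightarrow> b' \<le> b \<Longrightarrow> tt a b a' b' \<in> hom C (Zo a b) (Zo a' b')"
  unfolding tt_def Zo_def using A.tena_hom A.tr_hom B.tr_hom by blast

lemma tt_id: "tt a b a b = idn C (Zo a b)"
  unfolding tt_def Zo_def A.tr_id B.tr_id using A.tena_idn by simp

lemma tt_tt:
  assumes "a' \<le> a" "b' \<le> b" "a'' \<le> a'" "b'' \<le> b'" shows "tt a' b' a'' b'' \<cdot> tt a b a' b' = tt a b a'' b''"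
  unfolding tt_def
  using A.tena_cmp[OF A.tr_hom[OF assms(1)] A.tr_hom[OF assms(3)] B.tr_hom[OF assms(2)] B.tr_hom[OF assms(4)]]
    A.tr_cmp[OF assms(3,1)] B.tr_cmp[OF assms(4,2)] by simp

lemma tt_\<rho>:
  assumes "a' \<le> a" "b' \<le> b" shows "cona C (tt a b a' b') \<cdot>\<^bsub>P\<^esub> \<rho> a b = \<rho> a' b'"
  unfolding tt_def \<rho>_def
  using A.cona_cten[OF A.\<psi>_hom B.\<psi>_hom A.tr_hom[OF assms(1)] B.tr_hom[OF assms(2)]] A.tr_\<psi>[OF assms(1)] B.tr_\<psi>[OF assms(2)] by simp

lemma tt_epi: "a' \<le> a \<Longrightarrow> b' \<le> b \<Longrightarrow> epi C (tt a b a' b')"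
  unfolding tt_def using A.tena_epi[OF A.tr_epi A.tr_hom B.tr_epi B.tr_hom] by blast

lemma e1_hom: "e1 a b \<in> hom C ((shf C ^^ dA) (Zo a b)) (Zo (Suc a) b)"
  unfolding e1_def Zo_def using A.S.on_left_hom[OF A.\<zeta>(1) B.Tn_obj A.Tn_obj] .

lemma e2_hom: "e2 a b \<in> hom C ((shf C ^^ dB) (Zo a b)) (Zo a (Suc b))"
  unfolding e2_def Zo_def using A.S.on_right_hom[OF B.\<zeta>(1) A.Tn_obj B.Tn_obj] .

lemma \<rho>_e1: "\<rho> (Suc a) b \<cdot>\<^bsub>P\<^esub> on_left P dA zA XA XB = cona C (e1 a b) \<cdot>\<^bsub>P\<^esub> (shfa P ^^ dA) (\<rho> a b)"
  unfolding e1_def \<rho>_def by (rule A.cten_on_left[OF A.z A.\<psi>_hom A.\<psi>_hom A.\<zeta> B.\<psi>_hom A.Tn_obj B.Tn_obj])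

lemma \<rho>_e2: "\<rho> a (Suc b) \<cdot>\<^bsub>P\<^esub> on_right P dB zB XA XB = cona C (e2 a b) \<cdot>\<^bsub>P\<^esub> (shfa P ^^ dB) (\<rho> a b)"
  unfolding e2_def \<rho>_def by (rule A.cten_on_right[OF B.z B.\<psi>_hom B.\<psi>_hom B.\<zeta> A.\<psi>_hom B.Tn_obj A.Tn_obj])

lemma tt_e1:
  assumes "a' \<le> a" "b' \<le> b"
  shows "tt (Suc a) b (Suc a') b' \<cdot> e1 a b = e1 a' b' \<cdot> (shfa C ^^ dA) (tt a b a' b')"
proof -
  have le: "Suc a' \<le> Suc a" using assms by simp
  show ?thesis unfolding e1_def tt_def
    using A.S.on_left_square[OF A.\<zeta>(1) A.\<zeta>(1) A.tr_hom[OF assms(1)] A.tr_hom[OF le] B.tr_hom[OF assms(2)]]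
      A.tr_\<zeta>[OF assms(1)] by simp
qed

lemma tt_e2:
  assumes "a' \<le> a" "b' \<le> b"
  shows "tt a (Suc b) a' (Suc b') \<cdot> e2 a b = e2 a' b' \<cdot> (shfa C ^^ dB) (tt a b a' b')"
proof -
  have le: "Suc b' \<le> Suc b" using assms by simp
  show ?thesis unfolding e2_def tt_def
    using A.S.on_right_square[OF B.\<zeta>(1) B.\<zeta>(1) B.tr_hom[OF assms(2)] B.tr_hom[OF le] A.tr_hom[OF assms(1)]]
      B.tr_\<zeta>[OF assms(2)] by simp
qed

lemma e1_e2: "e1 a (Suc b) \<cdot> (shfa C ^^ dA) (e2 a b) = e2 (Suc a) b \<cdot> (shfa C ^^ dB) (e1 a b)"
  unfolding e1_def e2_def
  by (rule A.S.on_left_on_right[OF _ A.Tn_obj B.Tn_obj A.\<zeta>(1) B.\<zeta>(1)]) (rule A.shl_shr)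

lemma e1_exact: "is_kernel C (tt (Suc a) b 1 b) (e1 a b)" "is_cokernel C (e1 a b) (tt (Suc a) b 1 b)"
  unfolding e1_def tt_def B.tr_id
  using A.on_left_exact[OF A.zeta_exact A.\<zeta>(1) A.Tn_obj A.tr_hom B.Tn_obj] by simp_all

lemma e2_exact: "is_kernel C (tt a (Suc b) a 1) (e2 a b)" "is_cokernel C (e2 a b) (tt a (Suc b) a 1)"
  unfolding e2_def tt_def A.tr_id
  using A.on_right_exact[OF B.zeta_exact B.\<zeta>(1) B.Tn_obj B.tr_hom A.Tn_obj] by simp_all

text \<open>The identity of one factor is 0 times itself, and linearity in that factor passes this
  on to the identity of the tensor product.\<close>

lemma zero_objects: "idn C (Zo 0 b) = zer C (Zo 0 b) (Zo 0 b)" "idn C (Zo a 0) = zer C (Zo a 0) (Zo a 0)"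
proof -
  have i: "idn C (A.Tn 0) \<in> hom C (A.Tn 0) (A.Tn 0)" "idn C (B.Tn 0) \<in> hom C (B.Tn 0) (B.Tn 0)" using A.idn_hom by simp_all
  have "idn C (Zo 0 b) = smul C 0 (idn C (A.Tn 0)) \<odot> idn C (B.Tn b)"
    using A.tena_idn[of "A.Tn 0" "B.Tn b"] A.T0 A.smul_0[OF i(1)] by (simp add: Zo_def)
  also have "\<dots> = smul C 0 (idn C (A.Tn 0) \<odot> idn C (B.Tn b))"
    using A.tena_linear_right[OF B.Tn_obj[of b]] i unfolding linear_functor_def by blast
  also have "\<dots> = zer C (Zo 0 b) (Zo 0 b)"
    using A.tena_idn[of "A.Tn 0" "B.Tn b"] A.smul_0[OF A.idn_hom[OF Zo_obj[of 0 b]]] by (simp add: Zo_def)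
  finally show "idn C (Zo 0 b) = zer C (Zo 0 b) (Zo 0 b)" .
  have "idn C (Zo a 0) = idn C (A.Tn a) \<odot> smul C 0 (idn C (B.Tn 0))"
    using A.tena_idn[of "A.Tn a" "B.Tn 0"] B.T0 A.smul_0[OF i(2)] by (simp add: Zo_def)
  also have "\<dots> = smul C 0 (idn C (A.Tn a) \<odot> idn C (B.Tn 0))"
    using A.tena_linear_left[OF A.Tn_obj[of a]] i unfolding linear_functor_def by blast
  also have "\<dots> = zer C (Zo a 0) (Zo a 0)"
    using A.tena_idn[of "A.Tn a" "B.Tn 0"] A.smul_0[OF A.idn_hom[OF Zo_obj[of a 0]]] by (simp add: Zo_def)
  finally show "idn C (Zo a 0) = zer C (Zo a 0) (Zo a 0)" .
qed

lemma Q\<Phi>: "(shfa P ^^ n) \<Phi> \<in> hom P ((shf P ^^ n) Y) ((shf P ^^ n) D)" "iso P ((shfa P ^^ n) \<Phi>)"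
  using A.P.Q_hom[OF \<Phi>] A.P.Q_iso[OF \<Phi>_iso \<Phi>] by blast+

lemma QD_obj: "(shf P ^^ n) D \<in> pro_objs C"
  using A.P.Q_obj[of D n] D_obj by simp

lemma Qproj: "pro_proj C ((shf P ^^ n) D) (IxPair (IxNat a) (IxNat b)) \<in> hom P ((shf P ^^ n) D) (con C ((shf C ^^ n) (Zo a b)))"
  using A.projP(1)[OF QD_obj, of "IxPair (IxNat a) (IxNat b)" n] D_index[of a b] D_idx(2)[of a b] by simp

lemma Q\<rho>: "(shfa P ^^ n) (\<rho> a b) = pro_proj C ((shf P ^^ n) D) (IxPair (IxNat a) (IxNat b)) \<cdot>\<^bsub>P\<^esub> (shfa P ^^ n) \<Phi>"
  unfolding \<rho>_proj using A.P.Q_cmp[OF \<Phi> proj_D, of n a b] A.Q_proj[OF D_obj D_index, of n a b] by simp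

text \<open>\<open>q^n D\<close> is the limit of its constant terms and \<open>\<Phi>\<close>
  identifies \<open>Y\<close> with \<open>D\<close>; a compatible family indexed by pairs of
  naturals is a cone over the product of the two tower categories.\<close>

lemma \<rho>_limit:
  assumes W: "W \<in> pro_objs C" and f: "\<And>a b. f a b \<in> hom P W (con C ((shf C ^^ n) (Zo a b)))"
    and c: "\<And>a b a' b'. a' \<le> a \<Longrightarrow> b' \<le> b \<Longrightarrow> cona C ((shfa C ^^ n) (tt a b a' b')) \<cdot>\<^bsub>P\<^esub> f a b = f a' b'"
  obtains G where "G \<in> hom P W ((shf P ^^ n) Y)" "\<And>a b. (shfa P ^^ n) (\<rho> a b) \<cdot>\<^bsub>P\<^esub> G = f a b"
proof -
  \<comment> \<open>Inverse of \<open>IxNat\<close>, to read indices of the double tower as natural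
    numbers.\<close>
  define num where "num i = (THE n. i = IxNat n)" for i :: "('a, 'm) idx"
  have num [simp]: "num (IxNat n) = n" for n by (simp add: num_def)
  define g where "g p = f (num (ixfst p)) (num (ixsnd p))" for p
  have g: "g (IxPair (IxNat a) (IxNat b)) = f a b" for a b by (simp add: g_def)
  have 1: "g p \<in> hom P W (con C (pob ((shf P ^^ n) D) p))" if p: "p \<in> obj (pidx ((shf P ^^ n) D))" for p
  proof -
    have "p \<in> obj (pidx D)" using p by simp
    then obtain a b where "p = IxPair (IxNat a) (IxNat b)" by (rule D_cases)
    then show ?thesis using f[of a b] D_idx(2)[of a b] g by simp
  qed
  have 2: "cona C (par ((shf P ^^ n) D) v) \<cdot>\<^bsub>P\<^esub> g p = g p'" if v: "v \<in> hom (pidx ((shf P ^^ n) D)) p p'" for v p p'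
  proof -
    have "v \<in> hom (pidx D) p p'" using v by simp
    then obtain a b a' b' where "p = IxPair (IxNat a) (IxNat b)" "p' = IxPair (IxNat a') (IxNat b')" "a' \<le> a" "b' \<le> b"
      "par D v = tt a b a' b'" by (rule D_hom)
    then show ?thesis using c g by simp
  qed
  obtain F where F: "F \<in> hom P W ((shf P ^^ n) D)" "\<And>p. p \<in> obj (pidx ((shf P ^^ n) D)) \<Longrightarrow> pro_proj C ((shf P ^^ n) D) p \<cdot>\<^bsub>P\<^esub> F = g p"
    using A.pro_lift[OF W QD_obj 1 2] by blast
  obtain h where h: "h \<in> hom P ((shf P ^^ n) D) ((shf P ^^ n) Y)" "(shfa P ^^ n) \<Phi> \<cdot>\<^bsub>P\<^esub> h = idn P ((shf P ^^ n) D)"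
    using A.P.isoE[OF Q\<Phi>(2,1)] by metis
  note hF = A.cmpP(1)[OF F(1) h(1)]
  have \<Phi>hF: "(shfa P ^^ n) \<Phi> \<cdot>\<^bsub>P\<^esub> (h \<cdot>\<^bsub>P\<^esub> F) = F"
    using A.P.cmp_assoc[OF F(1) h(1) Q\<Phi>(1)] h(2) A.P.idn_cmp[OF F(1)] by simp
  have "(shfa P ^^ n) (\<rho> a b) \<cdot>\<^bsub>P\<^esub> (h \<cdot>\<^bsub>P\<^esub> F) = f a b" for a b
    unfolding Q\<rho> A.P.cmp_assoc[OF hF Q\<Phi>(1) Qproj, symmetric] \<Phi>hF using F(2)[of "IxPair (IxNat a) (IxNat b)"] D_index g by simp
  then show ?thesis using that[OF hF] by blast
qed

lemma \<rho>_separated: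
  assumes F: "F \<in> hom P W ((shf P ^^ n) Y)" and G: "G \<in> hom P W ((shf P ^^ n) Y)"
    and e: "\<And>a b. (shfa P ^^ n) (\<rho> a b) \<cdot>\<^bsub>P\<^esub> F = (shfa P ^^ n) (\<rho> a b) \<cdot>\<^bsub>P\<^esub> G"
  shows "F = G"
proof -
  have "(shfa P ^^ n) \<Phi> \<cdot>\<^bsub>P\<^esub> F = (shfa P ^^ n) \<Phi> \<cdot>\<^bsub>P\<^esub> G"
  proof (rule A.proj_eqI[OF A.cmpP(1)[OF F Q\<Phi>(1)] A.cmpP(1)[OF G Q\<Phi>(1)]])
    fix p assume "p \<in> obj (pidx ((shf P ^^ n) D))"
    then have "p \<in> obj (pidx D)" by simp
    then obtain a b where p: "p = IxPair (IxNat a) (IxNat b)" by (rule D_cases)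
    show "pro_proj C ((shf P ^^ n) D) p \<cdot>\<^bsub>P\<^esub> ((shfa P ^^ n) \<Phi> \<cdot>\<^bsub>P\<^esub> F) = pro_proj C ((shf P ^^ n) D) p \<cdot>\<^bsub>P\<^esub> ((shfa P ^^ n) \<Phi> \<cdot>\<^bsub>P\<^esub> G)"
      unfolding p A.P.cmp_assoc[OF F Q\<Phi>(1) Qproj] A.P.cmp_assoc[OF G Q\<Phi>(1) Qproj] Q\<rho>[symmetric] by (rule e)
  qed
  then show ?thesis using A.P.iso_cancel_left[OF Q\<Phi>(2,1) F G] by blast
qed

text \<open>Through the inverse of \<open>\<Phi>\<close> the morphism starts from
  \<open>q^n D\<close>, and there it is represented at a single pair of indices.\<close>

lemma \<rho>_factor:
  assumes F: "F \<in> hom P ((shf P ^^ n) Y) (con C c)"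
  obtains a b g where "g \<in> hom C ((shf C ^^ n) (Zo a b)) c" "F = cona C g \<cdot>\<^bsub>P\<^esub> (shfa P ^^ n) (\<rho> a b)"
proof -
  obtain h where h: "h \<in> hom P ((shf P ^^ n) D) ((shf P ^^ n) Y)" "h \<cdot>\<^bsub>P\<^esub> (shfa P ^^ n) \<Phi> = idn P ((shf P ^^ n) Y)"
    using A.P.isoE[OF Q\<Phi>(2,1)] by metis
  obtain p g where g: "p \<in> obj (pidx ((shf P ^^ n) D))" "g \<in> hom C (pob ((shf P ^^ n) D) p) c"
    "F \<cdot>\<^bsub>P\<^esub> h = cona C g \<cdot>\<^bsub>P\<^esub> pro_proj C ((shf P ^^ n) D) p"
    using A.con_factor[OF A.cmpP(1)[OF h(1) F]] by metis
  have "p \<in> obj (pidx D)" using g(1) by simp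
  then obtain a b where p: "p = IxPair (IxNat a) (IxNat b)" by (rule D_cases)
  have g': "g \<in> hom C ((shf C ^^ n) (Zo a b)) c" using g(2) D_idx(2)[of a b] p by simp
  have "F = (F \<cdot>\<^bsub>P\<^esub> h) \<cdot>\<^bsub>P\<^esub> (shfa P ^^ n) \<Phi>"
    using A.P.cmp_assoc[OF Q\<Phi>(1) h(1) F] h(2) A.P.cmp_idn[OF F] by simp
  also have "\<dots> = cona C g \<cdot>\<^bsub>P\<^esub> (shfa P ^^ n) (\<rho> a b)"
    unfolding g(3) p Q\<rho> using A.P.cmp_assoc[OF Q\<Phi>(1) Qproj A.conaP(1)[OF g']] by simp
  finally show ?thesis using that g' by blast
qed

text \<open>Since the germ of \<open>g\<close> is zero, \<open>g\<close> vanishes after some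
  transition map of the double tower, and these maps are epi.\<close>

lemma \<rho>_epi:
  assumes g: "g \<in> hom C ((shf C ^^ n) (Zo a b)) c"
    and z: "cona C g \<cdot>\<^bsub>P\<^esub> (shfa P ^^ n) (\<rho> a b) = zer P ((shf P ^^ n) Y) (con C c)"
  shows "g = zer C ((shf C ^^ n) (Zo a b)) c"
proof -
  have c: "con C c \<in> obj P" using A.homD(5)[OF g] by simp
  let ?p = "IxPair (IxNat a) (IxNat b) :: ('a, 'm) idx"
  note gp = A.cmpP(1)[OF Qproj A.conaP(1)[OF g]]
  have "(cona C g \<cdot>\<^bsub>P\<^esub> pro_proj C ((shf P ^^ n) D) ?p) \<cdot>\<^bsub>P\<^esub> (shfa P ^^ n) \<Phi> = zer P ((shf P ^^ n) D) (con C c) \<cdot>\<^bsub>P\<^esub> (shfa P ^^ n) \<Phi>"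
    using z A.P.zer_cmp[OF Q\<Phi>(1) c] A.P.cmp_assoc[OF Q\<Phi>(1) Qproj A.conaP(1)[OF g]] Q\<rho> by simp
  then have "cona C g \<cdot>\<^bsub>P\<^esub> pro_proj C ((shf P ^^ n) D) ?p = zer P ((shf P ^^ n) D) (con C c)"
    using A.P.iso_cancel_right[OF Q\<Phi>(2,1) gp A.P.zer_hom] QD_obj c by simp
  moreover have "(?p, idn C ((shf C ^^ n) (Zo a b))) \<in> pgerm (pro_proj C ((shf P ^^ n) D) ?p) (IxNat 0)"
    using A.projP(2)[OF QD_obj, of ?p n] D_index[of a b] D_idx(2)[of a b] by simp
  then have "(?p, g) \<in> pgerm (cona C g \<cdot>\<^bsub>P\<^esub> pro_proj C ((shf P ^^ n) D) ?p) (IxNat 0)"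
    using A.rep_con_cmp[OF Qproj _ g] A.cmp_idn[OF g] by metis
  ultimately obtain k u where u: "u \<in> hom (pidx ((shf P ^^ n) D)) k ?p" "g \<cdot> par ((shf P ^^ n) D) u = zer C (pob ((shf P ^^ n) D) k) c"
    using A.rep_zero[OF gp] by blast
  have "u \<in> hom (pidx D) k ?p" using u(1) by simp
  then obtain a1 b1 a' b' where v: "k = IxPair (IxNat a1) (IxNat b1)" "?p = IxPair (IxNat a') (IxNat b')" "a' \<le> a1" "b' \<le> b1"
      "par D u = tt a1 b1 a' b'" by (rule D_hom)
  have le: "a \<le> a1" "b \<le> b1" "par D u = tt a1 b1 a b" using v by auto
  have "g \<cdot> (shfa C ^^ n) (tt a1 b1 a b) = zer C ((shf C ^^ n) (Zo a1 b1)) c"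
    using u(2) le(3) v(1) D_idx(2)[of a1 b1] by simp
  then show ?thesis
    using A.epi_zeroD[OF A.S.Q_epi[OF tt_epi[OF le(1,2)] tt_hom[OF le(1,2)]] A.S.Q_hom[OF tt_hom[OF le(1,2)]] g] by blast
qed

definition Z :: "nat \<Rightarrow> nat \<Rightarrow> ('o, 'm, 'a) pro_ob" where "Z a b = con C (Zo a b)"
definition rG where "rG a b = (Y, Z a b, 0 :: int, \<rho> a b)"
definition tG where "tG a b a' b' = (Z a b, Z a' b', 0 :: int, cona C (tt a b a' b') :: ('o, 'm, 'a) pro_ar)"
definition s1G where "s1G a b = (Z a b, Z (Suc a) b, int dA, cona C (e1 a b) :: ('o, 'm, 'a) pro_ar)"
definition s2G where "s2G a b = (Z a b, Z a (Suc b), int dB, cona C (e2 a b) :: ('o, 'm, 'a) pro_ar)"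
definition y1G where "y1G = (Y, Y, int dA, on_left P dA zA XA XB)"
definition y2G where "y2G = (Y, Y, int dB, on_right P dB zB XA XB)"

lemma Z_obj: "Z a b \<in> obj P"
  by (simp add: Z_def)

lemma QZ: "(shf P ^^ n) (Z a b) = con C ((shf C ^^ n) (Zo a b))"
  by (simp add: Z_def A.Q_con)

lemma tG: "a' \<le> a \<Longrightarrow> b' \<le> b \<Longrightarrow> tG a b a' b' \<in> A.P.GH 0 (Z a b) (Z a' b')"
  unfolding tG_def Z_def using A.cona_GH0[OF tt_hom] .

lemma s1G: "s1G a b \<in> A.P.GH (int dA) (Z a b) (Z (Suc a) b)"
  unfolding s1G_def Z_def using A.cona_GH[OF e1_hom Zo_obj] .

lemma s2G: "s2G a b \<in> A.P.GH (int dB) (Z a b) (Z a (Suc b))"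
  unfolding s2G_def Z_def using A.cona_GH[OF e2_hom Zo_obj] .

lemma rG: "rG a b \<in> A.P.GH 0 Y (Z a b)"
  unfolding rG_def Z_def using A.P.GH_0[OF \<rho>_hom] .

lemma y1_hom: "on_left P dA zA XA XB \<in> hom P ((shf P ^^ dA) Y) Y"
  and y2_hom: "on_right P dB zB XA XB \<in> hom P ((shf P ^^ dB) Y) Y"
  unfolding Y_def using A.P.on_left_hom[OF A.z] A.P.on_right_hom[OF B.z] A.X B.X by simp_all

lemma YP: "Y \<in> obj P"
  using Y_obj by simp

lemma y1G: "y1G \<in> A.P.GH (int dA) Y Y" and y2G: "y2G \<in> A.P.GH (int dB) Y Y"
  unfolding y1G_def y2G_def using A.P.GH_nat[OF YP YP] y1_hom y2_hom by blast+

lemma cona_simp: "f \<in> hom C U V \<Longrightarrow> g \<in> hom C V W \<Longrightarrow> cona C g \<cdot>\<^bsub>P\<^esub> cona C f = cona C (g \<cdot> f)"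
  using A.cona_cmp by simp

lemma ST_to_Z:
  assumes "F \<in> A.P.GH k W (Z a b)" "0 \<le> int n + k"
  shows "A.P.ST n F \<in> hom P ((shf P ^^ nat (int n + k)) W) (con C ((shf C ^^ n) (Zo a b)))"
  using A.ST_to_con[OF _ Zo_obj assms(2)] assms(1) unfolding Z_def by blast

lemma ST_rG: "A.P.ST n (rG a b) = (shfa P ^^ n) (\<rho> a b)"
  by (simp add: rG_def A.P.ST_nonneg)

lemma graded_limit:
  assumes W: "W \<in> obj P" and f: "\<And>a b. f a b \<in> A.P.GH k W (Z a b)"
    and c: "\<And>a b a' b'. a' \<le> a \<Longrightarrow> b' \<le> b \<Longrightarrow> A.P.gc (tG a b a' b') (f a b) = f a' b'"
  shows "\<exists>G\<in>A.P.GH k W Y. \<forall>a b. A.P.gc (rG a b) G = f a b"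
proof -
  obtain n where n: "0 \<le> int n + k" by (rule A.P.ex_shift)
  have QW: "(shf P ^^ nat (int n + k)) W \<in> pro_objs C" using A.P.Q_obj[OF W] by simp
  have c': "cona C ((shfa C ^^ n) (tt a b a' b')) \<cdot>\<^bsub>P\<^esub> A.P.ST n (f a b) = A.P.ST n (f a' b')"
    if le: "a' \<le> a" "b' \<le> b" for a b a' b'
    using A.P.ST_gc[OF f tG[OF le], of n] n c[OF le] A.ST_cona0[OF tt_hom[OF le], of n] unfolding tG_def Z_def by simp
  obtain G' where G': "G' \<in> hom P ((shf P ^^ nat (int n + k)) W) ((shf P ^^ n) Y)"
    "\<And>a b. (shfa P ^^ n) (\<rho> a b) \<cdot>\<^bsub>P\<^esub> G' = A.P.ST n (f a b)"
    using \<rho>_limit[OF QW ST_to_Z[OF f n] c'] by blast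
  obtain G where G: "G \<in> A.P.GH k W Y" "A.P.ST n G = G'" using A.P.ST_surj[OF W YP n G'(1)] .
  have "A.P.gc (rG a b) G = f a b" for a b
  proof (rule A.P.ST_inj[OF _ f])
    show "A.P.gc (rG a b) G \<in> A.P.GH k W (Z a b)" using A.P.gc_GH[OF G(1) rG] by simp
    show "A.P.ST n (A.P.gc (rG a b) G) = A.P.ST n (f a b)"
      using A.P.ST_gc[OF G(1) rG, of n] n ST_rG G G'(2) by simp
  qed
  then show ?thesis using G(1) by blast
qed

lemma graded_separated:
  assumes F: "F \<in> A.P.GH k W Y" and G: "G \<in> A.P.GH k W Y" and e: "\<And>a b. A.P.gc (rG a b) F = A.P.gc (rG a b) G"
  shows "F = G"
proof -
  obtain n where n: "0 \<le> int n + k" by (rule A.P.ex_shift)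
  have "(shfa P ^^ n) (\<rho> a b) \<cdot>\<^bsub>P\<^esub> A.P.ST n F = (shfa P ^^ n) (\<rho> a b) \<cdot>\<^bsub>P\<^esub> A.P.ST n G" for a b
    using A.P.ST_gc[OF F rG, of n a b] A.P.ST_gc[OF G rG, of n a b] n ST_rG e by simp
  then have "A.P.ST n F = A.P.ST n G" using \<rho>_separated[OF A.P.ST_hom[OF F n] A.P.ST_hom[OF G n]] by blast
  then show ?thesis using A.P.ST_inj[OF F G] by blast
qed

lemma graded_factor:
  assumes c: "c \<in> obj C" and F: "F \<in> A.P.GH k Y (con C c)"
  shows "\<exists>a b. \<exists>G\<in>A.P.GH k (Z a b) (con C c). F = A.P.gc G (rG a b)"
proof -
  obtain n where n: "0 \<le> int n + k" by (rule A.P.ex_shift)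
  obtain a b g where g: "g \<in> hom C ((shf C ^^ nat (int n + k)) (Zo a b)) ((shf C ^^ n) c)"
    "A.P.ST n F = cona C g \<cdot>\<^bsub>P\<^esub> (shfa P ^^ nat (int n + k)) (\<rho> a b)"
    using \<rho>_factor[OF A.ST_to_con[OF F c n]] .
  obtain G where G: "G \<in> A.P.GH k (Z a b) (con C c)" "A.P.ST n G = cona C g"
    using A.GH_con_con[OF g(1) Zo_obj c n] unfolding Z_def by blast
  have "A.P.ST n (A.P.gc G (rG a b)) = A.P.ST n F"
    using A.P.ST_gc[OF rG G(1) n] n ST_rG G(2) g(2) by simp
  then have "F = A.P.gc G (rG a b)" using A.P.ST_inj[OF F, of "A.P.gc G (rG a b)" n] A.P.gc_GH[OF rG G(1)] by simp
  then show ?thesis using G(1) by blast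
qed

lemma graded_epi:
  assumes c: "c \<in> obj C" and G: "G \<in> A.P.GH k (Z a b) (con C c)" and z: "A.P.gc G (rG a b) = A.P.gz k Y (con C c)"
  shows "G = A.P.gz k (Z a b) (con C c)"
proof -
  obtain n where n: "0 \<le> int n + k" by (rule A.P.ex_shift)
  let ?N = "nat (int n + k)"
  have G': "G \<in> A.P.GH k (con C (Zo a b)) (con C c)" using G by (simp add: Z_def)
  obtain g where g: "g \<in> hom C ((shf C ^^ ?N) (Zo a b)) ((shf C ^^ n) c)" "A.P.ST n G = cona C g"
    using A.ST_con_con[OF G' Zo_obj c n] .
  have "cona C g \<cdot>\<^bsub>P\<^esub> (shfa P ^^ ?N) (\<rho> a b) = zer P ((shf P ^^ ?N) Y) (con C ((shf C ^^ n) c))"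
    using A.P.ST_gc[OF rG G n] n ST_rG g(2) z A.P.ST_gz[OF YP A.con_objP[OF c] n] c by (simp add: A.Q_con)
  then have "g = zer C ((shf C ^^ ?N) (Zo a b)) ((shf C ^^ n) c)" using \<rho>_epi[OF g(1)] by blast
  then have "A.P.ST n G = A.P.ST n (A.P.gz k (Z a b) (con C c))"
    using g(2) A.P.ST_gz[OF Z_obj A.con_objP[OF c] n, of a b] A.cona_zer[OF A.S.Q_obj[OF Zo_obj] A.S.Q_obj[OF c]] c QZ by (simp add: A.Q_con)
  then show ?thesis using A.P.ST_inj[OF G A.P.gz_GH[OF Z_obj A.con_objP[OF c]]] by blast
qed

lemma gi_zero:
  assumes "idn C (Zo a b) = zer C (Zo a b) (Zo a b)" shows "A.P.gi (Z a b) = A.P.gz 0 (Z a b) (Z a b)"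
  using assms A.cona_idn[OF Zo_obj, of a b] A.cona_zer[OF Zo_obj Zo_obj, of a b a b]
  by (simp add: A.P.gi_def A.P.gz_def Z_def shpow_def)

text \<open>Exactness of \<open>e1\<close> and \<open>e2\<close> in \<open>C\<close> gives the
  kernel, mono and cokernel axioms; that \<open>Y\<close> is the limit of the constant objects
  \<open>Z a b\<close>, with epi transition maps, gives \<open>limit\<close>,
  \<open>separated\<close>, \<open>factor\<close> and \<open>r_epi\<close>. The remaining axioms are
  the level identities with tags attached.\<close>

theorem bitower_tensor:
  "bitower (obj P) A.P.GH A.P.gc A.P.gi A.P.ga A.P.gs A.P.gz (con C ` obj C) Y (int dA) (int dB) y1G y2G Z rG tG s1G s2G"
proof (intro bitower.intro bitower_axioms.intro)
  show "graded_linear (obj P) A.P.GH A.P.gc A.P.gi A.P.ga A.P.gs A.P.gz" by unfold_locales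
  show "0 < int dA" "0 < int dB" using A.d B.d by simp_all
  show "y1G \<in> A.P.GH (int dA) Y Y" "y2G \<in> A.P.GH (int dB) Y Y" by (rule y1G y2G)+
  show "con C ` obj C \<subseteq> obj P" by auto
  show "Z a b \<in> con C ` obj C" for a b by (simp add: Z_def)
  show "rG a b \<in> A.P.GH 0 Y (Z a b)" for a b by (rule rG)
  show "s1G a b \<in> A.P.GH (int dA) (Z a b) (Z (Suc a) b)" "s2G a b \<in> A.P.GH (int dB) (Z a b) (Z a (Suc b))" for a b
    by (rule s1G s2G)+
  show "tG a b a' b' \<in> A.P.GH 0 (Z a b) (Z a' b')" if "a' \<le> a" "b' \<le> b" for a b a' b' by (rule tG[OF that])
  show "tG a b a b = A.P.gi (Z a b)" for a b
    using A.cona_idn[OF Zo_obj] by (simp add: tG_def A.P.gi_def tt_id Z_def)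
  show "A.P.gc (tG a' b' a'' b'') (tG a b a' b') = tG a b a'' b''"
    if le: "a' \<le> a" "b' \<le> b" "a'' \<le> a'" "b'' \<le> b'" for a b a' b' a'' b''
    using A.P.gc_nonneg[OF tG[OF le(1,2), unfolded tG_def] tG[OF le(3,4), unfolded tG_def]]
      cona_simp[OF tt_hom[OF le(1,2)] tt_hom[OF le(3,4)]] tt_tt[OF le] by (simp add: tG_def)
  show "A.P.gc (tG a b a' b') (rG a b) = rG a' b'" if le: "a' \<le> a" "b' \<le> b" for a b a' b'
    using A.P.gc_nonneg[OF rG[unfolded rG_def] tG[OF le, unfolded tG_def]] tt_\<rho>[OF le] by (simp add: rG_def tG_def)
  show "A.P.gc (rG (Suc a) b) y1G = A.P.gc (s1G a b) (rG a b)" for a b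
    using A.P.gc_nonneg[OF y1G[unfolded y1G_def] rG[of "Suc a" b, unfolded rG_def]]
      A.P.gc_nonneg[OF rG[of a b, unfolded rG_def] s1G[unfolded s1G_def]] \<rho>_e1[of a b] by (simp add: rG_def s1G_def y1G_def)
  show "A.P.gc (rG a (Suc b)) y2G = A.P.gc (s2G a b) (rG a b)" for a b
    using A.P.gc_nonneg[OF y2G[unfolded y2G_def] rG[of a "Suc b", unfolded rG_def]]
      A.P.gc_nonneg[OF rG[of a b, unfolded rG_def] s2G[unfolded s2G_def]] \<rho>_e2[of a b] by (simp add: rG_def s2G_def y2G_def)
  show "A.P.gc (tG (Suc a) b (Suc a') b') (s1G a b) = A.P.gc (s1G a' b') (tG a b a' b')" if le: "a' \<le> a" "b' \<le> b" for a b a' b'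
  proof -
    have le': "Suc a' \<le> Suc a" using le by simp
    show ?thesis
      using A.P.gc_nonneg[OF s1G[unfolded s1G_def] tG[OF le' le(2), unfolded tG_def]]
        A.P.gc_nonneg[OF tG[OF le, unfolded tG_def] s1G[unfolded s1G_def]]
        cona_simp[OF e1_hom tt_hom[OF le' le(2)]] cona_simp[OF A.S.Q_hom[OF tt_hom[OF le]] e1_hom] tt_e1[OF le]
        A.Q_cona[OF tt_hom[OF le], of dA]
      by (simp add: tG_def s1G_def)
  qed
  show "A.P.gc (tG a (Suc b) a' (Suc b')) (s2G a b) = A.P.gc (s2G a' b') (tG a b a' b')" if le: "a' \<le> a" "b' \<le> b" for a b a' b'
  proof -
    have le': "Suc b' \<le> Suc b" using le by simp
    show ?thesis
      using A.P.gc_nonneg[OF s2G[unfolded s2G_def] tG[OF le(1) le', unfolded tG_def]]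
        A.P.gc_nonneg[OF tG[OF le, unfolded tG_def] s2G[unfolded s2G_def]]
        cona_simp[OF e2_hom tt_hom[OF le(1) le']] cona_simp[OF A.S.Q_hom[OF tt_hom[OF le]] e2_hom] tt_e2[OF le]
        A.Q_cona[OF tt_hom[OF le], of dB]
      by (simp add: tG_def s2G_def)
  qed
  show "A.P.gc (s1G a (Suc b)) (s2G a b) = A.P.gc (s2G (Suc a) b) (s1G a b)" for a b
    using A.P.gc_nonneg[OF s2G[of a b, unfolded s2G_def] s1G[of a "Suc b", unfolded s1G_def]]
      A.P.gc_nonneg[OF s1G[of a b, unfolded s1G_def] s2G[of "Suc a" b, unfolded s2G_def]]
      cona_simp[OF A.S.Q_hom[OF e2_hom[of a b], of dA] e1_hom[of a "Suc b"]]
      cona_simp[OF A.S.Q_hom[OF e1_hom[of a b], of dB] e2_hom[of "Suc a" b]] e1_e2[of a b]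
      A.Q_cona[OF e1_hom[of a b], of dB] A.Q_cona[OF e2_hom[of a b], of dA]
    by (simp add: s1G_def s2G_def)
  show "A.P.gi (Z 0 b) = A.P.gz 0 (Z 0 b) (Z 0 b)" "A.P.gi (Z a 0) = A.P.gz 0 (Z a 0) (Z a 0)" for a b
    by (rule gi_zero[OF zero_objects(1)] gi_zero[OF zero_objects(2)])+
  show "\<exists>G\<in>A.P.GH (k - int dA) W (Z a b). A.P.gc (s1G a b) G = F"
    if "F \<in> A.P.GH k W (Z (Suc a) b)" "A.P.gc (tG (Suc a) b 1 b) F = A.P.gz k W (Z 1 b)" for F k W a b
    using A.kernel_graded[OF e1_exact(1) tt_hom e1_hom Zo_obj] that unfolding tG_def s1G_def Z_def by simp
  show "\<exists>G\<in>A.P.GH (k - int dB) W (Z a b). A.P.gc (s2G a b) G = F"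
    if "F \<in> A.P.GH k W (Z a (Suc b))" "A.P.gc (tG a (Suc b) a 1) F = A.P.gz k W (Z a 1)" for F k W a b
    using A.kernel_graded[OF e2_exact(1) tt_hom e2_hom Zo_obj] that unfolding tG_def s2G_def Z_def by simp
  show "G = A.P.gz k W (Z a b)" if "G \<in> A.P.GH k W (Z a b)" "A.P.gc (s1G a b) G = A.P.gz (k + int dA) W (Z (Suc a) b)" for G k W a b
    using A.mono_graded[OF A.kernel_mono[OF e1_exact(1)] e1_hom Zo_obj] that unfolding s1G_def Z_def by blast
  show "G = A.P.gz k W (Z a b)" if "G \<in> A.P.GH k W (Z a b)" "A.P.gc (s2G a b) G = A.P.gz (k + int dB) W (Z a (Suc b))" for G k W a b
    using A.mono_graded[OF A.kernel_mono[OF e2_exact(1)] e2_hom Zo_obj] that unfolding s2G_def Z_def by blast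
  show "\<exists>G\<in>A.P.GH k W Y. \<forall>a b. A.P.gc (rG a b) G = f a b" if "W \<in> obj P" "\<And>a b. f a b \<in> A.P.GH k W (Z a b)"
    "\<And>a b a' b'. a' \<le> a \<Longrightarrow> b' \<le> b \<Longrightarrow> A.P.gc (tG a b a' b') (f a b) = f a' b'" for W f k
    using graded_limit[OF that] .
  show "G = G'" if "G \<in> A.P.GH k W Y" "G' \<in> A.P.GH k W Y" "\<And>a b. A.P.gc (rG a b) G = A.P.gc (rG a b) G'" for G k W G'
    using graded_separated[OF that] .
  show "\<exists>a b. \<exists>G\<in>A.P.GH k (Z a b) c. F = A.P.gc G (rG a b)" if "c \<in> con C ` obj C" "F \<in> A.P.GH k Y c" for c F k
    using that graded_factor by blast
  show "G = A.P.gz k (Z a b) c" if "c \<in> con C ` obj C" "G \<in> A.P.GH k (Z a b) c" "A.P.gc G (rG a b) = A.P.gz k Y c" for c G k a b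
    using that graded_epi by blast
  show "\<exists>H\<in>A.P.GH k (Z 1 b) c. A.P.gc H (tG (Suc a) b 1 b) = G"
    if c: "c \<in> con C ` obj C" and G: "G \<in> A.P.GH k (Z (Suc a) b) c" "A.P.gc G (s1G a b) = A.P.gz (k + int dA) (Z a b) c" for c G k a b
  proof -
    obtain c0 where c0: "c0 \<in> obj C" "c = con C c0" using c by blast
    have t1: "tt (Suc a) b 1 b \<in> hom C (Zo (Suc a) b) (Zo 1 b)" by (rule tt_hom) simp_all
    show ?thesis
      using A.cokernel_graded[OF e1_exact(2) t1 e1_hom Zo_obj c0(1)] G unfolding s1G_def tG_def Z_def c0(2) by blast
  qed
  show "\<exists>H\<in>A.P.GH k (Z a 1) c. A.P.gc H (tG a (Suc b) a 1) = G"
    if c: "c \<in> con C ` obj C" and G: "G \<in> A.P.GH k (Z a (Suc b)) c" "A.P.gc G (s2G a b) = A.P.gz (k + int dB) (Z a b) c" for c G k a b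
  proof -
    obtain c0 where c0: "c0 \<in> obj C" "c = con C c0" using c by blast
    have t1: "tt a (Suc b) a 1 \<in> hom C (Zo a (Suc b)) (Zo a 1)" by (rule tt_hom) simp_all
    show ?thesis
      using A.cokernel_graded[OF e2_exact(2) t1 e2_hom Zo_obj c0(1)] G unfolding s2G_def tG_def Z_def c0(2) by blast
  qed
qed

end

subsection \<open>Polynomial actions on graded morphisms\<close>

context shift_category
begin

text \<open>A component with its tags, so that operations on families become degreewise operations
  of \<open>graded_linear\<close>.\<close>

definition fam :: "'o \<Rightarrow> 'o \<Rightarrow> (int \<Rightarrow> 'm) \<Rightarrow> int \<Rightarrow> 'o \<times> 'o \<times> int \<times> 'm" where
  "fam X Y f k = (X, Y, k, f k)"

lemma fam_gadd: "fam X Y (gadd C f g) k = ga (fam X Y f k) (fam X Y g k)"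
  by (simp add: fam_def gadd_def ga_def)

lemma fam_gsmul: "fam X Y (gsmul C a f) k = gs a (fam X Y f k)"
  by (simp add: fam_def gsmul_def gs_def)

lemma fam_gzero: "fam X Y (gzero C X Y) k = gz k X Y"
  by (simp add: fam_def gzero_def gz_def)

lemma fam_gmul: "fam X Y (gmul C X Y d y f) k = gc (Y, Y, d, y) (fam X Y f (k - d))"
  by (simp add: fam_def gmul_def gc_def)

lemma fam_eqI: "(\<And>k. fam X Y f k = fam X Y g k) \<Longrightarrow> f = g"
  by (auto simp: fam_def)

lemma fam_upd: "fam X Y (f(k := F)) j = (if j = k then (X, Y, k, F) else fam X Y f j)"
  by (simp add: fam_def)

definition families :: "'o \<Rightarrow> 'o \<Rightarrow> (int \<Rightarrow> 'm) set" where
  "families X Y = {f. \<forall>k. fam X Y f k \<in> GH k X Y}"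

lemma gHOM_families:
  assumes "X \<in> obj C" "Y \<in> obj C"
  shows "gHOM C X Y = {f \<in> families X Y. finite {k. fam X Y f k \<noteq> gz k X Y}}"
  using assms by (simp add: gHOM_def families_def fam_def GH_iff gzero_def gz_def)

end

locale polynomial_action = shift_category C
  for C :: "('o, 'm, 'k::field, 'x) tscat_scheme" (structure) +
  fixes X Y :: 'o and d e :: nat and y\<^sub>1 y\<^sub>2 :: 'm
  assumes X: "X \<in> obj C" and Y: "Y \<in> obj C"
    and y1: "(Y, Y, int d, y\<^sub>1) \<in> GH (int d) Y Y" and y2: "(Y, Y, int e, y\<^sub>2) \<in> GH (int e) Y Y"
begin

abbreviation "f\<^sub>0 \<equiv> gzero C X Y"
abbreviation "m1 \<equiv> gmul C X Y (int d) y\<^sub>1"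
abbreviation "m2 \<equiv> gmul C X Y (int e) y\<^sub>2"
abbreviation "act1 \<equiv> poly_act1 C X Y d y\<^sub>1"
abbreviation "act \<equiv> poly_act C d e X Y y\<^sub>1 y\<^sub>2"
abbreviation "\<F> \<equiv> families X Y"
abbreviation "cp \<equiv> fam X Y"

sublocale V: partial_vector_space "GH k X Y" ga gs "gz k X Y" for k
  by (rule vector_space[OF X Y])

lemma cpF: "f \<in> \<F> \<Longrightarrow> cp f k \<in> GH k X Y"
  by (simp add: families_def)

lemma zero_F: "f\<^sub>0 \<in> \<F>"
  by (simp add: families_def fam_gzero)

lemma
  assumes "f \<in> \<F>"
  shows m1_cp: "gc (Y, Y, int d, y\<^sub>1) (cp f (k - int d)) \<in> GH k X Y"
    and m2_cp: "gc (Y, Y, int e, y\<^sub>2) (cp f (k - int e)) \<in> GH k X Y"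
  using gc_in[OF cpF[OF assms, of "k - int d"] y1] gc_in[OF cpF[OF assms, of "k - int e"] y2] by simp_all

lemma add_F: "f \<in> \<F> \<Longrightarrow> g \<in> \<F> \<Longrightarrow> gadd C f g \<in> \<F>"
  and smul_F: "f \<in> \<F> \<Longrightarrow> gsmul C a f \<in> \<F>"
  by (simp_all add: families_def fam_gadd fam_gsmul)

lemma m1_F: "f \<in> \<F> \<Longrightarrow> m1 f \<in> \<F>" and m2_F: "f \<in> \<F> \<Longrightarrow> m2 f \<in> \<F>"
  using m1_cp m2_cp by (simp_all add: families_def fam_gmul)

lemma m1_zero: "m1 f\<^sub>0 = f\<^sub>0" and m2_zero: "m2 f\<^sub>0 = f\<^sub>0"
  using gc_gz[OF y1 X] gc_gz[OF y2 X] by (auto intro!: fam_eqI[of X Y] simp: fam_gmul fam_gzero)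

lemma act1_0: "act1 0 f = f\<^sub>0"
  by (simp add: poly_act1_def)

lemma act_0: "act 0 f = f\<^sub>0"
  by (simp add: poly_act_def)

text \<open>\<open>fold_coeffs\<close> runs over the coefficient list, which is empty for the zero
  polynomial; when \<open>pCons a p\<close> is zero, the equation holds because both summands on the
  right vanish.\<close>

lemma act1_pCons: "f \<in> \<F> \<Longrightarrow> act1 (pCons a p) f = gadd C (gsmul C a f) (m1 (act1 p f))"
proof (cases "a = 0 \<and> p = 0")
  case True
  assume f: "f \<in> \<F>"
  have "f\<^sub>0 = gadd C (gsmul C 0 f) f\<^sub>0"
    by (intro fam_eqI[of X Y]) (simp add: fam_gadd fam_gsmul fam_gzero gs_0[OF cpF[OF f]])
  then show ?thesis using True by (simp add: act1_0 m1_zero)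
next
  case False
  then show ?thesis by (auto simp: poly_act1_def fold_coeffs_def cCons_def)
qed

lemma act_pCons: "f \<in> \<F> \<Longrightarrow> act (pCons p P) f = gadd C (act1 p f) (m2 (act P f))"
proof (cases "p = 0 \<and> P = 0")
  case True
  assume f: "f \<in> \<F>"
  have "f\<^sub>0 = gadd C f\<^sub>0 f\<^sub>0"
    by (intro fam_eqI[of X Y]) (simp add: fam_gadd fam_gzero)
  then show ?thesis using True by (simp add: act1_0 act_0 m2_zero)
next
  case False
  then show ?thesis by (auto simp: poly_act_def fold_coeffs_def cCons_def)
qed

lemma act1_F: "f \<in> \<F> \<Longrightarrow> act1 p f \<in> \<F>"
  by (induction p) (simp_all add: act1_0 zero_F act1_pCons add_F smul_F m1_F)

lemma act_F: "f \<in> \<F> \<Longrightarrow> act P f \<in> \<F>"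
  by (induction P) (simp_all add: act_0 zero_F act_pCons add_F act1_F m2_F)

lemma m1_add: 
  assumes "f \<in> \<F>" "g \<in> \<F>" shows "m1 (gadd C f g) = gadd C (m1 f) (m1 g)"
  using gc_ga[OF cpF[OF assms(1)] cpF[OF assms(2)] y1] by (intro fam_eqI[of X Y]) (simp add: fam_gmul fam_gadd)

lemma m2_add: 
  assumes "f \<in> \<F>" "g \<in> \<F>" shows "m2 (gadd C f g) = gadd C (m2 f) (m2 g)"
  using gc_ga[OF cpF[OF assms(1)] cpF[OF assms(2)] y2] by (intro fam_eqI[of X Y]) (simp add: fam_gmul fam_gadd)

lemma add4:
  assumes "f \<in> \<F>" "g \<in> \<F>" "h \<in> \<F>" "h' \<in> \<F>"
  shows "gadd C (gadd C f g) (gadd C h h') = gadd C (gadd C f h) (gadd C g h')"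
proof (rule fam_eqI[of X Y])
  fix k
  note c = cpF[OF assms(1), of k] cpF[OF assms(2), of k] cpF[OF assms(3), of k] cpF[OF assms(4), of k]
  show "cp (gadd C (gadd C f g) (gadd C h h')) k = cp (gadd C (gadd C f h) (gadd C g h')) k"
    using V.pl_assoc[OF c(1,2), of "ga (cp h k) (cp h' k)"] V.pl_assoc[OF c(1,3), of "ga (cp g k) (cp h' k)"]
      V.pl_left_comm[OF c(2,3,4)] ga_in[OF c(3,4)] ga_in[OF c(2,4)] by (simp add: fam_gadd)
qed

lemma add_zero_F: "f \<in> \<F> \<Longrightarrow> gadd C f f\<^sub>0 = f"
  by (intro fam_eqI[of X Y]) (simp add: fam_gadd fam_gzero cpF)

lemma gsmul_add: "f \<in> \<F> \<Longrightarrow> gsmul C (a + b) f = gadd C (gsmul C a f) (gsmul C b f)"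
  by (intro fam_eqI[of X Y]) (simp add: fam_gadd fam_gsmul V.pl_sc[OF cpF])

lemma act1_add: "f \<in> \<F> \<Longrightarrow> act1 (p + q) f = gadd C (act1 p f) (act1 q f)"
proof (induction p q rule: poly_induct2)
  case 0 then show ?case using add_zero_F[OF zero_F] by (simp add: act1_0)
next
  case (pCons a p b q)
  then show ?case
    by (simp add: act1_pCons gsmul_add m1_add act1_F add4 smul_F m1_F)
qed

lemma act_add: "f \<in> \<F> \<Longrightarrow> act (P + Q) f = gadd C (act P f) (act Q f)"
proof (induction P Q rule: poly_induct2)
  case 0 then show ?case using add_zero_F[OF zero_F] by (simp add: act_0)
next
  case (pCons p P q Q)
  then show ?case
    by (simp add: act_pCons act1_add m2_add act1_F act_F add4 m2_F)
qed

definition supp where "supp f = {k. cp f k \<noteq> gz k X Y}"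

lemma supp_add: "finite (supp f) \<Longrightarrow> finite (supp g) \<Longrightarrow> finite (supp (gadd C f g))"
  by (rule finite_subset[of _ "supp f \<union> supp g"]) (auto simp: supp_def fam_gadd)

lemma supp_smul: "finite (supp f) \<Longrightarrow> finite (supp (gsmul C a f))"
  by (rule finite_subset[of _ "supp f"]) (auto simp: supp_def fam_gsmul)

lemma supp_m1: "finite (supp f) \<Longrightarrow> finite (supp (m1 f))"
proof (rule finite_subset[of _ "(\<lambda>k. k + int d) ` supp f"])
  show "supp (m1 f) \<subseteq> (\<lambda>k. k + int d) ` supp f"
  proof
    fix k assume "k \<in> supp (m1 f)"
    then have "k - int d \<in> supp f" using gc_gz[OF y1 X, of "k - int d"] by (auto simp: supp_def fam_gmul)
    then show "k \<in> (\<lambda>k. k + int d) ` supp f" by (rule rev_image_eqI) simp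
  qed
qed simp

lemma supp_m2: "finite (supp f) \<Longrightarrow> finite (supp (m2 f))"
proof (rule finite_subset[of _ "(\<lambda>k. k + int e) ` supp f"])
  show "supp (m2 f) \<subseteq> (\<lambda>k. k + int e) ` supp f"
  proof
    fix k assume "k \<in> supp (m2 f)"
    then have "k - int e \<in> supp f" using gc_gz[OF y2 X, of "k - int e"] by (auto simp: supp_def fam_gmul)
    then show "k \<in> (\<lambda>k. k + int e) ` supp f" by (rule rev_image_eqI) simp
  qed
qed simp

lemma supp_zero: "supp f\<^sub>0 = {}"
  by (simp add: supp_def fam_gzero)

lemma supp_act1: "f \<in> \<F> \<Longrightarrow> finite (supp f) \<Longrightarrow> finite (supp (act1 p f))"
  by (induction p) (simp_all add: act1_0 supp_zero act1_pCons supp_add supp_smul supp_m1)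

lemma supp_act: "f \<in> \<F> \<Longrightarrow> finite (supp f) \<Longrightarrow> finite (supp (act P f))"
  by (induction P) (simp_all add: act_0 supp_zero act_pCons supp_add supp_act1 supp_m2)

end

locale polynomial_line = polynomial_action C X Y d e y\<^sub>1 y\<^sub>2
  for C :: "('o, 'm, 'k::field, 'x) tscat_scheme" (structure) and X Y d e y\<^sub>1 y\<^sub>2 +
  fixes K Z r t s1 s2 x\<^sub>1 x\<^sub>2 c R0
  assumes line: "bitower_line (obj C) GH gc gi ga gs gz K Y (int d) (int e) (Y, Y, int d, y\<^sub>1) (Y, Y, int e, y\<^sub>2)
    Z r t s1 s2 X (X, X, int d, x\<^sub>1) (X, X, int e, x\<^sub>2) c R0"
begin

sublocale L: bitower_line "obj C" GH gc gi ga gs gz K Y "int d" "int e" "(Y, Y, int d, y\<^sub>1)" "(Y, Y, int e, y\<^sub>2)"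
    Z r t s1 s2 X "(X, X, int d, x\<^sub>1)" "(X, X, int e, x\<^sub>2)" c R0
  by (rule line)

text \<open>Equivariance is a condition in each degree separately, so \<open>polyHOM\<close> is the
  direct sum of the spaces \<open>L.H k\<close>.\<close>

lemma polyHOM_eq:
  "polyHOM C d e X x\<^sub>1 x\<^sub>2 Y y\<^sub>1 y\<^sub>2 = {f. (\<forall>k. cp f k \<in> L.H k) \<and> finite (supp f)}"
  unfolding polyHOM_def gHOM_families[OF X Y] L.H_def families_def supp_def
  by (auto simp: fam_def gc_def add.commute)

lemma cp_m1: "cp (m1 f) k = gc (Y, Y, int d, y\<^sub>1) (cp f (k - int d))"
  and cp_m2: "cp (m2 f) k = gc (Y, Y, int e, y\<^sub>2) (cp f (k - int e))"
  by (simp_all add: fam_gmul)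

lemma H_F: "(\<And>k. cp f k \<in> L.H k) \<Longrightarrow> f \<in> \<F>"
  using L.H_GH by (simp add: families_def)

lemma act1_H: "(\<And>k. cp f k \<in> L.H k) \<Longrightarrow> cp (act1 p f) k \<in> L.H k"
proof (induction p arbitrary: k)
  case 0 then show ?case by (simp add: act1_0 fam_gzero L.H_gz)
next
  case (pCons a p)
  then show ?case using L.H_y1[of "cp (act1 p f) (k - int d)" "k - int d"]
    by (simp add: act1_pCons[OF H_F] fam_gadd fam_gsmul cp_m1 L.H_ga L.H_gs)
qed

lemma act_H: "(\<And>k. cp f k \<in> L.H k) \<Longrightarrow> cp (act P f) k \<in> L.H k"
proof (induction P arbitrary: k)
  case 0 then show ?case by (simp add: act_0 fam_gzero L.H_gz)
next
  case (pCons p P)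
  then show ?case using L.H_y2[of "cp (act P f) (k - int e)" "k - int e"]
    by (simp add: act_pCons[OF H_F] fam_gadd cp_m2 L.H_ga act1_H)
qed

theorem polyHOM_generated:
  assumes R: "(X, Y, c, R) \<in> L.H c" "gc (r 1 1) (X, Y, c, R) = R0"
  shows "f\<^sub>0(c := R) \<in> polyHOM C d e X x\<^sub>1 x\<^sub>2 Y y\<^sub>1 y\<^sub>2"
    and "polyHOM C d e X x\<^sub>1 x\<^sub>2 Y y\<^sub>1 y\<^sub>2 = range (\<lambda>P. act P (f\<^sub>0(c := R)))"
proof -
  let ?R = "f\<^sub>0(c := R)"
  have cR: "cp ?R k = (if k = c then (X, Y, c, R) else gz k X Y)" for k by (simp add: fam_upd fam_gzero)
  have RH: "cp ?R k \<in> L.H k" for k using R(1) L.H_gz by (simp add: cR)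
  note RF = H_F[of ?R, OF RH]
  have fin: "finite (supp ?R)" by (rule finite_subset[of _ "{c}"]) (auto simp: supp_def cR)
  show "?R \<in> polyHOM C d e X x\<^sub>1 x\<^sub>2 Y y\<^sub>1 y\<^sub>2" using RH fin by (simp add: polyHOM_eq)
  \<comment> \<open>Some polynomial sends \<open>?R\<close> to the family concentrated in degree
    \<open>k\<close> with value \<open>F\<close>. Homogeneity is thus asked of the result, and the
    degrees of the monomials need not be tracked.\<close>
  define S1 where "S1 k = {F. \<exists>p. \<forall>j. cp (act1 p ?R) j = (if j = k then F else gz j X Y)}" for k
  define S where "S k = {F. \<exists>P. \<forall>j. cp (act P ?R) j = (if j = k then F else gz j X Y)}" for k
  have S_all: "F \<in> S k" if F: "F \<in> L.H k" for F k
  proof (rule L.generated_by[OF R])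
    show "gz k X Y \<in> S1 k" for k unfolding S1_def by (auto intro!: exI[of _ 0] simp: act1_0 fam_gzero)
    show "gz k X Y \<in> S k" for k unfolding S_def by (auto intro!: exI[of _ 0] simp: act_0 fam_gzero)
    show "gs a (X, Y, c, R) \<in> S1 c" for a
      unfolding S1_def using R(1) L.H_GH[OF R(1)]
      by (auto intro!: exI[of _ "[:a:]"] simp: act1_pCons[OF RF] act1_0 m1_zero fam_gadd fam_gsmul fam_gzero cR)
    show "gc (Y, Y, int d, y\<^sub>1) G \<in> S1 (j + int d)" if G: "G \<in> L.H j" "G \<in> S1 j" for G j
    proof -
      obtain p where p: "\<And>i. cp (act1 p ?R) i = (if i = j then G else gz i X Y)" using G(2) unfolding S1_def by blast
      \<comment> \<open>Prepending the coefficient 0 multiplies by the first variable.\<close>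
      have "cp (act1 (pCons 0 p) ?R) i = (if i = j + int d then gc (Y, Y, int d, y\<^sub>1) G else gz i X Y)" for i
        using gc_gz[OF y1 X, of "i - int d"] gc_in[OF L.H_GH[OF G(1)] y1] cpF[OF RF, of i]
        by (auto simp: act1_pCons[OF RF] fam_gadd fam_gsmul cp_m1 p)
      then show ?thesis unfolding S1_def by blast
    qed
    show "ga F' (gc (Y, Y, int e, y\<^sub>2) G) \<in> S j" if F': "F' \<in> L.H j" "F' \<in> S1 j"
      and G: "G \<in> L.H (j - int e)" "G \<in> S (j - int e)" for F' G j
    proof -
      obtain p where p: "\<And>i. cp (act1 p ?R) i = (if i = j then F' else gz i X Y)" using F'(2) unfolding S1_def by blast
      obtain P where P: "\<And>i. cp (act P ?R) i = (if i = j - int e then G else gz i X Y)" using G(2) unfolding S_def by blast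
      \<comment> \<open>One Horner step: \<open>p\<close> accounts for the part free of the second
        variable, \<open>P\<close> for the quotient of the rest by it.\<close>
      have "cp (act (pCons p P) ?R) i = (if i = j then ga F' (gc (Y, Y, int e, y\<^sub>2) G) else gz i X Y)" for i
        using gc_gz[OF y2 X, of "i - int e"] 
        by (auto simp: act_pCons[OF RF] fam_gadd cp_m2 p P)
      then show ?thesis unfolding S_def by blast
    qed
    show "F \<in> L.H k" by (rule F)
  qed
  show "polyHOM C d e X x\<^sub>1 x\<^sub>2 Y y\<^sub>1 y\<^sub>2 = range (\<lambda>P. act P ?R)"
  proof
    show "range (\<lambda>P. act P ?R) \<subseteq> polyHOM C d e X x\<^sub>1 x\<^sub>2 Y y\<^sub>1 y\<^sub>2"
      using act_H[of ?R, OF RH] supp_act[OF RF fin] by (auto simp: polyHOM_eq)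
    show "polyHOM C d e X x\<^sub>1 x\<^sub>2 Y y\<^sub>1 y\<^sub>2 \<subseteq> range (\<lambda>P. act P ?R)"
    proof
      fix f assume "f \<in> polyHOM C d e X x\<^sub>1 x\<^sub>2 Y y\<^sub>1 y\<^sub>2"
      then have f: "\<And>k. cp f k \<in> L.H k" "finite (supp f)" by (auto simp: polyHOM_eq)
      \<comment> \<open>Each homogeneous component is a multiple of \<open>?R\<close>; finitely many
        of them are collected by adding the polynomials.\<close>
      have "\<exists>P. \<forall>j. cp (act P ?R) j = (if j \<in> A then cp f j else gz j X Y)" if "finite A" for A
        using that
      proof induction
        case empty
        then show ?case by (auto intro!: exI[of _ 0] simp: act_0 fam_gzero)
      next
        case (insert k A)
        obtain P where P: "\<And>j. cp (act P ?R) j = (if j \<in> A then cp f j else gz j X Y)" using insert.IH by blast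
        obtain Q where Q: "\<And>j. cp (act Q ?R) j = (if j = k then cp f k else gz j X Y)"
          using S_all[OF f(1)[of k]] unfolding S_def by blast
        have "cp (act (P + Q) ?R) j = (if j \<in> insert k A then cp f j else gz j X Y)" for j
          using insert.hyps(2) L.H_GH[OF f(1)[of j]] by (auto simp: act_add[OF RF] fam_gadd P Q)
        then show ?case by blast
      qed
      from this[OF f(2)] obtain P where P: "\<And>j. cp (act P ?R) j = (if j \<in> supp f then cp f j else gz j X Y)" by blast
      have "act P ?R = f"
        by (rule fam_eqI[of X Y]) (simp add: P supp_def)
      then show "f \<in> range (\<lambda>P. act P ?R)" by blast
    qed
  qed
qed

theorem ex_generator:
  assumes "polyHOM C d e X x\<^sub>1 x\<^sub>2 Y y\<^sub>1 y\<^sub>2 \<noteq> {f\<^sub>0}"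
  obtains R where "(X, Y, c, R) \<in> L.H c" "gc (r 1 1) (X, Y, c, R) = R0"
proof -
  have "f\<^sub>0 \<in> polyHOM C d e X x\<^sub>1 x\<^sub>2 Y y\<^sub>1 y\<^sub>2" by (simp add: polyHOM_eq fam_gzero L.H_gz supp_zero)
  then obtain f where f: "f \<in> polyHOM C d e X x\<^sub>1 x\<^sub>2 Y y\<^sub>1 y\<^sub>2" "f \<noteq> f\<^sub>0" using assms by blast
  then obtain k where "cp f k \<noteq> cp f\<^sub>0 k" using fam_eqI by blast
  then have "cp f k \<noteq> gz k X Y" "cp f k \<in> L.H k" using f(1) by (auto simp: fam_gzero polyHOM_eq)
  then obtain F where F: "F \<in> L.H c" "gc (r 1 1) F = R0" using L.ex_renormalized by blast
  obtain R where "F = (X, Y, c, R)" using L.H_GH[OF F(1)] unfolding GH_def by blast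
  then show thesis using that F by blast
qed

end

subsection \<open>Reduction modulo both variables\<close>

context bitower
begin

text \<open>\<open>Z 1 1\<close> belongs to the chosen towers, while the theorem speaks of given
  quotients. \<open>A\<close> with its projection \<open>q\<close> is a given quotient of
  \<open>Y\<close> by both variables, identified with \<open>Z 1 1\<close> compatibly with the
  projections.\<close>

definition reduction :: "'o \<Rightarrow> 'g \<Rightarrow> bool" where
  "reduction A q \<longleftrightarrow> A \<in> K \<and> q \<in> GH 0 Y A \<and> (\<exists>J\<in>GH 0 (Z 1 1) A. \<exists>J'\<in>GH 0 A (Z 1 1).
    gc J' J = gi (Z 1 1) \<and> gc J J' = gi A \<and> gc J (r 1 1) = q)"

lemma reductionE:
  assumes "reduction A q"
  obtains J J' where "A \<in> K" "A \<in> Ob" "q \<in> GH 0 Y A" "J \<in> GH 0 (Z 1 1) A" "J' \<in> GH 0 A (Z 1 1)"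
    "gc J' J = gi (Z 1 1)" "gc J J' = gi A" "gc J (r 1 1) = q"
  using assms K unfolding reduction_def by blast

lemma reduction_factor:
  assumes q: "reduction A q" and c: "c \<in> K" and F: "F \<in> GH k Y c"
    "gc F y1 = gz (k + d1) Y c" "gc F y2 = gz (k + d2) Y c"
  obtains G where "G \<in> GH k A c" "F = gc G q"
proof -
  obtain J J' where J: "q \<in> GH 0 Y A" "J \<in> GH 0 (Z 1 1) A" "J' \<in> GH 0 A (Z 1 1)"
    "gc J' J = gi (Z 1 1)" "gc J (r 1 1) = q" using reductionE[OF q] .
  obtain G where G: "G \<in> GH k (Z 1 1) c" "F = gc G (r 1 1)" using factor_zero[OF c F] by blast
  have "gc (gc G J') q = gc (gc (gc G J') J) (r 1 1)"
    using gc_assoc[OF r J(2) gc_in[OF J(3) G(1)]] J(5) by simp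
  also have "\<dots> = gc G (r 1 1)" using gc_assoc[OF J(2,3) G(1)] J(4) gc_gi[OF G(1)] by simp
  finally have "gc (gc G J') q = F" using G(2) by simp
  then show thesis using that gc_in[OF J(3) G(1)] by simp
qed

lemma r_y_zero: "gc (r 1 1) y1 = gz d1 Y (Z 1 1)" "gc (r 1 1) y2 = gz d2 Y (Z 1 1)"
proof -
  interpret sw: bitower Ob GH gc gi ga gs gz K Y d2 d1 y2 y1 "\<lambda>a b. Z b a" "\<lambda>a b. r b a" "\<lambda>a b a' b'. t b a b' a'"
   "\<lambda>a b. s2 b a" "\<lambda>a b. s1 b a" by (rule swap)
  show "gc (r 1 1) y1 = gz d1 Y (Z 1 1)" using r_w1[of 1 1] w1_1[of 1] gz_gc[OF r[of 1 1] Z_Ob, of d1] by simp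
  show "gc (r 1 1) y2 = gz d2 Y (Z 1 1)" using sw.r_w1[of 1 1] sw.w1_1[of 1] gz_gc[OF r[of 1 1] Z_Ob, of d2] by simp
qed

lemma reduction_zero:
  assumes "reduction A q" shows "gc q y1 = gz d1 Y A" "gc q y2 = gz d2 Y A"
proof -
  obtain J J' where J: "J \<in> GH 0 (Z 1 1) A" "gc J (r 1 1) = q" using reductionE[OF assms] .
  show "gc q y1 = gz d1 Y A" "gc q y2 = gz d2 Y A"
    using gc_assoc[OF y1 r J(1)] gc_assoc[OF y2 r J(1)] J(2) r_y_zero gc_gz[OF J(1) Y_Ob] by simp_all
qed

end

context bitower_hom
begin

text \<open>Here \<open>X\<close> carries a double tower as well. A morphism in
  \<open>U 1 1 k\<close> kills both variables on \<open>X\<close>, so by the universal property of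
  the reduction \<open>A\<close> it comes from a morphism of \<open>A\<close> to \<open>B\<close>.
  This carries the hypothesis on those morphisms over to \<open>U 1 1\<close>, and \<open>R0\<close>
  is the transport of \<open>G0\<close>.\<close>

lemma line_of_reductions:
  assumes S: "bitower Ob GH gc gi ga gs gz K X d1 d2 x1 x2 ZX rX tX s1X s2X"
    and q: "bitower.reduction GH gc gi K X ZX rX A q" and q': "reduction B q'"
    and only: "\<And>G k. G \<in> GH k A B \<Longrightarrow> k \<noteq> c \<Longrightarrow> G = gz k A B"
    and line: "\<And>G. G \<in> GH c A B \<Longrightarrow> \<exists>a. G = gs a G0" and G0: "G0 \<in> GH c A B"
  obtains R0 where "bitower_line Ob GH gc gi ga gs gz K Y d1 d2 y1 y2 Z r t s1 s2 X x1 x2 c R0"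
    "\<And>R. R \<in> GH c X Y \<Longrightarrow> gc (r 1 1) R = R0 \<longleftrightarrow> gc q' R = gc G0 q"
proof -
  interpret S: bitower Ob GH gc gi ga gs gz K X d1 d2 x1 x2 ZX rX tX s1X s2X by (rule S)
  obtain I I' where q1: "A \<in> K" "A \<in> Ob" "q \<in> GH 0 X A" using S.reductionE[OF q] .
  obtain J J' where J: "B \<in> K" "B \<in> Ob" "J \<in> GH 0 (Z 1 1) B" "J' \<in> GH 0 B (Z 1 1)"
    "gc J' J = gi (Z 1 1)" "gc J J' = gi B" "gc J (r 1 1) = q'" using reductionE[OF q'] .
  have J'J: "gc J' (gc J F) = F" if F: "F \<in> GH k X (Z 1 1)" for F k
    using gc_assoc[OF F J(3,4)] J(5) gi_gc[OF F] by simp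
  have JJ': "gc J (gc J' F) = F" if F: "F \<in> GH k X B" for F k
    using gc_assoc[OF F J(4,3)] J(6) gi_gc[OF F] by simp
  have U: "\<exists>G\<in>GH k A B. gc J F = gc G q" if F: "F \<in> U 1 1 k" for F k
  proof -
    \<comment> \<open>On \<open>Z 1 1\<close> both variables act as zero, so equivariance of
      \<open>F\<close> says that it kills \<open>x1\<close> and \<open>x2\<close>.\<close>
    note F' = U_11[OF F]
    have F1: "F \<in> GH k X (Z 1 1)" using F' by simp
    have "gc (gc J F) x1 = gz (k + d1) X B" "gc (gc J F) x2 = gz (k + d2) X B"
      using gc_assoc[OF x1 F1 J(3)] gc_assoc[OF x2 F1 J(3)] F' gc_gz[OF J(3) X_Ob] by simp_all
    moreover have "gc J F \<in> GH k X B" using gc_in[OF F1 J(3)] by simp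
    ultimately show ?thesis using S.reduction_factor[OF q J(1)] by metis
  qed
  have qG: "gc G q \<in> GH k X B" if "G \<in> GH k A B" for G k using gc_in[OF q1(3) that] by simp
  define R0 where "R0 = gc J' (gc G0 q)"
  have R0': "R0 \<in> GH c X (Z 1 1)" unfolding R0_def using gc_in[OF qG[OF G0] J(4)] by simp
  have R0: "R0 \<in> U 1 1 c"
  proof -
    have G0x: "gc (gc G0 q) x1 = gz (d1 + c) X B" "gc (gc G0 q) x2 = gz (d2 + c) X B"
      using gc_assoc[OF x1 q1(3) G0] gc_assoc[OF x2 q1(3) G0] S.reduction_zero[OF q] gc_gz[OF G0 X_Ob] by simp_all
    have w: "gc (w1 1 1) R0 = gz (c + d1) X (Z 1 1)" "gc (w2 1 1) R0 = gz (c + d2) X (Z 1 1)"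
      using w1_1[of 1] sw.w1_1[of 1] gz_gc[OF R0' Z_Ob] by simp_all
    have "gc R0 x1 = gz (c + d1) X (Z 1 1)" "gc R0 x2 = gz (c + d2) X (Z 1 1)"
      unfolding R0_def using gc_assoc[OF x1 qG[OF G0] J(4)] gc_assoc[OF x2 qG[OF G0] J(4)] G0x gc_gz[OF J(4) X_Ob]
      by (simp_all add: add.commute)
    then show ?thesis using R0' w by (simp add: U_def)
  qed
  have "bitower_line Ob GH gc gi ga gs gz K Y d1 d2 y1 y2 Z r t s1 s2 X x1 x2 c R0"
  proof (intro bitower_line.intro bitower_line_axioms.intro)
    show "bitower_hom Ob GH gc gi ga gs gz K Y d1 d2 y1 y2 Z r t s1 s2 X x1 x2" by unfold_locales
    show "F = gz k X (Z 1 1)" if F: "F \<in> U 1 1 k" "k \<noteq> c" for F k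
    proof -
      obtain G where G: "G \<in> GH k A B" "gc J F = gc G q" using U[OF F(1)] by blast
      have "gc J F = gz k X B" using G(2) only[OF G(1) F(2)] gz_gc[OF q1(3) J(2), of k] by simp
      then show ?thesis using J'J[OF U_GH[OF F(1)]] gc_gz[OF J(4) X_Ob, of k] by simp
    qed
    show "\<exists>a. F = gs a R0" if F: "F \<in> U 1 1 c" for F
    proof -
      obtain G where G: "G \<in> GH c A B" "gc J F = gc G q" using U[OF F] by blast
      obtain a where a: "G = gs a G0" using line[OF G(1)] by blast
      have "gc J F = gs a (gc G0 q)" using G(2) a gs_gc[OF q1(3) G0] by simp
      then have "F = gs a R0" using J'J[OF U_GH[OF F]] gc_gs[OF qG[OF G0] J(4)] by (simp add: R0_def)
      then show ?thesis by blast
    qed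
    show "R0 \<in> U 1 1 c" by (rule R0)
  qed
  moreover have "gc (r 1 1) R = R0 \<longleftrightarrow> gc q' R = gc G0 q" if R: "R \<in> GH c X Y" for R
  proof -
    have rR: "gc (r 1 1) R \<in> GH c X (Z 1 1)" using gc_in[OF R r] by simp
    have "gc q' R = gc J (gc (r 1 1) R)" using gc_assoc[OF R r J(3)] J(7) by simp
    then show ?thesis using J'J[OF rR] JJ'[OF qG[OF G0]] unfolding R0_def by metis
  qed
  ultimately show thesis using that by blast
qed

end

context affine_tower
begin

text \<open>\<open>p\<close> and \<open>\<psi> 1\<close> are both cokernels of \<open>z\<close>, as
  \<open>zpow\<close> at exponent 1 is \<open>z\<close>; the comparison isomorphisms run between
  constant objects and so come from \<open>C\<close>.\<close>

lemma quotient_iso: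
  assumes "is_quotient C X z M p"
  obtains i j where "i \<in> hom C (Tn 1) M" "j \<in> hom C M (Tn 1)" "j \<cdot> i = idn C (Tn 1)" "i \<cdot> j = idn C M"
    "cona C i \<cdot>\<^bsub>P\<^esub> \<psi> 1 = p"
proof -
  have M: "M \<in> obj C" and p: "p \<in> hom P X (con C M)" and cp: "is_cokernel P z p"
    using assms unfolding is_quotient_def P[symmetric] by simp_all
  have z1: "zpow P d z X 1 = z" using z idnP(1)[OF X] P.Q_idn X P.cmp_idn[OF z] by simp
  have c\<psi>: "is_cokernel P z (\<psi> 1)" using \<psi>_cokernel[of 1] z1 by simp
  have zz: "p \<cdot>\<^bsub>P\<^esub> z = zer P ((shf P ^^ d) X) (con C M)" "\<psi> 1 \<cdot>\<^bsub>P\<^esub> z = zer P ((shf P ^^ d) X) (con C (Tn 1))"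
    using cp c\<psi> P.homD[OF z] P.homD[OF p] P.homD[OF \<psi>_hom[of 1]] unfolding is_cokernel_def by simp_all
  obtain I where I: "I \<in> hom P (con C (Tn 1)) (con C M)" "I \<cdot>\<^bsub>P\<^esub> \<psi> 1 = p"
    using P.cokernel_factor[OF c\<psi> \<psi>_hom p z zz(1)] by blast
  obtain J where J: "J \<in> hom P (con C M) (con C (Tn 1))" "J \<cdot>\<^bsub>P\<^esub> p = \<psi> 1"
    using P.cokernel_factor[OF cp p \<psi>_hom z zz(2)] by blast
  obtain i where i: "i \<in> hom C (Tn 1) M" "I = cona C i" using cona_full[OF Tn_obj I(1)] .
  obtain j where j: "j \<in> hom C M (Tn 1)" "J = cona C j" using cona_full[OF M J(1)] .
  have "(J \<cdot>\<^bsub>P\<^esub> I) \<cdot>\<^bsub>P\<^esub> \<psi> 1 = idn P (con C (Tn 1)) \<cdot>\<^bsub>P\<^esub> \<psi> 1"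
    using P.cmp_assoc[OF \<psi>_hom I(1) J(1)] I(2) J(2) P.idn_cmp[OF \<psi>_hom] by simp
  then have ji: "cona C (j \<cdot> i) = idn P (con C (Tn 1))"
    using P.epi_cancel[OF \<psi>_epi \<psi>_hom cmpP(1)[OF I(1) J(1)] idnP(1)] cona_cmp[OF i(1) j(1)] i(2) j(2) con_obj[OF Tn_obj] by simp
  have "(I \<cdot>\<^bsub>P\<^esub> J) \<cdot>\<^bsub>P\<^esub> p = idn P (con C M) \<cdot>\<^bsub>P\<^esub> p"
    using P.cmp_assoc[OF p J(1) I(1)] I(2) J(2) P.idn_cmp[OF p] by simp
  then have ij: "cona C (i \<cdot> j) = idn P (con C M)"
    using P.epi_cancel[OF P.cokernel_epi[OF cp] p cmpP(1)[OF J(1) I(1)] idnP(1)] cona_cmp[OF j(1) i(1)] i(2) j(2) con_obj[OF M] by simp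
  show thesis
    using that[OF i(1) j(1)] cona_faithful[OF cmp_hom[OF i(1) j(1)] idn_hom[OF Tn_obj]] ji cona_idn[OF Tn_obj]
      cona_faithful[OF cmp_hom[OF j(1) i(1)] idn_hom[OF M]] ij cona_idn[OF M] I(2) i(2) by simp
qed

end

context two_towers
begin

sublocale bt: bitower "obj P" A.P.GH A.P.gc A.P.gi A.P.ga A.P.gs A.P.gz "con C ` obj C" Y "int dA" "int dB" y1G y2G Z rG tG s1G s2G
  by (rule bitower_tensor)

text \<open>The required isomorphism is the tensor product of the comparison isomorphisms between
  the given quotients and the first levels of the two towers.\<close>

lemma reduction_tensor:
  assumes M: "is_quotient C XA zA M pM" and N: "is_quotient C XB zB N pN"
  shows "bt.reduction (con C (M \<otimes> N)) (Y, con C (M \<otimes> N), 0, con_ten C M N \<cdot>\<^bsub>P\<^esub> (pM \<odot>\<^bsub>P\<^esub> pN))"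
proof -
  obtain i i' where i: "i \<in> hom C (A.Tn 1) M" "i' \<in> hom C M (A.Tn 1)" "i' \<cdot> i = idn C (A.Tn 1)" "i \<cdot> i' = idn C M"
    "cona C i \<cdot>\<^bsub>P\<^esub> A.\<psi> 1 = pM" using A.quotient_iso[OF M] .
  obtain j j' where j: "j \<in> hom C (B.Tn 1) N" "j' \<in> hom C N (B.Tn 1)" "j' \<cdot> j = idn C (B.Tn 1)" "j \<cdot> j' = idn C N"
    "cona C j \<cdot>\<^bsub>P\<^esub> B.\<psi> 1 = pN" using B.quotient_iso[OF N] .
  have o: "M \<in> obj C" "N \<in> obj C" using A.homD(5)[OF i(1)] A.homD(5)[OF j(1)] .
  note MN = A.ten_obj[OF o]
  have J: "i \<odot> j \<in> hom C (Zo 1 1) (M \<otimes> N)" "i' \<odot> j' \<in> hom C (M \<otimes> N) (Zo 1 1)"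
    unfolding Zo_def using A.tena_hom[OF i(1) j(1)] A.tena_hom[OF i(2) j(2)] .
  have JJ: "(i' \<odot> j') \<cdot> (i \<odot> j) = idn C (Zo 1 1)" "(i \<odot> j) \<cdot> (i' \<odot> j') = idn C (M \<otimes> N)"
    unfolding Zo_def
    using A.tena_cmp[OF i(1,2) j(1,2)] A.tena_cmp[OF i(2,1) j(2,1)] i(3,4) j(3,4) A.tena_idn[OF A.Tn_obj B.Tn_obj] A.tena_idn[OF o] by simp_all
  have pp: "cona C (i \<odot> j) \<cdot>\<^bsub>P\<^esub> \<rho> 1 1 = con_ten C M N \<cdot>\<^bsub>P\<^esub> (pM \<odot>\<^bsub>P\<^esub> pN)"
    unfolding \<rho>_def using A.cona_cten[OF A.\<psi>_hom B.\<psi>_hom i(1) j(1)] i(5) j(5) by (simp add: A.cten_def)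
  let ?J = "(Z 1 1, con C (M \<otimes> N), 0::int, cona C (i \<odot> j) :: ('o, 'm, 'a) pro_ar)"
  let ?J' = "(con C (M \<otimes> N), Z 1 1, 0::int, cona C (i' \<odot> j') :: ('o, 'm, 'a) pro_ar)"
  have G: "?J \<in> A.P.GH 0 (Z 1 1) (con C (M \<otimes> N))" "?J' \<in> A.P.GH 0 (con C (M \<otimes> N)) (Z 1 1)"
    unfolding Z_def using A.cona_GH0[OF J(1)] A.cona_GH0[OF J(2)] .
  have 1: "A.P.gc ?J' ?J = A.P.gi (Z 1 1)" "A.P.gc ?J ?J' = A.P.gi (con C (M \<otimes> N))"
    using A.P.gc_nonneg[OF G] A.P.gc_nonneg[OF G(2,1)] cona_simp[OF J] cona_simp[OF J(2,1)] JJ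
      A.cona_idn[OF Zo_obj] A.cona_idn[OF MN] by (simp_all add: A.P.gi_def Z_def)
  have 2: "A.P.gc ?J (rG 1 1) = (Y, con C (M \<otimes> N), 0, con_ten C M N \<cdot>\<^bsub>P\<^esub> (pM \<odot>\<^bsub>P\<^esub> pN))"
    using A.P.gc_nonneg[OF rG[of 1 1, unfolded rG_def] G(1)] pp by (simp add: rG_def)
  have 3: "A.P.gc ?J (rG 1 1) \<in> A.P.GH 0 Y (con C (M \<otimes> N))" using A.P.gc_in[OF rG G(1)] by simp
  show ?thesis unfolding bt.reduction_def using G 1 2 3 MN by auto
qed

end

lemma (in pro_graded) ex_affine_tower:
  assumes "affine_object C X d z"
  obtains T \<phi> where "affine_tower C P X d z T \<phi>"
proof -
  obtain T \<phi> where T: "T \<in> obj P" "\<phi> \<in> hom P X T" "pidx T = tower_cat" "iso P \<phi>"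
    "\<And>n. is_quotient C X (zpow P d z X n) (pob T (IxNat n)) (pro_proj C T (IxNat n) \<cdot>\<^bsub>P\<^esub> \<phi>)"
    using assms unfolding affine_object_def P[symmetric] by blast
  have "affine_tower C P X d z T \<phi>"
    by unfold_locales
      (use assms T in \<open>simp_all add: affine_object_def P[symmetric] HOM_def shpow_def\<close>)
  then show thesis by (rule that)
qed

subsection \<open>Generators\<close>

context shift_category
begin

text \<open>All graded morphisms from \<open>X\<close> to \<open>Y\<close> are multiples of one
  homogeneous \<open>g\<^sub>0\<close>. The hypotheses of both statements take this form; in the
  first one, \<open>c = 0\<close> and \<open>g\<^sub>0\<close> is the identity.\<close>

definition hom_line :: "'o \<Rightarrow> 'o \<Rightarrow> int \<Rightarrow> 'm \<Rightarrow> bool" where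
  "hom_line X Y c g\<^sub>0 \<longleftrightarrow> X \<in> obj C \<and> Y \<in> obj C \<and> g\<^sub>0 \<in> HOM C c X Y \<and>
     (\<forall>k. \<forall>g\<in>HOM C k X Y. if k = c then \<exists>a. g = smul C a g\<^sub>0 else g = zer C (shpow C k X) Y)"

lemma zer_HOM: "X \<in> obj C \<Longrightarrow> Y \<in> obj C \<Longrightarrow> zer C (shpow C k X) Y \<in> HOM C k X Y"
  unfolding HOM_def using zer_hom shpow_obj by blast

lemma gHOM_single:
  assumes "X \<in> obj C" "Y \<in> obj C" "g \<in> HOM C k X Y"
  shows "(gzero C X Y)(k := g) \<in> gHOM C X Y"
proof -
  have "finite {j. ((gzero C X Y)(k := g)) j \<noteq> gzero C X Y j}" by (rule finite_subset[of _ "{k}"]) auto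
  then show ?thesis using assms zer_HOM by (simp add: gHOM_def gzero_def)
qed

lemma smul_zero_HOM: "f \<in> HOM C k X Y \<Longrightarrow> X \<in> obj C \<Longrightarrow> Y \<in> obj C \<Longrightarrow> smul C 0 f = zer C (shpow C k X) Y"
  using gs_0[of "(X, Y, k, f)" k X Y] by (simp add: GH_iff gs_def gz_def)

lemma smul_zer_HOM: "X \<in> obj C \<Longrightarrow> Y \<in> obj C \<Longrightarrow> smul C a (zer C (shpow C k X) Y) = zer C (shpow C k X) Y"
  using gs_gz[of X Y a k] by (simp add: gs_def gz_def)

lemma hom_line_idn:
  assumes X: "X \<in> obj C" and g: "gHOM C X X = range (\<lambda>a. gsmul C a (gid C X))"
  shows "hom_line X X 0 (idn C X)"
proof -
  have "if k = 0 then \<exists>a. h = smul C a (idn C X) else h = zer C (shpow C k X) X" if h: "h \<in> HOM C k X X" for k h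
  proof -
    obtain a where "(gzero C X X)(k := h) = gsmul C a (gid C X)" using gHOM_single[OF X X h] g by auto
    then have "h = gsmul C a (gid C X) k" by (metis fun_upd_same)
    then show ?thesis using smul_zer_HOM[OF X X] by (auto simp: gsmul_def gid_def gzero_def)
  qed
  moreover have "idn C X \<in> HOM C 0 X X" using idn_hom[OF X] by (simp add: HOM_def shpow_def)
  ultimately show ?thesis using X by (simp add: hom_line_def)
qed

text \<open>The basis vector \<open>f\<close> has a nonzero component in some degree
  \<open>c\<close>. A homogeneous morphism of another degree is a multiple \<open>a f\<close>, and
  comparison of the components at \<open>c\<close> forces \<open>a = 0\<close>; so only degree
  \<open>c\<close> occurs.\<close>

lemma hom_line_dim:
  assumes X: "X \<in> obj C" and Y: "Y \<in> obj C" and "gHOM_dim C X Y 1"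
  obtains c g\<^sub>0 where "hom_line X Y c g\<^sub>0" "g\<^sub>0 \<noteq> zer C (shpow C c X) Y"
proof -
  obtain fs where fs: "length fs = 1" "set fs \<subseteq> gHOM C X Y"
    "bij_betw (\<lambda>as. lincomb C X Y as fs) {as. length as = 1} (gHOM C X Y)"
    using assms unfolding gHOM_dim_def by blast
  then obtain f where f: "fs = [f]" by (auto simp: length_Suc_conv)
  have fH: "f k \<in> HOM C k X Y" for k using fs(2) f by (auto simp: gHOM_def)
  have lin: "lincomb C X Y [a] fs k = smul C a (f k)" for a k
    using add_zer[of "smul C a (f k)" "shpow C k X" Y] smul_hom[of "f k" "shpow C k X" Y a] fH[of k]
    by (simp add: lincomb_def f gadd_def gsmul_def gzero_def HOM_def)
  \<comment> \<open>Injectivity of the coordinate map says that the basis vector is not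
    zero.\<close>
  have "lincomb C X Y [0] fs \<noteq> lincomb C X Y [1] fs"
    using inj_onD[OF bij_betw_imp_inj_on[OF fs(3)], of "[0]" "[1]"] by auto
  then obtain c where "smul C 0 (f c) \<noteq> smul C 1 (f c)" using lin by (auto simp: fun_eq_iff)
  then have c: "f c \<noteq> zer C (shpow C c X) Y"
    using smul_zero_HOM[OF fH X Y, of c] smul_zer_HOM[OF X Y, of 1 c] by auto
  have "if k = c then \<exists>a. g = smul C a (f c) else g = zer C (shpow C k X) Y" if g: "g \<in> HOM C k X Y" for k g
  proof -
    obtain as where as: "length as = 1" "(gzero C X Y)(k := g) = lincomb C X Y as fs"
      using bij_betw_imp_surj_on[OF fs(3)] gHOM_single[OF X Y g] by auto
    obtain a where a: "as = [a]" using as(1) by (auto simp: length_Suc_conv)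
    have j: "((gzero C X Y)(k := g)) j = smul C a (f j)" for j using as(2) a lin by simp
    show ?thesis
    proof (cases "k = c")
      case True then show ?thesis using j[of c] by auto
    next
      case False
      then have z: "smul C a (f c) = zer C (shpow C c X) Y" using j[of c] by (simp add: gzero_def)
      have "a = 0"
      proof (rule ccontr)
        assume "a \<noteq> 0"
        then have "f c = smul C (inverse a) (smul C a (f c))"
          using smul_smul[of "f c" "shpow C c X" Y "inverse a" a] smul_one[of "f c" "shpow C c X" Y] fH[of c] by (simp add: HOM_def)
        then show False using z c smul_zer_HOM[OF X Y] by simp
      qed
      then show ?thesis using j[of k] smul_zero_HOM[OF fH X Y] False by simp
    qed
  qed
  then show thesis using that[of c "f c"] fH X Y c by (simp add: hom_line_def)
qed

end

context pro_graded
begin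

text \<open>The embedding of \<open>C\<close> is full, faithful and linear and commutes with the
  shift, so graded morphisms between constant pro-objects are those of \<open>C\<close>.\<close>

lemma hom_line_con:
  assumes L: "S.hom_line A B c g\<^sub>0"
  defines "A' \<equiv> con C A :: ('o, 'm, 'a) pro_ob" and "B' \<equiv> con C B :: ('o, 'm, 'a) pro_ob"
  defines "G\<^sub>0 \<equiv> (A', B', c, cona C g\<^sub>0 :: ('o, 'm, 'a) pro_ar)"
  shows "G\<^sub>0 \<in> P.GH c A' B'"
    and "G \<in> P.GH k A' B' \<Longrightarrow> k \<noteq> c \<Longrightarrow> G = P.gz k A' B'"
    and "G \<in> P.GH c A' B' \<Longrightarrow> \<exists>a. G = P.gs a G\<^sub>0"
proof -
  have o: "A \<in> obj C" "B \<in> obj C" and g: "g\<^sub>0 \<in> HOM C c A B" using L by (auto simp: S.hom_line_def)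
  have o': "A' \<in> obj P" "B' \<in> obj P" unfolding A'_def B'_def using con_objP o by blast+
  have H: "HOM P j A' B' = hom P (con C (shpow C j A)) (con C B)" for j
    using shpow_con[OF o(1), of j] by (simp add: HOM_def A'_def B'_def)
  have sh: "shpow P j A' = con C (shpow C j A)" for j using shpow_con[OF o(1), of j] by (simp add: A'_def)
  show "G\<^sub>0 \<in> P.GH c A' B'"
    unfolding G\<^sub>0_def P.GH_iff H using o' conaP(1)[OF g[unfolded HOM_def]] by blast
  have G: "\<exists>g\<in>HOM C j A B. G = (A', B', j, cona C g)" if G: "G \<in> P.GH j A' B'" for G j
  proof -
    obtain F where F: "G = (A', B', j, F)" "F \<in> HOM P j A' B'" using G unfolding P.GH_def by blast
    obtain g where "g \<in> hom C (shpow C j A) B" "F = cona C g"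
      using cona_full[OF S.shpow_obj[OF o(1)] F(2)[unfolded H]] .
    then show ?thesis using F(1) by (auto simp: HOM_def)
  qed
  show "G = P.gz k A' B'" if G': "G \<in> P.GH k A' B'" "k \<noteq> c"
  proof -
    obtain g where g: "g \<in> HOM C k A B" "G = (A', B', k, cona C g)" using G[OF G'(1)] by blast
    have "g = zer C (shpow C k A) B" using L g(1) G'(2) by (auto simp: S.hom_line_def)
    then show ?thesis using g(2) cona_zer[OF S.shpow_obj[OF o(1), of k] o(2)] by (simp add: P.gz_def sh B'_def)
  qed
  show "\<exists>a. G = P.gs a G\<^sub>0" if G': "G \<in> P.GH c A' B'"
  proof -
    obtain h where h: "h \<in> HOM C c A B" "G = (A', B', c, cona C h)" using G[OF G'] by blast
    obtain a where "h = smul C a g\<^sub>0" using L h(1) by (fastforce simp: S.hom_line_def)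
    then have "G = P.gs a G\<^sub>0" using h(2) cona_smul[of g\<^sub>0 "shpow C c A" B a] g by (simp add: P.gs_def G\<^sub>0_def HOM_def)
    then show ?thesis by blast
  qed
qed

text \<open>The common part of both statements. \<open>good R\<close> says that \<open>R\<close> is
  equivariant of degree \<open>c\<close> and induces \<open>g\<^sub>0\<close> on the reductions. Any
  such \<open>R\<close> generates, and one exists as soon as there is a nonzero equivariant
  morphism.\<close>

lemma polyHOM_line:
  assumes S: "bitower (obj P) P.GH P.gc P.gi P.ga P.gs P.gz (con C ` obj C) X (int d) (int e) (X, X, int d, x\<^sub>1) (X, X, int e, x\<^sub>2) ZX rX tX s1X s2X"
    and B: "bitower (obj P) P.GH P.gc P.gi P.ga P.gs P.gz (con C ` obj C) Y (int d) (int e) (Y, Y, int d, y\<^sub>1) (Y, Y, int e, y\<^sub>2) Z r t s1 s2"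
    and q: "bitower.reduction P.GH P.gc P.gi (con C ` obj C) X ZX rX (con C A) (X, con C A, 0, p)"
    and q': "bitower.reduction P.GH P.gc P.gi (con C ` obj C) Y Z r (con C D) (Y, con C D, 0, p')"
    and L: "S.hom_line A D c g\<^sub>0"
  defines "good \<equiv> \<lambda>R. (X, Y, c, R) \<in> bitower_hom.H P.GH P.gc Y (Y, Y, int d, y\<^sub>1) (Y, Y, int e, y\<^sub>2) X (X, X, int d, x\<^sub>1) (X, X, int e, x\<^sub>2) c \<and>
      P.gc (Y, con C D, 0, p') (X, Y, c, R) = P.gc (con C A, con C D, c, cona C g\<^sub>0) (X, con C A, 0, p)"
  shows "good R \<Longrightarrow> (gzero P X Y)(c := R) \<in> polyHOM P d e X x\<^sub>1 x\<^sub>2 Y y\<^sub>1 y\<^sub>2"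
    and "good R \<Longrightarrow> polyHOM P d e X x\<^sub>1 x\<^sub>2 Y y\<^sub>1 y\<^sub>2 = range (\<lambda>a. poly_act P d e X Y y\<^sub>1 y\<^sub>2 a ((gzero P X Y)(c := R)))"
    and "good R \<Longrightarrow> specializes C X Y A p D p' ((gzero P X Y)(c := R)) ((gzero C A D)(c := g\<^sub>0))"
    and "polyHOM P d e X x\<^sub>1 x\<^sub>2 Y y\<^sub>1 y\<^sub>2 \<noteq> {gzero P X Y} \<Longrightarrow> \<exists>R. good R"
proof -
  interpret S: bitower "obj P" P.GH P.gc P.gi P.ga P.gs P.gz "con C ` obj C" X "int d" "int e" "(X, X, int d, x\<^sub>1)" "(X, X, int e, x\<^sub>2)" ZX rX tX s1X s2X by (rule S)
  interpret B: bitower_hom "obj P" P.GH P.gc P.gi P.ga P.gs P.gz "con C ` obj C" Y "int d" "int e" "(Y, Y, int d, y\<^sub>1)" "(Y, Y, int e, y\<^sub>2)" Z r t s1 s2 X "(X, X, int d, x\<^sub>1)" "(X, X, int e, x\<^sub>2)"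
    by (intro bitower_hom.intro bitower_hom_axioms.intro B S.y1 S.y2)
  have good: "good R \<longleftrightarrow> (X, Y, c, R) \<in> B.H c \<and>
      P.gc (Y, con C D, 0, p') (X, Y, c, R) = P.gc (con C A, con C D, c, cona C g\<^sub>0) (X, con C A, 0, p)" for R
    by (simp add: good_def)
  have "\<exists>R0. bitower_line (obj P) P.GH P.gc P.gi P.ga P.gs P.gz (con C ` obj C) Y (int d) (int e)
      (Y, Y, int d, y\<^sub>1) (Y, Y, int e, y\<^sub>2) Z r t s1 s2 X (X, X, int d, x\<^sub>1) (X, X, int e, x\<^sub>2) c R0 \<and>
    (\<forall>R. R \<in> P.GH c X Y \<longrightarrow> (P.gc (r 1 1) R = R0 \<longleftrightarrow>
      P.gc (Y, con C D, 0, p') R = P.gc (con C A, con C D, c, cona C g\<^sub>0) (X, con C A, 0, p)))"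
    by (rule B.line_of_reductions[OF S q q' hom_line_con(2,3,1)[OF L]], assumption+) (rule exI, rule conjI, assumption, blast)
  then obtain R0 where R0: "bitower_line (obj P) P.GH P.gc P.gi P.ga P.gs P.gz (con C ` obj C) Y (int d) (int e)
      (Y, Y, int d, y\<^sub>1) (Y, Y, int e, y\<^sub>2) Z r t s1 s2 X (X, X, int d, x\<^sub>1) (X, X, int e, x\<^sub>2) c R0"
    "\<And>R. R \<in> P.GH c X Y \<Longrightarrow> P.gc (r 1 1) R = R0 \<longleftrightarrow>
      P.gc (Y, con C D, 0, p') R = P.gc (con C A, con C D, c, cona C g\<^sub>0) (X, con C A, 0, p)"
    by blast
  interpret L: polynomial_line P X Y d e y\<^sub>1 y\<^sub>2 "con C ` obj C" Z r t s1 s2 x\<^sub>1 x\<^sub>2 c R0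
    by (intro polynomial_line.intro polynomial_line_axioms.intro polynomial_action.intro polynomial_action_axioms.intro
        P.shift_category_axioms S.Y_Ob B.Y_Ob B.y1 B.y2 R0(1))
  have good': "good R \<longleftrightarrow> (X, Y, c, R) \<in> B.H c \<and> P.gc (r 1 1) (X, Y, c, R) = R0" for R
    unfolding good using R0(2)[OF B.H_GH] by blast
  show "(gzero P X Y)(c := R) \<in> polyHOM P d e X x\<^sub>1 x\<^sub>2 Y y\<^sub>1 y\<^sub>2" if "good R"
    using L.polyHOM_generated(1) that unfolding good' by blast
  show "polyHOM P d e X x\<^sub>1 x\<^sub>2 Y y\<^sub>1 y\<^sub>2 = range (\<lambda>a. poly_act P d e X Y y\<^sub>1 y\<^sub>2 a ((gzero P X Y)(c := R)))" if "good R"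
    using L.polyHOM_generated(2) that unfolding good' by blast
  show "\<exists>R. good R" if ne: "polyHOM P d e X x\<^sub>1 x\<^sub>2 Y y\<^sub>1 y\<^sub>2 \<noteq> {gzero P X Y}"
  proof -
    obtain R where "(X, Y, c, R) \<in> B.H c" "P.gc (r 1 1) (X, Y, c, R) = R0" using L.ex_generator[OF ne] .
    then show ?thesis unfolding good' by blast
  qed
  show "specializes C X Y A p D p' ((gzero P X Y)(c := R)) ((gzero C A D)(c := g\<^sub>0))" if R: "good R"
  proof -
    have o: "A \<in> obj C" "D \<in> obj C" using L by (auto simp: S.hom_line_def)
    have qG: "(X, con C A, 0, p) \<in> P.GH 0 X (con C A)" using S.reductionE[OF q] .
    have qG': "(Y, con C D, 0, p') \<in> P.GH 0 Y (con C D)" using B.reductionE[OF q'] .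
    have "P.gc (con C A, con C D, k, cona C (((gzero C A D)(c := g\<^sub>0)) k)) (X, con C A, 0, p) =
      P.gc (Y, con C D, 0, p') (X, Y, k, ((gzero P X Y)(c := R)) k)" for k
    proof (cases "k = c")
      case True then show ?thesis using R by (simp add: good)
    next
      case False
      have "(con C A, con C D, k, cona C (gzero C A D k)) = P.gz k (con C A) (con C D)"
        using cona_zer[OF S.shpow_obj[OF o(1), of k] o(2)] shpow_con[OF o(1), of k] by (simp add: gzero_def P.gz_def)
      moreover have "(X, Y, k, gzero P X Y k) = P.gz k X Y" by (simp add: gzero_def P.gz_def)
      ultimately show ?thesis
        using False P.gz_gc[OF qG con_objP[OF o(2)], of k] P.gc_gz[OF qG' S.Y_Ob, of k] by simp
    qed
    then show ?thesis unfolding specializes_def P[symmetric] by (simp add: P.gc_def)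
  qed
qed

end

theorem proposition6p2:
  fixes C :: "('o, 'm, 'k::field) moncat"
    and \<M> \<N> :: "('o, 'm, 'a) pro_ob"
    and z\<^sub>M z\<^sub>N p\<^sub>M p\<^sub>N :: "('o, 'm, 'a) pro_ar"
    and d\<^sub>M d\<^sub>N :: nat
    and M N :: 'o
  assumes C: "graded_monoidal_category C"
    and affine_M: "affine_object C \<M> d\<^sub>M z\<^sub>M"
    and affine_N: "affine_object C \<N> d\<^sub>N z\<^sub>N"
    and M: "is_quotient C \<M> z\<^sub>M M p\<^sub>M"
    and N: "is_quotient C \<N> z\<^sub>N N p\<^sub>N"
  defines "P \<equiv> Pro C :: (('o, 'm, 'a) pro_ob, ('o, 'm, 'a) pro_ar, 'k) tscat"
  defines "MN \<equiv> \<M> \<otimes>\<^bsub>P\<^esub> \<N>"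
    and "NM \<equiv> \<N> \<otimes>\<^bsub>P\<^esub> \<M>"
  defines "x\<^sub>M \<equiv> on_left P d\<^sub>M z\<^sub>M \<M> \<N>"
    and "x\<^sub>N \<equiv> on_right P d\<^sub>N z\<^sub>N \<M> \<N>"
    and "y\<^sub>M \<equiv> on_right P d\<^sub>M z\<^sub>M \<N> \<M>"
    and "y\<^sub>N \<equiv> on_left P d\<^sub>N z\<^sub>N \<N> \<M>"
  shows
    "(gHOM C (M \<otimes>\<^bsub>C\<^esub> N) (M \<otimes>\<^bsub>C\<^esub> N) = range (\<lambda>a. gsmul C a (gid C (M \<otimes>\<^bsub>C\<^esub> N))) \<longrightarrow>
      polyHOM P d\<^sub>M d\<^sub>N MN x\<^sub>M x\<^sub>N MN x\<^sub>M x\<^sub>N =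
        range (\<lambda>a. poly_act P d\<^sub>M d\<^sub>N MN MN x\<^sub>M x\<^sub>N a (gid P MN)))
     \<and>
     (gHOM_dim C (M \<otimes>\<^bsub>C\<^esub> N) (N \<otimes>\<^bsub>C\<^esub> M) 1 \<and>
      polyHOM P d\<^sub>M d\<^sub>N MN x\<^sub>M x\<^sub>N NM y\<^sub>M y\<^sub>N \<noteq> {gzero P MN NM} \<longrightarrow>
      (\<exists>R \<in> polyHOM P d\<^sub>M d\<^sub>N MN x\<^sub>M x\<^sub>N NM y\<^sub>M y\<^sub>N.
         polyHOM P d\<^sub>M d\<^sub>N MN x\<^sub>M x\<^sub>N NM y\<^sub>M y\<^sub>N =
           range (\<lambda>a. poly_act P d\<^sub>M d\<^sub>N MN NM y\<^sub>M y\<^sub>N a R) \<and>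
         (\<exists>R\<^sub>0 \<in> gHOM C (M \<otimes>\<^bsub>C\<^esub> N) (N \<otimes>\<^bsub>C\<^esub> M).
            specializes C MN NM
              (M \<otimes>\<^bsub>C\<^esub> N) (con_ten C M N \<cdot>\<^bsub>P\<^esub> (p\<^sub>M \<odot>\<^bsub>P\<^esub> p\<^sub>N))
              (N \<otimes>\<^bsub>C\<^esub> M) (con_ten C N M \<cdot>\<^bsub>P\<^esub> (p\<^sub>N \<odot>\<^bsub>P\<^esub> p\<^sub>M)) R R\<^sub>0 \<and>
            R\<^sub>0 \<noteq> gzero C (M \<otimes>\<^bsub>C\<^esub> N) (N \<otimes>\<^bsub>C\<^esub> M))))"
proof -
  interpret C: graded_monoidal_category C by (rule C)
  interpret G: pro_graded C P by unfold_locales (simp add: P_def)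
  obtain T\<^sub>M \<phi>\<^sub>M where TM: "affine_tower C P \<M> d\<^sub>M z\<^sub>M T\<^sub>M \<phi>\<^sub>M" using G.ex_affine_tower[OF affine_M] .
  obtain T\<^sub>N \<phi>\<^sub>N where TN: "affine_tower C P \<N> d\<^sub>N z\<^sub>N T\<^sub>N \<phi>\<^sub>N" using G.ex_affine_tower[OF affine_N] .
  interpret S: two_towers C P \<M> d\<^sub>M z\<^sub>M T\<^sub>M \<phi>\<^sub>M \<N> d\<^sub>N z\<^sub>N T\<^sub>N \<phi>\<^sub>N by (intro two_towers.intro TM TN)
  interpret T: two_towers C P \<N> d\<^sub>N z\<^sub>N T\<^sub>N \<phi>\<^sub>N \<M> d\<^sub>M z\<^sub>M T\<^sub>M \<phi>\<^sub>M by (intro two_towers.intro TM TN)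
  have SY: "S.Y = MN" and TY: "T.Y = NM" by (simp_all add: S.Y_def T.Y_def MN_def NM_def)
  have Sy: "S.y1G = (MN, MN, int d\<^sub>M, x\<^sub>M)" "S.y2G = (MN, MN, int d\<^sub>N, x\<^sub>N)"
    by (simp_all add: S.y1G_def S.y2G_def SY x\<^sub>M_def x\<^sub>N_def)
  have Ty: "T.y1G = (NM, NM, int d\<^sub>N, y\<^sub>N)" "T.y2G = (NM, NM, int d\<^sub>M, y\<^sub>M)"
    by (simp_all add: T.y1G_def T.y2G_def TY y\<^sub>M_def y\<^sub>N_def)
  note bS = S.bitower_tensor[unfolded SY Sy]
  note bT = T.bitower_tensor[unfolded TY Ty]
  \<comment> \<open>On \<open>NM\<close> the left factor is \<N>, so its double tower lists the
    variable of \<N> first; the swap restores the order of the variables used for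
    \<open>MN\<close>.\<close>
  note bT' = bitower.swap[OF bT]
  note qS = S.reduction_tensor[OF M N, unfolded SY]
  have qT: "bitower.reduction G.P.GH G.P.gc G.P.gi (con C ` obj C) NM (\<lambda>a b. T.Z b a) (\<lambda>a b. T.rG b a)
      (con C (N \<otimes>\<^bsub>C\<^esub> M)) (NM, con C (N \<otimes>\<^bsub>C\<^esub> M), 0, con_ten C N M \<cdot>\<^bsub>P\<^esub> (p\<^sub>N \<odot>\<^bsub>P\<^esub> p\<^sub>M))"
    using T.reduction_tensor[OF N M, unfolded TY] unfolding bitower.reduction_def[OF bT] bitower.reduction_def[OF bT'] .
  have o: "M \<otimes>\<^bsub>C\<^esub> N \<in> obj C" "N \<otimes>\<^bsub>C\<^esub> M \<in> obj C"
    using M N C.ten_obj by (simp_all add: is_quotient_def)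
  show ?thesis
  proof (intro conjI impI)
    assume "gHOM C (M \<otimes>\<^bsub>C\<^esub> N) (M \<otimes>\<^bsub>C\<^esub> N) = range (\<lambda>a. gsmul C a (gid C (M \<otimes>\<^bsub>C\<^esub> N)))"
    then have L: "G.S.hom_line (M \<otimes>\<^bsub>C\<^esub> N) (M \<otimes>\<^bsub>C\<^esub> N) 0 (idn C (M \<otimes>\<^bsub>C\<^esub> N))"
      by (rule G.S.hom_line_idn[OF o(1)])
    interpret B: bitower_hom "obj P" G.P.GH G.P.gc G.P.gi G.P.ga G.P.gs G.P.gz "con C ` obj C" MN "int d\<^sub>M" "int d\<^sub>N"
      "(MN, MN, int d\<^sub>M, x\<^sub>M)" "(MN, MN, int d\<^sub>N, x\<^sub>N)" S.Z S.rG S.tG S.s1G S.s2G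
      MN "(MN, MN, int d\<^sub>M, x\<^sub>M)" "(MN, MN, int d\<^sub>N, x\<^sub>N)"
      by (intro bitower_hom.intro bitower_hom_axioms.intro bS bitower.y1[OF bS] bitower.y2[OF bS])
    \<comment> \<open>The identity is equivariant of degree 0 and induces the identity of
      \<open>M \<otimes> N\<close>, so it serves as the generator.\<close>
    have i: "(MN, MN, 0, idn P MN) = G.P.gi MN" by (simp add: G.P.gi_def)
    have H: "(MN, MN, 0, idn P MN) \<in> B.H 0"
      unfolding i B.H_def using G.P.gi_in[OF B.Y_Ob] G.P.gc_gi[OF B.y1] G.P.gc_gi[OF B.y2] G.P.gi_gc[OF B.y1] G.P.gi_gc[OF B.y2] by simp
    let ?p = "con_ten C M N \<cdot>\<^bsub>P\<^esub> (p\<^sub>M \<odot>\<^bsub>P\<^esub> p\<^sub>N)"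
    have q: "(MN, con C (M \<otimes>\<^bsub>C\<^esub> N), 0, ?p) \<in> G.P.GH 0 MN (con C (M \<otimes>\<^bsub>C\<^esub> N))"
      by (rule B.reductionE[OF qS])
    have "(con C (M \<otimes>\<^bsub>C\<^esub> N), con C (M \<otimes>\<^bsub>C\<^esub> N), 0, cona C (idn C (M \<otimes>\<^bsub>C\<^esub> N))) = G.P.gi (con C (M \<otimes>\<^bsub>C\<^esub> N))"
      using G.cona_idn[OF o(1)] by (simp add: G.P.gi_def)
    then have "G.P.gc (MN, con C (M \<otimes>\<^bsub>C\<^esub> N), 0, ?p) (MN, MN, 0, idn P MN) =
      G.P.gc (con C (M \<otimes>\<^bsub>C\<^esub> N), con C (M \<otimes>\<^bsub>C\<^esub> N), 0, cona C (idn C (M \<otimes>\<^bsub>C\<^esub> N))) (MN, con C (M \<otimes>\<^bsub>C\<^esub> N), 0, ?p)"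
      using G.P.gc_gi[OF q] G.P.gi_gc[OF q] i by simp
    then show "polyHOM P d\<^sub>M d\<^sub>N MN x\<^sub>M x\<^sub>N MN x\<^sub>M x\<^sub>N = range (\<lambda>a. poly_act P d\<^sub>M d\<^sub>N MN MN x\<^sub>M x\<^sub>N a (gid P MN))"
      using G.polyHOM_line(2)[OF bS bS qS qS L, of "idn P MN"] H by (simp add: gid_def)
  next
    assume a: "gHOM_dim C (M \<otimes>\<^bsub>C\<^esub> N) (N \<otimes>\<^bsub>C\<^esub> M) 1 \<and> polyHOM P d\<^sub>M d\<^sub>N MN x\<^sub>M x\<^sub>N NM y\<^sub>M y\<^sub>N \<noteq> {gzero P MN NM}"
    obtain c g\<^sub>0 where L: "G.S.hom_line (M \<otimes>\<^bsub>C\<^esub> N) (N \<otimes>\<^bsub>C\<^esub> M) c g\<^sub>0"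
      and g0: "g\<^sub>0 \<noteq> zer C (shpow C c (M \<otimes>\<^bsub>C\<^esub> N)) (N \<otimes>\<^bsub>C\<^esub> M)"
      using G.S.hom_line_dim[OF o conjunct1[OF a]] .
    note line = G.polyHOM_line[OF bS bT' qS qT L]
    obtain R where R: "(gzero P MN NM)(c := R) \<in> polyHOM P d\<^sub>M d\<^sub>N MN x\<^sub>M x\<^sub>N NM y\<^sub>M y\<^sub>N"
      "polyHOM P d\<^sub>M d\<^sub>N MN x\<^sub>M x\<^sub>N NM y\<^sub>M y\<^sub>N =
        range (\<lambda>a. poly_act P d\<^sub>M d\<^sub>N MN NM y\<^sub>M y\<^sub>N a ((gzero P MN NM)(c := R)))"
      "specializes C MN NM (M \<otimes>\<^bsub>C\<^esub> N) (con_ten C M N \<cdot>\<^bsub>P\<^esub> (p\<^sub>M \<odot>\<^bsub>P\<^esub> p\<^sub>N))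
        (N \<otimes>\<^bsub>C\<^esub> M) (con_ten C N M \<cdot>\<^bsub>P\<^esub> (p\<^sub>N \<odot>\<^bsub>P\<^esub> p\<^sub>M)) ((gzero P MN NM)(c := R))
        ((gzero C (M \<otimes>\<^bsub>C\<^esub> N) (N \<otimes>\<^bsub>C\<^esub> M))(c := g\<^sub>0))"
      using line(4)[OF conjunct2[OF a]] line(1-3) by metis
    have g: "(gzero C (M \<otimes>\<^bsub>C\<^esub> N) (N \<otimes>\<^bsub>C\<^esub> M))(c := g\<^sub>0) \<in> gHOM C (M \<otimes>\<^bsub>C\<^esub> N) (N \<otimes>\<^bsub>C\<^esub> M)"
      using G.S.gHOM_single[OF o, of g\<^sub>0 c] L by (simp add: G.S.hom_line_def)
    \<comment> \<open>The induced morphism is \<open>g\<^sub>0\<close> placed in degree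
      \<open>c\<close>, and \<open>hom_line_dim\<close> provides it as nonzero.\<close>
    have "((gzero C (M \<otimes>\<^bsub>C\<^esub> N) (N \<otimes>\<^bsub>C\<^esub> M))(c := g\<^sub>0)) c \<noteq> gzero C (M \<otimes>\<^bsub>C\<^esub> N) (N \<otimes>\<^bsub>C\<^esub> M) c"
      using g0 by (simp add: gzero_def)
    then have "(gzero C (M \<otimes>\<^bsub>C\<^esub> N) (N \<otimes>\<^bsub>C\<^esub> M))(c := g\<^sub>0) \<noteq> gzero C (M \<otimes>\<^bsub>C\<^esub> N) (N \<otimes>\<^bsub>C\<^esub> M)" by metis
    then show "\<exists>R \<in> polyHOM P d\<^sub>M d\<^sub>N MN x\<^sub>M x\<^sub>N NM y\<^sub>M y\<^sub>N.
         polyHOM P d\<^sub>M d\<^sub>N MN x\<^sub>M x\<^sub>N NM y\<^sub>M y\<^sub>N = range (\<lambda>a. poly_act P d\<^sub>M d\<^sub>N MN NM y\<^sub>M y\<^sub>N a R) \<and>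
         (\<exists>R\<^sub>0 \<in> gHOM C (M \<otimes>\<^bsub>C\<^esub> N) (N \<otimes>\<^bsub>C\<^esub> M).
            specializes C MN NM
              (M \<otimes>\<^bsub>C\<^esub> N) (con_ten C M N \<cdot>\<^bsub>P\<^esub> (p\<^sub>M \<odot>\<^bsub>P\<^esub> p\<^sub>N))
              (N \<otimes>\<^bsub>C\<^esub> M) (con_ten C N M \<cdot>\<^bsub>P\<^esub> (p\<^sub>N \<odot>\<^bsub>P\<^esub> p\<^sub>M)) R R\<^sub>0 \<and>
            R\<^sub>0 \<noteq> gzero C (M \<otimes>\<^bsub>C\<^esub> N) (N \<otimes>\<^bsub>C\<^esub> M))"
      using R g by blast
  qed
qed

end
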